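(* Let $D$ be a connected $A$-adequate link diagram with $c$ crossings and let $\mathcal{X}_D$ be the partial presimplicial set associated to $D$, with geometric realization $|\mathcal{X}_D|$. Then the almost-extreme Khovanov complex $\{C_{i,j_{\mathrm{almax}}}(D),\partial_i\}_i$, regraded so that $C_{c-2k,\,j_{\mathrm{almax}}}(D)$ is placed in degree $c-1-k$, is chain homotopy equivalent to the (reduced) cellular chain complex of $|\mathcal{X}_D|$.
   Context: States. Let $D$ be an unoriented link diagram in the plane with a set $cr(D)$ of $c$ crossings. $D$ is connected if its underlying planar 4-valent graph is connected. A Kauffman state is a map $s:cr(D)\to\{A,B\}$. The $A$-smoothing at a crossing joins the two regions swept out by rotating the overcrossing strand counterclockwise until it meets the undercrossing strand; the $B$-smoothing is the other one. $sD$ denotes the system of circles obtained by smoothing every crossing according to its label, with one chord drawn at each smoothed crossing joining the two resulting arcs; $|sD|$ is its number of circles. Put $\sigma(s)=|s^{-1}(A)|-|s^{-1}(B)|$. $s_A$ is the state labelling every crossing by $A$. State graph. $G_A(D)$ is the multigraph whose vertices are the circles of $s_AD$ and whose edges are the chords (i.e. the crossings of $D$), each edge joining the circles on which the endpoints of its chord lie. $D$ is $A$-adequate if $G_A(D)$ has no loops. Khovanov complex (framed version, over $\mathbb{Z}$). An enhanced state is a state $s$ together with a sign $\epsilon_i=\pm1$ on each circle of $sD$ (still denoted $s$). Put $\tau(s)=\sum_i\epsilon_i$, $i(s)=\sigma(s)$, $j(s)=\sigma(s)+2\tau(s)$. $C_{i,j}(D)$ is the free abelian group on the enhanced states with $i(s)=i$,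 $j(s)=j$. An enhanced state $t$ is adjacent to $s$ if $i(t)=i(s)-2$, $j(t)=j(s)$, the labels of $s$ and $t$ agree except at one crossing $x$, where $s$ has label $A$ and $t$ has label $B$, and $s$, $t$ assign the same signs to the circles common to $sD$ and $tD$. Fix an ordering of the crossings. The differential $\partial_i:C_{i,j}(D)\to C_{i-2,j}(D)$ is $\partial_i(s)=\sum_t (s:t)\,t$, where $(s:t)=0$ if $t$ is not adjacent to $s$, and otherwise $(s:t)=(-1)^k$ with $k$ the number of $B$-labelled crossings of $s$ coming after $x$ in the ordering. Let $j_{\max}(D)$ be the maximum of $j(s)$ over all enhanced states of $D$ and $j_{\mathrm{almax}}(D)=j_{\max}(D)-4$. The almost-extreme Khovanov complex of $D$ is $\{C_{i,j_{\mathrm{almax}}(D)}(D),\partial_i\}_i$. Partial presimplicial sets. A partial presimplicial set $\mathcal{X}=(X_k,d_i)$ is a sequence of sets $\{X_k\}_{k\ge0}$ with partial maps $d_i=d_{i,k}:X_k\supseteq \mathrm{Dom}(d_{i,k})\to X_{k-1}$ ($0\le i\le k$, $k\geq 1$) such that for $0\le i<j\le k$ the composites $d_id_j$ and $d_{j-1}d_i$ are, at each element, either both defined and equal or both undefined. One writes $d_i(a)=0$ when $d_i(a)$ is undefined. It is proper if it is not a presimplicial set (i.e. if some $d_i$ is not everywhere defined). Let $\Delta^k=\{(x_0,\dots,x_k)\in\mathbb{R}^{k+1}: \sum x_i=1, x_i\ge0\}$ and $d^i:\Delta^{k-1}\to\Delta^k$, $d^i(x_0,\dots,x_{k-1})=(x_0,\dots,x_{i-1},0,x_i,\dots,x_{k-1})$.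 For $\mathcal{X}$ proper, its (pointed) geometric realization is the CW-complex $|\mathcal{X}|=\bigl(\{b\}\sqcup\bigsqcup_{k\ge0}X_k\times\Delta^k\bigr)/\sim$, where $b$ is an extra point and, for $a\in X_k$, $t\in\Delta^{k-1}$, $(a,d^i(t))\sim(d_i(a),t)$ if $d_i(a)\ne0$ and $(a,d^i(t))\sim b$ otherwise. For a presimplicial set, $|\mathcal{X}|$ is the usual geometric realization, without the extra point $b$. The partial presimplicial set $\mathcal{X}_D$. Let $D$ be a connected $A$-adequate diagram with $c=n+1$ ordered crossings and $G=G_A(D)$ with vertices $T_0,\dots,T_m$ and edges $v_0<\dots<v_n$. Edges are parallel if they connect the same pair of vertices. Then $\mathcal{X}_D=(X_k,d_i)$ is defined by: $X_n=\{T_0,\dots,T_m\}$; for $0\le k<n$, $X_k$ is the set of tuples $(w_0,\dots,w_k)$ of edges of $G$ with $w_0<\dots<w_k$ such that all the $n-k$ edges in $E(G)\setminus\{w_0,\dots,w_k\}$ are parallel to each other; $X_k=\emptyset$ for $k>n$. Face maps: $d_i(T_j)=(v_0,\dots,\widehat{v_i},\dots,v_n)$ if $v_i$ is incident to $T_j$, and $0$ otherwise; for $0<k<n$, $d_i(w_0,\dots,w_k)=(w_0,\dots,\widehat{w_i},\dots,w_k)$ if $w_i$ connects the same pair of vertices as the edges of $E(G)\setminus\{w_0,\dots,w_k\}$, and $0$ otherwise. If $c=0$, set $|\mathcal{X}_D|=\emptyset=S^{-1}$. Conventions. All homology of spaces is reduced; the cellular chain complex of a space is the reduced (augmented) cellular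 chain complex over $\mathbb{Z}$ (for $\emptyset$ it is $\mathbb{Z}$ concentrated in degree $-1$). *)

theory Defs
  imports "HOL-Homology.Homology"
begin

section \<open>Chain complexes of abelian groups\<close>

record 'a chain_complex =
  Grp :: "int \<Rightarrow> 'a monoid"
  Diff :: "int \<Rightarrow> 'a \<Rightarrow> 'a"

definition is_chain_complex :: "'a chain_complex \<Rightarrow> bool" where
  "is_chain_complex C \<longleftrightarrow>
     (\<forall>q. comm_group (Grp C q) \<and>
          Diff C q \<in> hom (Grp C q) (Grp C (q - 1)) \<and>
          (\<forall>x \<in> carrier (Grp C q). Diff C (q - 1) (Diff C q x) = \<one>\<^bsub>Grp C (q - 2)\<^esub>))"

definition complex_map ::
    "'a chain_complex \<Rightarrow> 'b chain_complex \<Rightarrow> (int \<Rightarrow> 'a \<Rightarrow> 'b) \<Rightarrow> bool" where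
  "complex_map C C' f \<longleftrightarrow>
     (\<forall>q. f q \<in> hom (Grp C q) (Grp C' q) \<and>
          (\<forall>x \<in> carrier (Grp C q). Diff C' q (f q x) = f (q - 1) (Diff C q x)))"

text \<open>The relation \<open>f - g = dh + hd\<close>, in the multiplicative notation of the group library.\<close>

definition complex_homotopic ::
    "'a chain_complex \<Rightarrow> 'b chain_complex \<Rightarrow> (int \<Rightarrow> 'a \<Rightarrow> 'b) \<Rightarrow> (int \<Rightarrow> 'a \<Rightarrow> 'b) \<Rightarrow> bool" where
  "complex_homotopic C C' f g \<longleftrightarrow>
     (\<exists>h. \<forall>q. h q \<in> hom (Grp C q) (Grp C' (q + 1)) \<and>
          (\<forall>x \<in> carrier (Grp C q).
             f q x = g q x \<otimes>\<^bsub>Grp C' q\<^esub>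
                      (Diff C' (q + 1) (h q x) \<otimes>\<^bsub>Grp C' q\<^esub> h (q - 1) (Diff C q x))))"

definition chain_homotopy_equivalent :: "'a chain_complex \<Rightarrow> 'b chain_complex \<Rightarrow> bool" where
  "chain_homotopy_equivalent C C' \<longleftrightarrow>
     is_chain_complex C \<and> is_chain_complex C' \<and>
     (\<exists>f g. complex_map C C' f \<and> complex_map C' C g \<and>
            complex_homotopic C C (\<lambda>q. g q \<circ> f q) (\<lambda>q. id) \<and>
            complex_homotopic C' C' (\<lambda>q. f q \<circ> g q) (\<lambda>q. id))"


section \<open>Quotients\<close>

definition generated_equiv :: "('a \<Rightarrow> 'a \<Rightarrow> bool) \<Rightarrow> 'a set \<Rightarrow> ('a \<times> 'a) set" where
  "generated_equiv R S =
     {(x, y) \<in> S \<times> S. equivclp (\<lambda>u v. u \<in> S \<and> v \<in> S \<and> R u v) x y}"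

lemma equiv_generated_equiv: "equiv S (generated_equiv R S)"
proof (rule equivI)
  show "generated_equiv R S \<subseteq> S \<times> S"
    by (auto simp: generated_equiv_def)
  show "refl_on S (generated_equiv R S)"
    by (auto simp: refl_on_def generated_equiv_def)
  show "sym (generated_equiv R S)"
    by (auto simp: sym_def generated_equiv_def intro: equivclp_sym)
  show "trans (generated_equiv R S)"
    by (auto simp: trans_def generated_equiv_def intro: equivclp_trans)
qed

definition gen_classes :: "('a \<Rightarrow> 'a \<Rightarrow> bool) \<Rightarrow> 'a set \<Rightarrow> 'a set set" where
  "gen_classes R S = S // generated_equiv R S"

definition quotient_space :: "('a \<Rightarrow> 'a \<Rightarrow> bool) \<Rightarrow> 'a topology \<Rightarrow> 'a set topology" where
  "quotient_space R T =
     topology (\<lambda>U. U \<subseteq> gen_classes R (topspace T) \<and> openin T (\<Union>U))"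

lemma openin_quotient_space:
  "openin (quotient_space R T) U \<longleftrightarrow> U \<subseteq> gen_classes R (topspace T) \<and> openin T (\<Union>U)"
proof -
  let ?C = "gen_classes R (topspace T)"
  have disj: "A = B \<or> A \<inter> B = {}" if "A \<in> ?C" "B \<in> ?C" for A B
    using that quotient_disj [OF equiv_generated_equiv] unfolding gen_classes_def by blast
  have Int: "\<Union>(U \<inter> V) = \<Union>U \<inter> \<Union>V" if "U \<subseteq> ?C" "V \<subseteq> ?C" for U V
    using disj that by blast
  have "istopology (\<lambda>U. U \<subseteq> ?C \<and> openin T (\<Union>U))"
    unfolding istopology_def
  proof (intro conjI allI impI)
    fix U V assume "U \<subseteq> ?C \<and> openin T (\<Union>U)" "V \<subseteq> ?C \<and> openin T (\<Union>V)"
    then show "U \<inter> V \<subseteq> ?C" "openin T (\<Union>(U \<inter> V))"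
      using Int by (auto simp: openin_Int)
  next
    fix K assume K: "\<forall>U\<in>K. U \<subseteq> ?C \<and> openin T (\<Union>U)"
    then show "\<Union>K \<subseteq> ?C" by blast
    have "\<Union>(\<Union>K) = (\<Union>U\<in>K. \<Union>U)" by blast
    moreover have "openin T (\<Union>U\<in>K. \<Union>U)" using K by blast
    ultimately show "openin T (\<Union>(\<Union>K))" by simp
  qed
  then show ?thesis
    by (simp add: quotient_space_def)
qed


section \<open>Link diagrams\<close>

text \<open>A diagram is recorded up to planar isotopy by its combinatorial planar map (a planar diagram
  code). The crossings are \<open>0, \<dots>, ncr - 1\<close>, and this numbering is the chosen ordering.
  The four strand ends (darts) at a crossing \<open>x\<close> are \<open>(x,0), \<dots>, (x,3)\<close> in counterclockwise
  order, where the undercrossing strand consists of \<open>(x,0)\<close> and \<open>(x,2)\<close> and the overcrossing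
  strand of \<open>(x,1)\<close> and \<open>(x,3)\<close>. Every dart is joined to \<open>arc_end\<close> of it by an edge of the
  underlying 4-valent graph. The components of the curve without crossings are counted by
  \<open>free_circles\<close>. The relative nesting of distinct components of the underlying graph is not
  recorded, so no information is lost for connected diagrams.\<close>

type_synonym dart = "nat \<times> nat"

record diagram =
  ncr :: nat
  arc_end :: "dart \<Rightarrow> dart"
  free_circles :: nat

definition darts :: "diagram \<Rightarrow> dart set" where
  "darts D = {..<ncr D} \<times> {..<4}"

definition rot :: "dart \<Rightarrow> dart" where
  "rot = (\<lambda>(x, p). (x, (p + 1) mod 4))"

definition graph_components :: "diagram \<Rightarrow> nat set set" where
  "graph_components D =
     gen_classes (\<lambda>x y. \<exists>p<4. fst (arc_end D (x, p)) = y) {..<ncr D}"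

text \<open>The boundary walks of the faces: run along an edge, then turn to the neighbouring dart.\<close>

definition face_walks :: "diagram \<Rightarrow> dart set set" where
  "face_walks D = gen_classes (\<lambda>d e. e = rot (arc_end D d)) (darts D)"

text \<open>Planarity is Euler's formula \<open>V - E + F = 2\<close> for each component, where \<open>F\<close> counts the
  boundary walks. As \<open>V - E + F \<le> 2\<close> holds for every component, this is equivalent to the
  equation summed over all components, with \<open>V = ncr D\<close> and \<open>E = 2 * ncr D\<close> in total.\<close>

definition link_diagram :: "diagram \<Rightarrow> bool" where
  "link_diagram D \<longleftrightarrow>
     (\<forall>d \<in> darts D. arc_end D d \<in> darts D \<and> arc_end D d \<noteq> d \<and> arc_end D (arc_end D d) = d) \<and>
     int (ncr D) - int (2 * ncr D) + int (card (face_walks D)) = 2 * int (card (graph_components D))"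

definition connected_diagram :: "diagram \<Rightarrow> bool" where
  "connected_diagram D \<longleftrightarrow> card (graph_components D) + free_circles D = 1"


section \<open>Kauffman states\<close>

datatype label = LabelA | LabelB

type_synonym state = "nat \<Rightarrow> label"

definition states :: "diagram \<Rightarrow> state set" where
  "states D = {..<ncr D} \<rightarrow>\<^sub>E {LabelA, LabelB}"

text \<open>Rotating the overcrossing strand counterclockwise sweeps out the corner between the darts
  1 and 2 and the corner between 3 and 0. The A-smoothing joins these two corners, so
  its two arcs connect 0 with 1 and 2 with 3.\<close>

fun smoothing_arc :: "label \<Rightarrow> nat \<Rightarrow> nat" where
  "smoothing_arc LabelA p = (if p = 0 then 1 else if p = 1 then 0 else if p = 2 then 3 else 2)"
| "smoothing_arc LabelB p = (if p = 1 then 2 else if p = 2 then 1 else if p = 3 then 0 else 3)"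

text \<open>A circle of \<open>sD\<close> is given by the set of darts it runs through, or it is one of the
  crossingless components of the diagram.\<close>

type_synonym circle = "dart set + nat"

definition dart_circles :: "diagram \<Rightarrow> state \<Rightarrow> dart set set" where
  "dart_circles D s =
     gen_classes (\<lambda>d e. e = arc_end D d \<or> e = (fst d, smoothing_arc (s (fst d)) (snd d))) (darts D)"

definition circles :: "diagram \<Rightarrow> state \<Rightarrow> circle set" where
  "circles D s = Inl ` dart_circles D s \<union> Inr ` {..<free_circles D}"

definition sigma :: "diagram \<Rightarrow> state \<Rightarrow> int" where
  "sigma D s = int (card {x. x < ncr D \<and> s x = LabelA}) - int (card {x. x < ncr D \<and> s x = LabelB})"

definition state_A :: "diagram \<Rightarrow> state" where
  "state_A D = (\<lambda>x \<in> {..<ncr D}. LabelA)"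


section \<open>The state graph\<close>

record ('v, 'e) multigraph =
  verts :: "'v set"
  edges :: "'e set"
  ends :: "'e \<Rightarrow> 'v set"

definition loop_edge :: "('v, 'e) multigraph \<Rightarrow> 'e \<Rightarrow> bool" where
  "loop_edge G e \<longleftrightarrow> (\<exists>v. ends G e = {v})"

definition parallel :: "('v, 'e) multigraph \<Rightarrow> 'e \<Rightarrow> 'e \<Rightarrow> bool" where
  "parallel G e e' \<longleftrightarrow> ends G e = ends G e'"

text \<open>The chord at \<open>x\<close> connects the two arcs of the A-smoothing, which contain the darts
  \<open>(x,0)\<close>, \<open>(x,1)\<close> and \<open>(x,2)\<close>, \<open>(x,3)\<close>, respectively.\<close>

definition state_graph_A :: "diagram \<Rightarrow> (circle, nat) multigraph" where
  "state_graph_A D =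
     \<lparr>verts = circles D (state_A D),
      edges = {..<ncr D},
      ends = (\<lambda>x. {Inl C | C. C \<in> dart_circles D (state_A D) \<and>
                               C \<inter> {(x, 0), (x, 1), (x, 2), (x, 3)} \<noteq> {}})\<rparr>"

definition A_adequate :: "diagram \<Rightarrow> bool" where
  "A_adequate D \<longleftrightarrow> (\<forall>e \<in> edges (state_graph_A D). \<not> loop_edge (state_graph_A D) e)"


section \<open>The Khovanov complex\<close>

type_synonym enhanced_state = "state \<times> (circle \<Rightarrow> int)"

definition enhanced_states :: "diagram \<Rightarrow> enhanced_state set" where
  "enhanced_states D = (SIGMA s : states D. circles D s \<rightarrow>\<^sub>E {1, - 1})"

definition tau :: "diagram \<Rightarrow> enhanced_state \<Rightarrow> int" where
  "tau D S = (\<Sum>C \<in> circles D (fst S). snd S C)"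

definition i_degree :: "diagram \<Rightarrow> enhanced_state \<Rightarrow> int" where
  "i_degree D S = sigma D (fst S)"

definition j_degree :: "diagram \<Rightarrow> enhanced_state \<Rightarrow> int" where
  "j_degree D S = sigma D (fst S) + 2 * tau D S"

definition khovanov_group :: "diagram \<Rightarrow> int \<Rightarrow> int \<Rightarrow> (enhanced_state \<Rightarrow>\<^sub>0 int) monoid" where
  "khovanov_group D i j =
     free_Abelian_group {S \<in> enhanced_states D. i_degree D S = i \<and> j_degree D S = j}"

definition adjacent_at :: "diagram \<Rightarrow> nat \<Rightarrow> enhanced_state \<Rightarrow> enhanced_state \<Rightarrow> bool" where
  "adjacent_at D x S T \<longleftrightarrow>
     S \<in> enhanced_states D \<and> T \<in> enhanced_states D \<and>
     i_degree D T = i_degree D S - 2 \<and> j_degree D T = j_degree D S \<and>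
     x < ncr D \<and> fst S x = LabelA \<and> fst T x = LabelB \<and>
     (\<forall>y < ncr D. y \<noteq> x \<longrightarrow> fst S y = fst T y) \<and>
     (\<forall>C \<in> circles D (fst S) \<inter> circles D (fst T). snd S C = snd T C)"

definition incidence :: "diagram \<Rightarrow> enhanced_state \<Rightarrow> enhanced_state \<Rightarrow> int" where
  "incidence D S T =
     (if \<exists>x. adjacent_at D x S T
      then (- 1) ^ card {y. (THE x. adjacent_at D x S T) < y \<and> y < ncr D \<and> fst S y = LabelB}
      else 0)"

definition khovanov_diff ::
    "diagram \<Rightarrow> (enhanced_state \<Rightarrow>\<^sub>0 int) \<Rightarrow> (enhanced_state \<Rightarrow>\<^sub>0 int)" where
  "khovanov_diff D =
     frag_extend (\<lambda>S. \<Sum>T \<in> enhanced_states D. frag_cmul (incidence D S T) (frag_of T))"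

definition j_max :: "diagram \<Rightarrow> int" where
  "j_max D = Max (j_degree D ` enhanced_states D)"

definition j_almax :: "diagram \<Rightarrow> int" where
  "j_almax D = j_max D - 4"

text \<open>The degree is \<open>q = c - 1 - k\<close>, where \<open>c\<close> is the number of crossings.\<close>

definition almost_extreme_complex :: "diagram \<Rightarrow> (enhanced_state \<Rightarrow>\<^sub>0 int) chain_complex" where
  "almost_extreme_complex D =
     \<lparr>Grp = (\<lambda>q. let k = int (ncr D) - 1 - q in khovanov_group D (int (ncr D) - 2 * k) (j_almax D)),
      Diff = (\<lambda>q. khovanov_diff D)\<rparr>"


section \<open>Partial presimplicial sets and their realizations\<close>

text \<open>\<open>face X k i\<close> is the partial map \<open>d\<^sub>i\<close> on the \<open>k\<close>-simplices, with value \<open>None\<close> where it is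
  undefined. Only its values at \<open>k \<ge> 1\<close>, \<open>i \<le> k\<close> and \<open>k\<close>-simplices are relevant.\<close>

record 'a partial_presimplicial =
  simplices :: "nat \<Rightarrow> 'a set"
  face :: "nat \<Rightarrow> nat \<Rightarrow> 'a \<Rightarrow> 'a option"

definition partial_presimplicial_set :: "'a partial_presimplicial \<Rightarrow> bool" where
  "partial_presimplicial_set X \<longleftrightarrow>
     (\<forall>k i a b. i \<le> Suc k \<longrightarrow> a \<in> simplices X (Suc k) \<longrightarrow> face X (Suc k) i a = Some b \<longrightarrow>
                b \<in> simplices X k) \<and>
     (\<forall>k i j a. i < j \<longrightarrow> j \<le> Suc (Suc k) \<longrightarrow> a \<in> simplices X (Suc (Suc k)) \<longrightarrow>
                Option.bind (face X (Suc (Suc k)) j a) (face X (Suc k) i) =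
                Option.bind (face X (Suc (Suc k)) i a) (face X (Suc k) (j - 1)))"

definition proper :: "'a partial_presimplicial \<Rightarrow> bool" where
  "proper X \<longleftrightarrow> (\<exists>k i. \<exists>a \<in> simplices X (Suc k). i \<le> Suc k \<and> face X (Suc k) i a = None)"

text \<open>The disjoint summands from which the realization is glued: \<open>Some (k, a)\<close> indexes a copy of
  the \<open>k\<close>-simplex for each \<open>a \<in> X\<^sub>k\<close>, and \<open>None\<close>, which is present in the proper case
  only, indexes the extra point \<open>b\<close>, realized as a copy of the one-point space \<open>\<Delta>\<^sup>0\<close>.\<close>

type_synonym 'a cell_index = "(nat \<times> 'a) option"

type_synonym 'a prepoint = "'a cell_index \<times> (nat \<Rightarrow> real)"

definition cell_indices :: "'a partial_presimplicial \<Rightarrow> 'a cell_index set" where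
  "cell_indices X =
     {Some (k, a) | k a. a \<in> simplices X k} \<union> (if proper X then {None} else {})"

fun cell_dim :: "'a cell_index \<Rightarrow> nat" where
  "cell_dim (Some (k, a)) = k"
| "cell_dim None = 0"

definition base_prepoint :: "'a prepoint" where
  "base_prepoint = (None, \<lambda>i. if i = 0 then 1 else 0)"

definition prerealization :: "'a partial_presimplicial \<Rightarrow> 'a prepoint topology" where
  "prerealization X =
     sum_topology (\<lambda>u. subtopology (powertop_real UNIV) (standard_simplex (cell_dim u)))
       (cell_indices X)"

inductive glue :: "'a partial_presimplicial \<Rightarrow> 'a prepoint \<Rightarrow> 'a prepoint \<Rightarrow> bool"
  for X :: "'a partial_presimplicial" where
  "\<lbrakk>a \<in> simplices X (Suc k); i \<le> Suc k; t \<in> standard_simplex k; face X (Suc k) i a = Some a'\<rbrakk>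
   \<Longrightarrow> glue X (Some (Suc k, a), simplical_face i t) (Some (k, a'), t)"
| "\<lbrakk>a \<in> simplices X (Suc k); i \<le> Suc k; t \<in> standard_simplex k; face X (Suc k) i a = None\<rbrakk>
   \<Longrightarrow> glue X (Some (Suc k, a), simplical_face i t) base_prepoint"

definition realization :: "'a partial_presimplicial \<Rightarrow> 'a prepoint set topology" where
  "realization X = quotient_space (glue X) (prerealization X)"

text \<open>The skeleta of the CW structure, whose cells are the interiors of the glued simplices, and
  the 0-cell \<open>b\<close> in the proper case.\<close>

definition skeleton :: "'a partial_presimplicial \<Rightarrow> int \<Rightarrow> 'a prepoint set set" where
  "skeleton X p =
     {z \<in> topspace (realization X). \<exists>(u, t) \<in> z. int (cell_dim u) \<le> p}"


section \<open>The reduced cellular chain complex\<close>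

text \<open>For a space \<open>X\<close> filtered by skeleta \<open>K p\<close>: the groups \<open>H\<^sub>q(K q, K (q - 1))\<close> for \<open>q \<ge> 0\<close>, the
  differential being the boundary of the pair followed by the map to the relative
  group. The group \<open>\<int>\<close> in degree -1 appears as \<open>H\<^sub>0\<close> of a one-point space, and the augmentation
  on \<open>H\<^sub>0(K 0)\<close> is induced by the map to that space. The skeleton \<open>K (-1)\<close> is empty, so in
  degree 0 the group is \<open>H\<^sub>0(K 0)\<close>.\<close>

definition point_space :: "'a topology" where
  "point_space = discrete_topology {undefined}"

definition reduced_cellular_complex ::
    "'a topology \<Rightarrow> (int \<Rightarrow> 'a set) \<Rightarrow> 'a chain set chain_complex" where
  "reduced_cellular_complex X K =
     \<lparr>Grp = (\<lambda>q. if q = -1 then homology_group 0 (point_space :: 'a topology)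
                 else relative_homology_group q (subtopology X (K q)) (K (q - 1))),
      Diff = (\<lambda>q. if q \<ge> 1 then
                     hom_induced (q - 1) (subtopology X (K (q - 1))) {}
                                         (subtopology X (K (q - 1))) (K (q - 2)) id
                     \<circ> hom_boundary q (subtopology X (K q)) (K (q - 1))
                   else if q = 0 then
                     hom_induced 0 (subtopology X (K 0)) {} point_space {} (\<lambda>_. undefined)
                   else (\<lambda>_. \<one>\<^bsub>relative_homology_group (q - 1) (subtopology X (K (q - 1))) (K (q - 2))\<^esub>))\<rparr>"

lemma homology_group_point_space: "homology_group 0 point_space \<cong> integer_group"
  by (rule homology_coefficients) (simp add: point_space_def)


section \<open>The partial presimplicial set of a diagram\<close>

datatype 'v state_simplex = Vertex 'v | Edges "nat list"

definition omit :: "nat \<Rightarrow> 'a list \<Rightarrow> 'a list" where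
  "omit i w = take i w @ drop (Suc i) w"

text \<open>Here \<open>n = c - 1\<close> with \<open>c\<close> the number of crossings, so \<open>k = n\<close> and \<open>k < n\<close> read
  \<open>k + 1 = c\<close> and \<open>k + 1 < c\<close>. For \<open>c = 0\<close> there are no simplices at all, whence the
  realization is empty.\<close>

definition state_simplices :: "diagram \<Rightarrow> nat \<Rightarrow> circle state_simplex set" where
  "state_simplices D k =
     (let G = state_graph_A D in
      if k + 1 = ncr D then Vertex ` verts G
      else if k + 1 < ncr D then
        {Edges w | w. length w = k + 1 \<and> sorted_wrt (<) w \<and> set w \<subseteq> edges G \<and>
                      (\<forall>e \<in> edges G - set w. \<forall>e' \<in> edges G - set w. parallel G e e')}
      else {})"

fun state_face ::
    "diagram \<Rightarrow> nat \<Rightarrow> nat \<Rightarrow> circle state_simplex \<Rightarrow> circle state_simplex option" where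
  "state_face D k i (Vertex T) =
     (if T \<in> ends (state_graph_A D) i then Some (Edges (omit i [0..<ncr D])) else None)"
| "state_face D k i (Edges w) =
     (if \<forall>e \<in> edges (state_graph_A D) - set w. parallel (state_graph_A D) (w ! i) e
      then Some (Edges (omit i w)) else None)"

definition presimplicial_of :: "diagram \<Rightarrow> circle state_simplex partial_presimplicial" where
  "presimplicial_of D = \<lparr>simplices = state_simplices D, face = state_face D\<rparr>"

lemma length_omit: "i < length w \<Longrightarrow> length (omit i w) = length w - 1"
  by (simp add: omit_def)

lemma nth_omit_less: "i < j \<Longrightarrow> j < length w \<Longrightarrow> omit j w ! i = w ! i"
  by (simp add: omit_def nth_append)

lemma nth_omit_greater: "i < j \<Longrightarrow> j < length w \<Longrightarrow> omit i w ! (j - 1) = w ! j"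
  by (auto simp: omit_def nth_append min_def)

lemma omit_omit:
  assumes "i < j" "j < length w"
  shows "omit i (omit j w) = omit (j - 1) (omit i w)"
proof -
  obtain k where k: "j = Suc (i + k)"
    using assms(1) less_iff_Suc_add by blast
  have "omit i (omit j w) = take i w @ take k (drop (Suc i) w) @ drop (Suc j) w"
    using assms k by (simp add: omit_def drop_take)
  moreover have "omit (j - 1) (omit i w) = take i w @ take k (drop (Suc i) w) @ drop (Suc j) w"
    using assms k by (simp add: omit_def add.commute)
  ultimately show ?thesis by simp
qed

lemma set_omit:
  assumes "sorted_wrt (<) (w :: nat list)" "i < length w"
  shows "set (omit i w) = set w - {w ! i}" "sorted_wrt (<) (omit i w)"
proof -
  have w: "w = take i w @ w ! i # drop (Suc i) w"
    using assms(2) by (simp add: id_take_nth_drop)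
  have s: "sorted_wrt (<) (take i w @ w ! i # drop (Suc i) w)"
    using assms(1) w by simp
  then show "sorted_wrt (<) (omit i w)"
    by (auto simp: omit_def sorted_wrt_append)
  have "set w = set (take i w) \<union> {w ! i} \<union> set (drop (Suc i) w)"
    using arg_cong[OF w, of set] by auto
  moreover have "w ! i \<notin> set (take i w)" "w ! i \<notin> set (drop (Suc i) w)"
    using s by (auto simp: sorted_wrt_append)
  ultimately show "set (omit i w) = set w - {w ! i}"
    by (auto simp: omit_def)
qed

lemma partial_presimplicial_set_presimplicial_of:
  "partial_presimplicial_set (presimplicial_of D)"
proof -
  define G where "G = state_graph_A D"
  have E: "edges G = {..<ncr D}" by (simp add: G_def state_graph_A_def)
  have EdgesI: "Edges w \<in> state_simplices D k"
    if "length w = k + 1" "k + 1 < ncr D" "sorted_wrt (<) w" "set w \<subseteq> edges G"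
       "\<forall>e \<in> edges G - set w. \<forall>e' \<in> edges G - set w. parallel G e e'" for w k
    using that by (auto simp: state_simplices_def G_def Let_def)
  have EdgesD: "length w = k + 1" "k + 1 < ncr D" "sorted_wrt (<) w" "set w \<subseteq> edges G"
       "\<forall>e \<in> edges G - set w. \<forall>e' \<in> edges G - set w. parallel G e e'"
    if "Edges w \<in> state_simplices D k" for w k
    using that by (auto simp: state_simplices_def G_def Let_def split: if_splits)
  have VertexD: "k + 1 = ncr D" if "Vertex T \<in> state_simplices D k" for T k
    using that by (auto simp: state_simplices_def Let_def split: if_splits)
  have sorted: "sorted_wrt (<) [0..<ncr D]" by simp
  have set_upt_omit: "set (omit j [0..<ncr D]) = {..<ncr D} - {j}" if "j < ncr D" for j
  proof -
    have "j < length [0..<ncr D]" using that by simp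
    from set_omit(1)[OF sorted this] show ?thesis
      using that by (simp add: atLeast0LessThan)
  qed
  have upt: "edges G - set (omit j [0..<ncr D]) = {j}" if "j < ncr D" for j
    unfolding set_upt_omit[OF that] E using that by blast
  have A: "b \<in> state_simplices D k"
    if "i \<le> Suc k" "a \<in> state_simplices D (Suc k)" "state_face D (Suc k) i a = Some b" for k i a b
  proof (cases a)
    case (Vertex T)
    then have c: "ncr D = k + 2" using VertexD that by force
    then have i: "i < ncr D" using that by simp
    have b: "b = Edges (omit i [0..<ncr D])"
      using that Vertex by (auto split: if_splits)
    have l: "i < length [0..<ncr D]" using i by simp
    show ?thesis unfolding b
    proof (rule EdgesI)
      show "length (omit i [0..<ncr D]) = k + 1" using length_omit[OF l] c by simp
      show "k + 1 < ncr D" using c by simp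
      show "sorted_wrt (<) (omit i [0..<ncr D])" by (rule set_omit(2)[OF sorted l])
      show "set (omit i [0..<ncr D]) \<subseteq> edges G" unfolding set_upt_omit[OF i] E by blast
    qed (simp add: upt[OF i] parallel_def)
  next
    case (Edges w)
    note w = EdgesD[OF that(2)[unfolded Edges]]
    have i: "i < length w" using that w by simp
    have p: "\<forall>e \<in> edges G - set w. parallel G (w ! i) e"
      and b: "b = Edges (omit i w)"
      using that Edges by (auto simp: G_def split: if_splits)
    show ?thesis unfolding b
    proof (rule EdgesI)
      show "\<forall>e\<in>edges G - set (omit i w). \<forall>e'\<in>edges G - set (omit i w). parallel G e e'"
      proof (intro ballI)
        have "parallel G (w ! i) e" if "e \<in> edges G - set (omit i w)" for e
          using p that set_omit(1)[OF w(3) i] by (cases "e = w ! i") (auto simp: parallel_def)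
        then show "parallel G e e'" if "e \<in> edges G - set (omit i w)"
          "e' \<in> edges G - set (omit i w)" for e e'
          using that unfolding parallel_def by metis
      qed
    qed (use w i set_omit[OF w(3) i] in \<open>auto simp: length_omit\<close>)
  qed
  have B: "Option.bind (state_face D (Suc (Suc k)) j a) (state_face D (Suc k) i) =
           Option.bind (state_face D (Suc (Suc k)) i a) (state_face D (Suc k) (j - 1))"
    if "i < j" "j \<le> Suc (Suc k)" "a \<in> state_simplices D (Suc (Suc k))" for k i j a
  proof (cases a)
    case (Vertex T)
    then have "ncr D = k + 3" using VertexD that by force
    then have j: "j < ncr D" and i: "i < ncr D" using that by auto
    have l: "j < length [0..<ncr D]" using j by simp
    have iff: "T \<in> ends G j \<and> parallel G i j \<longleftrightarrow> T \<in> ends G i \<and> parallel G j i"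
      by (auto simp: parallel_def)
    have n: "omit j [0..<ncr D] ! i = i" "omit i [0..<ncr D] ! (j - 1) = j"
      using nth_omit_less[OF that(1) l] nth_omit_greater[OF that(1) l] i j by simp_all
    show ?thesis
      using iff n omit_omit[OF that(1) l] upt[OF i] upt[OF j]
      unfolding Vertex G_def by (auto simp del: upt_Suc)
  next
    case (Edges w)
    note w = EdgesD[OF that(3)[unfolded Edges]]
    have j: "j < length w" and i: "i < length w" using that w by auto
    have wE: "w ! i \<in> edges G" "w ! j \<in> edges G" using w i j by (meson nth_mem subsetD)+
    have ci: "edges G - set (omit i w) = insert (w ! i) (edges G - set w)"
      and cj: "edges G - set (omit j w) = insert (w ! j) (edges G - set w)"
      using set_omit(1)[OF w(3) i] set_omit(1)[OF w(3) j] i j wE by auto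
    have "(\<forall>e \<in> edges G - set w. parallel G (w ! j) e) \<and>
            (\<forall>e \<in> insert (w ! j) (edges G - set w). parallel G (w ! i) e) \<longleftrightarrow>
          (\<forall>e \<in> edges G - set w. parallel G (w ! i) e) \<and>
            (\<forall>e \<in> insert (w ! i) (edges G - set w). parallel G (w ! j) e)"
      by (auto simp: parallel_def)
    then show ?thesis
      using nth_omit_less[OF that(1) j] nth_omit_greater[OF that(1) j] omit_omit[OF that(1) j] ci cj
      by (auto simp: Edges G_def)
  qed
  show ?thesis
    unfolding partial_presimplicial_set_def presimplicial_of_def using A B by simp
qed

end

theory Submission
  imports Defs "HOL-Analysis.Abstract_Topological_Spaces" "HOL-Combinatorics.Transposition"
begin

text \<open>Changing one label of a state merges two circles or splits one, so the state \<open>s\<^sub>B\<close> with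
  B-labels at \<open>B\<close> has at most \<open>|s\<^sub>A| + |B| - 2\<close> circles if \<open>B\<close> is nonempty and \<open>D\<close> is
  A-adequate, and at most \<open>|s\<^sub>A| + |B| - 4\<close> if \<open>B\<close> contains nonparallel edges. Equality in the
  first bound for parallel edges is where planarity enters: keep the crossings of \<open>B\<close> as vertices and smooth the others. The faces
  of the resulting plane graph are the circles of \<open>s\<^sub>A\<close> and of \<open>s\<^sub>B\<close>, each traversed once, and
  Euler's formula applies. Hence the almost-extreme complex is freely generated by the states
  \<open>s\<^sub>A\<close> with one negative circle, and by the all-plus states with nonempty parallel \<open>B\<close>. These are
  the cells of the realization; up to signs the differentials agree, except that in the proper case
  the base point and the augmentation form an additional contractible summand. The cellular complex
  of the realization is computed by showing that the characteristic maps of the \<open>q\<close>-cells represent a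
  basis of \<open>H\<^sub>q(K\<^sub>q, K\<^sub>q\<^sub>-\<^sub>1)\<close>: the skeleton minus the barycenters of its \<open>q\<close>-cells retracts to
  \<open>K\<^sub>q\<^sub>-\<^sub>1\<close>, and excision reduces the claim to the standard simplex.\<close>

section \<open>Bases of relative homology\<close>

text \<open>Homology is handled through explicit relative cycles instead of cosets: a basis is a
  family of cycles, so excision, relativization and connecting maps turn into statements about
  chains. Beyond degree 1 the square of the differential is not computed from signs: on cells it is
  inherited from the singular boundary, on the Khovanov side from the cells through the comparison
  maps. The obstacle in the planar count is that parallel chords might attach to a circle from
  different sides. Choosing a direction on each circle amounts to a two-colouring of the darts that
  every arc and every smoothing arc reverses. Planarity makes the colour of the darts at the
  crossings of \<open>B\<close> depend on their parity alone, after reversing the direction of the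
  two circles if necessary; then the face walk follows one state on each colour. Planarity itself
  survives smoothing by a squeeze: the Euler count never drops when a vertex is split, and it has
  the same value \<open>2 * ncr D\<close> for the unsmoothed diagram and for the map in which every
  dart is a vertex of its own.\<close>

definition homology_basis ::
    "nat \<Rightarrow> 'a topology \<Rightarrow> 'a set \<Rightarrow> 'i set \<Rightarrow> ('i \<Rightarrow> 'a chain) \<Rightarrow> bool" where
  "homology_basis p X S I z \<longleftrightarrow>
     (\<forall>i\<in>I. singular_relcycle p X S (z i)) \<and>
     (\<forall>c. singular_relcycle p X S c \<longrightarrow>
        (\<exists>n. Poly_Mapping.keys n \<subseteq> I \<and> homologous_rel p X S c (frag_extend z n))) \<and>
     (\<forall>n. Poly_Mapping.keys n \<subseteq> I \<longrightarrow> singular_relboundary p X S (frag_extend z n) \<longrightarrow> n = 0)"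

text \<open>A chain-level certificate that an additive \<open>F\<close> induces an isomorphism of
  relative homology: cycles go to cycles, boundaries are preserved and detected, and every class is
  hit up to homology. The two degrees are independent so that connecting homomorphisms fit as well
  as induced maps.\<close>

definition homology_iso_by ::
    "('a chain \<Rightarrow> 'b chain) \<Rightarrow> nat \<Rightarrow> 'a topology \<Rightarrow> 'a set \<Rightarrow> nat \<Rightarrow> 'b topology \<Rightarrow> 'b set \<Rightarrow> bool" where
  "homology_iso_by F p X S q Y T \<longleftrightarrow>
     (\<forall>a b. F (a - b) = F a - F b) \<and>
     (\<forall>c. singular_relcycle p X S c \<longrightarrow> singular_relcycle q Y T (F c)) \<and>
     (\<forall>c. singular_relcycle p X S c \<longrightarrow>
        (singular_relboundary q Y T (F c) \<longleftrightarrow> singular_relboundary p X S c)) \<and>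
     (\<forall>d. singular_relcycle q Y T d \<longrightarrow>
        (\<exists>c. singular_relcycle p X S c \<and> homologous_rel q Y T d (F c)))"

lemma frag_extend_additive:
  assumes "\<And>a b. F (a - b) = F a - F b"
  shows "F (frag_extend z n) = frag_extend (F \<circ> z) n"
proof -
  have F0: "F 0 = 0" using assms[of 0 0] by simp
  have "Poly_Mapping.keys n \<subseteq> UNIV" by simp
  then show ?thesis
    by (induction n rule: free_Abelian_group_induct [where S = UNIV])
       (simp_all add: F0 frag_extend_diff assms)
qed

lemma frag_cmul_diff_distrib2: "frag_cmul k (a - b) = frag_cmul k a - frag_cmul k b"
  by (rule poly_mapping_eqI) (simp add: lookup_minus right_diff_distrib)

lemma frag_extend_pointwise_diff:
  "frag_extend z n - frag_extend w n = frag_extend (\<lambda>i. z i - w i) n"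
  by (simp add: frag_extend_def frag_cmul_diff_distrib2 sum_subtractf)

lemma singular_relcycle_frag_extend:
  assumes "\<And>i. i \<in> Poly_Mapping.keys n \<Longrightarrow> singular_relcycle p X S (z i)"
  shows "singular_relcycle p X S (frag_extend z n)"
  unfolding frag_extend_def using assms
  by (auto intro!: singular_relcycle_sum singular_relcycle_cmul)

lemma singular_relboundary_frag_extend:
  assumes "\<And>i. i \<in> Poly_Mapping.keys n \<Longrightarrow> singular_relboundary p X S (z i)"
  shows "singular_relboundary p X S (frag_extend z n)"
proof -
  have *: "singular_relboundary p X S (\<Sum>i\<in>A. frag_cmul (f i) (z i))"
    if "finite A" "A \<subseteq> Poly_Mapping.keys n" for A f
    using that
    by (induction A rule: finite_induct)
       (auto intro!: singular_relboundary_add singular_relboundary_cmul assms)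
  show ?thesis unfolding frag_extend_def by (rule *) auto
qed

lemma homologous_rel_frag_extend:
  assumes "\<And>i. i \<in> Poly_Mapping.keys n \<Longrightarrow> homologous_rel p X S (z i) (w i)"
  shows "homologous_rel p X S (frag_extend z n) (frag_extend w n)"
  unfolding homologous_rel_def frag_extend_pointwise_diff
  using assms by (auto intro!: singular_relboundary_frag_extend simp: homologous_rel_def)

lemma homology_basis_relcycle:
  "homology_basis p X S I z \<Longrightarrow> i \<in> I \<Longrightarrow> singular_relcycle p X S (z i)"
  by (simp add: homology_basis_def)

lemma homology_basis_spans:
  assumes "homology_basis p X S I z" "singular_relcycle p X S c"
  obtains n where "Poly_Mapping.keys n \<subseteq> I" "homologous_rel p X S c (frag_extend z n)"
  using assms unfolding homology_basis_def by meson

lemma homology_basis_independent: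
  assumes "homology_basis p X S I z" "Poly_Mapping.keys n \<subseteq> I"
    "singular_relboundary p X S (frag_extend z n)"
  shows "n = 0"
  using assms unfolding homology_basis_def by meson

lemma homology_basis_cong:
  assumes "homology_basis p X S I z" "\<And>i. i \<in> I \<Longrightarrow> homologous_rel p X S (z i) (w i)"
  shows "homology_basis p X S I w"
proof -
  have h: "homologous_rel p X S (frag_extend z n) (frag_extend w n)"
    if "Poly_Mapping.keys n \<subseteq> I" for n
    using assms(2) that by (intro homologous_rel_frag_extend) auto
  show ?thesis
    unfolding homology_basis_def
  proof (intro conjI ballI allI impI)
    show "singular_relcycle p X S (w i)" if "i \<in> I" for i
      using homologous_rel_singular_relcycle[OF assms(2)[OF that]] homology_basis_relcycle[OF assms(1) that]
      by simp
    show "\<exists>n. Poly_Mapping.keys n \<subseteq> I \<and> homologous_rel p X S c (frag_extend w n)"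
      if c: "singular_relcycle p X S c" for c
    proof -
      obtain n where n: "Poly_Mapping.keys n \<subseteq> I" "homologous_rel p X S c (frag_extend z n)"
        using assms(1) c unfolding homology_basis_def by blast
      have "homologous_rel p X S c (frag_extend w n)"
        by (rule homologous_rel_trans [OF h[OF n(1)] n(2)])
      then show ?thesis using n(1) by blast
    qed
    show "n = 0" if "Poly_Mapping.keys n \<subseteq> I" "singular_relboundary p X S (frag_extend w n)" for n
    proof -
      have "singular_relboundary p X S (frag_extend z n - frag_extend w n + frag_extend w n)"
        using h[OF that(1)] that(2) unfolding homologous_rel_def by (rule singular_relboundary_add)
      then show ?thesis
        using assms(1) that(1) unfolding homology_basis_def by simp
    qed
  qed
qed

lemma homology_basis_push:
  assumes F: "homology_iso_by F p X S q Y T" and z: "homology_basis p X S I z"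
  shows "homology_basis q Y T I (F \<circ> z)"
proof -
  have D: "F (a - b) = F a - F b" for a b using F by (simp add: homology_iso_by_def)
  have E: "F (frag_extend z n) = frag_extend (F \<circ> z) n" for n
    by (rule frag_extend_additive) (rule D)
  have C: "singular_relcycle p X S (frag_extend z n)" if "Poly_Mapping.keys n \<subseteq> I" for n
    using that z by (intro singular_relcycle_frag_extend) (auto simp: homology_basis_def)
  show ?thesis
    unfolding homology_basis_def
  proof (intro conjI ballI allI impI)
    show "singular_relcycle q Y T ((F \<circ> z) i)" if "i \<in> I" for i
      using F z that by (simp add: homology_iso_by_def homology_basis_def)
    show "\<exists>n. Poly_Mapping.keys n \<subseteq> I \<and> homologous_rel q Y T d (frag_extend (F \<circ> z) n)"
      if d: "singular_relcycle q Y T d" for d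
    proof -
      obtain c where c: "singular_relcycle p X S c" "homologous_rel q Y T d (F c)"
        using F d by (auto simp: homology_iso_by_def)
      obtain n where n: "Poly_Mapping.keys n \<subseteq> I" "homologous_rel p X S c (frag_extend z n)"
        using z c by (auto simp: homology_basis_def)
      have "singular_relcycle p X S (c - frag_extend z n)"
        using c C[OF n(1)] by (simp add: singular_relcycle_diff)
      then have "homologous_rel q Y T (F c) (F (frag_extend z n))"
        using n F by (simp add: homologous_rel_def D[symmetric] homology_iso_by_def del: E)
      then show ?thesis
        using n c by (metis E homologous_rel_trans)
    qed
    show "n = 0" if "Poly_Mapping.keys n \<subseteq> I" "singular_relboundary q Y T (frag_extend (F \<circ> z) n)" for n
      using F C[OF that(1)] that z unfolding homology_iso_by_def homology_basis_def E[symmetric] by blast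
  qed
qed

text \<open>Because \<open>F\<close> detects boundaries, a family of cycles may be tested for being
  a basis after applying \<open>F\<close>. This certifies concrete cycles, such as characteristic
  maps, without inverting \<open>F\<close> on chains.\<close>

lemma homology_basis_pull:
  assumes F: "homology_iso_by F p X S q Y T"
    and z: "\<And>i. i \<in> I \<Longrightarrow> singular_relcycle p X S (z i)"
    and b: "homology_basis q Y T I (F \<circ> z)"
  shows "homology_basis p X S I z"
proof -
  have D: "F (a - b) = F a - F b" for a b using F by (simp add: homology_iso_by_def)
  have E: "F (frag_extend z n) = frag_extend (F \<circ> z) n" for n
    by (rule frag_extend_additive) (rule D)
  have C: "singular_relcycle p X S (frag_extend z n)" if "Poly_Mapping.keys n \<subseteq> I" for n
    using that z by (intro singular_relcycle_frag_extend) auto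
  show ?thesis
    unfolding homology_basis_def
  proof (intro conjI ballI allI impI)
    show "\<exists>n. Poly_Mapping.keys n \<subseteq> I \<and> homologous_rel p X S c (frag_extend z n)"
      if c: "singular_relcycle p X S c" for c
    proof -
      have "singular_relcycle q Y T (F c)" using F c by (simp add: homology_iso_by_def)
      then obtain n where n: "Poly_Mapping.keys n \<subseteq> I"
          "homologous_rel q Y T (F c) (frag_extend (F \<circ> z) n)"
        using b by (auto simp: homology_basis_def)
      have "singular_relcycle p X S (c - frag_extend z n)"
        using c C[OF n(1)] by (simp add: singular_relcycle_diff)
      then have "homologous_rel p X S c (frag_extend z n)"
        using n F unfolding homologous_rel_def E[symmetric] D[symmetric] homology_iso_by_def by blast
      then show ?thesis using n by blast
    qed
    show "n = 0" if "Poly_Mapping.keys n \<subseteq> I" "singular_relboundary p X S (frag_extend z n)" for n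
      using F C[OF that(1)] that b unfolding homology_iso_by_def homology_basis_def E[symmetric] by blast
  qed (use z in auto)
qed

text \<open>Preimages exist only up to homology. This is needed for excision, where the identity
  simplex is not contained in the space left after excision and has to be replaced by a homologous
  chain that is.\<close>

lemma homology_basis_lift:
  assumes F: "homology_iso_by F p X S q Y T" and w: "homology_basis q Y T I w"
  obtains z where "homology_basis p X S I z"
    "\<And>i. i \<in> I \<Longrightarrow> homologous_rel q Y T (w i) (F (z i))"
proof -
  have "\<forall>i\<in>I. \<exists>c. singular_relcycle p X S c \<and> homologous_rel q Y T (w i) (F c)"
    using F w by (auto simp: homology_iso_by_def homology_basis_def)
  then obtain z where z: "\<And>i. i \<in> I \<Longrightarrow> singular_relcycle p X S (z i)"
      "\<And>i. i \<in> I \<Longrightarrow> homologous_rel q Y T (w i) (F (z i))"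
    by metis
  have *: "homology_basis q Y T I (F \<circ> z)"
    by (rule homology_basis_cong [OF w]) (simp add: z)
  have "homology_basis p X S I z"
    by (rule homology_basis_pull [OF F]) (use z(1) * in auto)
  then show thesis
    using z(2) by (rule that)
qed

lemma homologous_rel_set_in_carrier:
  assumes "singular_relcycle p X S c"
  shows "homologous_rel_set p X S c \<in> carrier (relative_homology_group (int p) X S)"
  unfolding carrier_relative_homology_group using assms by (intro imageI CollectI)

lemma relative_homology_group_cases:
  assumes "x \<in> carrier (relative_homology_group (int p) X S)"
  obtains c where "singular_relcycle p X S c" "x = homologous_rel_set p X S c"
proof -
  have "x \<in> homologous_rel_set p X S ` singular_relcycle_set p X S"
    using assms by (simp only: carrier_relative_homology_group)
  then show thesis
    by (rule imageE) (rule that, simp_all only: mem_Collect_eq)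
qed

text \<open>Translates an isomorphism of coset groups into the chain-level form: injectivity,
  applied to a class and the class of \<open>0\<close>, gives detection of boundaries; surjectivity
  gives preimages up to homology.\<close>

lemma homology_iso_by_gen:
  assumes F: "\<And>a b. F (a - b) = F a - F b"
    and cyc: "\<And>c. singular_relcycle p X S c \<Longrightarrow> singular_relcycle q Y T (F c)"
    and h: "h \<in> iso (relative_homology_group (int p) X S) (relative_homology_group (int q) Y T)"
    and hF: "\<And>c. singular_relcycle p X S c \<Longrightarrow>
               h (homologous_rel_set p X S c) = homologous_rel_set q Y T (F c)"
  shows "homology_iso_by F p X S q Y T"
proof -
  have bij: "bij_betw h (carrier (relative_homology_group (int p) X S)) (carrier (relative_homology_group (int q) Y T))"
    using h unfolding iso_def by blast
  note inj = bij_betw_imp_inj_on [OF bij] and im = bij_betw_imp_surj_on [OF bij]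
  have F0: "F 0 = 0" using F[of 0 0] by simp
  have bd: "singular_relboundary q Y T (F c) \<longleftrightarrow> singular_relboundary p X S c"
    if c: "singular_relcycle p X S c" for c
  proof -
    have "homologous_rel_set p X S c \<in> carrier (relative_homology_group (int p) X S)"
         "homologous_rel_set p X S 0 \<in> carrier (relative_homology_group (int p) X S)"
      by (rule homologous_rel_set_in_carrier, rule c, rule homologous_rel_set_in_carrier, rule singular_relcycle_0)
    then have "h (homologous_rel_set p X S c) = h (homologous_rel_set p X S 0) \<longleftrightarrow>
          homologous_rel_set p X S c = homologous_rel_set p X S 0"
      by (rule inj_on_eq_iff [OF inj])
    then show ?thesis
      unfolding hF[OF c] hF[of 0, OF singular_relcycle_0] F0 homologous_rel_set_eq
      by (simp add: homologous_rel_def)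
  qed
  have sur: "\<exists>c. singular_relcycle p X S c \<and> homologous_rel q Y T d (F c)"
    if d: "singular_relcycle q Y T d" for d
  proof -
    have "homologous_rel_set q Y T d \<in> h ` carrier (relative_homology_group (int p) X S)"
      unfolding im by (rule homologous_rel_set_in_carrier) (rule d)
    then obtain x where x: "x \<in> carrier (relative_homology_group (int p) X S)"
        "homologous_rel_set q Y T d = h x"
      by (rule imageE)
    obtain c where c: "singular_relcycle p X S c" "x = homologous_rel_set p X S c"
      using x(1) by (rule relative_homology_group_cases)
    have "homologous_rel q Y T d (F c)"
      using x(2) unfolding c(2) hF[OF c(1)] homologous_rel_set_eq .
    then show ?thesis using c(1) by blast
  qed
  show ?thesis
    unfolding homology_iso_by_def using F cyc bd sur by blast
qed

lemma homology_iso_by_chain_map: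
  assumes "continuous_map X Y f" "f \<in> S \<rightarrow> T"
    and "hom_induced (int p) X S Y T f \<in> iso (relative_homology_group (int p) X S) (relative_homology_group (int p) Y T)"
  shows "homology_iso_by (chain_map p f) p X S p Y T"
proof (rule homology_iso_by_gen)
  show "singular_relcycle p Y T (chain_map p f c)" if "singular_relcycle p X S c" for c
    using that assms(1,2) by (rule singular_relcycle_chain_map)
  show "hom_induced (int p) X S Y T f (homologous_rel_set p X S c) =
        homologous_rel_set p Y T (chain_map p f c)" if "singular_relcycle p X S c" for c
    using assms(1,2) that by (rule hom_induced_chain_map)
qed (use assms in \<open>auto simp: chain_map_diff\<close>)

text \<open>In the triple \<open>T \<subseteq> S \<subseteq> X\<close>, the relative connecting map
  is the absolute boundary followed by passage to the pair, hence \<open>chain_boundary\<close> on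
  representatives.\<close>

lemma homology_iso_by_chain_boundary:
  assumes p: "1 \<le> p" and TS: "T \<subseteq> S"
    and iso: "hom_relboundary (int p) X S T \<in>
           iso (relative_homology_group (int p) X S) (relative_homology_group (int p - 1) (subtopology X S) T)"
  shows "homology_iso_by (chain_boundary p) p X S (p - 1) (subtopology X S) T"
proof (rule homology_iso_by_gen)
  have e: "int (p - 1) = int p - 1" using p by simp
  show "hom_relboundary (int p) X S T \<in>
           iso (relative_homology_group (int p) X S) (relative_homology_group (int (p - 1)) (subtopology X S) T)"
    using iso e by simp
  have *: "singular_relcycle (p - 1) (subtopology X S) {} (chain_boundary p c)"
    if "singular_relcycle p X S c" for c
  proof -
    have "singular_chain p X c" "singular_chain (p - 1) (subtopology X S) (chain_boundary p c)"
      using that unfolding singular_relcycle by simp_all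
    then show ?thesis
      using chain_boundary_boundary[of p X c] unfolding singular_cycle by simp
  qed
  show "singular_relcycle (p - 1) (subtopology X S) T (chain_boundary p c)"
    if "singular_relcycle p X S c" for c
    using *[OF that] unfolding singular_cycle unfolding singular_relcycle by simp
  show "hom_relboundary (int p) X S T (homologous_rel_set p X S c) =
         homologous_rel_set (p - 1) (subtopology X S) T (chain_boundary p c)"
    if c: "singular_relcycle p X S c" for c
  proof -
    have "hom_induced (int (p - 1)) (subtopology X S) {} (subtopology X S) T id
            (homologous_rel_set (p - 1) (subtopology X S) {} (chain_boundary p c)) =
          homologous_rel_set (p - 1) (subtopology X S) T (chain_map (p - 1) id (chain_boundary p c))"
      using *[OF c] by (intro hom_induced_chain_map) auto
    moreover have "chain_map (p - 1) id (chain_boundary p c) = chain_boundary p c"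
      using *[OF c] by (intro chain_map_ident) (auto simp: singular_relcycle)
    ultimately show ?thesis
      using hom_boundary_chain_boundary[OF c p] e by (simp add: hom_relboundary_def)
  qed
qed (simp add: chain_boundary_diff)

section \<open>Disjoint unions\<close>

text \<open>The projection of a chain to the simplices lying in \<open>V\<close>. It is shown to be
  compatible with boundaries for clopen \<open>V\<close>; for general \<open>V\<close> a face can
  lie in \<open>V\<close> without the whole simplex doing so.\<close>

definition chain_within :: "nat \<Rightarrow> 'a set \<Rightarrow> 'a chain \<Rightarrow> 'a chain" where
  "chain_within p V = frag_extend (\<lambda>f. if f ` standard_simplex p \<subseteq> V then frag_of f else 0)"

lemma chain_within_diff: "chain_within p V (a - b) = chain_within p V a - chain_within p V b"
  by (simp add: chain_within_def frag_extend_diff)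

lemma chain_within_0 [simp]: "chain_within p V 0 = 0"
  by (simp add: chain_within_def)

lemma chain_within_add: "chain_within p V (a + b) = chain_within p V a + chain_within p V b"
  by (simp add: chain_within_def frag_extend_add)

lemma keys_chain_within:
  "Poly_Mapping.keys (chain_within p V c) \<subseteq> {f \<in> Poly_Mapping.keys c. f ` standard_simplex p \<subseteq> V}"
  unfolding chain_within_def
  by (rule order_trans [OF keys_frag_extend]) (auto simp: image_subset_iff split: if_splits)

lemma singular_chain_chain_within:
  assumes "singular_chain p (subtopology X S) c"
  shows "singular_chain p (subtopology (subtopology X V) S) (chain_within p V c)"
  unfolding singular_chain_def
proof
  fix f assume "f \<in> Poly_Mapping.keys (chain_within p V c)"
  then have "f \<in> Poly_Mapping.keys c" "f ` standard_simplex p \<subseteq> V"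
    using keys_chain_within by blast+
  moreover have "singular_simplex p (subtopology X S) f"
    using assms calculation(1) unfolding singular_chain_def by blast
  ultimately show "f \<in> singular_simplex_set p (subtopology (subtopology X V) S)"
    unfolding mem_Collect_eq singular_simplex_subtopology by simp
qed

lemma chain_within_ident:
  assumes "singular_chain p (subtopology X V) c"
  shows "chain_within p V c = c"
proof -
  have "chain_within p V c = frag_extend frag_of c"
    unfolding chain_within_def
  proof (rule frag_extend_eq)
    fix f assume "f \<in> Poly_Mapping.keys c"
    then have "f ` standard_simplex p \<subseteq> V"
      using assms unfolding singular_chain_subtopology by blast
    then show "(if f ` standard_simplex p \<subseteq> V then frag_of f else 0) = frag_of f" by simp
  qed
  then show ?thesis by (simp add: frag_expansion[symmetric])
qed

lemma chain_within_zero: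
  assumes "singular_chain p (subtopology X W) c" "W \<inter> V = {}"
  shows "chain_within p V c = 0"
  unfolding chain_within_def
proof (rule frag_extend_eq_0)
  fix f assume "f \<in> Poly_Mapping.keys c"
  then have "f ` standard_simplex p \<subseteq> W" using assms by (auto simp: singular_chain_subtopology)
  moreover have "f ` standard_simplex p \<noteq> {}" by (simp add: nonempty_standard_simplex)
  ultimately show "(if f ` standard_simplex p \<subseteq> V then frag_of f else 0) = 0"
    using assms(2) by auto
qed

lemma singular_simplex_clopen_cases:
  assumes "singular_simplex p X f" "openin X V" "closedin X V"
  shows "f ` standard_simplex p \<subseteq> V \<or> f ` standard_simplex p \<inter> V = {}"
proof -
  have "connectedin X (f ` standard_simplex p)"
    using assms(1) connectedin_standard_simplex[of p]
    by (metis connectedin_continuous_map_image connectedin_subtopology order_refl singular_simplex_def)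
  then show ?thesis
    using connectedin_clopen_cases[OF _ assms(3,2)] by (auto simp: disjnt_def)
qed

text \<open>A simplex is connected, so with respect to a clopen set it lies inside or outside as a
  whole, and its faces fall on the same side.\<close>

lemma chain_boundary_chain_within:
  assumes "singular_chain p X c" "openin X V" "closedin X V" "1 \<le> p"
  shows "chain_boundary p (chain_within p V c) = chain_within (p - 1) V (chain_boundary p c)"
proof -
  have gen: "chain_boundary p (chain_within p V (frag_of f)) = chain_within (p - 1) V (chain_boundary p (frag_of f))"
    if f: "singular_simplex p X f" for f
  proof -
    have sub: "singular_face p k f ` standard_simplex (p - 1) \<subseteq> f ` standard_simplex p" if "k \<le> p" for k
      using that assms(4) simplical_face_in_standard_simplex
      by (fastforce simp: singular_face_def)
    have ne: "singular_face p k f ` standard_simplex (p - 1) \<noteq> {}" for k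
      by (simp add: nonempty_standard_simplex)
    have iff: "singular_face p k f ` standard_simplex (p - 1) \<subseteq> V \<longleftrightarrow> f ` standard_simplex p \<subseteq> V"
      if "k \<le> p" for k
      using singular_simplex_clopen_cases[OF f assms(2,3)] sub[OF that] ne[of k] by blast
    have "chain_within (p - 1) V (chain_boundary p (frag_of f)) =
          (\<Sum>k\<le>p. chain_within (p - 1) V (frag_cmul ((-1) ^ k) (frag_of (singular_face p k f))))"
      using assms(4) by (simp add: chain_boundary_of chain_within_def frag_extend_sum o_def)
    also have "\<dots> = (\<Sum>k\<le>p. if f ` standard_simplex p \<subseteq> V
                 then frag_cmul ((-1) ^ k) (frag_of (singular_face p k f)) else 0)"
      using iff by (intro sum.cong) (auto simp: chain_within_def frag_extend_cmul)
    also have "\<dots> = chain_boundary p (chain_within p V (frag_of f))"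
      using assms(4) by (auto simp: chain_within_def chain_boundary_of)
    finally show ?thesis by simp
  qed
  have "Poly_Mapping.keys c \<subseteq> singular_simplex_set p X" using assms(1) by (simp add: singular_chain_def)
  then show ?thesis
    by (rule free_Abelian_group_induct)
       (use gen in \<open>auto simp: chain_within_diff chain_boundary_diff\<close>)
qed

lemma singular_relcycle_chain_within:
  assumes "singular_relcycle p X S c" "openin X V" "closedin X V"
  shows "singular_relcycle p (subtopology X V) S (chain_within p V c)"
proof -
  have c: "singular_chain p X c" "singular_chain (p - 1) (subtopology X S) (chain_boundary p c)"
    using assms(1) by (auto simp: singular_relcycle)
  have 1: "singular_chain p (subtopology X V) (chain_within p V c)"
    using singular_chain_chain_within[of p X UNIV c V] c by simp
  show ?thesis
  proof (cases "p = 0")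
    case True
    then show ?thesis using 1 by (auto simp: singular_relcycle chain_boundary_def)
  next
    case False
    then show ?thesis
      using 1 singular_chain_chain_within[OF c(2), of V] chain_boundary_chain_within[OF c(1) assms(2,3)]
      by (auto simp: singular_relcycle)
  qed
qed

lemma singular_relboundary_chain_within:
  assumes "singular_relboundary p X S c" "openin X V" "closedin X V"
  shows "singular_relboundary p (subtopology X V) S (chain_within p V c)"
proof -
  obtain d e where d: "singular_chain (Suc p) X d" and e: "singular_chain p (subtopology X S) e"
    and c: "chain_boundary (Suc p) d + e = c"
    using assms(1) by (auto simp: singular_relboundary)
  have "chain_boundary (Suc p) (chain_within (Suc p) V d) + chain_within p V e = chain_within p V c"
    using chain_boundary_chain_within[OF d assms(2,3)] c by (auto simp: chain_within_add)
  moreover have "singular_chain (Suc p) (subtopology X V) (chain_within (Suc p) V d)"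
    using singular_chain_chain_within[of "Suc p" X UNIV d V] d by simp
  ultimately show ?thesis
    using singular_chain_chain_within[OF e, of V] unfolding singular_relboundary by blast
qed

lemma singular_relcycle_subtopology_mono:
  assumes "singular_relcycle p (subtopology X V) S c"
  shows "singular_relcycle p X S c"
  using assms unfolding singular_relcycle
  by (metis inf_commute singular_chain_mono subtopology_UNIV subtopology_subtopology top_greatest inf.cobounded1)

lemma singular_relboundary_subtopology_mono:
  assumes "singular_relboundary p (subtopology X V) S c"
  shows "singular_relboundary p X S c"
  using assms unfolding singular_relboundary
  by (metis inf_commute singular_chain_mono subtopology_UNIV subtopology_subtopology top_greatest inf.cobounded1)

text \<open>A chain has finitely many simplices, each connected and hence inside exactly one piece;
  thus finitely many pieces suffice even for an infinite \<open>I\<close>.\<close>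

lemma chain_within_partition:
  assumes c: "singular_chain p X c" and un: "topspace X = (\<Union>a\<in>I. V a)"
    and opn: "\<And>a. a \<in> I \<Longrightarrow> openin X (V a)" and clo: "\<And>a. a \<in> I \<Longrightarrow> closedin X (V a)"
    and disj: "\<And>a b. a \<in> I \<Longrightarrow> b \<in> I \<Longrightarrow> a \<noteq> b \<Longrightarrow> V a \<inter> V b = {}"
  obtains A where "finite A" "A \<subseteq> I" "c = (\<Sum>a\<in>A. chain_within p (V a) c)"
proof -
  have ex: "\<exists>a\<in>I. f ` standard_simplex p \<subseteq> V a" if f: "f \<in> Poly_Mapping.keys c" for f
  proof -
    have s: "singular_simplex p X f" using f c by (auto simp: singular_chain_def)
    obtain t where t: "t \<in> standard_simplex p" using nonempty_standard_simplex by blast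
    have "f t \<in> topspace X" using s t by (auto simp: singular_simplex_def continuous_map_def)
    then obtain a where "a \<in> I" "f t \<in> V a" using un by blast
    then show ?thesis
      using singular_simplex_clopen_cases[OF s opn clo] t by blast
  qed
  then obtain k where k: "\<And>f. f \<in> Poly_Mapping.keys c \<Longrightarrow> k f \<in> I \<and> f ` standard_simplex p \<subseteq> V (k f)"
    by metis
  define A where "A = k ` Poly_Mapping.keys c"
  have AI: "A \<subseteq> I" "finite A" using k by (auto simp: A_def)
  have "(\<Sum>a\<in>A. chain_within p (V a) c) =
     (\<Sum>f\<in>Poly_Mapping.keys c. \<Sum>a\<in>A. frag_cmul (Poly_Mapping.lookup c f)
         (if f ` standard_simplex p \<subseteq> V a then frag_of f else 0))"
    unfolding chain_within_def frag_extend_def by (rule sum.swap)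
  also have "\<dots> = (\<Sum>f\<in>Poly_Mapping.keys c. frag_cmul (Poly_Mapping.lookup c f) (frag_of f))"
  proof (rule sum.cong [OF refl])
    fix f assume f: "f \<in> Poly_Mapping.keys c"
    have ne: "f ` standard_simplex p \<noteq> {}" by (simp add: nonempty_standard_simplex)
    have "f ` standard_simplex p \<subseteq> V a \<longleftrightarrow> a = k f" if "a \<in> A" for a
    proof
      assume "f ` standard_simplex p \<subseteq> V a"
      then have "V a \<inter> V (k f) \<noteq> {}" using k[OF f] ne by blast
      then show "a = k f" using disj[of a "k f"] that AI k[OF f] by auto
    qed (use k[OF f] in simp)
    then have "(\<Sum>a\<in>A. frag_cmul (Poly_Mapping.lookup c f) (if f ` standard_simplex p \<subseteq> V a then frag_of f else 0))
       = (\<Sum>a\<in>A. if a = k f then frag_cmul (Poly_Mapping.lookup c f) (frag_of f) else 0)"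
      by (intro sum.cong) auto
    also have "\<dots> = frag_cmul (Poly_Mapping.lookup c f) (frag_of f)"
      using AI f by (simp add: sum.delta A_def)
    finally show "(\<Sum>a\<in>A. frag_cmul (Poly_Mapping.lookup c f) (if f ` standard_simplex p \<subseteq> V a then frag_of f else 0))
       = frag_cmul (Poly_Mapping.lookup c f) (frag_of f)" .
  qed
  also have "\<dots> = c" using frag_expansion[of c] by (simp add: frag_extend_def)
  finally show thesis using that AI by metis
qed

text \<open>Projection to a piece separates the summands: it isolates one coefficient for
  independence, and splits a cycle into cycles of the pieces for generation. The index set
  \<open>{()}\<close> marks each piece as having a single generator.\<close>

lemma homology_basis_disjoint_union:
  assumes un: "topspace X = (\<Union>a\<in>I. V a)"
    and opn: "\<And>a. a \<in> I \<Longrightarrow> openin X (V a)"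
    and disj: "\<And>a b. a \<in> I \<Longrightarrow> b \<in> I \<Longrightarrow> a \<noteq> b \<Longrightarrow> V a \<inter> V b = {}"
    and basis: "\<And>a. a \<in> I \<Longrightarrow> homology_basis p (subtopology X (V a)) S {()} (\<lambda>_. z a)"
  shows "homology_basis p X S I z"
proof -
  have clo: "closedin X (V a)" if a: "a \<in> I" for a
  proof -
    have "V a \<inter> V b = {}" if "b \<in> I - {a}" for b
      using disj[OF a, of b] that by auto
    then have "topspace X - V a = (\<Union>b\<in>I - {a}. V b)" using un a by blast
    moreover have "openin X (\<Union>b\<in>I - {a}. V b)" using opn by blast
    ultimately show ?thesis using opn[OF a] by (simp add: closedin_def openin_subset)
  qed
  have fe: "frag_extend (\<lambda>_. c) n = frag_cmul (Poly_Mapping.lookup n ()) c" for c :: "'a chain" and n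
  proof -
    have "n = frag_cmul (Poly_Mapping.lookup n ()) (frag_of ())"
      by (rule poly_mapping_eqI) auto
    then show ?thesis by (metis frag_extend_cmul frag_extend_of)
  qed
  have zc: "singular_relcycle p (subtopology X (V a)) S (z a)" if "a \<in> I" for a
    using basis[OF that] by (simp add: homology_basis_def)
  have within: "chain_within p (V a) (frag_extend z n) = frag_cmul (Poly_Mapping.lookup n a) (z a)"
    if n: "Poly_Mapping.keys n \<subseteq> I" and a: "a \<in> I" for n a
  proof -
    have "chain_within p (V a) (frag_extend z n) = frag_extend (chain_within p (V a) \<circ> z) n"
      by (rule frag_extend_additive) (rule chain_within_diff)
    also have "\<dots> = (\<Sum>b\<in>Poly_Mapping.keys n. if b = a then frag_cmul (Poly_Mapping.lookup n a) (z a) else 0)"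
      unfolding frag_extend_def
    proof (rule sum.cong [OF refl])
      fix b assume "b \<in> Poly_Mapping.keys n"
      then have b: "b \<in> I" using n by auto
      have c: "singular_chain p (subtopology X (V b)) (z b)" using zc[OF b] by (simp add: singular_relcycle)
      show "frag_cmul (Poly_Mapping.lookup n b) ((chain_within p (V a) \<circ> z) b) =
            (if b = a then frag_cmul (Poly_Mapping.lookup n a) (z a) else 0)"
        using chain_within_ident[OF c] chain_within_zero[OF c, of "V a"] disj[OF b a] by auto
    qed
    also have "\<dots> = frag_cmul (Poly_Mapping.lookup n a) (z a)"
      by (auto simp: sum.delta in_keys_iff)
    finally show ?thesis .
  qed
  show ?thesis
    unfolding homology_basis_def
  proof (intro conjI ballI allI impI)
    show "singular_relcycle p X S (z a)" if "a \<in> I" for a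
      using zc[OF that] by (rule singular_relcycle_subtopology_mono)
    show "n = 0" if n: "Poly_Mapping.keys n \<subseteq> I" and b: "singular_relboundary p X S (frag_extend z n)" for n
    proof (rule poly_mapping_eqI)
      fix a
      show "Poly_Mapping.lookup n a = Poly_Mapping.lookup 0 a"
      proof (cases "a \<in> I")
        case True
        have "singular_relboundary p (subtopology X (V a)) S (frag_cmul (Poly_Mapping.lookup n a) (z a))"
          using singular_relboundary_chain_within[OF b opn[OF True] clo[OF True]] within[OF n True] by simp
        then have "singular_relboundary p (subtopology X (V a)) S
            (frag_extend (\<lambda>_. z a) (frag_cmul (Poly_Mapping.lookup n a) (frag_of ())))"
          by (simp add: fe)
        moreover have "Poly_Mapping.keys (frag_cmul (Poly_Mapping.lookup n a) (frag_of ())) \<subseteq> {()}"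
          by (rule subsetI) simp
        ultimately have "frag_cmul (Poly_Mapping.lookup n a) (frag_of ()) = 0"
          by (rule homology_basis_independent [OF basis[OF True], rotated])
        then show ?thesis by simp
      next
        case False
        then show ?thesis using n by (auto simp: in_keys_iff)
      qed
    qed
    show "\<exists>n. Poly_Mapping.keys n \<subseteq> I \<and> homologous_rel p X S c (frag_extend z n)"
      if c: "singular_relcycle p X S c" for c
    proof -
      have sc: "singular_chain p X c" using c by (simp add: singular_relcycle)
      obtain A where A: "finite A" "A \<subseteq> I" "c = (\<Sum>a\<in>A. chain_within p (V a) c)"
      proof (rule chain_within_partition [OF sc un])
        show "openin X (V a)" "closedin X (V a)" if "a \<in> I" for a
          using opn[OF that] clo[OF that] .
        show "V a \<inter> V b = {}" if "a \<in> I" "b \<in> I" "a \<noteq> b" for a b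
          using that by (rule disj)
      qed
      have "\<forall>a\<in>A. \<exists>k. homologous_rel p X S (chain_within p (V a) c) (frag_cmul k (z a))"
      proof
        fix a assume "a \<in> A"
        then have a: "a \<in> I" using A by auto
        have "singular_relcycle p (subtopology X (V a)) S (chain_within p (V a) c)"
          by (rule singular_relcycle_chain_within[OF c opn[OF a] clo[OF a]])
        then obtain m where "Poly_Mapping.keys m \<subseteq> {()}" and m: "homologous_rel p (subtopology X (V a)) S (chain_within p (V a) c) (frag_extend (\<lambda>_. z a) m)"
          by (rule homology_basis_spans [OF basis[OF a]])
        have "homologous_rel p X S (chain_within p (V a) c) (frag_cmul (Poly_Mapping.lookup m ()) (z a))"
          using m unfolding fe homologous_rel_def by (rule singular_relboundary_subtopology_mono)
        then show "\<exists>k. homologous_rel p X S (chain_within p (V a) c) (frag_cmul k (z a))" ..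
      qed
      then obtain k where k: "\<And>a. a \<in> A \<Longrightarrow> homologous_rel p X S (chain_within p (V a) c) (frag_cmul (k a) (z a))"
        by metis
      define n where "n = (\<Sum>a\<in>A. frag_cmul (k a) (frag_of a))"
      have keys: "Poly_Mapping.keys n \<subseteq> I"
        unfolding n_def using A by (intro order_trans[OF keys_sum]) (auto split: if_splits)
      have fn: "frag_extend z n = (\<Sum>a\<in>A. frag_cmul (k a) (z a))"
        using A by (simp add: n_def frag_extend_sum o_def frag_extend_cmul)
      have "homologous_rel p X S (\<Sum>a\<in>B. chain_within p (V a) c) (\<Sum>a\<in>B. frag_cmul (k a) (z a))"
        if "finite B" "B \<subseteq> A" for B
        using that by (induction B rule: finite_induct) (auto intro!: homologous_rel_add k)
      from this[OF A(1) order_refl] have "homologous_rel p X S c (frag_extend z n)"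
        by (simp only: A(3)[symmetric] fn)
      then show ?thesis using keys by blast
    qed
  qed
qed

section \<open>Attaching simplices\<close>

abbreviation simplex_space :: "nat \<Rightarrow> (nat \<Rightarrow> real) topology" where
  "simplex_space p \<equiv> subtopology (powertop_real UNIV) (standard_simplex p)"

definition simplex_boundary :: "nat \<Rightarrow> (nat \<Rightarrow> real) set" where
  "simplex_boundary p = {t \<in> standard_simplex p. \<exists>i\<le>p. t i = 0}"

definition barycenter :: "nat \<Rightarrow> nat \<Rightarrow> real" where
  "barycenter p = (\<lambda>i. if i \<le> p then 1 / (real p + 1) else 0)"

text \<open>With \<open>m\<close> the least coordinate, \<open>t\<close> is
  \<open>(p + 1) * m\<close> times the barycenter plus a nonnegative vector with a vanishing
  coordinate. Subtracting \<open>s * m\<close> from every coordinate and renormalizing therefore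
  moves along the ray from the barycenter, which is the formula of
  \<open>radial_push\<close>.\<close>

definition least_coord :: "nat \<Rightarrow> (nat \<Rightarrow> real) \<Rightarrow> real" where
  "least_coord p t = Min (t ` {..p})"

text \<open>Moves \<open>t\<close> away from the barycenter, reaching the boundary at time 1.\<close>

definition radial_push :: "nat \<Rightarrow> real \<Rightarrow> (nat \<Rightarrow> real) \<Rightarrow> nat \<Rightarrow> real" where
  "radial_push p s t = (\<lambda>i. if i \<le> p then (t i - s * least_coord p t) / (1 - (real p + 1) * s * least_coord p t) else 0)"

lemma simplex_boundary_subset: "simplex_boundary p \<subseteq> standard_simplex p"
  by (auto simp: simplex_boundary_def)

lemma barycenter_in_simplex: "barycenter p \<in> standard_simplex p"
  by (auto simp: standard_simplex_def barycenter_def)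

lemma barycenter_notin_boundary: "barycenter p \<notin> simplex_boundary p"
  by (auto simp: simplex_boundary_def barycenter_def)

lemma least_coord_le: "i \<le> p \<Longrightarrow> least_coord p t \<le> t i"
  by (auto simp: least_coord_def)

lemma least_coord_attained: obtains i where "i \<le> p" "t i = least_coord p t"
proof -
  have "Min (t ` {..p}) \<in> t ` {..p}" by (rule Min_in) auto
  then obtain i where "i \<le> p" "t i = Min (t ` {..p})" by (metis atMost_iff imageE)
  then show thesis using that[of i] by (simp add: least_coord_def)
qed

lemma least_coord_nonneg: "t \<in> standard_simplex p \<Longrightarrow> 0 \<le> least_coord p t"
  by (metis (no_types, lifting) least_coord_attained mem_Collect_eq standard_simplex_def)

lemma least_coord_boundary: "t \<in> simplex_boundary p \<Longrightarrow> least_coord p t = 0"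
  using least_coord_le[of _ p t] least_coord_nonneg[of t p] by (force simp: simplex_boundary_def)

text \<open>The difference of the two sides is the sum of the nonnegative numbers
  \<open>t i - m\<close>; it vanishes only when all coordinates agree, that is, at the
  barycenter.\<close>

lemma least_coord_less:
  assumes "t \<in> standard_simplex p" "t \<noteq> barycenter p"
  shows "(real p + 1) * least_coord p t < 1"
proof -
  let ?m = "least_coord p t"
  have sum: "(\<Sum>i\<le>p. t i) = 1" using assms(1) by (simp add: standard_simplex_def)
  have s: "(\<Sum>i\<le>p. t i - ?m) = 1 - (real p + 1) * ?m"
    by (simp add: sum_subtractf sum algebra_simps)
  have nn: "0 \<le> t i - ?m" if "i \<in> {..p}" for i using that least_coord_le[of i p t] by simp
  have "0 \<le> (\<Sum>i\<le>p. t i - ?m)" using nn by (rule sum_nonneg)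
  moreover have "(\<Sum>i\<le>p. t i - ?m) \<noteq> 0"
  proof
    assume *: "(\<Sum>i\<le>p. t i - ?m) = 0"
    then have "t i = ?m" if "i \<le> p" for i
      using sum_nonneg_eq_0_iff[of "{..p}" "\<lambda>i. t i - ?m"] nn that by auto
    moreover have "?m = 1 / (real p + 1)" using s * by (simp add: field_simps)
    moreover have "t i = 0" if "i > p" for i using assms(1) that by (simp add: standard_simplex_def)
    ultimately have "t = barycenter p" by (auto simp: barycenter_def fun_eq_iff)
    with assms(2) show False by simp
  qed
  ultimately show ?thesis using s by linarith
qed

lemma push_denominator_pos:
  assumes "t \<in> standard_simplex p" "t \<noteq> barycenter p" "0 \<le> s" "s \<le> 1"
  shows "0 < 1 - (real p + 1) * s * least_coord p t"
proof -
  have "s * ((real p + 1) * least_coord p t) \<le> 1 * ((real p + 1) * least_coord p t)"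
    using assms least_coord_nonneg by (intro mult_right_mono) auto
  then have "s * ((real p + 1) * least_coord p t) < 1"
    using least_coord_less[OF assms(1,2)] by linarith
  then show ?thesis by (simp add: algebra_simps)
qed

lemma radial_push_in_simplex:
  assumes "t \<in> standard_simplex p" "t \<noteq> barycenter p" "0 \<le> s" "s \<le> 1"
  shows "radial_push p s t \<in> standard_simplex p"
proof -
  let ?m = "least_coord p t" and ?D = "1 - (real p + 1) * s * least_coord p t"
  have D: "0 < ?D" by (rule push_denominator_pos[OF assms])
  have sm: "s * ?m \<le> ?m" using assms least_coord_nonneg[OF assms(1)] by (simp add: mult_left_le_one_le)
  have nn: "0 \<le> radial_push p s t i" for i
    using D sm least_coord_le[of i p t] by (auto simp: radial_push_def)
  have "(\<Sum>i\<le>p. radial_push p s t i) = (\<Sum>i\<le>p. (t i - s * ?m)) / ?D"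
    by (simp add: radial_push_def sum_divide_distrib)
  also have "(\<Sum>i\<le>p. (t i - s * ?m)) = ?D"
    using assms(1) by (simp add: sum_subtractf standard_simplex_def algebra_simps)
  finally have sum: "(\<Sum>i\<le>p. radial_push p s t i) = 1" using D by simp
  have "radial_push p s t i \<le> 1" for i
  proof (cases "i \<le> p")
    case True
    then have "radial_push p s t i \<le> (\<Sum>i\<le>p. radial_push p s t i)"
      by (intro member_le_sum) (auto simp: nn)
    then show ?thesis using sum by simp
  qed (simp add: radial_push_def)
  then show ?thesis
    using nn sum by (simp add: standard_simplex_def) (simp add: radial_push_def)
qed

lemma radial_push_0:
  assumes "t \<in> standard_simplex p"
  shows "radial_push p 0 t = t"
  using assms by (auto simp: radial_push_def fun_eq_iff standard_simplex_def)

lemma radial_push_boundary: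
  assumes "t \<in> simplex_boundary p"
  shows "radial_push p s t = t"
proof -
  have "t \<in> standard_simplex p" using assms simplex_boundary_subset by blast
  then show ?thesis
    by (auto simp: radial_push_def fun_eq_iff least_coord_boundary[OF assms] standard_simplex_def)
qed

text \<open>If the image had equal coordinates, all \<open>t i\<close> would equal one number;
  evaluating where the least coordinate is attained identifies it with the minimum, contradicting
  \<open>least_coord_less\<close>.\<close>

lemma radial_push_neq_barycenter:
  assumes "t \<in> standard_simplex p" "t \<noteq> barycenter p" "0 \<le> s" "s \<le> 1"
  shows "radial_push p s t \<noteq> barycenter p"
proof
  let ?m = "least_coord p t" and ?D = "1 - (real p + 1) * s * least_coord p t"
  assume eq: "radial_push p s t = barycenter p"
  have D: "0 < ?D" by (rule push_denominator_pos[OF assms])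
  have c: "t i = s * ?m + ?D / (real p + 1)" if "i \<le> p" for i
  proof -
    have "(t i - s * ?m) / ?D = 1 / (real p + 1)"
      using fun_cong[OF eq, of i] that by (simp add: radial_push_def barycenter_def)
    then show ?thesis using D by (simp add: field_simps)
  qed
  have "?m = s * ?m + ?D / (real p + 1)"
    using c by (metis least_coord_attained)
  then have "t i = ?m" if "i \<le> p" for i using c[OF that] by simp
  then have "(\<Sum>i\<le>p. t i) = (real p + 1) * ?m" by (simp add: algebra_simps)
  then show False
    using least_coord_less[OF assms(1,2)] assms(1) by (simp add: standard_simplex_def)
qed

lemma radial_push_1:
  assumes "t \<in> standard_simplex p" "t \<noteq> barycenter p"
  shows "radial_push p 1 t \<in> simplex_boundary p"
proof -
  obtain i where "i \<le> p" "t i = least_coord p t" by (rule least_coord_attained)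
  then have "radial_push p 1 t i = 0" by (simp add: radial_push_def)
  then show ?thesis
    using \<open>i \<le> p\<close> radial_push_in_simplex[OF assms] by (auto simp: simplex_boundary_def)
qed

lemma continuous_map_least_coord:
  assumes "\<And>i. continuous_map X euclideanreal (\<lambda>x. f x i)"
  shows "continuous_map X euclideanreal (\<lambda>x. least_coord p (f x))"
proof (induction p)
  case 0
  then show ?case using assms by (simp add: least_coord_def)
next
  case (Suc p)
  have "least_coord (Suc p) t = min (t (Suc p)) (least_coord p t)" for t
    by (simp add: least_coord_def atMost_Suc)
  then show ?case using Suc assms by (simp add: continuous_map_real_min)
qed

lemma continuous_map_radial_push:
  "continuous_map
     (prod_topology (top_of_set {0..1}) (subtopology (simplex_space p) (- {barycenter p})))
     (subtopology (simplex_space p) (- {barycenter p})) (\<lambda>(s, t). radial_push p s t)"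
    (is "continuous_map ?Z _ _")
proof -
  have t: "continuous_map ?Z euclideanreal (\<lambda>z. snd z i)" for i
  proof -
    have "continuous_map (subtopology (simplex_space p) (- {barycenter p})) euclideanreal (\<lambda>t. t i)"
      by (intro continuous_map_from_subtopology continuous_map_product_projection) simp
    then show ?thesis
      using continuous_map_compose[OF continuous_map_snd] by (fastforce simp: o_def)
  qed
  have s: "continuous_map ?Z euclideanreal fst"
    using continuous_map_fst continuous_map_into_fulltopology by blast
  have m: "continuous_map ?Z euclideanreal (\<lambda>z. least_coord p (snd z))"
    by (rule continuous_map_least_coord) (rule t)
  have comp: "continuous_map ?Z euclideanreal (\<lambda>z. radial_push p (fst z) (snd z) i)" for i
  proof (cases "i \<le> p")
    case True
    have "continuous_map ?Z euclideanreal
      (\<lambda>z. (snd z i - fst z * least_coord p (snd z)) / (1 - (real p + 1) * fst z * least_coord p (snd z)))"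
    proof (rule continuous_map_real_divide)
      fix z assume "z \<in> topspace ?Z"
      then show "1 - (real p + 1) * fst z * least_coord p (snd z) \<noteq> 0"
        using push_denominator_pos[of "snd z" p "fst z"] by auto
    qed (intro continuous_intros s t m)+
    then show ?thesis using True by (simp add: radial_push_def)
  qed (simp add: radial_push_def)
  have "(\<lambda>(s, t). radial_push p s t) \<in> topspace ?Z \<rightarrow> standard_simplex p \<inter> - {barycenter p}"
    using radial_push_in_simplex radial_push_neq_barycenter by auto
  then show ?thesis
    using comp by (auto simp: continuous_map_in_subtopology continuous_map_componentwise_UNIV case_prod_beta' image_subset_iff_funcset)
qed

lemma closedin_simplex_boundary: "closedin (simplex_space p) (simplex_boundary p)"
proof -
  have "closedin (simplex_space p) {t \<in> topspace (simplex_space p). t i \<in> {0}}" for i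
    by (rule closedin_continuous_map_preimage[where Y = euclideanreal])
       (auto intro!: continuous_map_from_subtopology continuous_map_product_projection)
  then have "closedin (simplex_space p) (\<Union>i\<in>{..p}. {t \<in> topspace (simplex_space p). t i \<in> {0}})"
    by (intro closedin_Union) auto
  moreover have "(\<Union>i\<in>{..p}. {t \<in> topspace (simplex_space p). t i \<in> {0}}) = simplex_boundary p"
    by (auto simp: simplex_boundary_def)
  ultimately show ?thesis by simp
qed

lemma t1_space_simplex: "closedin (simplex_space p) {t}" if "t \<in> standard_simplex p"
proof -
  have "Hausdorff_space (simplex_space p)"
    by (intro Hausdorff_space_subtopology) (simp add: Hausdorff_space_product_topology)
  then show ?thesis
    using that closedin_Hausdorff_sing_eq by force
qed

text \<open>Cells of dimension \<open>q\<close> are attached to a part \<open>B\<close> that already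
  contains the images of all other cells. The situation occurs three times: for a skeleton over the
  preceding one, for a simplex over its own boundary, and for the boundary of a simplex over a
  horn.\<close>

locale simplex_attachment =
  fixes Y :: "'y topology" and J :: "'u set" and dim :: "'u \<Rightarrow> nat"
    and \<phi> :: "'u \<Rightarrow> (nat \<Rightarrow> real) \<Rightarrow> 'y" and B :: "'y set" and I :: "'u set" and q :: nat
  assumes quotient: "quotient_map (sum_topology (\<lambda>u. simplex_space (dim u)) J) Y (\<lambda>(u, t). \<phi> u t)"
    and subset: "I \<subseteq> J"
    and dim: "\<And>u. u \<in> I \<Longrightarrow> dim u = q"
    and old: "\<And>u t. u \<in> J - I \<Longrightarrow> t \<in> standard_simplex (dim u) \<Longrightarrow> \<phi> u t \<in> B"
    and attach: "\<And>u t. u \<in> I \<Longrightarrow> t \<in> simplex_boundary q \<Longrightarrow> \<phi> u t \<in> B"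
    and new: "\<And>u t. u \<in> I \<Longrightarrow> t \<in> standard_simplex q - simplex_boundary q \<Longrightarrow> \<phi> u t \<notin> B"
    and inj: "\<And>u v s t. u \<in> I \<Longrightarrow> v \<in> I \<Longrightarrow> s \<in> standard_simplex q - simplex_boundary q \<Longrightarrow>
                t \<in> standard_simplex q - simplex_boundary q \<Longrightarrow> \<phi> u s = \<phi> v t \<Longrightarrow> u = v \<and> s = t"
    and old_subset: "B \<subseteq> topspace Y"
begin

abbreviation "P \<equiv> sum_topology (\<lambda>u. simplex_space (dim u)) J"
abbreviation "\<pi> \<equiv> (\<lambda>(u, t). \<phi> u t)"
definition "centers = (\<lambda>u. \<phi> u (barycenter q)) ` I"
definition "N = topspace Y - centers"
definition "open_cell u = \<phi> u ` (standard_simplex q - simplex_boundary q)"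

lemma surj: "y \<in> topspace Y \<Longrightarrow> \<exists>u\<in>J. \<exists>t\<in>standard_simplex (dim u). y = \<phi> u t"
  using quotient_imp_surjective_map[OF quotient] by force

lemma cell_in_space: "u \<in> J \<Longrightarrow> t \<in> standard_simplex (dim u) \<Longrightarrow> \<phi> u t \<in> topspace Y"
  using quotient_imp_surjective_map[OF quotient] by force

lemma continuous_cell: "u \<in> J \<Longrightarrow> continuous_map (simplex_space (dim u)) Y (\<phi> u)"
  using continuous_map_compose[OF continuous_map_component_injection quotient_imp_continuous_map[OF quotient]]
  by (fastforce simp: o_def)

lemma openin_iff:
  "openin Y U \<longleftrightarrow> U \<subseteq> topspace Y \<and>
     (\<forall>u\<in>J. openin (simplex_space (dim u)) {t \<in> standard_simplex (dim u). \<phi> u t \<in> U})"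
proof -
  have *: "\<forall>U. U \<subseteq> topspace Y \<longrightarrow> (openin P {x \<in> topspace P. \<pi> x \<in> U} \<longleftrightarrow> openin Y U)"
    using quotient unfolding quotient_map_def by (rule conjunct2)
  have "openin P {x \<in> topspace P. \<pi> x \<in> U} \<longleftrightarrow> openin Y U" if "U \<subseteq> topspace Y"
    using spec [OF *, of U] that by (rule mp)
  then have "openin Y U \<longleftrightarrow> U \<subseteq> topspace Y \<and> openin P {x \<in> topspace P. \<pi> x \<in> U}"
    using openin_subset[of Y U] by argo
  moreover have "openin P {x \<in> topspace P. \<pi> x \<in> U} \<longleftrightarrow>
     (\<forall>u\<in>J. openin (simplex_space (dim u)) {t \<in> standard_simplex (dim u). \<phi> u t \<in> U})"
    by (auto simp: openin_sum_topology)
  ultimately show ?thesis by simp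
qed

lemma openin_interior: "openin (simplex_space q) (standard_simplex q - simplex_boundary q)"
  using closedin_simplex_boundary[of q] by (simp add: closedin_def)

lemma closedin_old: "closedin Y B"
proof -
  have "{t \<in> standard_simplex (dim u). \<phi> u t \<in> topspace Y - B} =
        (if u \<in> I then standard_simplex q - simplex_boundary q else {})" if "u \<in> J" for u
    using that old attach new dim cell_in_space by (auto simp: subset_iff)
  then have "openin Y (topspace Y - B)"
    unfolding openin_iff using openin_interior dim by auto
  then show ?thesis using old_subset by (simp add: closedin_def)
qed

lemma barycenter_interior: "barycenter q \<in> standard_simplex q - simplex_boundary q"
  using barycenter_in_simplex barycenter_notin_boundary by blast

lemma center_notin_old: "u \<in> I \<Longrightarrow> \<phi> u (barycenter q) \<notin> B"
  using new barycenter_interior by blast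

text \<open>Interior points of new cells are identified with no other point, so a center has its
  barycenter as the only preimage.\<close>

lemma cell_in_N_iff:
  assumes "u \<in> J" "t \<in> standard_simplex (dim u)"
  shows "\<phi> u t \<in> N \<longleftrightarrow> u \<notin> I \<or> t \<noteq> barycenter q"
proof
  assume "\<phi> u t \<in> N"
  then show "u \<notin> I \<or> t \<noteq> barycenter q" by (auto simp: N_def centers_def)
next
  assume *: "u \<notin> I \<or> t \<noteq> barycenter q"
  have "\<phi> u t \<noteq> \<phi> v (barycenter q)" if v: "v \<in> I" for v
  proof
    assume eq: "\<phi> u t = \<phi> v (barycenter q)"
    then have nB: "\<phi> u t \<notin> B" using center_notin_old[OF v] by simp
    then have u: "u \<in> I" using old assms by blast
    then have "t \<in> standard_simplex q - simplex_boundary q" using nB attach dim assms by auto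
    then show False using inj[OF u v _ barycenter_interior eq] * u by blast
  qed
  then show "\<phi> u t \<in> N" using cell_in_space assms by (auto simp: N_def centers_def)
qed

lemma N_subset: "N \<subseteq> topspace Y" by (auto simp: N_def)

lemma old_subset_N: "B \<subseteq> N"
  using old_subset center_notin_old by (auto simp: N_def centers_def)

lemma openin_N: "openin Y N"
proof -
  have "{t \<in> standard_simplex (dim u). \<phi> u t \<in> N} =
        (if u \<in> I then topspace (simplex_space q) - {barycenter q} else topspace (simplex_space (dim u)))" if "u \<in> J" for u
    using that cell_in_N_iff dim by auto
  moreover have "openin (simplex_space q) (topspace (simplex_space q) - {barycenter q})"
    using t1_space_simplex[OF barycenter_in_simplex, of q] by (simp add: closedin_def)
  ultimately show ?thesis
    unfolding openin_iff using N_subset dim by (auto simp del: topspace_subtopology)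
qed

text \<open>The deformation is defined before gluing, on the disjoint simplices, where continuity is
  checked one simplex at a time; it descends to the quotient afterwards.\<close>

definition push :: "real \<times> ('u \<times> (nat \<Rightarrow> real)) \<Rightarrow> 'y" where
  "push = (\<lambda>(s, u, t). \<phi> u (if u \<in> I then radial_push q s t else t))"

abbreviation "PN \<equiv> {x \<in> topspace P. \<pi> x \<in> N}"

lemma PN_iff: "(u, t) \<in> PN \<longleftrightarrow> u \<in> J \<and> t \<in> standard_simplex (dim u) \<and> (u \<in> I \<longrightarrow> t \<noteq> barycenter q)"
  using cell_in_N_iff by auto

lemma push_in_N:
  assumes "s \<in> {0..1}" "(u, t) \<in> PN"
  shows "push (s, u, t) \<in> N"
proof (cases "u \<in> I")
  case True
  have t: "t \<in> standard_simplex q" "t \<noteq> barycenter q" using assms True dim unfolding PN_iff by auto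
  have s: "0 \<le> s" "s \<le> 1" using assms(1) by auto
  have "\<phi> u (radial_push q s t) \<in> N"
    using True subset dim radial_push_in_simplex[OF t s] radial_push_neq_barycenter[OF t s]
    by (subst cell_in_N_iff) auto
  then show ?thesis using True by (simp add: push_def)
next
  case False
  then show ?thesis using assms by (simp add: push_def)
qed

text \<open>Each simplex is open in the disjoint union, so continuity can be pasted together from
  the single simplices.\<close>

lemma continuous_push:
  "continuous_map (prod_topology (top_of_set {0..1}) (subtopology P PN)) (subtopology Y N) push"
    (is "continuous_map ?Z _ _")
proof (rule pasting_lemma [where I = J and T = "\<lambda>u. {0..1} \<times> (PN \<inter> {u} \<times> UNIV)" and f = "\<lambda>_. push"])
  fix u assume u: "u \<in> J"
  have "openin P ({u} \<times> standard_simplex (dim u))"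
    unfolding openin_sum_topology
  proof (intro conjI ballI)
    show "{u} \<times> standard_simplex (dim u) \<subseteq> Sigma J (topspace \<circ> (\<lambda>u. simplex_space (dim u)))"
      using u by auto
    show "openin (simplex_space (dim v)) {x. (v, x) \<in> {u} \<times> standard_simplex (dim u)}" for v
      using openin_topspace[of "simplex_space (dim u)"] by (cases "v = u") auto
  qed
  then have "openin (subtopology P PN) (PN \<inter> {u} \<times> standard_simplex (dim u))"
    by (auto simp: openin_subtopology)
  moreover have "PN \<inter> {u} \<times> standard_simplex (dim u) = PN \<inter> {u} \<times> UNIV" by auto
  ultimately have "openin (subtopology P PN) (PN \<inter> {u} \<times> UNIV)" by simp
  then show "openin ?Z ({0..1} \<times> (PN \<inter> {u} \<times> UNIV))"
    by (simp add: openin_prod_Times_iff)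
  have ev: "continuous_map (subtopology ?Z ({0..1} \<times> (PN \<inter> {u} \<times> UNIV)))
         (prod_topology (top_of_set {0..1}) (subtopology (simplex_space (dim u)) (if u \<in> I then - {barycenter q} else UNIV)))
         (\<lambda>z. (fst z, snd (snd z)))" (is "continuous_map ?W _ _")
    unfolding continuous_map_pairwise o_def fst_conv snd_conv
  proof
    show "continuous_map ?W (top_of_set {0..1}) fst"
      by (intro continuous_map_from_subtopology continuous_map_fst)
    have "continuous_map (subtopology P ({u} \<times> standard_simplex (dim u))) (simplex_space (dim u)) snd"
    proof -
      have "embedding_map (simplex_space (dim u)) P (\<lambda>t. (u, t))"
        by (rule embedding_map_component_injection[OF u])
      then have "homeomorphic_map (simplex_space (dim u)) (subtopology P ((\<lambda>t. (u, t)) ` standard_simplex (dim u))) (\<lambda>t. (u, t))"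
        by (simp add: embedding_map_def)
      then obtain g where g: "homeomorphic_maps (simplex_space (dim u)) (subtopology P ((\<lambda>t. (u, t)) ` standard_simplex (dim u))) (\<lambda>t. (u, t)) g"
        by (auto simp: homeomorphic_map_maps)
      have "continuous_map (subtopology P ((\<lambda>t. (u, t)) ` standard_simplex (dim u))) (simplex_space (dim u)) g"
        using g by (simp add: homeomorphic_maps_def)
      then have "continuous_map (subtopology P ((\<lambda>t. (u, t)) ` standard_simplex (dim u))) (simplex_space (dim u)) snd"
        by (rule continuous_map_eq) (use g u in \<open>auto simp: homeomorphic_maps_def\<close>)
      moreover have "(\<lambda>t. (u, t)) ` standard_simplex (dim u) = {u} \<times> standard_simplex (dim u)" by auto
      ultimately show ?thesis by simp
    qed
    moreover have "continuous_map ?W (subtopology P ({u} \<times> standard_simplex (dim u))) snd"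
    proof -
      have "continuous_map ?W (subtopology P PN) snd"
        by (intro continuous_map_from_subtopology continuous_map_snd)
      then have "continuous_map ?W P snd" by (rule continuous_map_into_fulltopology)
      moreover have "snd ` topspace ?W \<subseteq> {u} \<times> standard_simplex (dim u)" by auto
      ultimately show ?thesis by (simp add: continuous_map_in_subtopology image_subset_iff_funcset)
    qed
    ultimately have "continuous_map ?W (simplex_space (dim u)) (snd \<circ> snd)"
      by (rule continuous_map_compose [rotated])
    have im: "(snd \<circ> snd) z \<in> (if u \<in> I then - {barycenter q} else UNIV)" if z: "z \<in> topspace ?W" for z
    proof -
      obtain s v t where zz: "z = (s, v, t)" by (metis prod.exhaust)
      have "(v, t) \<in> PN" "v = u" using z unfolding zz by auto
      then show ?thesis using PN_iff[of v t] by (auto simp: zz)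
    qed
    then have "(snd \<circ> snd) ` topspace ?W \<subseteq> (if u \<in> I then - {barycenter q} else UNIV)"
      by blast
    with \<open>continuous_map ?W (simplex_space (dim u)) (snd \<circ> snd)\<close> show "continuous_map ?W (subtopology (simplex_space (dim u)) (if u \<in> I then - {barycenter q} else UNIV)) (\<lambda>z. snd (snd z))"
      by (simp add: continuous_map_in_subtopology image_subset_iff_funcset o_def)
  qed
  have "continuous_map ?W Y push"
  proof (cases "u \<in> I")
    case True
    have "continuous_map ?W (subtopology (simplex_space q) (- {barycenter q})) (\<lambda>z. radial_push q (fst z) (snd (snd z)))"
      using continuous_map_compose[OF ev[unfolded if_P[OF True] dim[OF True]] continuous_map_radial_push[of q]]
      by (simp add: o_def case_prod_beta')
    moreover have "continuous_map (subtopology (simplex_space q) (- {barycenter q})) Y (\<phi> u)"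
      using continuous_map_from_subtopology[OF continuous_cell[OF u]] dim[OF True] by simp
    ultimately have "continuous_map ?W Y (\<phi> u \<circ> (\<lambda>z. radial_push q (fst z) (snd (snd z))))"
      by (rule continuous_map_compose)
    then show ?thesis
      by (rule continuous_map_eq) (auto simp: push_def True)
  next
    case False
    have "continuous_map ?W (simplex_space (dim u)) (\<lambda>z. snd (snd z))"
      using ev[unfolded if_not_P[OF False]] by (simp add: continuous_map_pairwise o_def)
    then have "continuous_map ?W Y (\<phi> u \<circ> (\<lambda>z. snd (snd z)))"
      using continuous_cell[OF u] continuous_map_compose by blast
    then show ?thesis
      by (rule continuous_map_eq) (auto simp: push_def False)
  qed
  moreover have "push ` topspace ?W \<subseteq> N" using push_in_N by auto
  ultimately show "continuous_map (subtopology ?Z ({0..1} \<times> (PN \<inter> {u} \<times> UNIV))) (subtopology Y N) push"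
    by (simp add: continuous_map_in_subtopology image_subset_iff_funcset)
qed auto

lemma push_fixes_old:
  assumes "(u, t) \<in> PN" "\<phi> u t \<in> B"
  shows "push (s, u, t) = \<phi> u t"
proof (cases "u \<in> I")
  case True
  then have "t \<in> standard_simplex q" using assms(1) dim unfolding PN_iff by auto
  then have "t \<in> simplex_boundary q" using new[OF True] assms(2) by blast
  then show ?thesis by (simp add: push_def radial_push_boundary)
qed (simp add: push_def)

text \<open>Two distinct prepoints can have the same image only inside \<open>B\<close>, and there
  the deformation is stationary.\<close>

lemma push_respects:
  assumes "s \<in> {0..1}" "(u, t) \<in> PN" "(v, t') \<in> PN" "\<phi> u t = \<phi> v t'"
  shows "push (s, u, t) = push (s, v, t')"
proof -
  have *: "push (s, u, t) = \<phi> u t" if "(u, t) \<in> PN" "\<phi> u t \<in> B" for u t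
    using push_fixes_old that by blast
  show ?thesis
  proof (cases "\<phi> u t \<in> B")
    case True
    then show ?thesis using *[OF assms(2)] *[OF assms(3)] assms(4) by simp
  next
    case False
    then have "u \<in> I" "v \<in> I" "t \<in> standard_simplex q - simplex_boundary q" "t' \<in> standard_simplex q - simplex_boundary q"
      using assms old attach dim unfolding PN_iff by (metis DiffI)+
    then show ?thesis using inj assms(4) by blast
  qed
qed

text \<open>\<open>N\<close> deforms into \<open>B\<close> while \<open>B\<close> stays fixed, the
  motion being \<open>push\<close> read on the quotient.\<close>

lemma trivial_relative_homology_N: "trivial_group (relative_homology_group p (subtopology Y N) B)"
proof -
  have qN: "quotient_map (subtopology P PN) (subtopology Y N) \<pi>"
    by (rule quotient_map_restriction[OF quotient]) (use openin_N in auto)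
  \<comment> \<open>Quotient maps are not stable under products in general; multiplying by the
    locally compact Hausdorff interval keeps the quotient property, which lets the homotopy
    descend.\<close>
  have "locally_compact_space (top_of_set {0..1::real})" "Hausdorff_space (top_of_set {0..1::real})"
    by (auto intro: compact_imp_locally_compact_space Hausdorff_space_subtopology simp: compact_space_subtopology)
  then have Q: "quotient_map (prod_topology (top_of_set {0..1::real}) (subtopology P PN))
              (prod_topology (top_of_set {0..1}) (subtopology Y N)) (\<lambda>(s, x). (s, \<pi> x))"
    using quotient_map_prod_right[OF _ _ qN] by blast
  have resp: "push x = push y"
    if "x \<in> topspace (prod_topology (top_of_set {0..1}) (subtopology P PN))"
      "y \<in> topspace (prod_topology (top_of_set {0..1}) (subtopology P PN))"
      "(\<lambda>(s, x). (s, \<pi> x)) x = (\<lambda>(s, x). (s, \<pi> x)) y" for x y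
  proof -
    obtain s u t s' v t' where x: "x = (s, u, t)" and y: "y = (s', v, t')"
      by (metis prod.exhaust)
    show ?thesis
      using that push_respects[of s u t v t'] unfolding x y by simp
  qed
  have "\<exists>g. continuous_map (prod_topology (top_of_set {0..1}) (subtopology Y N)) (subtopology Y N) g \<and>
     (\<forall>x \<in> topspace (prod_topology (top_of_set {0..1::real}) (subtopology P PN)).
        g ((\<lambda>(s, x). (s, \<pi> x)) x) = push x)"
    by (rule quotient_map_lift_exists [OF Q continuous_push resp]) (blast | metis)+
  then obtain g where g: "continuous_map (prod_topology (top_of_set {0..1}) (subtopology Y N)) (subtopology Y N) g"
     "\<forall>x \<in> topspace (prod_topology (top_of_set {0..1::real}) (subtopology P PN)).
        g ((\<lambda>(s, x). (s, \<pi> x)) x) = push x"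
    by (elim exE conjE)
  have gp: "g (s, \<phi> u t) = push (s, u, t)" if "s \<in> {0..1}" "(u, t) \<in> PN" for s u t
    using bspec[OF g(2), of "(s, u, t)"] that by auto
  have rep: "\<exists>u t. (u, t) \<in> PN \<and> x = \<phi> u t" if "x \<in> N" for x
    using that surj N_subset by (fastforce simp: PN_iff cell_in_N_iff)
  \<comment> \<open>Extended by \<open>x\<close> outside \<open>N\<close> because the homotopy has
    to start at \<open>id\<close> for every argument, not only for points of the space.\<close>
  define h where "h = (\<lambda>(s, x). if x \<in> N then g (s, x) else x)"
  define f where "f x = h (1, x)" for x
  have topN: "topspace (subtopology Y N) = N" using N_subset by auto
  have hB: "h (s, x) = x" if s: "s \<in> {0..1}" and x: "x \<in> B" for s x
  proof -
    have "x \<in> N" using x old_subset_N by blast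
    then obtain u t where ut: "(u, t) \<in> PN" "x = \<phi> u t" using rep by blast
    have "push (s, u, t) = x"
      using push_fixes_old[OF ut(1)] ut(2) x by simp
    then show ?thesis using gp[OF s ut(1)] ut(2) by (simp add: h_def)
  qed
  have hom: "homotopic_with (\<lambda>k. k ` B \<subseteq> B) (subtopology Y N) (subtopology Y N) id f"
    unfolding homotopic_with_def
  proof (intro exI[of _ h] conjI allI ballI)
    show "continuous_map (prod_topology (top_of_set {0..1}) (subtopology Y N)) (subtopology Y N) h"
      by (rule continuous_map_eq[OF g(1)]) (auto simp: h_def)
    show "h (0, x) = id x" for x
    proof (cases "x \<in> N")
      case True
      then obtain u t where ut: "(u, t) \<in> PN" "x = \<phi> u t" using rep by blast
      have "push (0, u, t) = \<phi> u t"
        using ut(1) radial_push_0 dim unfolding PN_iff push_def by auto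
      then show ?thesis using gp[OF _ ut(1), of 0] ut(2) True by (simp add: h_def)
    qed (simp add: h_def)
    show "(\<lambda>x. h (s, x)) ` B \<subseteq> B" if "s \<in> {0..1}" for s
      using hB[OF that] by auto
  qed (simp add: f_def)
  have "f x \<in> B" if x: "x \<in> N" for x
  proof -
    obtain u t where ut: "(u, t) \<in> PN" "x = \<phi> u t" using rep x by blast
    have "push (1, u, t) \<in> B"
    proof (cases "u \<in> I")
      case True
      then show ?thesis
        using ut(1) radial_push_1[of t q] attach[of u] dim unfolding PN_iff push_def by auto
    next
      case False
      then show ?thesis using ut(1) old unfolding PN_iff push_def by auto
    qed
    then show ?thesis using gp[OF _ ut(1), of 1] ut(2) x by (simp add: f_def h_def)
  qed
  then have "continuous_map (subtopology Y N) (subtopology (subtopology Y N) B) f"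
    using homotopic_with_imp_continuous_maps[OF hom] topN
    by (simp add: continuous_map_in_subtopology Pi_iff image_subset_iff)
  then show ?thesis
    by (rule trivial_relative_homology_group_alt) (rule homotopic_with_symD[OF hom])
qed

text \<open>In the exact sequence of the triple \<open>B \<subseteq> N \<subseteq> Y\<close>, both
  neighbours of this map are homology groups of the pair formed by \<open>N\<close> and
  \<open>B\<close>, which vanish.\<close>

lemma iso_relativize:
  "hom_induced p Y B Y N id \<in> iso (relative_homology_group p Y B) (relative_homology_group p Y N)"
proof (rule very_short_exact_sequence)
  show "exact_seq
         ([relative_homology_group(p - 1) (subtopology Y N) B, relative_homology_group p Y N, relative_homology_group p Y B, relative_homology_group p (subtopology Y N) B],
          [hom_relboundary p Y N B, hom_induced p Y B Y N id, hom_induced p (subtopology Y N) B Y B id])"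
    using homology_exactness_triple_1 [OF old_subset_N] homology_exactness_triple_3 [OF old_subset_N]
    by fastforce
qed (rule trivial_relative_homology_N)+

lemma homology_iso_relativize: "homology_iso_by (chain_map p id) p Y B p Y N"
  by (rule homology_iso_by_chain_map) (use iso_relativize old_subset_N in auto)

text \<open>\<open>B\<close> is closed and contained in the open set \<open>N\<close>, so it can be
  cut out.\<close>

lemma homology_iso_excision:
  "homology_iso_by (chain_map p id) p (subtopology Y (topspace Y - B)) (N - B) p Y N"
proof (rule homology_iso_by_chain_map)
  show "continuous_map (subtopology Y (topspace Y - B)) Y id"
    by (simp add: continuous_map_from_subtopology)
  have "hom_induced (int p) (subtopology Y (topspace Y - B)) (N - B) (subtopology Y (topspace Y)) N id
     \<in> iso (relative_homology_group (int p) (subtopology Y (topspace Y - B)) (N - B))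
          (relative_homology_group (int p) (subtopology Y (topspace Y)) N)"
  proof (rule homology_excision_axiom)
    show "Y closure_of B \<subseteq> Y interior_of N"
      using closedin_old openin_N old_subset_N by (simp add: closure_of_closedin interior_of_openin)
  qed (rule N_subset)
  then show "hom_induced (int p) (subtopology Y (topspace Y - B)) (N - B) Y N id
     \<in> iso (relative_homology_group (int p) (subtopology Y (topspace Y - B)) (N - B)) (relative_homology_group (int p) Y N)"
    by simp
qed auto

text \<open>The image of an open subset of the interior has no preimage in other cells, so its trace
  on every simplex is open and the characteristic map is open.\<close>

lemma homeomorphic_open_cell:
  assumes u: "u \<in> I"
  shows "homeomorphic_map (subtopology (simplex_space q) (standard_simplex q - simplex_boundary q))
           (subtopology Y (open_cell u)) (\<phi> u)"
proof -
  let ?int = "standard_simplex q - simplex_boundary q"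
  have uJ: "u \<in> J" using u subset by blast
  have top: "topspace (subtopology (simplex_space q) ?int) = ?int" by auto
  have cont: "continuous_map (subtopology (simplex_space q) ?int) Y (\<phi> u)"
    using continuous_cell[OF uJ] dim[OF u] by (simp add: continuous_map_from_subtopology)
  have "open_map (subtopology (simplex_space q) ?int) Y (\<phi> u)"
    unfolding open_map_def
  proof (intro allI impI)
    fix U assume "openin (subtopology (simplex_space q) ?int) U"
    then have U: "openin (simplex_space q) U" "U \<subseteq> ?int"
      using openin_interior by (auto simp: openin_open_subtopology)
    have "{t \<in> standard_simplex (dim v). \<phi> v t \<in> \<phi> u ` U} = (if v = u then U else {})" if v: "v \<in> J" for v
    proof -
      have "v = u \<and> t \<in> U" if t: "t \<in> standard_simplex (dim v)" and im: "\<phi> v t \<in> \<phi> u ` U" for t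
      proof -
        from im obtain s where s: "\<phi> v t = \<phi> u s" "s \<in> U" by (rule imageE)
        then have nB: "\<phi> v t \<notin> B" using new[OF u] U by auto
        then have vI: "v \<in> I" using old t v by blast
        then have "t \<in> ?int" using nB attach t dim by auto
        then show ?thesis using inj[OF vI u _ _ s(1)] s U by blast
      qed
      then show ?thesis using U dim[OF u] by (auto split: if_splits)
    qed
    then show "openin Y (\<phi> u ` U)"
      unfolding openin_iff using U cell_in_space[OF uJ] dim[OF u] by (auto split: if_splits)
  qed
  moreover have "inj_on (\<phi> u) ?int"
    using inj[OF u u] by (meson inj_onI)
  ultimately have "embedding_map (subtopology (simplex_space q) ?int) Y (\<phi> u)"
    by (intro injective_open_imp_embedding_map cont) (simp_all only: top)
  then show ?thesis
    unfolding embedding_map_def open_cell_def top .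
qed

lemma open_cell_subset: "u \<in> I \<Longrightarrow> open_cell u \<subseteq> topspace Y - B"
  using new cell_in_space subset dim by (force simp: open_cell_def)

lemma openin_open_cell:
  assumes u: "u \<in> I" shows "openin Y (open_cell u)"
proof -
  have "{t \<in> standard_simplex (dim v). \<phi> v t \<in> open_cell u} =
        (if v = u then standard_simplex q - simplex_boundary q else {})" if v: "v \<in> J" for v
  proof -
    have "v = u \<and> t \<in> standard_simplex q - simplex_boundary q"
      if t: "t \<in> standard_simplex (dim v)" and c: "\<phi> v t \<in> open_cell u" for t
    proof -
      have nB: "\<phi> v t \<notin> B" using c open_cell_subset[OF u] by blast
      then have vI: "v \<in> I" using old t v by blast
      then have "t \<in> standard_simplex q - simplex_boundary q" using nB attach t dim by auto
      then show ?thesis using inj[OF vI u] c by (auto simp: open_cell_def)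
    qed
    then show ?thesis using dim[OF u] by (auto simp: open_cell_def split: if_splits)
  qed
  then show ?thesis
    unfolding openin_iff using openin_interior dim[OF u] open_cell_subset[OF u] by auto
qed

lemma open_cells_cover: "topspace Y - B = (\<Union>u\<in>I. open_cell u)"
proof
  show "topspace Y - B \<subseteq> (\<Union>u\<in>I. open_cell u)"
  proof
    fix y assume y: "y \<in> topspace Y - B"
    then obtain u t where ut: "u \<in> J" "t \<in> standard_simplex (dim u)" "y = \<phi> u t" using surj by blast
    then have "u \<in> I" using old y by blast
    moreover have "t \<notin> simplex_boundary q" using attach[OF \<open>u \<in> I\<close>] y ut by blast
    ultimately show "y \<in> (\<Union>u\<in>I. open_cell u)"
      using ut dim by (auto simp: open_cell_def)
  qed
qed (use open_cell_subset in blast)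

lemma open_cells_disjoint:
  "u \<in> I \<Longrightarrow> v \<in> I \<Longrightarrow> u \<noteq> v \<Longrightarrow> open_cell u \<inter> open_cell v = {}"
  using inj by (fastforce simp: open_cell_def)

end

lemma homology_basis_restrict:
  "homology_basis p X (topspace X \<inter> S) I z \<longleftrightarrow> homology_basis p X S I z"
  by (simp add: homology_basis_def)

text \<open>The model case: one cell, attached along its boundary by the identity. It supplies
  excision for the simplex itself.\<close>

lemma simplex_attachment_self:
  "simplex_attachment (simplex_space q) {()} (\<lambda>_. q) (\<lambda>_ t. t) (simplex_boundary q) {()} q"
proof
  show "quotient_map (sum_topology (\<lambda>u. simplex_space q) {()}) (simplex_space q) (\<lambda>(u, t). t)"
    unfolding quotient_map_def
  proof (intro conjI allI impI)
    fix U assume U: "U \<subseteq> topspace (simplex_space q)"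
    have "{x. (u, x) \<in> {z. z \<in> topspace (sum_topology (\<lambda>u. simplex_space q) {()}) \<and> (case z of (u, t) \<Rightarrow> t) \<in> U}} = U" for u :: unit
      using U by auto
    then show "openin (sum_topology (\<lambda>u. simplex_space q) {()})
          {x \<in> topspace (sum_topology (\<lambda>u. simplex_space q) {()}). (case x of (u, t) \<Rightarrow> t) \<in> U} \<longleftrightarrow>
       openin (simplex_space q) U"
      unfolding openin_sum_topology by auto
  qed force
qed (use simplex_boundary_subset in auto)

text \<open>\<open>restrict\<close> appears because singular simplices are extensional functions on
  the standard simplex. Faces of the simplex land in its boundary, hence in
  \<open>B\<close>.\<close>

lemma singular_relcycle_frag_of_map:
  assumes f: "continuous_map (simplex_space p) Y f" and "f ` simplex_boundary p \<subseteq> B"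
  shows "singular_relcycle p Y B (frag_of (restrict f (standard_simplex p)))"
proof -
  have s: "singular_simplex p Y (restrict f (standard_simplex p))"
    unfolding singular_simplex_def using continuous_map_eq[OF f] by auto
  have "singular_chain (p - 1) (subtopology Y B) (chain_boundary p (frag_of (restrict f (standard_simplex p))))"
  proof (cases "p = 0")
    case False
    have "singular_simplex (p - 1) (subtopology Y B) (singular_face p k (restrict f (standard_simplex p)))" if k: "k \<le> p" for k
    proof -
      have "simplical_face k t \<in> simplex_boundary p" if "t \<in> standard_simplex (p - 1)" for t
        using simplical_face_in_standard_simplex[of p k t] k that False
        by (auto simp: simplex_boundary_def simplical_face_def)
      then have "singular_face p k (restrict f (standard_simplex p)) ` standard_simplex (p - 1) \<subseteq> B"
        using assms(2) simplex_boundary_subset by (auto simp: singular_face_def)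
      then show ?thesis
        using singular_simplex_singular_face[OF s, of k] k False
        by (simp add: singular_simplex_subtopology)
    qed
    then show ?thesis
      using False by (auto simp: chain_boundary_of intro!: singular_chain_sum singular_chain_cmul simp: singular_chain_of)
  qed (simp add: chain_boundary_def)
  then show ?thesis using s by (simp add: singular_relcycle singular_chain_of)
qed

context simplex_attachment begin

text \<open>The generator of the simplex is moved into the open simplex, copied to each open cell by
  its homeomorphism, collected over the disjoint cells, and carried back through excision, first
  modulo \<open>N\<close> and then modulo \<open>B\<close>. The assumption \<open>simplex\<close>
  keeps this usable inside the induction that proves it.\<close>

lemma homology_basis_attachment:
  assumes simplex: "homology_basis q (simplex_space q) (simplex_boundary q) {()}
      (\<lambda>_. frag_of (restrict id (standard_simplex q)))"
  shows "homology_basis q Y B I (\<lambda>u. frag_of (restrict (\<phi> u) (standard_simplex q)))"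
proof -
  interpret S: simplex_attachment "simplex_space q" "{()}" "\<lambda>_. q" "\<lambda>_ t. t" "simplex_boundary q" "{()}" q
    by (rule simplex_attachment_self)
  let ?X = "simplex_space q" and ?int = "standard_simplex q - simplex_boundary q"
  let ?z0 = "frag_of (restrict id (standard_simplex q)) :: (nat \<Rightarrow> real) chain"
  have SN: "S.N = standard_simplex q - {barycenter q}"
    unfolding S.N_def S.centers_def by auto
  have z0: "singular_chain q ?X ?z0"
    using homology_basis_relcycle[OF simplex, of "()"] by (simp add: singular_relcycle)
  have "homology_basis q ?X S.N {()} (chain_map q id \<circ> (\<lambda>_. ?z0))"
    by (rule homology_basis_push[OF S.homology_iso_relativize simplex])
  then have 1: "homology_basis q ?X S.N {()} (\<lambda>_. ?z0)"
    using chain_map_ident[OF z0] by (simp add: o_def)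
  \<comment> \<open>The identity simplex touches the boundary, so excision replaces it by a chain
    supported in the interior and homologous to it modulo the punctured simplex.\<close>
  obtain z' where z': "homology_basis q (subtopology ?X (topspace ?X - simplex_boundary q)) (S.N - simplex_boundary q) {()} z'"
      and hz': "homologous_rel q ?X S.N ?z0 (chain_map q id (z' ()))"
    by (rule homology_basis_lift[OF S.homology_iso_excision 1]) (use that in blast)
  define z where "z = z' ()"
  have zz: "z' = (\<lambda>_. z)" by (auto simp: z_def)
  have topX: "topspace ?X = standard_simplex q" by simp
  have zb: "homology_basis q (subtopology ?X ?int) (S.N - simplex_boundary q) {()} (\<lambda>_. z)"
    using z' unfolding zz topX .
  have zc: "singular_chain q ?X z"
    using homology_basis_relcycle[OF zb, of "()"] singular_chain_mono[of q ?X ?int z "standard_simplex q"]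
    by (auto simp: singular_relcycle subtopology_subtopology)
  have hz: "homologous_rel q ?X S.N ?z0 z"
    using hz' chain_map_ident[OF zc] by (simp add: z_def)
  let ?Y' = "subtopology Y (topspace Y - B)"
  have cell: "homology_basis q (subtopology ?Y' (open_cell u)) (N - B) {()} (\<lambda>_. chain_map q (\<phi> u) z)"
    if u: "u \<in> I" for u
  proof -
    have uJ: "u \<in> J" using u subset by blast
    have img: "\<phi> u ` (S.N - simplex_boundary q) = open_cell u \<inter> (N - B)"
    proof -
      have "\<phi> u t \<in> N \<longleftrightarrow> t \<noteq> barycenter q" if "t \<in> standard_simplex q" for t
        using cell_in_N_iff[OF uJ] that u dim by auto
      then show ?thesis
        using new[OF u] unfolding open_cell_def SN by auto
    qed
    have hm: "hom_induced (int q) (subtopology ?X ?int) (S.N - simplex_boundary q) (subtopology Y (open_cell u)) (open_cell u \<inter> (N - B)) (\<phi> u)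
       \<in> iso (relative_homology_group (int q) (subtopology ?X ?int) (S.N - simplex_boundary q))
             (relative_homology_group (int q) (subtopology Y (open_cell u)) (open_cell u \<inter> (N - B)))"
      by (rule homeomorphic_map_relative_homology_iso[OF homeomorphic_open_cell[OF u] _ img]) (auto simp: SN)
    have "homology_iso_by (chain_map q (\<phi> u)) q (subtopology ?X ?int) (S.N - simplex_boundary q)
            q (subtopology Y (open_cell u)) (open_cell u \<inter> (N - B))"
      by (rule homology_iso_by_chain_map[OF _ _ hm])
         (use homeomorphic_imp_continuous_map[OF homeomorphic_open_cell[OF u]] img in auto)
    from homology_basis_push[OF this zb]
    have "homology_basis q (subtopology Y (open_cell u)) (open_cell u \<inter> (N - B)) {()} (\<lambda>_. chain_map q (\<phi> u) z)"
      by (simp add: o_def)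
    moreover have "topspace (subtopology Y (open_cell u)) = open_cell u"
      using open_cell_subset[OF u] by auto
    moreover have "subtopology ?Y' (open_cell u) = subtopology Y (open_cell u)"
      using open_cell_subset[OF u] by (simp add: subtopology_subtopology inf_absorb2)
    ultimately show ?thesis
      using homology_basis_restrict by metis
  qed
  have "homology_basis q ?Y' (N - B) I (\<lambda>u. chain_map q (\<phi> u) z)"
  proof (rule homology_basis_disjoint_union[where V = open_cell])
    show "topspace ?Y' = \<Union> (open_cell ` I)" using open_cells_cover by auto
    show "openin ?Y' (open_cell u)" if "u \<in> I" for u
      using openin_open_cell[OF that] open_cell_subset[OF that] by (metis openin_subset_topspace_eq openin_subtopology_alt subset_openin_subtopology)
  qed (use open_cells_disjoint cell in auto)
  from homology_basis_push[OF homology_iso_excision this]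
  have b1: "homology_basis q Y N I (chain_map q id \<circ> (\<lambda>u. chain_map q (\<phi> u) z))" .
  \<comment> \<open>Applying the characteristic map to the homology between \<open>z\<close> and the
    identity simplex turns the abstract generators into the characteristic maps themselves, modulo
    \<open>N\<close>.\<close>
  have b2: "homology_basis q Y N I (chain_map q id \<circ> (\<lambda>u. frag_of (restrict (\<phi> u) (standard_simplex q))))"
  proof (rule homology_basis_cong[OF b1])
    fix u assume u: "u \<in> I"
    have uJ: "u \<in> J" using u subset by blast
    have c: "continuous_map ?X Y (\<phi> u)" using continuous_cell[OF uJ] dim[OF u] by simp
    have m: "\<phi> u \<in> S.N \<rightarrow> N" using cell_in_N_iff[OF uJ] dim[OF u] by (auto simp: SN)
    have "simplex_map q (\<phi> u) (restrict id (standard_simplex q)) = restrict (\<phi> u) (standard_simplex q)"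
      by (rule ext) (simp add: simplex_map_def restrict_def)
    then have "chain_map q (\<phi> u) ?z0 = frag_of (restrict (\<phi> u) (standard_simplex q))"
      by simp
    moreover have "singular_relboundary q Y N (chain_map q (\<phi> u) (z - ?z0))"
      using hz homologous_rel_sym c m unfolding homologous_rel_def by (metis singular_relboundary_chain_map)
    ultimately have h: "homologous_rel q Y N (chain_map q (\<phi> u) z) (frag_of (restrict (\<phi> u) (standard_simplex q)))"
      by (simp add: homologous_rel_def chain_map_diff)
    have "singular_chain q Y (chain_map q (\<phi> u) z)" using zc c by (rule singular_chain_chain_map)
    then show "homologous_rel q Y N ((chain_map q id \<circ> (\<lambda>u. chain_map q (\<phi> u) z)) u)
        ((chain_map q id \<circ> (\<lambda>u. frag_of (restrict (\<phi> u) (standard_simplex q)))) u)"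
      using h homologous_rel_singular_chain[OF h] by (simp add: chain_map_ident)
  qed
  show ?thesis
  proof (rule homology_basis_pull[OF homology_iso_relativize _ b2])
    fix u assume u: "u \<in> I"
    then show "singular_relcycle q Y B (frag_of (restrict (\<phi> u) (standard_simplex q)))"
      using continuous_cell[of u] dim[OF u] subset attach[OF u] by (intro singular_relcycle_frag_of_map) auto
  qed
qed

end

lemma frag_extend_singleton:
  assumes "Poly_Mapping.keys n \<subseteq> {a}"
  shows "frag_extend z n = frag_cmul (Poly_Mapping.lookup n a) (z a)"
proof -
  have "n = frag_cmul (Poly_Mapping.lookup n a) (frag_of a)"
    using assms by (intro poly_mapping_eqI) (auto simp: in_keys_iff)
  then show ?thesis by (metis frag_extend_cmul frag_extend_of)
qed

lemma homology_basis_singleton_iff: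
  "homology_basis p X S {a} z \<longleftrightarrow>
     singular_relcycle p X S (z a) \<and>
     (\<forall>c. singular_relcycle p X S c \<longrightarrow> (\<exists>k. homologous_rel p X S c (frag_cmul k (z a)))) \<and>
     (\<forall>k. singular_relboundary p X S (frag_cmul k (z a)) \<longrightarrow> k = 0)" (is "?L \<longleftrightarrow> ?R")
proof
  assume L: ?L
  show ?R
  proof (intro conjI allI impI)
    show "singular_relcycle p X S (z a)" using homology_basis_relcycle[OF L] by simp
    fix c assume "singular_relcycle p X S c"
    then obtain n where "Poly_Mapping.keys n \<subseteq> {a}" "homologous_rel p X S c (frag_extend z n)"
      by (rule homology_basis_spans [OF L])
    then show "\<exists>k. homologous_rel p X S c (frag_cmul k (z a))"
      using frag_extend_singleton by metis
  next
    fix k assume k: "singular_relboundary p X S (frag_cmul k (z a))"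
    have "frag_cmul k (frag_of a) = 0"
      by (rule homology_basis_independent [OF L]) (use k in \<open>auto simp: frag_extend_cmul\<close>)
    then show "k = 0" by simp
  qed
next
  assume R: ?R
  show ?L
    unfolding homology_basis_def
  proof (intro conjI ballI allI impI)
    show "singular_relcycle p X S (z i)" if "i \<in> {a}" for i using R that by simp
    fix c assume "singular_relcycle p X S c"
    then obtain k where "homologous_rel p X S c (frag_cmul k (z a))" using R by metis
    then show "\<exists>n. Poly_Mapping.keys n \<subseteq> {a} \<and> homologous_rel p X S c (frag_extend z n)"
      by (intro exI[of _ "frag_cmul k (frag_of a)"]) (auto simp: frag_extend_cmul)
  next
    fix n assume n: "Poly_Mapping.keys n \<subseteq> {a}" "singular_relboundary p X S (frag_extend z n)"
    then have "Poly_Mapping.lookup n a = 0"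
      using R unfolding frag_extend_singleton[OF n(1)] by metis
    then show "n = 0" using n(1) by (intro poly_mapping_eqI) (auto simp: in_keys_iff)
  qed
qed

lemma contractible_starlike:
  assumes a: "a \<in> S"
    and star: "\<And>x u. x \<in> S \<Longrightarrow> 0 \<le> u \<Longrightarrow> u \<le> 1 \<Longrightarrow> (\<lambda>i. (1 - u) * x i + u * a i) \<in> S"
  shows "contractible_space (subtopology (powertop_real (UNIV :: nat set)) S)"
proof -
  let ?X = "subtopology (powertop_real (UNIV :: nat set)) S"
  let ?h = "\<lambda>(u, x). (\<lambda>i. (1 - u) * x i + u * a i)"
  let ?Z = "prod_topology (top_of_set {0..1::real}) ?X"
  have t: "continuous_map ?Z euclideanreal (\<lambda>z. snd z i)" for i
  proof -
    have "continuous_map ?X euclideanreal (\<lambda>t. t i)"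
      by (intro continuous_map_from_subtopology continuous_map_product_projection) simp
    then show ?thesis
      using continuous_map_compose[OF continuous_map_snd] by (fastforce simp: o_def)
  qed
  have s: "continuous_map ?Z euclideanreal fst"
    using continuous_map_fst continuous_map_into_fulltopology by blast
  have "continuous_map ?Z euclideanreal (\<lambda>z. (1 - fst z) * snd z i + fst z * a i)" for i
    by (intro continuous_intros s t)
  moreover have "?h \<in> topspace ?Z \<rightarrow> S" using star by auto
  ultimately have c: "continuous_map ?Z ?X ?h"
    by (auto simp: continuous_map_in_subtopology continuous_map_componentwise_UNIV case_prod_beta' image_subset_iff_funcset)
  have "homotopic_with (\<lambda>x. True) ?X ?X id (\<lambda>x. a)"
    unfolding homotopic_with_def
    by (rule exI[of _ ?h]) (use c in auto)
  then show ?thesis unfolding contractible_space_def by blast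
qed

section \<open>The generator of a simplex modulo its boundary\<close>

lemma continuous_map_simplical_face:
  assumes "k \<le> Suc p"
  shows "continuous_map (simplex_space p) (simplex_space (Suc p)) (simplical_face k)"
proof -
  have "continuous_map (simplex_space p) euclideanreal (\<lambda>t. simplical_face k t i)" for i
  proof -
    consider "i < k" | "i = k" | "k < i" by linarith
    then show ?thesis
      by cases (auto simp: simplical_face_def intro!: continuous_map_from_subtopology continuous_map_product_projection)
  qed
  then show ?thesis
    using simplical_face_in_standard_simplex[of "Suc p" k] assms
    by (auto simp: continuous_map_in_subtopology continuous_map_componentwise_UNIV image_subset_iff)
qed

lemma inj_simplical_face: "inj (simplical_face k)"
proof (rule injI)
  fix x y :: "nat \<Rightarrow> 'a" assume eq: "simplical_face k x = simplical_face k y"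
  show "x = y"
  proof
    fix i show "x i = y i"
      using fun_cong[OF eq, of i] fun_cong[OF eq, of "Suc i"]
      by (cases "i < k") (auto simp: simplical_face_def)
  qed
qed

lemma simplical_face_in_boundary:
  assumes "k \<le> Suc p" "t \<in> standard_simplex p"
  shows "simplical_face k t \<in> simplex_boundary (Suc p)"
  using simplical_face_in_standard_simplex[of "Suc p" k t] assms
  by (auto simp: simplex_boundary_def simplical_face_def)

lemma standard_simplex_face_preimage:
  assumes t: "t \<in> standard_simplex (Suc p)" and k: "k \<le> Suc p" "t k = 0"
  obtains s where "s \<in> standard_simplex p" "t = simplical_face k s"
proof -
  define s where "s = (\<lambda>j. if j < k then t j else t (Suc j))"
  have ts: "t = simplical_face k s"
    using k by (auto simp: s_def simplical_face_def fun_eq_iff)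
  have "(\<Sum>j\<le>p. s j) = (\<Sum>j\<in>{..Suc p} - {k}. t j)"
    by (rule sum.reindex_bij_witness[where i = "\<lambda>j. if j < k then j else j - 1" and j = "\<lambda>j. if j < k then j else Suc j"])
       (use k in \<open>auto simp: s_def\<close>)
  also have "\<dots> = (\<Sum>j\<le>Suc p. t j)"
    using k by (simp add: sum.remove[of "{..Suc p}" k] del: sum.atMost_Suc)
  finally have "s \<in> standard_simplex p"
    using t k by (auto simp: standard_simplex_def s_def)
  then show thesis using that ts by blast
qed

text \<open>The horn at vertex 0: all facets except the zeroth. In positive dimension it is starlike
  about that vertex, hence contractible.\<close>

definition horn :: "nat \<Rightarrow> (nat \<Rightarrow> real) set" where
  "horn p = {t \<in> standard_simplex p. \<exists>i\<in>{1..p}. t i = 0}"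

lemma horn_subset: "horn p \<subseteq> simplex_boundary p"
  by (auto simp: horn_def simplex_boundary_def)

text \<open>The boundary of the simplex of dimension \<open>q + 1\<close> is the zeroth facet glued
  to the horn along its own boundary; the remaining facets lie in the horn and count as old
  cells.\<close>

lemma simplex_attachment_boundary:
  "simplex_attachment (subtopology (powertop_real UNIV) (simplex_boundary (Suc q)))
     {..Suc q} (\<lambda>_. q) simplical_face (horn (Suc q)) {0} q"
proof
  let ?Y = "subtopology (powertop_real UNIV) (simplex_boundary (Suc q))"
  let ?P = "sum_topology (\<lambda>u::nat. simplex_space q) {..Suc q}"
  have top: "topspace ?Y = simplex_boundary (Suc q)" by simp
  have cont: "continuous_map (simplex_space q) ?Y (simplical_face u)" if "u \<le> Suc q" for u
    using continuous_map_simplical_face[OF that] simplical_face_in_boundary[OF that]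
    by (auto simp: continuous_map_in_subtopology)
  have sur: "(\<lambda>(u, t). simplical_face u t) ` topspace ?P = topspace ?Y"
  proof
    show "topspace ?Y \<subseteq> (\<lambda>(u, t). simplical_face u t) ` topspace ?P"
    proof
      fix t assume "t \<in> topspace ?Y"
      then obtain k where "t \<in> standard_simplex (Suc q)" "k \<le> Suc q" "t k = 0"
        by (auto simp: simplex_boundary_def)
      then obtain s where "s \<in> standard_simplex q" "t = simplical_face k s"
        by (rule standard_simplex_face_preimage)
      then show "t \<in> (\<lambda>(u, t). simplical_face u t) ` topspace ?P"
        using \<open>k \<le> Suc q\<close> by force
    qed
  qed (use simplical_face_in_boundary in auto)
  have haus: "Hausdorff_space ?Y"
    by (intro Hausdorff_space_subtopology) (simp add: Hausdorff_space_product_topology)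
  \<comment> \<open>Finitely many compact facets in a Hausdorff space have closed images, whence the
    boundary carries the quotient topology of its facets.\<close>
  have clo: "closedin ?Y (\<Union>u\<in>{..Suc q}. simplical_face u ` C u)"
    if "\<And>u. u \<le> Suc q \<Longrightarrow> closedin (simplex_space q) (C u)" for C
  proof (intro closedin_Union ballI)
    fix T assume "T \<in> (\<lambda>u. simplical_face u ` C u) ` {..Suc q}"
    then obtain u where u: "u \<le> Suc q" "T = simplical_face u ` C u" by auto
    have "compact_space (simplex_space q)"
      using compactin_standard_simplex by (simp add: compact_space_subtopology)
    then have "compactin (simplex_space q) (C u)"
      using that[OF u(1)] closedin_compact_space by blast
    then have "compactin ?Y T"
      using cont[OF u(1)] u(2) image_compactin by blast
    then show "closedin ?Y T" using haus compactin_imp_closedin by blast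
  qed auto
  show "quotient_map ?P ?Y (\<lambda>(u, t). simplical_face u t)"
    unfolding quotient_map_closedin
  proof (intro conjI allI impI)
    fix F assume F: "F \<subseteq> topspace ?Y"
    let ?C = "\<lambda>u. {t \<in> standard_simplex q. simplical_face u t \<in> F}"
    have e: "{x \<in> topspace ?P. (case x of (u, t) \<Rightarrow> simplical_face u t) \<in> F} = Sigma {..Suc q} ?C" by auto
    have "closedin ?P (Sigma {..Suc q} ?C) \<longleftrightarrow> (\<forall>u\<in>{..Suc q}. closedin (simplex_space q) (?C u))"
      by (rule closedin_disjoint_union)
    also have "\<dots> \<longleftrightarrow> closedin ?Y F"
    proof
      assume *: "\<forall>u\<in>{..Suc q}. closedin (simplex_space q) (?C u)"
      have "(\<Union>u\<in>{..Suc q}. simplical_face u ` ?C u) = F"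
      proof (intro subset_antisym subsetI)
        fix t assume "t \<in> F"
        then have "t \<in> (\<lambda>(u, t). simplical_face u t) ` topspace ?P" using F unfolding sur by blast
        then obtain u s where "u \<le> Suc q" "s \<in> standard_simplex q" "t = simplical_face u s" by auto
        then show "t \<in> (\<Union>u\<in>{..Suc q}. simplical_face u ` ?C u)" using \<open>t \<in> F\<close> by blast
      qed blast
      moreover have "closedin ?Y (\<Union>u\<in>{..Suc q}. simplical_face u ` ?C u)"
        by (rule clo) (rule bspec [OF *], simp only: atMost_iff)
      ultimately show "closedin ?Y F" by (simp only:)
    next
      assume *: "closedin ?Y F"
      show "\<forall>u\<in>{..Suc q}. closedin (simplex_space q) (?C u)"
        using closedin_continuous_map_preimage[OF cont *] by auto
    qed
    finally show "closedin ?P {x \<in> topspace ?P. (case x of (u, t) \<Rightarrow> simplical_face u t) \<in> F} \<longleftrightarrow> closedin ?Y F"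
      unfolding e .
  qed (rule sur)
  show "simplical_face u t \<in> horn (Suc q)"
    if "u \<in> {..Suc q} - {0}" "t \<in> standard_simplex q" for u t
    using simplical_face_in_standard_simplex[of "Suc q" u t] that
    by (auto simp: horn_def simplical_face_def intro!: bexI[of _ u])
  show "simplical_face u t \<in> horn (Suc q)" if "u \<in> {0}" "t \<in> simplex_boundary q" for u t
  proof -
    from that(2) obtain j where j: "j \<le> q" "t j = 0" "t \<in> standard_simplex q"
      unfolding simplex_boundary_def by blast
    then have "simplical_face 0 t (Suc j) = 0" by (simp add: simplical_face_def)
    then show ?thesis
      using simplical_face_in_standard_simplex[of "Suc q" 0 t] that j
      by (auto simp: horn_def intro!: bexI[of _ "Suc j"])
  qed
  show "simplical_face u t \<notin> horn (Suc q)" if "u \<in> {0}" "t \<in> standard_simplex q - simplex_boundary q" for u t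
  proof
    assume "simplical_face u t \<in> horn (Suc q)"
    then obtain i where i: "1 \<le> i" "i \<le> Suc q" "simplical_face u t i = 0"
      unfolding horn_def by auto
    then have "t (i - 1) = 0" using that(1) by (simp add: simplical_face_def)
    then have "t \<in> simplex_boundary q" using that(2) i by (auto simp: simplex_boundary_def intro!: exI[of _ "i - 1"])
    then show False using that(2) by blast
  qed
  show "u = v \<and> s = t" if "u \<in> {0::nat}" "v \<in> {0}" "simplical_face u s = simplical_face v t" for u v s t
    using that inj_simplical_face[of 0] by (auto dest: injD)
qed (use horn_subset in auto)

lemma singular_face_id:
  assumes "k \<le> Suc q"
  shows "singular_face (Suc q) k (restrict id (standard_simplex (Suc q))) = restrict (simplical_face k) (standard_simplex q)"
  using simplical_face_in_standard_simplex[of "Suc q" k] assms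
  by (auto simp: singular_face_def fun_eq_iff restrict_def)

text \<open>Simplex and horn are contractible, so the connecting map of the triple identifies the
  simplex modulo its boundary with the boundary modulo the horn. The latter is one dimension lower,
  and the zeroth facet attached to the horn is covered by the induction hypothesis.\<close>

lemma homology_basis_simplex:
  "homology_basis q (simplex_space q) (simplex_boundary q) {()} (\<lambda>_. frag_of (restrict id (standard_simplex q)))"
proof (induction q)
  case 0
  define a :: "nat \<Rightarrow> real" where "a = (\<lambda>j. if j = 0 then 1 else 0)"
  have top: "topspace (simplex_space 0) = {a}" by (simp add: standard_simplex_0 a_def)
  have id: "restrict id (standard_simplex 0) = restrict (\<lambda>x. a) (standard_simplex 0)"
    by (auto simp: standard_simplex_0 a_def fun_eq_iff restrict_def)
  have bd: "simplex_boundary 0 = {}" by (auto simp: simplex_boundary_def standard_simplex_def)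
  show ?case
    unfolding homology_basis_singleton_iff
  proof (intro conjI allI impI)
    show "singular_relcycle 0 (simplex_space 0) (simplex_boundary 0) (frag_of (restrict id (standard_simplex 0)))"
      by (rule singular_relcycle_frag_of_map) (auto simp: continuous_map_from_subtopology)
    fix c assume "singular_relcycle 0 (simplex_space 0) (simplex_boundary 0) c"
    then have "singular_chain 0 (simplex_space 0) c" by (simp add: singular_relcycle)
    then obtain k where "c = frag_cmul k (frag_of (restrict id (standard_simplex 0)))"
      unfolding singular_chain_singleton[OF top] id by blast
    then show "\<exists>k. homologous_rel 0 (simplex_space 0) (simplex_boundary 0) c (frag_cmul k (frag_of (restrict id (standard_simplex 0))))"
      by (metis homologous_rel_refl)
  next
    fix k assume "singular_relboundary 0 (simplex_space 0) (simplex_boundary 0) (frag_cmul k (frag_of (restrict id (standard_simplex 0))))"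
    then show "k = 0"
      unfolding bd singular_boundary_singleton[OF top] by simp
  qed
next
  case (Suc q)
  let ?X = "simplex_space (Suc q)" and ?S = "simplex_boundary (Suc q)" and ?T = "horn (Suc q)"
  let ?Y = "subtopology (powertop_real UNIV) ?S"
  let ?a = "\<lambda>j::nat. if j = 0 then 1 else (0::real)"
  interpret A: simplex_attachment ?Y "{..Suc q}" "\<lambda>_. q" simplical_face ?T "{0}" q
    by (rule simplex_attachment_boundary)
  have YS: "subtopology ?X ?S = ?Y"
    using simplex_boundary_subset[of "Suc q"] by (simp add: subtopology_subtopology inf_absorb2)
  have XT: "subtopology ?X ?T = subtopology (powertop_real UNIV) ?T"
    using simplex_boundary_subset[of "Suc q"] horn_subset[of "Suc q"] by (simp add: subtopology_subtopology inf_absorb2)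
  \<comment> \<open>\<open>?a\<close> is vertex 0, the common center for contracting the simplex and
    the horn.\<close>
  have aT: "?a \<in> ?T" by (auto simp: horn_def)
  have "contractible_space ?X"
    by (rule contractible_starlike[of ?a]) (auto intro: convex_standard_simplex)
  moreover have "contractible_space (subtopology ?X ?T)"
    unfolding XT by (rule contractible_starlike[OF aT]) (auto simp: horn_def intro: convex_standard_simplex)
  moreover have "?a \<in> topspace ?X \<inter> ?T"
    using aT unfolding topspace_standard_simplex horn_def by blast
  then have "topspace ?X \<inter> ?T \<noteq> {}" by blast
  ultimately have iso: "hom_relboundary (int (Suc q)) ?X ?S ?T \<in>
     iso (relative_homology_group (int (Suc q)) ?X ?S) (relative_homology_group (int (Suc q) - 1) (subtopology ?X ?S) ?T)"
    by (intro iso_hom_relboundary_contractible horn_subset)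
  have F: "homology_iso_by (chain_boundary (Suc q)) (Suc q) ?X ?S q ?Y ?T"
    using homology_iso_by_chain_boundary[OF _ horn_subset iso] unfolding YS by simp
  have "homology_basis q ?Y ?T {0} (\<lambda>u. frag_of (restrict (simplical_face u) (standard_simplex q)))"
    by (rule A.homology_basis_attachment [OF Suc.IH])
  then have b: "homology_basis q ?Y ?T {()} (\<lambda>_. frag_of (restrict (simplical_face 0) (standard_simplex q)))"
    unfolding homology_basis_singleton_iff .
  have "homology_basis q ?Y ?T {()} (chain_boundary (Suc q) \<circ> (\<lambda>_. frag_of (restrict id (standard_simplex (Suc q)))))"
  proof (rule homology_basis_cong[OF b])
    let ?f = "\<lambda>k. frag_of (restrict (simplical_face k) (standard_simplex q)) :: (nat \<Rightarrow> real) chain"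
    \<comment> \<open>Modulo the horn only the zeroth facet survives; its sign is
      \<open>(- 1) ^ 0\<close>, so the identity simplex corresponds to the generator without
      correction.\<close>
    have "chain_boundary (Suc q) (frag_of (restrict id (standard_simplex (Suc q)))) = (\<Sum>k\<le>Suc q. frag_cmul ((-1) ^ k) (?f k))"
      by (simp add: chain_boundary_of singular_face_id del: sum.atMost_Suc singular_face_restrict)
    also have "\<dots> = ?f 0 + (\<Sum>k\<in>{1..Suc q}. frag_cmul ((-1) ^ k) (?f k))"
      by (subst atMost_atLeast0, subst sum.atLeast_Suc_atMost) auto
    finally have e: "chain_boundary (Suc q) (frag_of (restrict id (standard_simplex (Suc q)))) =
      ?f 0 + (\<Sum>k\<in>{1..Suc q}. frag_cmul ((-1) ^ k) (?f k))" .
    have "singular_chain q (subtopology ?Y ?T) (?f k)" if k: "k \<in> {1..Suc q}" for k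
    proof -
      have "continuous_map (simplex_space q) ?Y (simplical_face k)"
        using A.continuous_cell[of k] k by simp
      then have "singular_simplex q ?Y (restrict (simplical_face k) (standard_simplex q))"
        unfolding singular_simplex_def by (auto intro: continuous_map_eq)
      moreover have "simplical_face k ` standard_simplex q \<subseteq> ?T" using A.old[of k] k by auto
      ultimately show ?thesis by (simp add: singular_chain_of singular_simplex_subtopology)
    qed
    then have "singular_chain q (subtopology ?Y ?T) (\<Sum>k\<in>{1..Suc q}. frag_cmul ((-1) ^ k) (?f k))"
      by (intro singular_chain_sum singular_chain_cmul)
    then have "singular_relboundary q ?Y ?T (- (\<Sum>k\<in>{1..Suc q}. frag_cmul ((-1) ^ k) (?f k)))"
      by (intro singular_chain_imp_relboundary) (simp only: singular_chain_minus)
    moreover have "?f 0 - (?f 0 + s) = - s" for s by simp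
    ultimately show "homologous_rel q ?Y ?T (?f 0) ((chain_boundary (Suc q) \<circ> (\<lambda>_. frag_of (restrict id (standard_simplex (Suc q))))) i)" for i :: unit
      by (simp only: homologous_rel_def o_apply e)
  qed
  then show ?case
    by (rule homology_basis_pull[OF F, rotated])
       (auto intro!: singular_relcycle_frag_of_map simp: continuous_map_from_subtopology)
qed

section \<open>The skeleta of a realization\<close>

text \<open>The group law of relative homology is that of a quotient by the boundaries, so on
  representatives it is addition of chains; spanning and independence then say surjective and
  injective.\<close>

lemma homology_basis_iso:
  assumes b: "homology_basis p X S I z"
  shows "(\<lambda>n. homologous_rel_set p X S (frag_extend z n)) \<in>
           iso (free_Abelian_group I) (relative_homology_group (int p) X S)"
proof -
  let ?f = "\<lambda>n. homologous_rel_set p X S (frag_extend z n)"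
  have cyc: "singular_relcycle p X S (frag_extend z n)" if "Poly_Mapping.keys n \<subseteq> I" for n
    using that homology_basis_relcycle[OF b] by (intro singular_relcycle_frag_extend) auto
  have mult: "homologous_rel_set p X S a \<otimes>\<^bsub>relative_homology_group (int p) X S\<^esub> homologous_rel_set p X S c =
              homologous_rel_set p X S (a + c)"
    if "singular_relcycle p X S a" "singular_relcycle p X S c" for a c
  proof -
    interpret N: normal "singular_relboundary_set p X S" "relcycle_group p X S"
      by (rule normal_subgroup_singular_relboundary_relcycle)
    have "(singular_relboundary_set p X S #>\<^bsub>relcycle_group p X S\<^esub> a) <#>\<^bsub>relcycle_group p X S\<^esub>
          (singular_relboundary_set p X S #>\<^bsub>relcycle_group p X S\<^esub> c) =
          singular_relboundary_set p X S #>\<^bsub>relcycle_group p X S\<^esub> (a \<otimes>\<^bsub>relcycle_group p X S\<^esub> c)"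
      by (rule N.rcos_sum) (use that in auto)
    then show ?thesis
      by (simp add: nontrivial_relative_homology_group right_coset_singular_relboundary FactGroup_def)
  qed
  show ?thesis
  proof (rule isoI)
    show "?f \<in> hom (free_Abelian_group I) (relative_homology_group (int p) X S)"
    proof (rule homI)
      show "?f n \<in> carrier (relative_homology_group (int p) X S)" if "n \<in> carrier (free_Abelian_group I)" for n
        by (rule homologous_rel_set_in_carrier, rule cyc) (use that in simp)
      show "?f (n \<otimes>\<^bsub>free_Abelian_group I\<^esub> m) = ?f n \<otimes>\<^bsub>relative_homology_group (int p) X S\<^esub> ?f m"
        if "n \<in> carrier (free_Abelian_group I)" "m \<in> carrier (free_Abelian_group I)" for n m
        using mult[OF cyc cyc, of n m] that by (simp add: frag_extend_add)
    qed
    show "bij_betw ?f (carrier (free_Abelian_group I)) (carrier (relative_homology_group (int p) X S))"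
      unfolding bij_betw_def
    proof
      show "inj_on ?f (carrier (free_Abelian_group I))"
      proof (rule inj_onI)
        fix n m assume n: "n \<in> carrier (free_Abelian_group I)" and m: "m \<in> carrier (free_Abelian_group I)"
          and eq: "?f n = ?f m"
        have "homologous_rel p X S (frag_extend z n) (frag_extend z m)"
          using eq unfolding homologous_rel_set_eq .
        then have "singular_relboundary p X S (frag_extend z (n - m))"
          by (simp add: homologous_rel_def frag_extend_diff)
        moreover have "Poly_Mapping.keys (n - m) \<subseteq> I"
          using n m keys_diff[of n m] by auto
        ultimately have "n - m = 0" using homology_basis_independent[OF b] by metis
        then show "n = m" by simp
      qed
      show "?f ` carrier (free_Abelian_group I) = carrier (relative_homology_group (int p) X S)"
      proof (intro subset_antisym subsetI)
        fix x assume "x \<in> ?f ` carrier (free_Abelian_group I)"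
        then obtain n where n: "x = ?f n" "Poly_Mapping.keys n \<subseteq> I" by auto
        show "x \<in> carrier (relative_homology_group (int p) X S)"
          unfolding n(1) by (rule homologous_rel_set_in_carrier, rule cyc, rule n(2))
      next
        fix x assume "x \<in> carrier (relative_homology_group (int p) X S)"
        then obtain c where c: "singular_relcycle p X S c" "x = homologous_rel_set p X S c"
          by (rule relative_homology_group_cases)
        obtain n where n: "Poly_Mapping.keys n \<subseteq> I" "homologous_rel p X S c (frag_extend z n)"
          using b c(1) by (rule homology_basis_spans)
        have "x = ?f n" unfolding c(2) homologous_rel_set_eq by (rule n(2))
        then show "x \<in> ?f ` carrier (free_Abelian_group I)" using n(1) by auto
      qed
    qed
  qed
qed

lemma closed_map_simplical_face:
  assumes "k \<le> Suc p"
  shows "closed_map (simplex_space p) (simplex_space (Suc p)) (simplical_face k)"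
proof -
  have "compact_space (simplex_space p)"
    using compactin_standard_simplex by (simp add: compact_space_subtopology)
  moreover have "Hausdorff_space (simplex_space (Suc p))"
    by (intro Hausdorff_space_subtopology) (simp add: Hausdorff_space_product_topology)
  ultimately show ?thesis
    using continuous_map_simplical_face[OF assms] continuous_imp_closed_map by blast
qed

section \<open>Normal forms for the points of a realization\<close>

definition remove_coord :: "nat \<Rightarrow> (nat \<Rightarrow> real) \<Rightarrow> nat \<Rightarrow> real" where
  "remove_coord k t = (\<lambda>j. if j < k then t j else t (Suc j))"

lemma remove_coord_simplical_face [simp]: "remove_coord k (simplical_face k t) = t"
  by (auto simp: remove_coord_def simplical_face_def fun_eq_iff)

lemma simplical_face_simplical_face:
  "j < i \<Longrightarrow> simplical_face i (simplical_face j t) = simplical_face j (simplical_face (i - 1) t)"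
  by (rule ext) (auto simp: simplical_face_def)

text \<open>The representative of a point in the interior of a cell, or the base point: vanishing
  coordinates are dropped, the smallest index first, as long as the faces are defined. It provides a
  test for the generated equivalence, whose definition alone gives no way to show two points
  distinct.\<close>

primrec normal_form :: "'a partial_presimplicial \<Rightarrow> nat \<Rightarrow> 'a \<Rightarrow> (nat \<Rightarrow> real) \<Rightarrow> 'a prepoint" where
  "normal_form X 0 a t = (Some (0, a), t)"
| "normal_form X (Suc k) a t =
     (if \<exists>i\<le>Suc k. t i = 0
      then (let i = LEAST i. t i = 0 in
            case face X (Suc k) i a of None \<Rightarrow> base_prepoint
            | Some b \<Rightarrow> normal_form X k b (remove_coord i t))
      else (Some (Suc k, a), t))"

fun normalize :: "'a partial_presimplicial \<Rightarrow> 'a prepoint \<Rightarrow> 'a prepoint" where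
  "normalize X (None, t) = base_prepoint"
| "normalize X (Some (k, a), t) = normal_form X k a t"

definition glue_target :: "'a partial_presimplicial \<Rightarrow> nat \<Rightarrow> 'a \<Rightarrow> nat \<Rightarrow> (nat \<Rightarrow> real) \<Rightarrow> 'a prepoint" where
  "glue_target X k a i t =
     (case face X (Suc k) i a of None \<Rightarrow> base_prepoint | Some b \<Rightarrow> (Some (k, b), t))"

lemma glue_iff:
  "glue X x y \<longleftrightarrow> (\<exists>k a i t. a \<in> simplices X (Suc k) \<and> i \<le> Suc k \<and> t \<in> standard_simplex k \<and>
      x = (Some (Suc k, a), simplical_face i t) \<and> y = glue_target X k a i t)"
proof
  assume "glue X x y"
  then show "\<exists>k a i t. a \<in> simplices X (Suc k) \<and> i \<le> Suc k \<and> t \<in> standard_simplex k \<and>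
      x = (Some (Suc k, a), simplical_face i t) \<and> y = glue_target X k a i t"
  proof cases
    case (1 a k i t a')
    then show ?thesis
      by (intro exI[of _ k] exI[of _ a] exI[of _ i] exI[of _ t]) (simp add: glue_target_def)
  next
    case (2 a k i t)
    then show ?thesis
      by (intro exI[of _ k] exI[of _ a] exI[of _ i] exI[of _ t]) (simp add: glue_target_def)
  qed
next
  assume "\<exists>k a i t. a \<in> simplices X (Suc k) \<and> i \<le> Suc k \<and> t \<in> standard_simplex k \<and>
      x = (Some (Suc k, a), simplical_face i t) \<and> y = glue_target X k a i t"
  then obtain k a i t where *: "a \<in> simplices X (Suc k)" "i \<le> Suc k" "t \<in> standard_simplex k"
      "x = (Some (Suc k, a), simplical_face i t)" "y = glue_target X k a i t" by blast
  show "glue X x y"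
  proof (cases "face X (Suc k) i a")
    case None
    show ?thesis using glue.intros(2)[OF *(1-3) None] *(4,5) None by (simp add: glue_target_def)
  next
    case (Some b)
    show ?thesis using glue.intros(1)[OF *(1-3) Some] *(4,5) Some by (simp add: glue_target_def)
  qed
qed

locale presimplicial =
  fixes X :: "'a partial_presimplicial"
  assumes presimplicial: "partial_presimplicial_set X"
begin

lemma face_simplex:
  "i \<le> Suc k \<Longrightarrow> a \<in> simplices X (Suc k) \<Longrightarrow> face X (Suc k) i a = Some b \<Longrightarrow> b \<in> simplices X k"
  using presimplicial unfolding partial_presimplicial_set_def by blast

lemma face_face:
  "i < j \<Longrightarrow> j \<le> Suc (Suc k) \<Longrightarrow> a \<in> simplices X (Suc (Suc k)) \<Longrightarrow>
     Option.bind (face X (Suc (Suc k)) j a) (face X (Suc k) i) =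
     Option.bind (face X (Suc (Suc k)) i a) (face X (Suc k) (j - 1))"
  using presimplicial unfolding partial_presimplicial_set_def by blast

text \<open>Any vanishing coordinate may be removed first. If \<open>i\<close> is not the least one,
  the point lies on two facets, and the identity for iterated faces, including its statement about
  undefined composites, makes both orders agree.\<close>

lemma normal_form_face:
  "i \<le> Suc k \<Longrightarrow> t \<in> standard_simplex k \<Longrightarrow> a \<in> simplices X (Suc k) \<Longrightarrow>
     normal_form X (Suc k) a (simplical_face i t) =
     (case face X (Suc k) i a of None \<Rightarrow> base_prepoint | Some b \<Rightarrow> normal_form X k b t)"
proof (induction k arbitrary: i t a)
  case (0 i t a)
  then have t: "t = (\<lambda>j. if j = 0 then 1 else 0)" using standard_simplex_0 by auto
  let ?T = "simplical_face i t"
  have Ti: "?T i = 0" by (simp add: simplical_face_def)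
  have "(LEAST j. ?T j = 0) = i"
  proof (rule Least_equality)
    fix j assume "?T j = 0"
    then show "i \<le> j" using 0(1) t by (auto simp: simplical_face_def split: if_splits)
  qed (rule Ti)
  then show ?case using Ti 0(1) by (auto simp: Let_def split: option.splits)
next
  case (Suc k i t a)
  let ?T = "simplical_face i t"
  define j where "j = (LEAST j. ?T j = 0)"
  have Ti: "?T i = 0" by (simp add: simplical_face_def)
  have Tj: "?T j = 0" unfolding j_def by (rule LeastI[of _ i]) (rule Ti)
  have ji: "j \<le> i" unfolding j_def by (rule Least_le) (rule Ti)
  have L: "normal_form X (Suc (Suc k)) a ?T =
      (case face X (Suc (Suc k)) j a of None \<Rightarrow> base_prepoint
       | Some b \<Rightarrow> normal_form X (Suc k) b (remove_coord j ?T))"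
  proof -
    have "\<exists>i\<le>Suc (Suc k). ?T i = 0" using Ti Suc.prems(1) by blast
    then show ?thesis by (simp only: normal_form.simps(2) if_True Let_def j_def)
  qed
  show ?case
  proof (cases "j = i")
    case True
    then show ?thesis unfolding L by (simp only: remove_coord_simplical_face)
  next
    case False
    then have lt: "j < i" using ji by simp
    then have tj: "t j = 0" using Tj by (simp add: simplical_face_def)
    have jk: "j \<le> Suc k" using lt Suc.prems by simp
    obtain s where s: "s \<in> standard_simplex k" "t = simplical_face j s"
      using standard_simplex_face_preimage[OF Suc.prems(2) jk tj] by blast
    have TT: "?T = simplical_face j (simplical_face (i - 1) s)"
      unfolding s(2) by (rule simplical_face_simplical_face[OF lt])
    have i1: "i - 1 \<le> Suc k" using Suc.prems by simp
    let ?F = "\<lambda>x. case x of None \<Rightarrow> base_prepoint | Some c \<Rightarrow> normal_form X k c s"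
    \<comment> \<open>Writing the double face as \<open>Option.bind\<close> covers the undefined
      faces: wherever one occurs, the point is sent to the base point.\<close>
    have "normal_form X (Suc (Suc k)) a ?T = ?F (Option.bind (face X (Suc (Suc k)) j a) (face X (Suc k) (i - 1)))"
    proof (cases "face X (Suc (Suc k)) j a")
      case (Some b)
      then have b: "b \<in> simplices X (Suc k)" using face_simplex jk Suc.prems by (metis le_SucI)
      show ?thesis
        unfolding L using Some Suc.IH[OF i1 s(1) b] by (simp add: TT del: normal_form.simps)
    qed (simp add: L del: normal_form.simps)
    also have "\<dots> = ?F (Option.bind (face X (Suc (Suc k)) i a) (face X (Suc k) j))"
      using face_face[OF lt Suc.prems(1,3)] by simp
    also have "\<dots> = (case face X (Suc (Suc k)) i a of None \<Rightarrow> base_prepoint | Some b \<Rightarrow> normal_form X (Suc k) b t)"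
    proof (cases "face X (Suc (Suc k)) i a")
      case (Some b)
      then have b: "b \<in> simplices X (Suc k)" using face_simplex Suc.prems by metis
      show ?thesis
        using Some Suc.IH[OF jk s(1) b] by (simp add: s(2) del: normal_form.simps)
    qed simp
    finally show ?thesis .
  qed
qed

abbreviation "Pre \<equiv> prerealization X"

lemma topspace_prerealization:
  "topspace Pre = Sigma (cell_indices X) (\<lambda>u. standard_simplex (cell_dim u))"
  by (auto simp: prerealization_def)

lemma Some_cell_iff [simp]: "Some (k, a) \<in> cell_indices X \<longleftrightarrow> a \<in> simplices X k"
  by (auto simp: cell_indices_def)

lemma None_cellI: "a \<in> simplices X (Suc k) \<Longrightarrow> i \<le> Suc k \<Longrightarrow> face X (Suc k) i a = None \<Longrightarrow> None \<in> cell_indices X"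
  by (auto simp: cell_indices_def proper_def)

lemma glue_target_in:
  assumes "a \<in> simplices X (Suc k)" "i \<le> Suc k" "t \<in> standard_simplex k"
  shows "glue_target X k a i t \<in> topspace Pre"
  using assms face_simplex None_cellI
  by (auto simp: glue_target_def topspace_prerealization base_prepoint_def split: option.splits)

definition cls :: "'a prepoint \<Rightarrow> 'a prepoint set" where
  "cls x = generated_equiv (glue X) (topspace Pre) `` {x}"

lemma topspace_realization: "topspace (realization X) = cls ` topspace Pre"
proof -
  have "\<Union>(gen_classes (glue X) (topspace Pre)) = topspace Pre"
    unfolding gen_classes_def by (rule Union_quotient[OF equiv_generated_equiv])
  then have "openin (realization X) (gen_classes (glue X) (topspace Pre))"
    by (simp add: realization_def openin_quotient_space)
  moreover have "U \<subseteq> gen_classes (glue X) (topspace Pre)" if "openin (realization X) U" for U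
    using that by (simp add: realization_def openin_quotient_space)
  ultimately have "topspace (realization X) = gen_classes (glue X) (topspace Pre)"
    by (metis openin_subset openin_topspace subset_antisym)
  then show ?thesis by (auto simp: gen_classes_def quotient_def cls_def)
qed

lemma quotient_map_cls: "quotient_map Pre (realization X) cls"
  unfolding quotient_map_def
proof (intro conjI allI impI)
  fix U assume U: "U \<subseteq> topspace (realization X)"
  have gc: "gen_classes (glue X) (topspace Pre) = cls ` topspace Pre"
    by (auto simp: gen_classes_def quotient_def cls_def)
  have "{x \<in> topspace Pre. cls x \<in> U} = \<Union>U"
  proof (intro subset_antisym subsetI)
    fix x assume "x \<in> {x \<in> topspace Pre. cls x \<in> U}"
    moreover then have "x \<in> cls x"
      unfolding cls_def by (intro equiv_class_self[OF equiv_generated_equiv]) simp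
    ultimately show "x \<in> \<Union>U" by blast
  next
    fix x assume "x \<in> \<Union>U"
    then obtain V where V: "V \<in> U" "x \<in> V" by blast
    then obtain y where y: "y \<in> topspace Pre" "V = cls y" using U topspace_realization by blast
    have yx: "(y, x) \<in> generated_equiv (glue X) (topspace Pre)" using V(2) y(2) by (simp add: cls_def)
    then have "x \<in> topspace Pre" by (auto simp: generated_equiv_def)
    moreover have "cls y = cls x"
      unfolding cls_def by (rule equiv_class_eq[OF equiv_generated_equiv yx])
    ultimately show "x \<in> {x \<in> topspace Pre. cls x \<in> U}" using V y by auto
  qed
  then show "openin Pre {x \<in> topspace Pre. cls x \<in> U} \<longleftrightarrow> openin (realization X) U"
    using U by (simp add: realization_def openin_quotient_space gc topspace_realization[unfolded realization_def])
qed (simp add: topspace_realization)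

lemma normalize_glue:
  assumes "glue X x y"
  shows "normalize X x = normalize X y"
  using assms unfolding glue_iff
  by (auto simp: normal_form_face glue_target_def base_prepoint_def simp del: normal_form.simps split: option.splits)

lemma cls_glue:
  assumes "glue X x y" "x \<in> topspace Pre"
  shows "cls x = cls y"
proof -
  have "y \<in> topspace Pre"
    using assms(1) glue_target_in unfolding glue_iff by blast
  then have "(x, y) \<in> generated_equiv (glue X) (topspace Pre)"
    using assms by (auto simp: generated_equiv_def intro!: r_into_equivclp)
  then show ?thesis unfolding cls_def by (rule equiv_class_eq[OF equiv_generated_equiv])
qed

lemma cls_face:
  assumes "a \<in> simplices X (Suc k)" "i \<le> Suc k" "t \<in> standard_simplex k"
  shows "cls (Some (Suc k, a), simplical_face i t) = cls (glue_target X k a i t)"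
  using assms simplical_face_in_standard_simplex[of "Suc k" i t]
  by (intro cls_glue) (auto simp: glue_iff topspace_prerealization)

lemma normal_form_spec:
  assumes "a \<in> simplices X k" "t \<in> standard_simplex k"
  shows "normal_form X k a t \<in> topspace Pre \<and> cls (normal_form X k a t) = cls (Some (k, a), t) \<and>
         cell_dim (fst (normal_form X k a t)) \<le> k"
  using assms
proof (induction k arbitrary: a t)
  case 0
  then show ?case by (simp add: topspace_prerealization)
next
  case (Suc k)
  show ?case
  proof (cases "\<exists>i\<le>Suc k. t i = 0")
    case True
    then obtain i where i: "i \<le> Suc k" "t i = 0" by blast
    obtain s where s: "s \<in> standard_simplex k" "t = simplical_face i s"
      using standard_simplex_face_preimage[OF Suc.prems(2) i] by blast
    have nf: "normal_form X (Suc k) a t =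
        (case face X (Suc k) i a of None \<Rightarrow> base_prepoint | Some b \<Rightarrow> normal_form X k b s)"
      unfolding s(2) by (rule normal_form_face[OF i(1) s(1) Suc.prems(1)])
    show ?thesis
    proof (cases "face X (Suc k) i a")
      case None
      then show ?thesis
        using nf cls_face[OF Suc.prems(1) i(1) s(1)] glue_target_in[OF Suc.prems(1) i(1) s(1)]
        by (simp add: s(2) glue_target_def base_prepoint_def)
    next
      case (Some b)
      then have b: "b \<in> simplices X k" using face_simplex i(1) Suc.prems(1) by blast
      show ?thesis
        using nf cls_face[OF Suc.prems(1) i(1) s(1)] Suc.IH[OF b s(1)] Some
        by (auto simp: s(2) glue_target_def simp del: normal_form.simps)
    qed
  next
    case False
    then have "normal_form X (Suc k) a t = (Some (Suc k, a), t)" by auto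
    then show ?thesis using Suc.prems by (simp add: topspace_prerealization del: normal_form.simps)
  qed
qed

lemma normalize_spec:
  assumes "x \<in> topspace Pre"
  shows "normalize X x \<in> topspace Pre" "cls (normalize X x) = cls x"
    "cell_dim (fst (normalize X x)) \<le> cell_dim (fst x)"
proof -
  obtain u t where x: "x = (u, t)" by force
  have "normalize X x \<in> topspace Pre \<and> cls (normalize X x) = cls x \<and>
    cell_dim (fst (normalize X x)) \<le> cell_dim (fst x)"
  proof (cases u)
    case None
    then have "t = (\<lambda>j. if j = 0 then 1 else 0)" "None \<in> cell_indices X"
      using assms standard_simplex_0 by (auto simp: x topspace_prerealization)
    then show ?thesis using assms by (auto simp: x None base_prepoint_def)
  next
    case (Some v)
    then show ?thesis
      using normal_form_spec[of "snd v" "fst v" t] assms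
      by (cases v) (auto simp: x topspace_prerealization)
  qed
  then show "normalize X x \<in> topspace Pre" "cls (normalize X x) = cls x"
    "cell_dim (fst (normalize X x)) \<le> cell_dim (fst x)" by auto
qed

lemma normalize_equiv:
  assumes "(x, y) \<in> generated_equiv (glue X) (topspace Pre)"
  shows "normalize X x = normalize X y"
proof -
  have "equivclp (\<lambda>u v. u \<in> topspace Pre \<and> v \<in> topspace Pre \<and> glue X u v) x y"
    using assms by (auto simp: generated_equiv_def)
  then show ?thesis
    by (induction rule: equivclp_induct) (auto dest: normalize_glue)
qed

text \<open>Normalization stays inside a class and is constant along gluings, so it is a complete
  invariant.\<close>

lemma cls_eq_iff:
  assumes "x \<in> topspace Pre" "y \<in> topspace Pre"
  shows "cls x = cls y \<longleftrightarrow> normalize X x = normalize X y"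
proof
  assume "cls x = cls y"
  then have "(x, y) \<in> generated_equiv (glue X) (topspace Pre)"
    unfolding cls_def using eq_equiv_class[OF _ equiv_generated_equiv] assms by metis
  then show "normalize X x = normalize X y" by (rule normalize_equiv)
next
  assume "normalize X x = normalize X y"
  then show "cls x = cls y" using normalize_spec(2) assms by metis
qed

text \<open>All members of a class share their normal form, and normalizing never raises the
  dimension; thus the normal form attains the least dimension in the class.\<close>

lemma cls_in_skeleton_iff:
  assumes "x \<in> topspace Pre"
  shows "cls x \<in> skeleton X p \<longleftrightarrow> int (cell_dim (fst (normalize X x))) \<le> p"
proof
  assume "cls x \<in> skeleton X p"
  then obtain u t where ut: "(u, t) \<in> cls x" "int (cell_dim u) \<le> p"
    unfolding skeleton_def by blast
  then have e: "(x, (u, t)) \<in> generated_equiv (glue X) (topspace Pre)" by (simp add: cls_def)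
  then have "(u, t) \<in> topspace Pre" by (auto simp: generated_equiv_def)
  then show "int (cell_dim (fst (normalize X x))) \<le> p"
    using normalize_spec(3)[of "(u, t)"] normalize_equiv[OF e] ut(2) by auto
next
  assume *: "int (cell_dim (fst (normalize X x))) \<le> p"
  have "normalize X x \<in> cls (normalize X x)"
    unfolding cls_def by (rule equiv_class_self[OF equiv_generated_equiv normalize_spec(1)[OF assms]])
  then have "normalize X x \<in> cls x" using normalize_spec(2)[OF assms] by simp
  then show "cls x \<in> skeleton X p"
    using * assms unfolding skeleton_def topspace_realization
    by (auto intro!: bexI[of _ "normalize X x"] simp: case_prod_beta)
qed

lemma normalize_boundary:
  assumes "u \<in> cell_indices X" "t \<in> simplex_boundary (cell_dim u)"
  shows "cell_dim (fst (normalize X (u, t))) < cell_dim u"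
proof (cases u)
  case None
  then show ?thesis using assms by (auto simp: simplex_boundary_def standard_simplex_0)
next
  case (Some v)
  obtain k a where v: "v = (k, a)" by force
  have k: "a \<in> simplices X k" "t \<in> standard_simplex k" using assms Some v by (auto simp: simplex_boundary_def)
  obtain i where i: "i \<le> k" "t i = 0" using assms Some v by (auto simp: simplex_boundary_def)
  obtain k' where k': "k = Suc k'"
    using i k by (cases k) (auto simp: standard_simplex_0)
  obtain s where s: "s \<in> standard_simplex k'" "t = simplical_face i s"
    using standard_simplex_face_preimage k i unfolding k' by blast
  have nf: "normalize X (u, t) =
        (case face X (Suc k') i a of None \<Rightarrow> base_prepoint | Some b \<Rightarrow> normal_form X k' b s)"
    using normal_form_face[of i k' s a] i s k k' by (simp add: Some v del: normal_form.simps)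
  show ?thesis
  proof (cases "face X (Suc k') i a")
    case None
    then show ?thesis using nf by (simp add: Some v k' base_prepoint_def)
  next
    case (Some b)
    then have b: "b \<in> simplices X k'" using face_simplex i(1) k(1) unfolding k' by blast
    show ?thesis using nf normal_form_spec[OF b s(1)] Some
      by (simp add: \<open>u = Some v\<close> v k' del: normal_form.simps)
  qed
qed

lemma normalize_interior:
  assumes "u \<in> cell_indices X" "t \<in> standard_simplex (cell_dim u) - simplex_boundary (cell_dim u)"
  shows "normalize X (u, t) = (u, t)"
proof (cases u)
  case None
  then show ?thesis using assms by (auto simp: standard_simplex_0 base_prepoint_def)
next
  case (Some v)
  then show ?thesis
    using assms by (cases v, cases "fst v") (auto simp: simplex_boundary_def)
qed

section \<open>Cells and skeleta\<close>

definition cell_map :: "'a cell_index \<Rightarrow> (nat \<Rightarrow> real) \<Rightarrow> 'a prepoint set" where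
  "cell_map u t = cls (u, t)"

lemma continuous_cell_map:
  assumes "u \<in> cell_indices X"
  shows "continuous_map (simplex_space (cell_dim u)) (realization X) (cell_map u)"
proof -
  have "continuous_map (simplex_space (cell_dim u)) Pre (\<lambda>t. (u, t))"
    unfolding prerealization_def using continuous_map_component_injection[OF assms] .
  from continuous_map_compose[OF this quotient_imp_continuous_map[OF quotient_map_cls]]
  show ?thesis by (simp add: o_def cell_map_def[abs_def])
qed

lemma skeleton_cells:
  assumes "z \<in> skeleton X p"
  obtains u t where "u \<in> cell_indices X" "int (cell_dim u) \<le> p" "t \<in> standard_simplex (cell_dim u)" "z = cell_map u t"
proof -
  obtain x where x: "x \<in> topspace Pre" "z = cls x"
    using assms unfolding skeleton_def topspace_realization by blast
  obtain u t where ut: "normalize X x = (u, t)" by force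
  have "int (cell_dim u) \<le> p" using cls_in_skeleton_iff[OF x(1)] assms x(2) ut by simp
  then show thesis
    using that[of u t] normalize_spec(1,2)[OF x(1)] ut x(2) by (auto simp: cell_map_def topspace_prerealization)
qed

lemma cell_map_in_skeleton:
  assumes "u \<in> cell_indices X" "t \<in> standard_simplex (cell_dim u)" "int (cell_dim u) \<le> p"
  shows "cell_map u t \<in> skeleton X p"
proof -
  have x: "(u, t) \<in> topspace Pre" using assms by (simp add: topspace_prerealization)
  show ?thesis
    unfolding cell_map_def cls_in_skeleton_iff[OF x] using normalize_spec(3)[OF x] assms(3) by simp
qed

lemma skeleton_subset: "skeleton X p \<subseteq> topspace (realization X)"
  by (auto simp: skeleton_def)

lemma skeleton_mono:
  assumes "p \<le> p'"
  shows "skeleton X p \<subseteq> skeleton X p'"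
proof
  fix z assume "z \<in> skeleton X p"
  then obtain x where "z \<in> topspace (realization X)" "x \<in> z" "int (cell_dim (fst x)) \<le> p"
    unfolding skeleton_def case_prod_beta by blast
  then show "z \<in> skeleton X p'"
    unfolding skeleton_def case_prod_beta using assms order_trans by blast
qed

text \<open>The trace of a subset of the \<open>q\<close>-skeleton on a higher-dimensional cell lies in the faces
  of that cell, so it is controlled by the traces on the cells of dimension at most \<open>q\<close>.\<close>

lemma closedin_skeleton_trace:
  assumes F: "F \<subseteq> skeleton X (int q)"
    and low: "\<And>u. u \<in> cell_indices X \<Longrightarrow> cell_dim u \<le> q \<Longrightarrow>
        closedin (simplex_space (cell_dim u)) {t \<in> standard_simplex (cell_dim u). cell_map u t \<in> F}"
    and a: "a \<in> simplices X k"
  shows "closedin (simplex_space k) {t \<in> standard_simplex k. cell_map (Some (k, a)) t \<in> F}"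
  using a
proof (induction k arbitrary: a)
  case 0
  then show ?case using low[of "Some (0, a)"] by simp
next
  case (Suc k)
  show ?case
  proof (cases "Suc k \<le> q")
    case True
    then show ?thesis using low[of "Some (Suc k, a)"] Suc.prems by simp
  next
    case False
    let ?G = "\<lambda>i. {s \<in> standard_simplex k. cls (glue_target X k a i s) \<in> F}"
    have "{t \<in> standard_simplex (Suc k). cell_map (Some (Suc k, a)) t \<in> F} =
          (\<Union>i\<in>{..Suc k}. simplical_face i ` ?G i)"
    proof (intro subset_antisym subsetI)
      fix t assume "t \<in> {t \<in> standard_simplex (Suc k). cell_map (Some (Suc k, a)) t \<in> F}"
      then have t: "t \<in> standard_simplex (Suc k)" "cls (Some (Suc k, a), t) \<in> F" by (auto simp: cell_map_def)
      have x: "(Some (Suc k, a), t) \<in> topspace Pre" using t Suc.prems by (simp add: topspace_prerealization)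
      have "int (cell_dim (fst (normalize X (Some (Suc k, a), t)))) \<le> int q"
        using cls_in_skeleton_iff[OF x, of "int q"] t(2) F by blast
      then have "t \<in> simplex_boundary (Suc k)"
        using normalize_interior[of "Some (Suc k, a)" t] Suc.prems t(1) False
        by (cases "t \<in> simplex_boundary (Suc k)") (auto simp del: normalize.simps)
      then obtain i where i: "i \<le> Suc k" "t i = 0" by (auto simp: simplex_boundary_def)
      obtain s where s: "s \<in> standard_simplex k" "t = simplical_face i s"
        using standard_simplex_face_preimage[OF t(1) i] by blast
      have "s \<in> ?G i" using cls_face[OF Suc.prems i(1) s(1)] t(2) s by simp
      then show "t \<in> (\<Union>i\<in>{..Suc k}. simplical_face i ` ?G i)" using i(1) s(2) by blast
    next
      fix t assume "t \<in> (\<Union>i\<in>{..Suc k}. simplical_face i ` ?G i)"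
      then obtain i s where ist: "i \<le> Suc k" "s \<in> standard_simplex k" "cls (glue_target X k a i s) \<in> F" "t = simplical_face i s"
        by auto
      then show "t \<in> {t \<in> standard_simplex (Suc k). cell_map (Some (Suc k, a)) t \<in> F}"
        using cls_face[OF Suc.prems ist(1,2)] simplical_face_in_standard_simplex[of "Suc k" i s]
        by (simp add: cell_map_def)
    qed
    moreover have "closedin (simplex_space (Suc k)) (simplical_face i ` ?G i)" if i: "i \<le> Suc k" for i
    proof -
      have "closedin (simplex_space k) (?G i)"
      proof (cases "face X (Suc k) i a")
        case None
        then have "?G i = (if cls base_prepoint \<in> F then standard_simplex k else {})"
          by (auto simp: glue_target_def)
        moreover have "closedin (simplex_space k) (standard_simplex k)"
          using closedin_topspace[of "simplex_space k"] by simp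
        ultimately show ?thesis by simp
      next
        case (Some b)
        then have "b \<in> simplices X k" using face_simplex i Suc.prems by blast
        from Suc.IH[OF this] show ?thesis using Some by (simp add: glue_target_def cell_map_def)
      qed
      then show ?thesis using closed_map_simplical_face[OF i] by (auto simp: closed_map_def)
    qed
    ultimately show ?thesis by (auto intro!: closedin_Union)
  qed
qed

text \<open>Interior points are their own normal forms, which gives injectivity and separation from
  the lower skeleton; boundary points normalize to smaller dimension.\<close>

lemma simplex_attachment_skeleton:
  "simplex_attachment (subtopology (realization X) (skeleton X (int q)))
     {u \<in> cell_indices X. cell_dim u \<le> q} cell_dim cell_map (skeleton X (int q - 1))
     {u \<in> cell_indices X. cell_dim u = q} q"
proof
  let ?Y = "subtopology (realization X) (skeleton X (int q))"
  let ?J = "{u \<in> cell_indices X. cell_dim u \<le> q}"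
  let ?P = "sum_topology (\<lambda>u. simplex_space (cell_dim u)) ?J"
  have topY: "topspace ?Y = skeleton X (int q)" using skeleton_subset by auto
  have sur: "(\<lambda>(u, t). cell_map u t) ` topspace ?P = topspace ?Y"
    unfolding topY
  proof (intro subset_antisym subsetI)
    fix z assume "z \<in> (\<lambda>(u, t). cell_map u t) ` topspace ?P"
    then show "z \<in> skeleton X (int q)" using cell_map_in_skeleton by auto
  next
    fix z assume "z \<in> skeleton X (int q)"
    then obtain u t where "u \<in> cell_indices X" "int (cell_dim u) \<le> int q" "t \<in> standard_simplex (cell_dim u)" "z = cell_map u t"
      by (rule skeleton_cells)
    then show "z \<in> (\<lambda>(u, t). cell_map u t) ` topspace ?P" by force
  qed
  have cont: "continuous_map (simplex_space (cell_dim u)) ?Y (cell_map u)" if "u \<in> ?J" for u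
    using that continuous_cell_map cell_map_in_skeleton
    by (auto simp: continuous_map_in_subtopology)
  show "quotient_map ?P ?Y (\<lambda>(u, t). cell_map u t)"
    unfolding quotient_map_closedin
  proof (intro conjI allI impI)
    fix F assume F: "F \<subseteq> topspace ?Y"
    let ?C = "\<lambda>u. {t \<in> standard_simplex (cell_dim u). cell_map u t \<in> F}"
    have e: "{x \<in> topspace ?P. (case x of (u, t) \<Rightarrow> cell_map u t) \<in> F} = Sigma ?J ?C" by auto
    have "closedin ?P (Sigma ?J ?C) \<longleftrightarrow> (\<forall>u\<in>?J. closedin (simplex_space (cell_dim u)) (?C u))"
      by (rule closedin_disjoint_union)
    also have "\<dots> \<longleftrightarrow> closedin ?Y F"
    proof
      assume *: "\<forall>u\<in>?J. closedin (simplex_space (cell_dim u)) (?C u)"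
      have Fs: "F \<subseteq> skeleton X (int q)" using F topY by simp
      \<comment> \<open>The skeleton carries the subspace topology, so closedness is first proved in
        the whole realization, where cells of every dimension have to be inspected.\<close>
      have all: "closedin (simplex_space (cell_dim u)) (?C u)" if u: "u \<in> cell_indices X" for u
      proof (cases u)
        case None
        then show ?thesis using * u by auto
      next
        case (Some v)
        show ?thesis
        proof (cases v)
          case (Pair k a)
          have "closedin (simplex_space k) {t \<in> standard_simplex k. cell_map (Some (k, a)) t \<in> F}"
            by (rule closedin_skeleton_trace[OF Fs]) (use * u Some Pair in auto)
          then show ?thesis by (simp add: Some Pair)
        qed
      qed
      have "{x \<in> topspace Pre. cls x \<in> F} = Sigma (cell_indices X) ?C"
        by (auto simp: topspace_prerealization cell_map_def)
      moreover have "closedin Pre (Sigma (cell_indices X) ?C)"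
        unfolding prerealization_def closedin_disjoint_union using all by blast
      moreover have *: "\<forall>U. U \<subseteq> topspace (realization X) \<longrightarrow>
          (closedin Pre {x \<in> topspace Pre. cls x \<in> U} \<longleftrightarrow> closedin (realization X) U)"
        using quotient_map_cls unfolding quotient_map_closedin by (rule conjunct2)
      moreover have "F \<subseteq> topspace (realization X)" using Fs skeleton_subset by blast
      ultimately have "closedin (realization X) F"
        using spec [OF *, of F] by (simp only:)
      then show "closedin ?Y F"
        using Fs by (auto simp: closedin_subtopology)
    next
      assume *: "closedin ?Y F"
      show "\<forall>u\<in>?J. closedin (simplex_space (cell_dim u)) (?C u)"
        using closedin_continuous_map_preimage[OF cont *] by auto
    qed
    finally show "closedin ?P {x \<in> topspace ?P. (case x of (u, t) \<Rightarrow> cell_map u t) \<in> F} \<longleftrightarrow> closedin ?Y F"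
      unfolding e .
  qed (rule sur)
  show "cell_map u t \<in> skeleton X (int q - 1)"
    if "u \<in> ?J - {u \<in> cell_indices X. cell_dim u = q}" "t \<in> standard_simplex (cell_dim u)" for u t
    using that by (intro cell_map_in_skeleton) auto
  show "cell_map u t \<in> skeleton X (int q - 1)"
    if "u \<in> {u \<in> cell_indices X. cell_dim u = q}" "t \<in> simplex_boundary q" for u t
  proof -
    have "(u, t) \<in> topspace Pre"
      using that simplex_boundary_subset by (auto simp: topspace_prerealization)
    then show ?thesis
      unfolding cell_map_def using cls_in_skeleton_iff normalize_boundary[of u t] that by fastforce
  qed
  have self: "(u, t) \<in> topspace Pre \<and> normalize X (u, t) = (u, t)"
    if "u \<in> {u \<in> cell_indices X. cell_dim u = q}" "t \<in> standard_simplex q - simplex_boundary q" for u t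
    using that normalize_interior[of u t] by (auto simp: topspace_prerealization)
  show "cell_map u t \<notin> skeleton X (int q - 1)"
    if "u \<in> {u \<in> cell_indices X. cell_dim u = q}" "t \<in> standard_simplex q - simplex_boundary q" for u t
    using self[OF that] that(1) cls_in_skeleton_iff[of "(u, t)" "int q - 1"] by (auto simp: cell_map_def)
  show "u = v \<and> s = t"
    if "u \<in> {u \<in> cell_indices X. cell_dim u = q}" "v \<in> {u \<in> cell_indices X. cell_dim u = q}"
      "s \<in> standard_simplex q - simplex_boundary q" "t \<in> standard_simplex q - simplex_boundary q"
      "cell_map u s = cell_map v t" for u v s t
    using self[OF that(1,3)] self[OF that(2,4)] that(5) cls_eq_iff[of "(u, s)" "(v, t)"]
    by (auto simp: cell_map_def)
  show "skeleton X (int q - 1) \<subseteq> topspace ?Y"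
    unfolding topY by (rule skeleton_mono) simp
qed auto

lemma homology_basis_skeleton:
  "homology_basis q (subtopology (realization X) (skeleton X (int q))) (skeleton X (int q - 1))
     {u \<in> cell_indices X. cell_dim u = q} (\<lambda>u. frag_of (restrict (cell_map u) (standard_simplex q)))"
  by (rule simplex_attachment.homology_basis_attachment[OF simplex_attachment_skeleton homology_basis_simplex])

end

section \<open>The cellular complex of a realization\<close>

text \<open>An undefined face is constant at the base point. As a singular simplex of positive
  dimension it lies in a lower skeleton and contributes nothing; for \<open>k = 0\<close> it is the
  cell \<open>None\<close> itself. Cells of dimension 0 are sent to the generator of the
  augmentation.\<close>

fun cell_boundary :: "'a partial_presimplicial \<Rightarrow> 'a cell_index \<Rightarrow> 'a cell_index \<Rightarrow>\<^sub>0 int" where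
  "cell_boundary X (Some (Suc k, a)) =
     (\<Sum>i\<le>Suc k. frag_cmul ((- 1) ^ i)
        (case face X (Suc k) i a of Some b \<Rightarrow> frag_of (Some (k, b))
         | None \<Rightarrow> if k = 0 then frag_of None else 0))"
| "cell_boundary X (Some (0, a)) = frag_of None"
| "cell_boundary X None = frag_of None"

text \<open>In degree \<open>-1\<close> the index \<open>None\<close> stands for the generator of the augmentation target,
  in degree 0 for the base point.\<close>

definition chain_cells :: "'a partial_presimplicial \<Rightarrow> int \<Rightarrow> 'a cell_index set" where
  "chain_cells X q = (if q = -1 then {None} else {u \<in> cell_indices X. int (cell_dim u) = q})"

definition cell_complex :: "'a partial_presimplicial \<Rightarrow> ('a cell_index \<Rightarrow>\<^sub>0 int) chain_complex" where
  "cell_complex X =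
     \<lparr>Grp = (\<lambda>q. free_Abelian_group (chain_cells X q)),
      Diff = (\<lambda>q. if q \<ge> 0 then frag_extend (cell_boundary X) else (\<lambda>_. 0))\<rparr>"

lemma singular_relboundary_sum:
  assumes "finite A" "\<And>i. i \<in> A \<Longrightarrow> singular_relboundary p X S (f i)"
  shows "singular_relboundary p X S (sum f A)"
  using assms by (induction A rule: finite_induct) (auto intro: singular_relboundary_add)

lemma frag_extend_frag_extend: "frag_extend f (frag_extend g n) = frag_extend (\<lambda>u. frag_extend f (g u)) n"
  using frag_extend_additive[of "frag_extend f" g n] by (simp add: frag_extend_diff o_def)

lemma homology_basis_point:
  assumes top: "topspace X = {a}"
  shows "homology_basis 0 X {} {i} (\<lambda>_. frag_of (restrict (\<lambda>_. a) (standard_simplex 0)))"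
  unfolding homology_basis_singleton_iff
proof (intro conjI allI impI)
  show "singular_relcycle 0 X {} (frag_of (restrict (\<lambda>_. a) (standard_simplex 0)))"
    unfolding singular_cycle_singleton[OF top]
    by (simp add: singular_chain_of singular_simplex_singleton[OF top])
  fix c assume "singular_relcycle 0 X {} c"
  then have "singular_chain 0 X c" by (simp add: singular_relcycle)
  then obtain k where "c = frag_cmul k (frag_of (restrict (\<lambda>_. a) (standard_simplex 0)))"
    unfolding singular_chain_singleton[OF top] by blast
  then show "\<exists>k. homologous_rel 0 X {} c (frag_cmul k (frag_of (restrict (\<lambda>_. a) (standard_simplex 0))))"
    by (metis homologous_rel_refl)
next
  fix k assume "singular_relboundary 0 X {} (frag_cmul k (frag_of (restrict (\<lambda>_. a) (standard_simplex 0))))"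
  then show "k = 0"
    unfolding singular_boundary_singleton[OF top] by simp
qed

lemma is_chain_complexD:
  assumes "is_chain_complex C"
  shows "comm_group (Grp C q)" "Diff C q \<in> hom (Grp C q) (Grp C (q - 1))"
    "x \<in> carrier (Grp C q) \<Longrightarrow> Diff C (q - 1) (Diff C q x) = \<one>\<^bsub>Grp C (q - 2)\<^esub>"
  using assms unfolding is_chain_complex_def by blast+

text \<open>Maps and homotopies are conjugated by the isomorphisms \<open>F\<close>. That
  \<open>C'\<close> is a complex is a consequence, its differential being that of \<open>M\<close>
  conjugated by \<open>F\<close>.\<close>

lemma chain_homotopy_equivalent_transfer:
  assumes CM: "chain_homotopy_equivalent C M"
    and comm: "\<And>q. comm_group (Grp C' q)"
    and F: "\<And>q. F q \<in> iso (Grp M q) (Grp C' q)"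
    and DF: "\<And>q x. x \<in> carrier (Grp M q) \<Longrightarrow> Diff C' q (F q x) = F (q - 1) (Diff M q x)"
  shows "chain_homotopy_equivalent C C'"
proof -
  have C: "is_chain_complex C" and M: "is_chain_complex M"
    using CM by (auto simp: chain_homotopy_equivalent_def)
  obtain f g where f: "complex_map C M f" and g: "complex_map M C g"
    and gf: "complex_homotopic C C (\<lambda>q. g q \<circ> f q) (\<lambda>q. id)"
    and fg: "complex_homotopic M M (\<lambda>q. f q \<circ> g q) (\<lambda>q. id)"
    using CM unfolding chain_homotopy_equivalent_def by blast
  have grpM: "group (Grp M q)" for q using is_chain_complexD(1)[OF M] by (simp add: comm_group_def)
  have grpC': "group (Grp C' q)" for q using comm by (simp add: comm_group_def)
  define G where "G q = inv_into (carrier (Grp M q)) (F q)" for q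
  have G: "G q \<in> iso (Grp C' q) (Grp M q)" for q
    unfolding G_def using group.iso_set_sym[OF grpM F] .
  have Fh: "F q \<in> hom (Grp M q) (Grp C' q)" and Gh: "G q \<in> hom (Grp C' q) (Grp M q)" for q
    using F G by (auto simp: iso_def)
  have bij: "bij_betw (F q) (carrier (Grp M q)) (carrier (Grp C' q))" for q
    using F unfolding iso_def by blast
  have GF: "G q (F q x) = x" if "x \<in> carrier (Grp M q)" for q x
    unfolding G_def using bij_betw_inv_into_left[OF bij that] .
  have FG: "F q (G q y) = y" if "y \<in> carrier (Grp C' q)" for q y
    unfolding G_def using bij_betw_inv_into_right[OF bij that] .
  have Fc: "F q x \<in> carrier (Grp C' q)" if "x \<in> carrier (Grp M q)" for q x
    using Fh that by (auto simp: hom_def)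
  have Gc: "G q y \<in> carrier (Grp M q)" if "y \<in> carrier (Grp C' q)" for q y
    using Gh that by (auto simp: hom_def)
  have DM: "Diff M q x \<in> carrier (Grp M (q - 1))" if "x \<in> carrier (Grp M q)" for q x
    using is_chain_complexD(2)[OF M, of q] that by (auto simp: hom_def)
  have D': "Diff C' q y = F (q - 1) (Diff M q (G q y))" if "y \<in> carrier (Grp C' q)" for q y
    using DF[OF Gc[OF that]] FG[OF that] by simp
  have GD: "G (q - 1) (Diff C' q y) = Diff M q (G q y)" if "y \<in> carrier (Grp C' q)" for q y
    using D'[OF that] GF[OF DM[OF Gc[OF that]]] by simp
  have C': "is_chain_complex C'"
    unfolding is_chain_complex_def
  proof (intro allI conjI ballI)
    fix q
    show "comm_group (Grp C' q)" by (rule comm)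
    have "F (q - 1) \<circ> (Diff M q \<circ> G q) \<in> hom (Grp C' q) (Grp C' (q - 1))"
      using hom_compose[OF hom_compose[OF Gh is_chain_complexD(2)[OF M]] Fh] .
    then show "Diff C' q \<in> hom (Grp C' q) (Grp C' (q - 1))"
      using D' by (auto simp: hom_def Pi_iff group.is_monoid[OF grpC'] monoid.m_closed)
    fix y assume y: "y \<in> carrier (Grp C' q)"
    have "Diff C' (q - 1) (Diff C' q y) = F (q - 1 - 1) (Diff M (q - 1) (Diff M q (G q y)))"
      unfolding D'[OF y] by (rule DF[OF DM[OF Gc[OF y]]])
    also have "\<dots> = F (q - 2) \<one>\<^bsub>Grp M (q - 2)\<^esub>"
      using is_chain_complexD(3)[OF M Gc[OF y]] by simp
    also have "\<dots> = \<one>\<^bsub>Grp C' (q - 2)\<^esub>" by (rule hom_one[OF Fh grpM grpC'])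
    finally show "Diff C' (q - 1) (Diff C' q y) = \<one>\<^bsub>Grp C' (q - 2)\<^esub>" .
  qed
  have fc: "f q x \<in> carrier (Grp M q)" if "x \<in> carrier (Grp C q)" for q x
    using f that by (auto simp: complex_map_def hom_def)
  have gc: "g q x \<in> carrier (Grp C q)" if "x \<in> carrier (Grp M q)" for q x
    using g that by (auto simp: complex_map_def hom_def)
  have DC: "Diff C q x \<in> carrier (Grp C (q - 1))" if "x \<in> carrier (Grp C q)" for q x
    using is_chain_complexD(2)[OF C, of q] that by (auto simp: hom_def)
  have D'c: "Diff C' q x \<in> carrier (Grp C' (q - 1))" if "x \<in> carrier (Grp C' q)" for q x
    using is_chain_complexD(2)[OF C', of q] that by (auto simp: hom_def)
  have 1: "complex_map C C' (\<lambda>q. F q \<circ> f q)"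
    unfolding complex_map_def
  proof (intro allI conjI ballI)
    fix q
    have "f q \<in> hom (Grp C q) (Grp M q)" using f by (simp add: complex_map_def)
    then show "F q \<circ> f q \<in> hom (Grp C q) (Grp C' q)" using Fh by (rule hom_compose)
    fix x assume x: "x \<in> carrier (Grp C q)"
    show "Diff C' q ((F q \<circ> f q) x) = (F (q - 1) \<circ> f (q - 1)) (Diff C q x)"
      using DF[OF fc[OF x]] f x by (simp add: complex_map_def)
  qed
  have 2: "complex_map C' C (\<lambda>q. g q \<circ> G q)"
    unfolding complex_map_def
  proof (intro allI conjI ballI)
    fix q
    have "g q \<in> hom (Grp M q) (Grp C q)" using g by (simp add: complex_map_def)
    then show "g q \<circ> G q \<in> hom (Grp C' q) (Grp C q)" using Gh hom_compose by blast
    fix y assume y: "y \<in> carrier (Grp C' q)"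
    show "Diff C q ((g q \<circ> G q) y) = (g (q - 1) \<circ> G (q - 1)) (Diff C' q y)"
      using GD[OF y] g Gc[OF y] by (simp add: complex_map_def)
  qed
  have 3: "complex_homotopic C C (\<lambda>q. (g q \<circ> G q) \<circ> (F q \<circ> f q)) (\<lambda>q. id)"
    using gf unfolding complex_homotopic_def by (simp add: GF fc)
  obtain h where h: "\<And>q. h q \<in> hom (Grp M q) (Grp M (q + 1))"
    "\<And>q x. x \<in> carrier (Grp M q) \<Longrightarrow>
       f q (g q x) = x \<otimes>\<^bsub>Grp M q\<^esub> (Diff M (q + 1) (h q x) \<otimes>\<^bsub>Grp M q\<^esub> h (q - 1) (Diff M q x))"
    using fg unfolding complex_homotopic_def by (auto simp: id_def o_def)
  have hc: "h q x \<in> carrier (Grp M (q + 1))" if "x \<in> carrier (Grp M q)" for q x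
    using h(1)[of q] that by (auto simp: hom_def)
  have 4: "complex_homotopic C' C' (\<lambda>q. (F q \<circ> f q) \<circ> (g q \<circ> G q)) (\<lambda>q. id)"
    unfolding complex_homotopic_def
  proof (intro exI[of _ "\<lambda>q. F (q + 1) \<circ> (h q \<circ> G q)"] allI conjI ballI)
    fix q
    show "F (q + 1) \<circ> (h q \<circ> G q) \<in> hom (Grp C' q) (Grp C' (q + 1))"
      using hom_compose[OF hom_compose[OF Gh h(1)] Fh] .
    fix y assume y: "y \<in> carrier (Grp C' q)"
    let ?x = "G q y"
    have x: "?x \<in> carrier (Grp M q)" by (rule Gc[OF y])
    have a: "Diff M (q + 1) (h q ?x) \<in> carrier (Grp M q)" using DM[OF hc[OF x]] by simp
    have b: "h (q - 1) (Diff M q ?x) \<in> carrier (Grp M q)" using hc[OF DM[OF x]] by simp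
    have ab: "Diff M (q + 1) (h q ?x) \<otimes>\<^bsub>Grp M q\<^esub> h (q - 1) (Diff M q ?x) \<in> carrier (Grp M q)"
      using a b by (rule monoid.m_closed[OF group.is_monoid[OF grpM]])
    have "F q (f q (g q ?x)) = F q ?x \<otimes>\<^bsub>Grp C' q\<^esub>
        (F q (Diff M (q + 1) (h q ?x)) \<otimes>\<^bsub>Grp C' q\<^esub> F q (h (q - 1) (Diff M q ?x)))"
      unfolding h(2)[OF x] hom_mult[OF Fh x ab] hom_mult[OF Fh a b] ..
    moreover have "F q (Diff M (q + 1) (h q ?x)) = Diff C' (q + 1) (F (q + 1) (h q ?x))"
      using DF[OF hc[OF x]] by simp
    moreover have "F q (h (q - 1) (Diff M q ?x)) = F (q - 1 + 1) (h (q - 1) (G (q - 1) (Diff C' q y)))"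
      using GD[OF y] by simp
    ultimately show "((F q \<circ> f q) \<circ> (g q \<circ> G q)) y = id y \<otimes>\<^bsub>Grp C' q\<^esub>
        (Diff C' (q + 1) ((F (q + 1) \<circ> (h q \<circ> G q)) y) \<otimes>\<^bsub>Grp C' q\<^esub>
         (F (q - 1 + 1) \<circ> (h (q - 1) \<circ> G (q - 1))) (Diff C' q y))"
      using FG[OF y] by simp
  qed
  show ?thesis
    unfolding chain_homotopy_equivalent_def using C C' 1 2 3 4 by blast
qed

context presimplicial begin

abbreviation "R \<equiv> realization X"
abbreviation "K \<equiv> skeleton X"
abbreviation "cellular \<equiv> reduced_cellular_complex R K"

definition cell_simplex :: "'a cell_index \<Rightarrow> 'a prepoint set chain" where
  "cell_simplex u = frag_of (restrict (cell_map u) (standard_simplex (cell_dim u)))"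

lemma skeleton_neg: "p < 0 \<Longrightarrow> K p = {}"
  by (auto simp: skeleton_def)

lemma chain_cells_Suc:
  assumes "u \<in> chain_cells X (int (Suc k))"
  obtains a where "u = Some (Suc k, a)" "a \<in> simplices X (Suc k)"
proof -
  have "u \<in> cell_indices X" "cell_dim u = Suc k"
    using assms by (auto simp: chain_cells_def simp del: of_nat_Suc)
  then show thesis using that by (cases u rule: cell_dim.cases) auto
qed

lemma cell_simplex_basis:
  "homology_basis q (subtopology R (K (int q))) (K (int q - 1)) (chain_cells X (int q)) cell_simplex"
proof (rule homology_basis_cong)
  show "homology_basis q (subtopology R (K (int q))) (K (int q - 1)) (chain_cells X (int q))
     (\<lambda>u. frag_of (restrict (cell_map u) (standard_simplex q)))"
    using homology_basis_skeleton[of q] by (simp add: chain_cells_def)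
qed (simp add: chain_cells_def cell_simplex_def)

lemma Diff_cellular:
  assumes c: "singular_relcycle (Suc k) (subtopology R (K (int (Suc k)))) (K (int k)) c"
  shows "Diff cellular (int (Suc k)) (homologous_rel_set (Suc k) (subtopology R (K (int (Suc k)))) (K (int k)) c) =
         homologous_rel_set k (subtopology R (K (int k))) (K (int k - 1)) (chain_boundary (Suc k) c)"
    and "singular_relcycle k (subtopology R (K (int k))) (K (int k - 1)) (chain_boundary (Suc k) c)"
proof -
  have sub: "subtopology (subtopology R (K (int (Suc k)))) (K (int k)) = subtopology R (K (int k))"
    using skeleton_mono[of "int k" "int (Suc k)"] by (simp add: subtopology_subtopology inf_absorb2)
  have ch: "singular_chain k (subtopology R (K (int k))) (chain_boundary (Suc k) c)"
    using c sub by (simp add: singular_relcycle)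
  have z: "chain_boundary k (chain_boundary (Suc k) c) = 0"
    using c chain_boundary_boundary_alt unfolding singular_relcycle by blast
  have cyc: "singular_relcycle k (subtopology R (K (int k))) {} (chain_boundary (Suc k) c)"
    unfolding singular_cycle using ch z by simp
  show "singular_relcycle k (subtopology R (K (int k))) (K (int k - 1)) (chain_boundary (Suc k) c)"
    unfolding singular_relcycle using ch z by simp
  have "hom_boundary (int (Suc k)) (subtopology R (K (int (Suc k)))) (K (int k))
      (homologous_rel_set (Suc k) (subtopology R (K (int (Suc k)))) (K (int k)) c) =
      homologous_rel_set k (subtopology R (K (int k))) {} (chain_boundary (Suc k) c)"
    using hom_boundary_chain_boundary[OF c] sub by simp
  moreover have "hom_induced (int k) (subtopology R (K (int k))) {} (subtopology R (K (int k))) (K (int k - 1)) id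
       (homologous_rel_set k (subtopology R (K (int k))) {} (chain_boundary (Suc k) c)) =
      homologous_rel_set k (subtopology R (K (int k))) (K (int k - 1)) (chain_map k id (chain_boundary (Suc k) c))"
    by (rule hom_induced_chain_map) (use cyc in auto)
  moreover have "chain_map k id (chain_boundary (Suc k) c) = chain_boundary (Suc k) c"
    by (rule chain_map_ident[OF ch])
  ultimately show "Diff cellular (int (Suc k)) (homologous_rel_set (Suc k) (subtopology R (K (int (Suc k)))) (K (int k)) c) =
         homologous_rel_set k (subtopology R (K (int k))) (K (int k - 1)) (chain_boundary (Suc k) c)"
    by (simp add: reduced_cellular_complex_def)
qed

lemma singular_face_cell:
  assumes a: "a \<in> simplices X (Suc k)" and i: "i \<le> Suc k"
  shows "singular_face (Suc k) i (restrict (cell_map (Some (Suc k, a))) (standard_simplex (Suc k))) =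
         restrict (\<lambda>t. cls (glue_target X k a i t)) (standard_simplex k)"
  using cls_face[OF a i] simplical_face_in_standard_simplex[of "Suc k" i] i
  by (auto simp: singular_face_def fun_eq_iff restrict_def cell_map_def)

text \<open>Defined faces of a characteristic map are characteristic maps on the nose. An undefined
  face is the constant simplex at the base point: for \<open>k > 0\<close> it is a chain of the
  preceding skeleton, and for \<open>k = 0\<close> it is the base point as a 0-cell.\<close>

lemma cell_boundary_homologous:
  assumes u: "u \<in> chain_cells X (int (Suc k))"
  shows "homologous_rel k (subtopology R (K (int k))) (K (int k - 1))
     (chain_boundary (Suc k) (cell_simplex u)) (frag_extend cell_simplex (cell_boundary X u))"
proof -
  obtain a where ua: "u = Some (Suc k, a)" and a: "a \<in> simplices X (Suc k)"
    using u by (rule chain_cells_Suc)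
  let ?f = "\<lambda>i. frag_of (restrict (\<lambda>t. cls (glue_target X k a i t)) (standard_simplex k)) :: 'a prepoint set chain"
  let ?g = "\<lambda>i. frag_extend cell_simplex (case face X (Suc k) i a of Some b \<Rightarrow> frag_of (Some (k, b))
         | None \<Rightarrow> if k = 0 then frag_of None else 0)"
  have "chain_boundary (Suc k) (cell_simplex u) = (\<Sum>i\<le>Suc k. frag_cmul ((- 1) ^ i) (?f i))"
    unfolding ua cell_simplex_def chain_boundary_of
    using singular_face_cell[OF a] by (simp del: sum.atMost_Suc singular_face_restrict)
  moreover have "frag_extend cell_simplex (cell_boundary X u) = (\<Sum>i\<le>Suc k. frag_cmul ((- 1) ^ i) (?g i))"
    unfolding ua by (simp add: frag_extend_sum o_def frag_extend_cmul del: sum.atMost_Suc)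
  ultimately have d: "chain_boundary (Suc k) (cell_simplex u) - frag_extend cell_simplex (cell_boundary X u) =
      (\<Sum>i\<le>Suc k. frag_cmul ((- 1) ^ i) (?f i - ?g i))"
    by (simp add: sum_subtractf frag_cmul_diff_distrib2 del: sum.atMost_Suc)
  have t: "singular_relboundary k (subtopology R (K (int k))) (K (int k - 1)) (?f i - ?g i)" if i: "i \<le> Suc k" for i
  proof (cases "face X (Suc k) i a")
    case (Some b)
    then have "?f i = ?g i"
      by (simp add: glue_target_def cell_simplex_def cell_map_def[abs_def])
    then show ?thesis by simp
  next
    case None
    have N: "None \<in> cell_indices X" by (rule None_cellI[OF a i None])
    have f: "?f i = frag_of (restrict (\<lambda>t. cls base_prepoint) (standard_simplex k))"
      using None by (simp add: glue_target_def)
    show ?thesis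
    proof (cases "k = 0")
      case True
      have "restrict (\<lambda>t. cls base_prepoint) (standard_simplex 0) = restrict (cell_map None) (standard_simplex 0)"
      proof (rule restrict_ext)
        fix t :: "nat \<Rightarrow> real" assume "t \<in> standard_simplex 0"
        then have "t = (\<lambda>j. if j = 0 then 1 else 0)" unfolding standard_simplex_0 by (rule singletonD)
        then have "(base_prepoint :: 'a prepoint) = (None, t)" by (simp only: base_prepoint_def)
        then show "cls base_prepoint = cell_map None t" by (simp only: cell_map_def)
      qed
      then have "?f i = ?g i" using True f None by (simp add: cell_simplex_def)
      then show ?thesis by simp
    next
      case False
      have "(\<lambda>j. if j = 0 then 1 else (0::real)) \<in> standard_simplex (cell_dim None)" by simp
      from cell_map_in_skeleton[OF N this, of "int k - 1"] False
      have b: "cls base_prepoint \<in> K (int k - 1)" by (simp add: cell_map_def base_prepoint_def)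
      then have b': "cls base_prepoint \<in> K (int k)" "cls base_prepoint \<in> topspace R"
        using skeleton_mono[of "int k - 1" "int k"] skeleton_subset by auto
      have "singular_simplex k (subtopology (subtopology R (K (int k))) (K (int k - 1)))
          (restrict (\<lambda>t. cls base_prepoint) (standard_simplex k))"
        unfolding singular_simplex_def
        using b b' by (auto intro!: continuous_map_eq[where f = "\<lambda>t. cls base_prepoint"])
      then have "singular_relboundary k (subtopology R (K (int k))) (K (int k - 1)) (?f i)"
        unfolding f by (intro singular_chain_imp_relboundary) (simp add: singular_chain_of)
      moreover have "?g i = 0" using None False by simp
      ultimately show ?thesis by simp
    qed
  qed
  show ?thesis
    unfolding homologous_rel_def d
    by (intro singular_relboundary_sum singular_relboundary_cmul t) auto
qed

text \<open>In degree -1 the generator goes to the class of the constant 0-simplex of the one-point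
  space; below that both complexes are trivial and the value is the neutral element.\<close>

definition cellular_iso :: "int \<Rightarrow> ('a cell_index \<Rightarrow>\<^sub>0 int) \<Rightarrow> 'a prepoint set chain set" where
  "cellular_iso q n =
     (if q \<ge> 0 then homologous_rel_set (nat q) (subtopology R (K q)) (K (q - 1)) (frag_extend cell_simplex n)
      else if q = -1 then homologous_rel_set 0 point_space {}
             (frag_extend (\<lambda>_. frag_of (restrict (\<lambda>_. undefined) (standard_simplex 0))) n)
      else \<one>\<^bsub>Grp cellular q\<^esub>)"

lemma comm_group_cellular: "comm_group (Grp cellular q)"
  by (simp add: reduced_cellular_complex_def)

lemma cellular_iso_iso: "cellular_iso q \<in> iso (Grp (cell_complex X) q) (Grp cellular q)"
proof -
  consider k where "q = int k" | "q = -1" | "q < -1"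
    by (metis int_one_le_iff_zero_less linorder_neqE_linordered_idom nonneg_int_cases not_less zle_diff1_eq  add.commute  diff_0 less_le_not_le)
  then show ?thesis
  proof cases
    case 1
    then show ?thesis
      using homology_basis_iso[OF cell_simplex_basis[of k]]
      by (simp add: cellular_iso_def[abs_def] cell_complex_def reduced_cellular_complex_def)
  next
    case 2
    have "topspace point_space = {undefined}" by (simp add: point_space_def)
    from homology_basis_iso[OF homology_basis_point[OF this, of None]]
    show ?thesis
      by (simp add: 2 cellular_iso_def[abs_def] cell_complex_def reduced_cellular_complex_def chain_cells_def)
  next
    case 3
    have "chain_cells X q = {}" using 3 by (auto simp: chain_cells_def)
    then have "carrier (Grp (cell_complex X) q) = {0}"
      by (auto simp: cell_complex_def free_Abelian_group_def)
    moreover have "group (Grp (cell_complex X) q)" "\<one>\<^bsub>Grp (cell_complex X) q\<^esub> = 0"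
      by (simp_all add: cell_complex_def)
    ultimately have "trivial_group (Grp (cell_complex X) q)" "group (Grp (cell_complex X) q)"
      by (simp_all add: trivial_group_def)
    moreover have "trivial_group (Grp cellular q)" and g: "group (Grp cellular q)"
      using 3 by (auto simp: reduced_cellular_complex_def)
    moreover note monoid.l_one[OF group.is_monoid[OF g] monoid.one_closed[OF group.is_monoid[OF g]]]
    ultimately show ?thesis
      using 3 by (auto simp: cellular_iso_def[abs_def] iso_def hom_def trivial_group_def bij_betw_def inj_on_def)
  qed
qed

lemma cellular_iso_zero: "cellular_iso q 0 = \<one>\<^bsub>Grp cellular q\<^esub>"
proof -
  have "cellular_iso q \<in> hom (Grp (cell_complex X) q) (Grp cellular q)"
    using cellular_iso_iso by (auto simp: iso_def)
  from hom_one[OF this] show ?thesis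
    using comm_group_cellular by (simp add: cell_complex_def comm_group_def)
qed

lemma frag_extend_cell_simplex_relcycle:
  assumes "Poly_Mapping.keys n \<subseteq> chain_cells X (int k)"
  shows "singular_relcycle k (subtopology R (K (int k))) (K (int k - 1)) (frag_extend cell_simplex n)"
  using assms homology_basis_relcycle[OF cell_simplex_basis[of k]]
  by (intro singular_relcycle_frag_extend) auto

lemma cellular_iso_Diff:
  assumes n: "n \<in> carrier (Grp (cell_complex X) q)"
  shows "Diff cellular q (cellular_iso q n) = cellular_iso (q - 1) (Diff (cell_complex X) q n)"
proof -
  have keys: "Poly_Mapping.keys n \<subseteq> chain_cells X q" using n by (simp add: cell_complex_def)
  consider k where "q = int (Suc k)" | "q = 0" | "q < 0"
    by (metis  int_cases less_eq_int_code(1) linorder_not_less not0_implies_Suc of_nat_0 negative_zless)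
  then show ?thesis
  proof cases
    case 1
    have keys': "Poly_Mapping.keys n \<subseteq> chain_cells X (int (Suc k))" using keys 1 by simp
    have c: "singular_relcycle (Suc k) (subtopology R (K (int (Suc k)))) (K (int k)) (frag_extend cell_simplex n)"
      using frag_extend_cell_simplex_relcycle[OF keys'] by simp
    have "Diff cellular q (cellular_iso q n) =
        homologous_rel_set k (subtopology R (K (int k))) (K (int k - 1)) (chain_boundary (Suc k) (frag_extend cell_simplex n))"
      using Diff_cellular(1)[OF c] by (simp add: 1 cellular_iso_def del: of_nat_Suc)
         (metis add_diff_cancel_left' diff_add_cancel nat_int of_nat_0_le_iff of_nat_Suc)
    also have "\<dots> = homologous_rel_set k (subtopology R (K (int k))) (K (int k - 1))
        (frag_extend cell_simplex (frag_extend (cell_boundary X) n))"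
    proof -
      have "chain_boundary (Suc k) (frag_extend cell_simplex n) = frag_extend (chain_boundary (Suc k) \<circ> cell_simplex) n"
        by (rule frag_extend_additive) (rule chain_boundary_diff)
      moreover have "homologous_rel k (subtopology R (K (int k))) (K (int k - 1))
          (frag_extend (chain_boundary (Suc k) \<circ> cell_simplex) n)
          (frag_extend (\<lambda>u. frag_extend cell_simplex (cell_boundary X u)) n)"
      proof (rule homologous_rel_frag_extend)
        fix u assume "u \<in> Poly_Mapping.keys n"
        then have "u \<in> chain_cells X (int (Suc k))" using keys' by blast
        from cell_boundary_homologous[OF this]
        show "homologous_rel k (subtopology R (K (int k))) (K (int k - 1))
           ((chain_boundary (Suc k) \<circ> cell_simplex) u) (frag_extend cell_simplex (cell_boundary X u))"
          by (simp only: o_apply)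
      qed
      ultimately show ?thesis
        by (simp only: homologous_rel_set_eq frag_extend_frag_extend)
    qed
    also have "\<dots> = cellular_iso (q - 1) (Diff (cell_complex X) q n)"
      by (simp add: 1 cellular_iso_def cell_complex_def)
    finally show ?thesis .
  next
    case 2
    have keys': "Poly_Mapping.keys n \<subseteq> chain_cells X (int 0)" using keys 2 by simp
    have K1: "K (- 1) = {}" by (rule skeleton_neg) simp
    have c: "singular_relcycle 0 (subtopology R (K 0)) {} (frag_extend cell_simplex n)"
      using frag_extend_cell_simplex_relcycle[OF keys'] K1 by simp
    have "hom_induced (int 0) (subtopology R (K 0)) {} point_space {} (\<lambda>_. undefined :: 'a prepoint set)
        (homologous_rel_set 0 (subtopology R (K 0)) {} (frag_extend cell_simplex n)) =
       homologous_rel_set 0 point_space {} (chain_map 0 (\<lambda>_. undefined) (frag_extend cell_simplex n))"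
      by (rule hom_induced_chain_map) (use c in \<open>auto simp: point_space_def\<close>)
    moreover have "chain_map 0 (\<lambda>_. undefined :: 'a prepoint set) (frag_extend cell_simplex n) =
       frag_extend (chain_map 0 (\<lambda>_. undefined) \<circ> cell_simplex) n"
      by (rule frag_extend_additive) (rule chain_map_diff)
    \<comment> \<open>Every 0-cell, the base point included, is mapped to the one simplex of the
      point; this is the augmentation.\<close>
    moreover have "frag_extend (chain_map 0 (\<lambda>_. undefined :: 'a prepoint set) \<circ> cell_simplex) n =
       frag_extend (\<lambda>u. frag_extend (\<lambda>_. frag_of (restrict (\<lambda>_. undefined) (standard_simplex 0))) (cell_boundary X u)) n"
    proof (rule frag_extend_eq)
      fix u assume "u \<in> Poly_Mapping.keys n"
      then have u: "cell_dim u = 0" using keys' by (auto simp: chain_cells_def)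
      then have "cell_boundary X u = frag_of None"
        by (cases u rule: cell_dim.cases) auto
      moreover have "simplex_map 0 (\<lambda>_. undefined :: 'a prepoint set) (restrict (cell_map u) (standard_simplex 0)) =
          restrict (\<lambda>_. undefined) (standard_simplex 0)"
        by (auto simp: simplex_map_def fun_eq_iff restrict_def)
      ultimately show "(chain_map 0 (\<lambda>_. undefined :: 'a prepoint set) \<circ> cell_simplex) u =
        frag_extend (\<lambda>_. frag_of (restrict (\<lambda>_. undefined) (standard_simplex 0))) (cell_boundary X u)"
        by (simp add: cell_simplex_def u)
    qed
    ultimately show ?thesis
      by (simp add: 2 cellular_iso_def cell_complex_def reduced_cellular_complex_def K1 frag_extend_frag_extend)
  next
    case 3
    then have "Diff cellular q (cellular_iso q n) = \<one>\<^bsub>Grp cellular (q - 1)\<^esub>"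
      by (simp add: reduced_cellular_complex_def)
    then show ?thesis using 3 cellular_iso_zero by (simp add: cell_complex_def)
  qed
qed

lemma cell_boundary_in:
  assumes "u \<in> chain_cells X q" "q \<ge> 0"
  shows "Poly_Mapping.keys (cell_boundary X u) \<subseteq> chain_cells X (q - 1)"
proof (cases "(X, u)" rule: cell_boundary.cases)
  case (1 X' k a)
  have "X' = X" using 1 by simp
  then have u: "u = Some (Suc k, a)" "a \<in> simplices X (Suc k)" "q = int k + 1"
    using assms 1 by (auto simp: chain_cells_def split: if_splits)
  have "Poly_Mapping.keys (case face X (Suc k) i a of Some b \<Rightarrow> frag_of (Some (k, b))
         | None \<Rightarrow> if k = 0 then frag_of None else 0) \<subseteq> chain_cells X (int k)" if "i \<le> Suc k" for i
    using face_simplex[OF that u(2)] None_cellI[OF u(2) that]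
    by (auto simp: chain_cells_def split: option.splits)
  then show ?thesis
    unfolding u(1) cell_boundary.simps u(3)
    by (intro order_trans[OF keys_sum] UN_least order_trans[OF keys_cmul]) auto
qed (use assms in \<open>auto simp: chain_cells_def\<close>)

text \<open>Each of the two faces of a 1-cell is a 0-cell or, where undefined, the base point; both
  have augmentation 1 and they carry opposite signs.\<close>

lemma cell_boundary_augment:
  assumes "u \<in> chain_cells X 1"
  shows "frag_extend (cell_boundary X) (cell_boundary X u) = 0"
proof -
  obtain a where u: "u = Some (Suc 0, a)" using assms
    by (auto simp: chain_cells_def cell_indices_def split: if_splits)
  have "frag_extend (cell_boundary X) (case face X (Suc 0) i a of Some b \<Rightarrow> frag_of (Some (0, b)) | None \<Rightarrow> frag_of None) =
     frag_of None" for i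
    by (auto split: option.splits)
  then show ?thesis unfolding u by (simp add: frag_extend_add frag_extend_cmul frag_extend_diff frag_extend_minus)
qed

text \<open>From degree 2 on, the square of the differential is transported from singular chains
  through the injective \<open>cellular_iso\<close>, which spares a sign computation with partial
  faces. Degree 1 involves the augmentation and is checked directly.\<close>

lemma is_chain_complex_cell_complex: "is_chain_complex (cell_complex X)"
  unfolding is_chain_complex_def
proof (intro allI conjI ballI)
  fix q
  let ?D = "Diff (cell_complex X)"
  have Dc: "?D q x \<in> carrier (Grp (cell_complex X) (q - 1))" if "x \<in> carrier (Grp (cell_complex X) q)" for x q
  proof (cases "q \<ge> 0")
    case True
    then show ?thesis
      using that cell_boundary_in[of _ q] order_trans[OF keys_frag_extend] 
      by (auto simp: cell_complex_def intro!: order_trans[OF keys_frag_extend] UN_least dest!: subsetD)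
  qed (simp add: cell_complex_def)
  show "comm_group (Grp (cell_complex X) q)"
    by (simp add: cell_complex_def abelian_free_Abelian_group)
  show "?D q \<in> hom (Grp (cell_complex X) q) (Grp (cell_complex X) (q - 1))"
    using Dc by (auto simp: hom_def cell_complex_def frag_extend_add)
  fix x assume x: "x \<in> carrier (Grp (cell_complex X) q)"
  have keys: "Poly_Mapping.keys x \<subseteq> chain_cells X q" using x by (simp add: cell_complex_def)
  consider "q \<le> 0" | "q = 1" | "q \<ge> 2" by linarith
  then have "?D (q - 1) (?D q x) = 0"
  proof cases
    case 2
    have "frag_extend (cell_boundary X) (frag_extend (cell_boundary X) x) = 0"
      unfolding frag_extend_frag_extend
    proof (rule frag_extend_eq_0)
      fix u assume "u \<in> Poly_Mapping.keys x"
      then have "u \<in> chain_cells X 1" using keys 2 by auto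
      then show "frag_extend (cell_boundary X) (cell_boundary X u) = 0" by (rule cell_boundary_augment)
    qed
    then show ?thesis by (simp add: cell_complex_def 2)
  next
    case 3
    define k where "k = nat q - 2"
    have q: "q = int (Suc (Suc k))" using 3 by (simp add: k_def)
    have c: "singular_relcycle (Suc (Suc k)) (subtopology R (K (int (Suc (Suc k))))) (K (int (Suc k))) (frag_extend cell_simplex x)"
      using frag_extend_cell_simplex_relcycle[of x "Suc (Suc k)"] keys by (simp add: q)
    note d = Diff_cellular[OF c]
    have d2: "singular_relcycle (Suc k) (subtopology R (K (int (Suc k)))) (K (int k)) (chain_boundary (Suc (Suc k)) (frag_extend cell_simplex x))"
      using d(2) by simp
    have z: "chain_boundary (Suc k) (chain_boundary (Suc (Suc k)) (frag_extend cell_simplex x)) = 0"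
      using c chain_boundary_boundary_alt unfolding singular_relcycle by blast
    have e: "cellular_iso q x = homologous_rel_set (Suc (Suc k)) (subtopology R (K (int (Suc (Suc k))))) (K (int (Suc k))) (frag_extend cell_simplex x)"
    proof -
      have "int (Suc (Suc k)) - 1 = int (Suc k)" by simp
      then show ?thesis by (simp only: cellular_iso_def q nat_int of_nat_0_le_iff if_True)
    qed
    have "cellular_iso (q - 1 - 1) (?D (q - 1) (?D q x)) = Diff cellular (q - 1) (Diff cellular q (cellular_iso q x))"
      using cellular_iso_Diff[OF x] cellular_iso_Diff[OF Dc[OF x]] by simp
    also have "\<dots> = Diff cellular (int (Suc k)) (Diff cellular (int (Suc (Suc k))) (cellular_iso q x))"
      by (simp add: q)
    also have "\<dots> = homologous_rel_set k (subtopology R (K (int k))) (K (int k - 1)) 0"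
      unfolding e d(1) using Diff_cellular(1)[OF d2] z by simp
    also have "\<dots> = cellular_iso (q - 1 - 1) 0"
      by (simp add: cellular_iso_def q)
    finally have eq: "cellular_iso (q - 1 - 1) (?D (q - 1) (?D q x)) = cellular_iso (q - 1 - 1) 0" .
    have inj: "inj_on (cellular_iso (q - 1 - 1)) (carrier (Grp (cell_complex X) (q - 1 - 1)))"
      using cellular_iso_iso[of "q - 1 - 1"] by (auto simp: iso_def bij_betw_def)
    show ?thesis
    proof (rule inj_onD [OF inj eq])
      show "?D (q - 1) (?D q x) \<in> carrier (Grp (cell_complex X) (q - 1 - 1))"
        by (intro Dc x)
    qed (simp add: cell_complex_def)
  qed (simp add: cell_complex_def)
  then show "?D (q - 1) (?D q x) = \<one>\<^bsub>Grp (cell_complex X) (q - 2)\<^esub>"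
    by (simp add: cell_complex_def)
qed

theorem cellular_complex_transfer:
  assumes "chain_homotopy_equivalent C (cell_complex X)"
  shows "chain_homotopy_equivalent C (reduced_cellular_complex (realization X) (skeleton X))"
  using assms comm_group_cellular cellular_iso_iso cellular_iso_Diff
  by (rule chain_homotopy_equivalent_transfer)

end

section \<open>Counting classes of generated equivalence relations\<close>

lemma generated_equiv_refl: "x \<in> S \<Longrightarrow> (x, x) \<in> generated_equiv R S"
  by (simp add: generated_equiv_def)

lemma generated_equiv_sym: "(x, y) \<in> generated_equiv R S \<Longrightarrow> (y, x) \<in> generated_equiv R S"
  using equiv_generated_equiv[of S R] by (meson equivE symE)

lemma generated_equiv_trans:
  "(x, y) \<in> generated_equiv R S \<Longrightarrow> (y, z) \<in> generated_equiv R S \<Longrightarrow> (x, z) \<in> generated_equiv R S"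
  using equiv_generated_equiv[of S R] by (meson equivE transE)

lemma generated_equiv_base: "x \<in> S \<Longrightarrow> y \<in> S \<Longrightarrow> R x y \<Longrightarrow> (x, y) \<in> generated_equiv R S"
  by (auto simp: generated_equiv_def intro!: r_into_equivclp)

lemma generated_equiv_in: "(x, y) \<in> generated_equiv R S \<Longrightarrow> x \<in> S \<and> y \<in> S"
  by (auto simp: generated_equiv_def)

text \<open>The universal property; inclusions of generated relations are proved below by exhibiting
  a suitable equivalence \<open>E\<close>.\<close>

lemma generated_equiv_least:
  assumes "equiv S E" "\<And>x y. x \<in> S \<Longrightarrow> y \<in> S \<Longrightarrow> R x y \<Longrightarrow> (x, y) \<in> E"
  shows "generated_equiv R S \<subseteq> E"
proof clarify
  fix x y assume *: "(x, y) \<in> generated_equiv R S"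
  then have "equivclp (\<lambda>u v. u \<in> S \<and> v \<in> S \<and> R u v) x y" "x \<in> S" by (auto simp: generated_equiv_def)
  then show "(x, y) \<in> E"
  proof (induction rule: equivclp_induct)
    case base
    then show ?case using assms(1) by (meson equivE refl_onD)
  next
    case (step y z)
    then show ?case using assms by (meson equivE symE transE)
  qed
qed

lemma generated_equiv_mono:
  assumes "\<And>x y. x \<in> S \<Longrightarrow> y \<in> S \<Longrightarrow> R x y \<Longrightarrow> (x, y) \<in> generated_equiv R' S"
  shows "generated_equiv R S \<subseteq> generated_equiv R' S"
  using assms by (intro generated_equiv_least equiv_generated_equiv) auto

lemma generated_equiv_eqI:
  assumes "\<And>x y. x \<in> S \<Longrightarrow> y \<in> S \<Longrightarrow> R x y \<Longrightarrow> (x, y) \<in> generated_equiv R' S"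
    and "\<And>x y. x \<in> S \<Longrightarrow> y \<in> S \<Longrightarrow> R' x y \<Longrightarrow> (x, y) \<in> generated_equiv R S"
  shows "generated_equiv R S = generated_equiv R' S"
  using generated_equiv_mono[OF assms(1)] generated_equiv_mono[OF assms(2)] by blast

lemma generated_equiv_class_eq_iff:
  assumes "x \<in> S" "y \<in> S"
  shows "generated_equiv R S `` {x} = generated_equiv R S `` {y} \<longleftrightarrow> (x, y) \<in> generated_equiv R S"
  using eq_equiv_class_iff[OF equiv_generated_equiv assms] .

abbreviation class_count :: "('a \<Rightarrow> 'a \<Rightarrow> bool) \<Rightarrow> 'a set \<Rightarrow> nat" where
  "class_count R S \<equiv> card (gen_classes R S)"

lemma finite_gen_classes: "finite S \<Longrightarrow> finite (gen_classes R S)"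
  unfolding gen_classes_def by (rule finite_quotient) (auto simp: generated_equiv_def)

definition joined :: "('a \<Rightarrow> 'a \<Rightarrow> bool) \<Rightarrow> 'a \<Rightarrow> 'a \<Rightarrow> 'a \<Rightarrow> 'a \<Rightarrow> bool" where
  "joined R a b = (\<lambda>x y. R x y \<or> x = a \<and> y = b)"

text \<open>A chain of relations never needs the new pair more than once, so the right-hand side is
  already transitive.\<close>

lemma generated_equiv_joined_iff:
  assumes ab: "a \<in> S" "b \<in> S"
  shows "(x, y) \<in> generated_equiv (joined R a b) S \<longleftrightarrow>
     (x, y) \<in> generated_equiv R S \<or>
     (x, a) \<in> generated_equiv R S \<and> (b, y) \<in> generated_equiv R S \<or>
     (x, b) \<in> generated_equiv R S \<and> (a, y) \<in> generated_equiv R S"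
    (is "_ \<longleftrightarrow> ?Q x y")
proof
  let ?E = "generated_equiv R S" and ?J = "generated_equiv (joined R a b) S"
  have sub: "?E \<subseteq> ?J"
    by (rule generated_equiv_mono) (auto simp: joined_def intro: generated_equiv_base)
  have abJ: "(a, b) \<in> ?J" using ab by (auto simp: joined_def intro: generated_equiv_base)
  assume "(x, y) \<in> ?J"
  moreover have "?J \<subseteq> {(x, y). ?Q x y}"
  proof (rule generated_equiv_least)
    show "equiv S {(x, y). ?Q x y}"
    proof (rule equivI)
      show "{(x, y). ?Q x y} \<subseteq> S \<times> S" using generated_equiv_in by fastforce
      show "refl_on S {(x, y). ?Q x y}" by (auto simp: refl_on_def generated_equiv_refl)
      show "sym {(x, y). ?Q x y}" unfolding sym_def by (blast intro: generated_equiv_sym)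
      show "trans {(x, y). ?Q x y}"
        unfolding trans_def by (blast intro: generated_equiv_sym generated_equiv_trans)
    qed
    show "(x, y) \<in> {(x, y). ?Q x y}" if "x \<in> S" "y \<in> S" "joined R a b x y" for x y
      using that by (auto simp: joined_def intro: generated_equiv_base generated_equiv_refl)
  qed
  ultimately show "?Q x y" by blast
next
  let ?E = "generated_equiv R S" and ?J = "generated_equiv (joined R a b) S"
  have sub: "?E \<subseteq> ?J"
    by (rule generated_equiv_mono) (auto simp: joined_def intro: generated_equiv_base)
  have abJ: "(a, b) \<in> ?J" using ab by (auto simp: joined_def intro: generated_equiv_base)
  assume "?Q x y"
  then show "(x, y) \<in> ?J"
    using sub abJ generated_equiv_sym[OF abJ] by (meson generated_equiv_trans subsetD)
qed

lemma gen_classes_joined: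
  assumes ab: "a \<in> S" "b \<in> S" and n: "(a, b) \<notin> generated_equiv R S"
  shows "gen_classes (joined R a b) S =
     insert (generated_equiv R S `` {a} \<union> generated_equiv R S `` {b})
       (gen_classes R S - {generated_equiv R S `` {a}, generated_equiv R S `` {b}})"
proof -
  let ?E = "generated_equiv R S" and ?J = "generated_equiv (joined R a b) S"
  have c1: "?J `` {x} = ?E `` {a} \<union> ?E `` {b}" if "(x, a) \<in> ?E \<or> (x, b) \<in> ?E" for x
    using that unfolding Image_def
    by (auto simp: generated_equiv_joined_iff[OF ab] intro: generated_equiv_sym generated_equiv_trans)
  have c2: "?J `` {x} = ?E `` {x}" if "(x, a) \<notin> ?E" "(x, b) \<notin> ?E" for x
    using that by (auto simp: generated_equiv_joined_iff[OF ab])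
  have iff: "?E `` {x} = ?E `` {c} \<longleftrightarrow> (x, c) \<in> ?E" if "x \<in> S" "c \<in> S" for x c
    by (rule generated_equiv_class_eq_iff [OF that])
  show ?thesis
  proof (intro subset_antisym subsetI)
    fix C assume "C \<in> gen_classes (joined R a b) S"
    then obtain x where x: "x \<in> S" "C = ?J `` {x}" by (auto simp: gen_classes_def quotient_def)
    show "C \<in> insert (?E `` {a} \<union> ?E `` {b}) (gen_classes R S - {?E `` {a}, ?E `` {b}})"
    proof (cases "(x, a) \<in> ?E \<or> (x, b) \<in> ?E")
      case False
      then have "C = ?E `` {x}" "?E `` {x} \<noteq> ?E `` {a}" "?E `` {x} \<noteq> ?E `` {b}"
        using x c2 iff[OF x(1) ab(1)] iff[OF x(1) ab(2)] by auto
      then show ?thesis using x(1) by (auto simp: gen_classes_def intro: quotientI)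
    qed (use c1 x in auto)
  next
    fix C assume C: "C \<in> insert (?E `` {a} \<union> ?E `` {b}) (gen_classes R S - {?E `` {a}, ?E `` {b}})"
    show "C \<in> gen_classes (joined R a b) S"
    proof (cases "C = ?E `` {a} \<union> ?E `` {b}")
      case True
      then have "C = ?J `` {a}" using c1[of a] ab generated_equiv_refl by metis
      then show ?thesis using ab by (auto simp: gen_classes_def intro: quotientI)
    next
      case False
      then obtain x where x: "x \<in> S" "C = ?E `` {x}" "?E `` {x} \<noteq> ?E `` {a}" "?E `` {x} \<noteq> ?E `` {b}"
        using C by (auto simp: gen_classes_def quotient_def)
      then have "C = ?J `` {x}" using c2[of x] iff ab by auto
      then show ?thesis using x(1) by (auto simp: gen_classes_def intro: quotientI)
    qed
  qed
qed

lemma class_count_joined: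
  assumes fin: "finite S" and ab: "a \<in> S" "b \<in> S"
  shows "class_count R S = class_count (joined R a b) S + (if (a, b) \<in> generated_equiv R S then 0 else 1)"
proof (cases "(a, b) \<in> generated_equiv R S")
  case True
  have "generated_equiv (joined R a b) S = generated_equiv R S"
    using True by (intro generated_equiv_eqI) (auto simp: joined_def intro: generated_equiv_base)
  then show ?thesis using True by (simp add: gen_classes_def)
next
  case False
  let ?E = "generated_equiv R S"
  have A: "?E `` {a} \<in> gen_classes R S" "?E `` {b} \<in> gen_classes R S"
    using ab by (auto simp: gen_classes_def intro: quotientI)
  have ne: "?E `` {a} \<noteq> ?E `` {b}" using False generated_equiv_class_eq_iff[OF ab] by blast
  have "?E `` {a} \<union> ?E `` {b} \<notin> gen_classes R S"
  proof
    assume "?E `` {a} \<union> ?E `` {b} \<in> gen_classes R S"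
    then obtain x where "?E `` {a} \<union> ?E `` {b} = ?E `` {x}" by (auto simp: gen_classes_def quotient_def)
    moreover have "a \<in> ?E `` {a}" "b \<in> ?E `` {b}" using ab by (simp_all add: generated_equiv_refl)
    ultimately have "(x, a) \<in> ?E" "(x, b) \<in> ?E" by blast+
    then show False using False generated_equiv_sym generated_equiv_trans by metis
  qed
  then have "card (gen_classes (joined R a b) S) = Suc (card (gen_classes R S - {?E `` {a}, ?E `` {b}}))"
    unfolding gen_classes_joined[OF ab False] using finite_gen_classes[OF fin] by simp
  also have "card (gen_classes R S - {?E `` {a}, ?E `` {b}}) = card (gen_classes R S) - 2"
    using A ne by (subst card_Diff_subset) auto
  finally have "class_count (joined R a b) S = Suc (class_count R S - 2)" .
  moreover have "2 \<le> class_count R S"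
    using card_mono[OF finite_gen_classes[OF fin], of "{?E `` {a}, ?E `` {b}}" R] A ne by auto
  ultimately show ?thesis using False by simp
qed

lemma card_quotient_image:
  assumes E: "equiv S E" and E': "equiv T E'" and h: "h ` S = T"
    and iff: "\<And>x y. x \<in> S \<Longrightarrow> y \<in> S \<Longrightarrow> (x, y) \<in> E \<longleftrightarrow> (h x, h y) \<in> E'"
  shows "card (S // E) = card (T // E')"
proof -
  have im: "h ` (E `` {x}) = E' `` {h x}" if x: "x \<in> S" for x
  proof (intro subset_antisym subsetI)
    fix z assume "z \<in> E' `` {h x}"
    then have "(h x, z) \<in> E'" "z \<in> T" using E' by (auto dest: equiv_type[THEN subsetD])
    then obtain y where "y \<in> S" "z = h y" using h by blast
    then show "z \<in> h ` (E `` {x})" using iff[OF x, of y] \<open>(h x, z) \<in> E'\<close> by blast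
  next
    fix z assume "z \<in> h ` (E `` {x})"
    then obtain y where "(x, y) \<in> E" "z = h y" by blast
    moreover then have "y \<in> S" using E by (auto dest: equiv_type[THEN subsetD])
    ultimately show "z \<in> E' `` {h x}" using iff[OF x] by blast
  qed
  have "bij_betw ((`) h) (S // E) (T // E')"
    unfolding bij_betw_def
  proof
    show "inj_on ((`) h) (S // E)"
    proof (rule inj_onI)
      fix C D assume "C \<in> S // E" "D \<in> S // E" and eq: "h ` C = h ` D"
      then obtain x y where xy: "x \<in> S" "C = E `` {x}" "y \<in> S" "D = E `` {y}" by (auto simp: quotient_def)
      then have "E' `` {h x} = E' `` {h y}" using eq im by simp
      moreover have "h x \<in> T" "h y \<in> T" using xy h by auto
      ultimately have "(h x, h y) \<in> E'" using eq_equiv_class_iff[OF E'] by blast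
      then have "(x, y) \<in> E" using iff xy by blast
      then show "C = D" using xy equiv_class_eq[OF E] by blast
    qed
    show "(`) h ` (S // E) = T // E'"
    proof (intro subset_antisym subsetI)
      fix C assume "C \<in> (`) h ` (S // E)"
      then obtain x where "x \<in> S" "C = E' `` {h x}" using im by (auto simp: quotient_def)
      then show "C \<in> T // E'" using h by (auto intro: quotientI)
    next
      fix C assume "C \<in> T // E'"
      then obtain x where "x \<in> S" "C = E' `` {h x}" using h by (auto simp: quotient_def)
      then show "C \<in> (`) h ` (S // E)" using im by (auto simp: quotient_def)
    qed
  qed
  then show ?thesis by (rule bij_betw_same_card)
qed

section \<open>Orbits of permutations\<close>

abbreviation exchange :: "'a \<Rightarrow> 'a \<Rightarrow> 'a \<Rightarrow> 'a" where
  "exchange \<equiv> Transposition.transpose"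

abbreviation graph_of :: "('a \<Rightarrow> 'a) \<Rightarrow> 'a \<Rightarrow> 'a \<Rightarrow> bool" where
  "graph_of \<pi> \<equiv> \<lambda>x y. y = \<pi> x"

lemma funpow_in:
  assumes "bij_betw \<pi> S S" "x \<in> S"
  shows "(\<pi> ^^ n) x \<in> S"
  using assms by (induction n) (auto simp: bij_betw_def)

lemma funpow_cancel:
  assumes bij: "bij_betw \<pi> S S"
  shows "(\<pi> ^^ k) y = (\<pi> ^^ k) z \<Longrightarrow> y \<in> S \<Longrightarrow> z \<in> S \<Longrightarrow> y = z"
proof (induction k)
  case (Suc k)
  then have "\<pi> ((\<pi> ^^ k) y) = \<pi> ((\<pi> ^^ k) z)" by simp
  then have "(\<pi> ^^ k) y = (\<pi> ^^ k) z"
    using bij funpow_in[OF bij] Suc.prems by (auto simp: bij_betw_def inj_on_def)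
  then show ?case using Suc by blast
qed simp

lemma funpow_returns:
  assumes fin: "finite S" and bij: "bij_betw \<pi> S S" and x: "x \<in> S"
  obtains n where "n > 0" "(\<pi> ^^ n) x = x"
proof -
  have "\<not> inj_on (\<lambda>n. (\<pi> ^^ n) x) UNIV"
  proof
    assume "inj_on (\<lambda>n. (\<pi> ^^ n) x) UNIV"
    moreover have "range (\<lambda>n. (\<pi> ^^ n) x) \<subseteq> S" using funpow_in[OF bij x] by auto
    ultimately show False using fin finite_imageD finite_subset infinite_UNIV_nat by metis
  qed
  then obtain m n where mn: "m < n" "(\<pi> ^^ m) x = (\<pi> ^^ n) x"
    unfolding inj_on_def by (metis UNIV_I linorder_neqE_nat)
  have "(\<pi> ^^ m) ((\<pi> ^^ (n - m)) x) = (\<pi> ^^ m) x"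
    using mn by (metis add_diff_inverse_nat funpow_add less_imp_not_less o_apply)
  then have "(\<pi> ^^ (n - m)) x = x" using funpow_in[OF bij x] x by (rule funpow_cancel [OF bij])
  then show thesis using that mn(1) by (metis zero_less_diff)
qed

text \<open>Forward iterates suffice because on a finite set some positive power returns to the
  start.\<close>

lemma same_orbit_iff:
  assumes fin: "finite S" and bij: "bij_betw \<pi> S S" and x: "x \<in> S"
  shows "(x, y) \<in> generated_equiv (graph_of \<pi>) S \<longleftrightarrow> (\<exists>n. y = (\<pi> ^^ n) x)"
proof
  let ?Q = "{(x, y). x \<in> S \<and> (\<exists>n. y = (\<pi> ^^ n) x)}"
  assume "(x, y) \<in> generated_equiv (graph_of \<pi>) S"
  moreover have "generated_equiv (graph_of \<pi>) S \<subseteq> ?Q"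
  proof (rule generated_equiv_least)
    show "equiv S ?Q"
    proof (rule equivI)
      show "?Q \<subseteq> S \<times> S" using funpow_in[OF bij] by auto
      show "refl_on S ?Q" unfolding refl_on_def by (auto intro: exI[of _ 0])
      show "trans ?Q" unfolding trans_def by clarsimp (metis funpow_add o_apply)
      show "sym ?Q" unfolding sym_def
      proof clarsimp
        fix x n assume x: "x \<in> S"
        obtain m where m: "m > 0" "(\<pi> ^^ m) x = x" by (rule funpow_returns[OF fin bij x])
        have rep: "(\<pi> ^^ (m * k)) x = x" for k
          by (induction k) (simp_all add: funpow_add m(2))
        \<comment> \<open>\<open>m * n\<close> steps return to \<open>x\<close>, so the remaining
          \<open>m * n - n\<close> steps undo the first \<open>n\<close>.\<close>
        have "(\<pi> ^^ (m * n - n)) ((\<pi> ^^ n) x) = (\<pi> ^^ (m * n)) x"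
          using m(1) by (metis diff_add funpow_add mult.commute mult_le_mono2 nat_mult_1_right o_apply Suc_leI One_nat_def)
        then show "(\<pi> ^^ n) x \<in> S \<and> (\<exists>na. x = (\<pi> ^^ na) ((\<pi> ^^ n) x))"
          using rep funpow_in[OF bij x] by metis
      qed
    qed
    show "(x, y) \<in> ?Q" if "x \<in> S" "y \<in> S" "y = \<pi> x" for x y
      using that by (auto intro: exI[of _ 1])
  qed
  ultimately show "\<exists>n. y = (\<pi> ^^ n) x" by blast
next
  assume "\<exists>n. y = (\<pi> ^^ n) x"
  then obtain n where n: "y = (\<pi> ^^ n) x" by blast
  have "(x, (\<pi> ^^ n) x) \<in> generated_equiv (graph_of \<pi>) S"
  proof (induction n)
    case (Suc n)
    have "((\<pi> ^^ n) x, (\<pi> ^^ Suc n) x) \<in> generated_equiv (graph_of \<pi>) S"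
      using funpow_in[OF bij x, of n] funpow_in[OF bij x, of "Suc n"] by (intro generated_equiv_base) auto
    then show ?case using Suc generated_equiv_trans by metis
  qed (use x in \<open>simp add: generated_equiv_refl\<close>)
  then show "(x, y) \<in> generated_equiv (graph_of \<pi>) S" using n by simp
qed

lemma bij_betw_transpose_comp:
  assumes "bij_betw \<pi> S S" "a \<in> S" "b \<in> S"
  shows "bij_betw (exchange a b \<circ> \<pi>) S S"
proof -
  have "exchange a b ` S = S" using assms(2,3) by (auto simp: Transposition.transpose_def image_iff split: if_splits)
  then have "bij_betw (exchange a b) S S" by (simp add: bij_betw_def inj_on_transpose)
  then show ?thesis using assms(1) bij_betw_trans by blast
qed

text \<open>The first arrival at \<open>b\<close>; a return to \<open>a\<close> before that would
  give an earlier arrival. With \<open>b = a\<close> it is the first return.\<close>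

lemma first_hit:
  assumes fin: "finite S" and bij: "bij_betw \<pi> S S" and a: "a \<in> S" and b: "b = a \<or> (a, b) \<in> generated_equiv (graph_of \<pi>) S"
  obtains n where "n > 0" "(\<pi> ^^ n) a = b"
    "\<forall>j. 0 < j \<and> j < n \<longrightarrow> (\<pi> ^^ j) a \<noteq> b \<and> (\<pi> ^^ j) a \<noteq> a"
proof -
  have ex: "\<exists>n. n > 0 \<and> (\<pi> ^^ n) a = b"
  proof (cases "b = a")
    case True
    then show ?thesis using funpow_returns[OF fin bij a] by metis
  next
    case False
    then obtain n where n: "b = (\<pi> ^^ n) a" using b same_orbit_iff[OF fin bij a] by blast
    then have "n \<noteq> 0" using False by (intro notI) simp
    then show ?thesis using n by blast
  qed
  define n where "n = (LEAST n. n > 0 \<and> (\<pi> ^^ n) a = b)"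
  have n: "n > 0" "(\<pi> ^^ n) a = b" using LeastI_ex[OF ex] by (auto simp: n_def)
  have least: "(\<pi> ^^ j) a \<noteq> b" if "0 < j" "j < n" for j
    using not_less_Least[of j "\<lambda>n. n > 0 \<and> (\<pi> ^^ n) a = b"] that by (auto simp: n_def)
  have "(\<pi> ^^ j) a \<noteq> a" if j: "0 < j" "j < n" for j
  proof
    assume *: "(\<pi> ^^ j) a = a"
    have "(\<pi> ^^ (n - j)) ((\<pi> ^^ j) a) = b"
      using j n by (metis add.commute add_diff_inverse_nat funpow_add less_imp_not_less o_apply)
    then show False using least[of "n - j"] * j by simp
  qed
  then show thesis using that n least by blast
qed

lemma funpow_agree:
  assumes "\<And>j. j < n \<Longrightarrow> \<pi>' ((\<pi> ^^ j) a) = \<pi> ((\<pi> ^^ j) a)"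
  shows "(\<pi>' ^^ n) a = (\<pi> ^^ n) a"
  using assms by (induction n) auto

text \<open>The classical fact that multiplying by a transposition splits or merges cycles. Both
  permutations agree along the orbit of \<open>a\<close> until the first arrival at \<open>b\<close>
  or the first return to \<open>a\<close>; there the transposition redirects the walk to the other
  point.\<close>

lemma same_orbit_transpose_iff:
  assumes fin: "finite S" and bij: "bij_betw \<pi> S S" and ab: "a \<in> S" "b \<in> S" "a \<noteq> b"
  shows "(a, b) \<in> generated_equiv (graph_of (exchange a b \<circ> \<pi>)) S \<longleftrightarrow> (a, b) \<notin> generated_equiv (graph_of \<pi>) S"
proof -
  let ?\<pi>' = "exchange a b \<circ> \<pi>"
  have bij': "bij_betw ?\<pi>' S S" using bij_betw_transpose_comp[OF bij] ab by blast
  show ?thesis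
  proof (cases "(a, b) \<in> generated_equiv (graph_of \<pi>) S")
    case True
    obtain n where n: "n > 0" "(\<pi> ^^ n) a = b"
       "\<forall>j. 0 < j \<and> j < n \<longrightarrow> (\<pi> ^^ j) a \<noteq> b \<and> (\<pi> ^^ j) a \<noteq> a"
      by (rule first_hit [OF fin bij ab(1) disjI2 [OF True]])
    have agree: "(?\<pi>' ^^ j) a = (\<pi> ^^ j) a" if "j < n" for j
    proof (rule funpow_agree)
      fix i assume "i < j"
      then have "(\<pi> ^^ Suc i) a \<noteq> a" "(\<pi> ^^ Suc i) a \<noteq> b" using spec[OF n(3), of "Suc i"] that by auto
      then show "?\<pi>' ((\<pi> ^^ i) a) = \<pi> ((\<pi> ^^ i) a)" by (simp add: Transposition.transpose_def)
    qed
    obtain m where m: "n = Suc m" using n(1) gr0_implies_Suc by blast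
    have ret: "(?\<pi>' ^^ n) a = a" using agree[of m] n(2) m by (simp add: Transposition.transpose_def)
    have "(?\<pi>' ^^ k) a \<noteq> b" for k
    proof -
      have per: "(?\<pi>' ^^ (n * i)) a = a" for i
      proof (induction i)
        case (Suc i)
        have "(?\<pi>' ^^ (n * Suc i)) a = (?\<pi>' ^^ n) ((?\<pi>' ^^ (n * i)) a)"
          by (simp only: mult_Suc_right funpow_add o_apply)
        then show ?case by (simp only: Suc ret)
      qed simp
      have "(?\<pi>' ^^ k) a = (?\<pi>' ^^ (k mod n)) ((?\<pi>' ^^ (n * (k div n))) a)"
        by (metis add.commute funpow_add mod_mult_div_eq o_apply)
      also have "\<dots> = (\<pi> ^^ (k mod n)) a" using per agree n(1) by simp
      also have "\<dots> \<noteq> b" using spec[OF n(3), of "k mod n"] n(1) ab(3) by (cases "k mod n = 0") auto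
      finally show ?thesis .
    qed
    then show ?thesis using True same_orbit_iff[OF fin bij' ab(1)] by metis
  next
    case False
    obtain n where n: "n > 0" "(\<pi> ^^ n) a = a"
      "\<forall>j. 0 < j \<and> j < n \<longrightarrow> (\<pi> ^^ j) a \<noteq> a \<and> (\<pi> ^^ j) a \<noteq> a"
      by (rule first_hit [OF fin bij ab(1) disjI1 [OF refl]])
    have nb: "(\<pi> ^^ j) a \<noteq> b" for j using False same_orbit_iff[OF fin bij ab(1)] by metis
    have agree: "(?\<pi>' ^^ j) a = (\<pi> ^^ j) a" if "j < n" for j
    proof (rule funpow_agree)
      fix i assume "i < j"
      then have "(\<pi> ^^ Suc i) a \<noteq> a" "(\<pi> ^^ Suc i) a \<noteq> b" using spec[OF n(3), of "Suc i"] nb[of "Suc i"] that by auto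
      then show "?\<pi>' ((\<pi> ^^ i) a) = \<pi> ((\<pi> ^^ i) a)" by (simp add: Transposition.transpose_def)
    qed
    obtain m where m: "n = Suc m" using n(1) gr0_implies_Suc by blast
    have "(?\<pi>' ^^ n) a = b" using agree[of m] n(2) m by (simp add: Transposition.transpose_def)
    then show ?thesis using False same_orbit_iff[OF fin bij' ab(1)] by metis
  qed
qed

text \<open>Once \<open>a\<close> and \<open>b\<close> are identified, exchanging them is invisible.
  The extra relation \<open>Q\<close> later holds the arcs.\<close>

lemma generated_equiv_joined_transpose:
  assumes bij: "bij_betw \<pi> S S" and ab: "a \<in> S" "b \<in> S"
  shows "generated_equiv (joined (\<lambda>x y. y = (exchange a b \<circ> \<pi>) x \<or> Q x y) a b) S =
         generated_equiv (joined (\<lambda>x y. y = \<pi> x \<or> Q x y) a b) S"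
proof (rule generated_equiv_eqI)
  let ?J' = "generated_equiv (joined (\<lambda>x y. y = (exchange a b \<circ> \<pi>) x \<or> Q x y) a b) S"
  let ?J = "generated_equiv (joined (\<lambda>x y. y = \<pi> x \<or> Q x y) a b) S"
  have abJ: "(a, b) \<in> ?J" "(a, b) \<in> ?J'" using ab by (auto simp: joined_def intro: generated_equiv_base)
  have t: "(z, exchange a b z) \<in> ?J" "(z, exchange a b z) \<in> ?J'" if "z \<in> S" for z
    using abJ that generated_equiv_sym generated_equiv_refl by (auto simp: Transposition.transpose_def)
  have s: "\<pi> x \<in> S" "exchange a b (\<pi> x) \<in> S" if "x \<in> S" for x
    using bij that ab by (auto simp: bij_betw_def Transposition.transpose_def)
  fix x y assume xy: "x \<in> S" "y \<in> S"
  show "(x, y) \<in> ?J" if j: "joined (\<lambda>x y. y = (exchange a b \<circ> \<pi>) x \<or> Q x y) a b x y"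
  proof (cases "y = (exchange a b \<circ> \<pi>) x")
    case True
    have "(x, \<pi> x) \<in> ?J" using s[OF xy(1)] xy(1) by (auto simp: joined_def intro: generated_equiv_base)
    from generated_equiv_trans[OF this t(1)[OF s(1)[OF xy(1)]]] show ?thesis using True by simp
  next
    case False
    then show ?thesis using j xy by (auto simp: joined_def intro: generated_equiv_base)
  qed
  show "(x, y) \<in> ?J'" if j: "joined (\<lambda>x y. y = \<pi> x \<or> Q x y) a b x y"
  proof (cases "y = \<pi> x")
    case True
    have "(x, exchange a b (\<pi> x)) \<in> ?J'" using s[OF xy(1)] xy(1) by (auto simp: joined_def intro: generated_equiv_base)
    from generated_equiv_trans[OF this generated_equiv_sym[OF t(2)[OF s(1)[OF xy(1)]]]]
    show ?thesis using True by simp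
  next
    case False
    then show ?thesis using j xy by (auto simp: joined_def intro: generated_equiv_base)
  qed
qed

text \<open>Both permutations give the same classes after \<open>a\<close> and \<open>b\<close> are
  joined, and joining costs a class for exactly one of the two.\<close>

lemma orbit_count_transpose:
  assumes fin: "finite S" and bij: "bij_betw \<pi> S S" and ab: "a \<in> S" "b \<in> S" "a \<noteq> b"
  shows "int (class_count (graph_of (exchange a b \<circ> \<pi>)) S) =
         int (class_count (graph_of \<pi>) S) + (if (a, b) \<in> generated_equiv (graph_of \<pi>) S then 1 else - 1)"
proof -
  have "generated_equiv (joined (graph_of (exchange a b \<circ> \<pi>)) a b) S = generated_equiv (joined (graph_of \<pi>) a b) S"
    using generated_equiv_joined_transpose[OF bij ab(1,2), of "\<lambda>_ _. False"] by simp
  then have "class_count (joined (graph_of (exchange a b \<circ> \<pi>)) a b) S = class_count (joined (graph_of \<pi>) a b) S"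
    by (simp add: gen_classes_def)
  then show ?thesis
    using class_count_joined[OF fin ab(1,2), of "graph_of (exchange a b \<circ> \<pi>)"]
      class_count_joined[OF fin ab(1,2), of "graph_of \<pi>"] same_orbit_transpose_iff[OF fin bij ab]
    by auto
qed

section \<open>The Euler characteristic of a pair of permutations\<close>

text \<open>For a combinatorial map with vertex rotation \<open>\<rho>\<close> and edge involution \<open>\<alpha>\<close> this is
  \<open>V + F\<close> minus twice the number of components, which is at most the number of edges, with
  equality exactly for planar maps. Splitting a vertex does not decrease it.\<close>

definition euler_count :: "'a set \<Rightarrow> ('a \<Rightarrow> 'a) \<Rightarrow> ('a \<Rightarrow> 'a) \<Rightarrow> int" where
  "euler_count S \<alpha> \<rho> = int (class_count (graph_of \<rho>) S) + int (class_count (graph_of (\<rho> \<circ> \<alpha>)) S)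
     - 2 * int (class_count (\<lambda>x y. y = \<rho> x \<or> y = \<alpha> x) S)"

locale arc_involution =
  fixes S :: "'a set" and \<alpha> :: "'a \<Rightarrow> 'a"
  assumes fin: "finite S"
    and \<alpha>_in: "\<And>x. x \<in> S \<Longrightarrow> \<alpha> x \<in> S"
    and \<alpha>_ne: "\<And>x. x \<in> S \<Longrightarrow> \<alpha> x \<noteq> x"
    and \<alpha>_\<alpha>: "\<And>x. x \<in> S \<Longrightarrow> \<alpha> (\<alpha> x) = x"
begin

lemma bij_\<alpha>: "bij_betw \<alpha> S S"
  by (rule bij_betw_byWitness[where f' = \<alpha>]) (auto simp: \<alpha>_in \<alpha>_\<alpha>)

lemma bij_comp_\<alpha>: "bij_betw \<rho> S S \<Longrightarrow> bij_betw (\<rho> \<circ> \<alpha>) S S"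
  using bij_\<alpha> bij_betw_trans by blast

abbreviation "linked \<rho> \<equiv> generated_equiv (\<lambda>x y. y = \<rho> x \<or> y = \<alpha> x) S"

lemma orbit_subset_linked:
  assumes "bij_betw \<rho> S S"
  shows "generated_equiv (graph_of \<rho>) S \<subseteq> linked \<rho>" "generated_equiv (graph_of (\<rho> \<circ> \<alpha>)) S \<subseteq> linked \<rho>"
proof -
  show "generated_equiv (graph_of \<rho>) S \<subseteq> linked \<rho>"
    by (rule generated_equiv_mono) (auto intro: generated_equiv_base)
  show "generated_equiv (graph_of (\<rho> \<circ> \<alpha>)) S \<subseteq> linked \<rho>"
  proof (rule generated_equiv_mono)
    fix x y assume xy: "x \<in> S" "y \<in> S" "y = (\<rho> \<circ> \<alpha>) x"
    have "(x, \<alpha> x) \<in> linked \<rho>" "(\<alpha> x, y) \<in> linked \<rho>"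
      using xy \<alpha>_in by (auto intro!: generated_equiv_base)
    then show "(x, y) \<in> linked \<rho>" by (rule generated_equiv_trans)
  qed
qed

lemma component_count_split:
  assumes bij: "bij_betw \<rho> S S" and ab: "a \<in> S" "b \<in> S"
    and same: "(a, b) \<in> generated_equiv (graph_of \<rho>) S"
  shows "class_count (\<lambda>x y. y = (exchange a b \<circ> \<rho>) x \<or> y = \<alpha> x) S =
     class_count (\<lambda>x y. y = \<rho> x \<or> y = \<alpha> x) S + (if (a, b) \<in> linked (exchange a b \<circ> \<rho>) then 0 else 1)"
proof -
  have "(a, b) \<in> linked \<rho>" using same orbit_subset_linked(1)[OF bij] by blast
  then have "class_count (\<lambda>x y. y = \<rho> x \<or> y = \<alpha> x) S = class_count (joined (\<lambda>x y. y = \<rho> x \<or> y = \<alpha> x) a b) S"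
    using class_count_joined[OF fin ab, of "\<lambda>x y. y = \<rho> x \<or> y = \<alpha> x"] by simp
  also have "\<dots> = class_count (joined (\<lambda>x y. y = (exchange a b \<circ> \<rho>) x \<or> y = \<alpha> x) a b) S"
    using generated_equiv_joined_transpose[OF bij ab] by (simp add: gen_classes_def)
  finally show ?thesis
    using class_count_joined[OF fin ab, of "\<lambda>x y. y = (exchange a b \<circ> \<rho>) x \<or> y = \<alpha> x"] by simp
qed

text \<open>The number of vertices grows by one and the number of faces changes by one. If the
  component falls apart, \<open>a\<close> and \<open>b\<close> end up on different faces, so the
  faces grew, and the total change is \<open>1 + 1 - 2\<close>; otherwise it is 0 or 2. If the faces
  grow and the count does not, the component must therefore fall apart.\<close>

lemma euler_count_split:
  assumes bij: "bij_betw \<rho> S S" and ab: "a \<in> S" "b \<in> S" "a \<noteq> b"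
    and same: "(a, b) \<in> generated_equiv (graph_of \<rho>) S"
  shows "euler_count S \<alpha> \<rho> \<le> euler_count S \<alpha> (exchange a b \<circ> \<rho>)"
    and "euler_count S \<alpha> (exchange a b \<circ> \<rho>) \<le> euler_count S \<alpha> \<rho> \<Longrightarrow>
         (a, b) \<in> generated_equiv (graph_of (\<rho> \<circ> \<alpha>)) S \<Longrightarrow> (a, b) \<notin> linked (exchange a b \<circ> \<rho>)"
proof -
  let ?\<rho>' = "exchange a b \<circ> \<rho>"
  have bij': "bij_betw ?\<rho>' S S" using bij_betw_transpose_comp[OF bij] ab by blast
  have F: "int (class_count (graph_of (?\<rho>' \<circ> \<alpha>)) S) =
         int (class_count (graph_of (\<rho> \<circ> \<alpha>)) S) + (if (a, b) \<in> generated_equiv (graph_of (\<rho> \<circ> \<alpha>)) S then 1 else - 1)"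
    using orbit_count_transpose[OF fin bij_comp_\<alpha>[OF bij] ab] by (simp add: o_assoc)
  have V: "int (class_count (graph_of ?\<rho>') S) = int (class_count (graph_of \<rho>) S) + 1"
    using orbit_count_transpose[OF fin bij ab] same by simp
  have f: "(a, b) \<in> generated_equiv (graph_of (\<rho> \<circ> \<alpha>)) S" if "(a, b) \<notin> linked ?\<rho>'"
  proof -
    have "(a, b) \<notin> generated_equiv (graph_of (?\<rho>' \<circ> \<alpha>)) S"
      using that orbit_subset_linked(2)[OF bij'] by blast
    then show ?thesis
      using same_orbit_transpose_iff[OF fin bij_comp_\<alpha>[OF bij] ab] by (simp add: o_assoc)
  qed
  show "euler_count S \<alpha> \<rho> \<le> euler_count S \<alpha> ?\<rho>'"
    unfolding euler_count_def V F component_count_split[OF bij ab(1,2) same] using f by auto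
  show "(a, b) \<notin> linked ?\<rho>'"
    if "euler_count S \<alpha> ?\<rho>' \<le> euler_count S \<alpha> \<rho>" "(a, b) \<in> generated_equiv (graph_of (\<rho> \<circ> \<alpha>)) S"
    using that unfolding euler_count_def V F component_count_split[OF bij ab(1,2) same] by (auto split: if_splits)
qed

text \<open>Splitting a dart \<open>a\<close> from its successor turns it into a fixed point and
  creates no moved point, so repeated splitting ends at the identity.\<close>

lemma euler_count_le_id:
  assumes "bij_betw \<rho> S S"
  shows "euler_count S \<alpha> \<rho> \<le> euler_count S \<alpha> id"
  using assms
proof (induction "card {x \<in> S. \<rho> x \<noteq> x}" arbitrary: \<rho> rule: less_induct)
  case less
  show ?case
  proof (cases "\<exists>a\<in>S. \<rho> a \<noteq> a")
    case False
    then have g: "generated_equiv (\<lambda>x y. y = \<rho> x \<or> Q x y) S = generated_equiv (\<lambda>x y. y = id x \<or> Q x y) S" for Q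
      by (intro generated_equiv_eqI) (auto intro: generated_equiv_base)
    have "generated_equiv (graph_of (\<rho> \<circ> \<alpha>)) S = generated_equiv (graph_of (id \<circ> \<alpha>)) S"
      using False \<alpha>_in by (intro generated_equiv_eqI) (auto intro!: generated_equiv_base)
    then show ?thesis
      using g[of "\<lambda>_ _. False"] g[of "graph_of \<alpha>"] by (simp add: euler_count_def gen_classes_def)
  next
    case True
    then obtain a where a: "a \<in> S" "\<rho> a \<noteq> a" by blast
    let ?b = "\<rho> a" and ?\<rho>' = "exchange a (\<rho> a) \<circ> \<rho>"
    have b: "?b \<in> S" using less.prems a by (auto simp: bij_betw_def)
    have same: "(a, ?b) \<in> generated_equiv (graph_of \<rho>) S" using a b by (intro generated_equiv_base) auto
    have bij': "bij_betw ?\<rho>' S S" using bij_betw_transpose_comp[OF less.prems a(1) b] .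
    have "\<rho> x \<noteq> x" if x: "x \<in> S" "?\<rho>' x \<noteq> x" for x
    proof
      assume *: "\<rho> x = x"
      then have "x = a \<or> x = \<rho> a" using x by (auto simp: Transposition.transpose_def split: if_splits)
      then have "x = \<rho> a" using * a by auto
      then have "\<rho> (\<rho> a) = \<rho> a" using * by simp
      then have "\<rho> a = a" using less.prems a(1) b unfolding bij_betw_def inj_on_def by blast
      then show False using a by simp
    qed
    moreover have "?\<rho>' a = a" by (simp add: Transposition.transpose_def)
    ultimately have "{x \<in> S. ?\<rho>' x \<noteq> x} \<subset> {x \<in> S. \<rho> x \<noteq> x}" using a by blast
    then have "card {x \<in> S. ?\<rho>' x \<noteq> x} < card {x \<in> S. \<rho> x \<noteq> x}"
      using fin by (intro psubset_card_mono) auto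
    from less.hyps[OF this bij'] euler_count_split(1)[OF less.prems a(1) b a(2)[symmetric] same]
    show ?thesis by linarith
  qed
qed

end

section \<open>Pairs of involutions\<close>

lemma arc_involution_class:
  assumes "arc_involution S \<alpha>" "x \<in> S"
  shows "generated_equiv (graph_of \<alpha>) S `` {x} = {x, \<alpha> x}"
proof -
  interpret arc_involution S \<alpha> by fact
  have "generated_equiv (graph_of \<alpha>) S \<subseteq> {(x, y). x \<in> S \<and> (y = x \<or> y = \<alpha> x)}"
  proof (rule generated_equiv_least)
    show "equiv S {(x, y). x \<in> S \<and> (y = x \<or> y = \<alpha> x)}"
      by (rule equivI) (auto simp: refl_on_def sym_def trans_def \<alpha>_in \<alpha>_\<alpha>)
  qed auto
  moreover have "(x, \<alpha> x) \<in> generated_equiv (graph_of \<alpha>) S" "(x, x) \<in> generated_equiv (graph_of \<alpha>) S"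
    using assms(2) \<alpha>_in by (auto intro: generated_equiv_base generated_equiv_refl)
  ultimately show ?thesis by auto
qed

lemma arc_involution_count:
  assumes "arc_involution S \<alpha>"
  shows "2 * class_count (graph_of \<alpha>) S = card S"
proof -
  interpret arc_involution S \<alpha> by fact
  let ?C = "gen_classes (graph_of \<alpha>) S"
  have U: "\<Union>?C = S" unfolding gen_classes_def by (rule Union_quotient[OF equiv_generated_equiv])
  have "2 * card ?C = card (\<Union>?C)"
  proof (rule card_partition)
    show "finite ?C" by (rule finite_gen_classes[OF fin])
    show "finite (\<Union>?C)" using U fin by simp
    show "card c = 2" if "c \<in> ?C" for c
    proof -
      from that obtain x where "x \<in> S" "c = generated_equiv (graph_of \<alpha>) S `` {x}"
        unfolding gen_classes_def by (rule quotientE)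
      then show ?thesis using arc_involution_class[OF assms] \<alpha>_ne by (metis card_2_iff)
    qed
    show "c \<inter> c' = {}" if "c \<in> ?C" "c' \<in> ?C" "c \<noteq> c'" for c c'
      using quotient_disj[OF equiv_generated_equiv] that unfolding gen_classes_def by blast
  qed
  then show ?thesis using U by simp
qed

lemma same_orbit_closed_subset:
  assumes fin: "finite S" and bij: "bij_betw \<pi> S S" and T: "T \<subseteq> S" "\<And>x. x \<in> T \<Longrightarrow> \<pi> x \<in> T"
  shows "bij_betw \<pi> T T"
    and "x \<in> T \<Longrightarrow> generated_equiv (graph_of \<pi>) S `` {x} = generated_equiv (graph_of \<pi>) T `` {x}"
proof -
  have finT: "finite T" using fin T(1) finite_subset by blast
  have "inj_on \<pi> T" using bij T(1) by (auto simp: bij_betw_def intro: inj_on_subset)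
  then show bT: "bij_betw \<pi> T T"
    using endo_inj_surj[OF finT] T(2) by (auto simp: bij_betw_def)
  show "generated_equiv (graph_of \<pi>) S `` {x} = generated_equiv (graph_of \<pi>) T `` {x}" if x: "x \<in> T"
    using same_orbit_iff[OF fin bij, of x] same_orbit_iff[OF finT bT x] x T(1) by auto
qed

lemma orbit_count_partition:
  assumes fin: "finite S" and bij: "bij_betw \<pi> S S"
    and o: "\<And>x. x \<in> S \<Longrightarrow> P (\<pi> x) \<longleftrightarrow> P x"
  shows "class_count (graph_of \<pi>) S =
         class_count (graph_of \<pi>) {x \<in> S. P x} + class_count (graph_of \<pi>) {x \<in> S. \<not> P x}"
proof -
  let ?T = "{x \<in> S. P x}" and ?U = "{x \<in> S. \<not> P x}"
  have in_S: "\<pi> x \<in> S" if "x \<in> S" for x using that bij by (auto simp: bij_betw_def)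
  have T: "generated_equiv (graph_of \<pi>) S `` {x} = generated_equiv (graph_of \<pi>) ?T `` {x}" if "x \<in> ?T" for x
    by (rule same_orbit_closed_subset(2)[OF fin bij _ _ that]) (auto simp: o in_S)
  have U: "generated_equiv (graph_of \<pi>) S `` {x} = generated_equiv (graph_of \<pi>) ?U `` {x}" if "x \<in> ?U" for x
    by (rule same_orbit_closed_subset(2)[OF fin bij _ _ that]) (auto simp: o in_S)
  have "gen_classes (graph_of \<pi>) S = (\<lambda>x. generated_equiv (graph_of \<pi>) S `` {x}) ` (?T \<union> ?U)"
    by (auto simp: gen_classes_def quotient_def)
  also have "\<dots> = gen_classes (graph_of \<pi>) ?T \<union> gen_classes (graph_of \<pi>) ?U"
    unfolding image_Un using T U by (auto simp: gen_classes_def quotient_def)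
  finally have e: "gen_classes (graph_of \<pi>) S = gen_classes (graph_of \<pi>) ?T \<union> gen_classes (graph_of \<pi>) ?U" .
  have "gen_classes (graph_of \<pi>) ?T \<inter> gen_classes (graph_of \<pi>) ?U = {}"
  proof -
    have False if C: "C \<in> gen_classes (graph_of \<pi>) ?T" "C \<in> gen_classes (graph_of \<pi>) ?U" for C
    proof -
      have "C \<subseteq> ?T" "C \<subseteq> ?U" "C \<noteq> {}"
        using C unfolding gen_classes_def
        by (meson in_quotient_imp_subset in_quotient_imp_non_empty equiv_generated_equiv)+
      then show False by blast
    qed
    then show ?thesis by blast
  qed
  then show ?thesis
    unfolding e using fin by (intro card_Un_disjoint finite_gen_classes) auto
qed

text \<open>In the application \<open>\<alpha>\<close> runs along the arcs of the diagram and
  \<open>\<beta>\<close> along the smoothing arcs. The classes generated by both are the circles of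
  the state, and \<open>turn\<close> walks two steps along a circle.\<close>

locale arc_involutions = arc_involution S \<alpha> for S :: "'a set" and \<alpha> +
  fixes \<beta> :: "'a \<Rightarrow> 'a"
  assumes arc_involution_\<beta>: "arc_involution S \<beta>"
begin

sublocale B: arc_involution S \<beta> by (rule arc_involution_\<beta>)

abbreviation "turn \<equiv> \<beta> \<circ> \<alpha>"
abbreviation "same_cycle \<equiv> generated_equiv (graph_of turn) S"

text \<open>Such a colouring is a choice of direction on each circle: the coloured darts of a circle
  form one of its two \<open>turn\<close> cycles.\<close>

definition alternating :: "('a \<Rightarrow> bool) \<Rightarrow> bool" where
  "alternating P \<longleftrightarrow> (\<forall>x\<in>S. P (\<alpha> x) \<noteq> P x \<and> P (\<beta> x) \<noteq> P x)"

lemma bij_turn: "bij_betw turn S S"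
  using bij_comp_\<alpha>[OF B.bij_\<alpha>] .

text \<open>\<open>\<alpha>\<close> conjugates \<open>turn\<close> into its inverse, so it maps
  cycles to cycles.\<close>

lemma same_cycle_\<alpha>:
  assumes "(x, y) \<in> same_cycle"
  shows "(\<alpha> x, \<alpha> y) \<in> same_cycle"
proof -
  have "same_cycle \<subseteq> {(x, y). x \<in> S \<and> y \<in> S \<and> (\<alpha> x, \<alpha> y) \<in> same_cycle}"
  proof (rule generated_equiv_least)
    show "equiv S {(x, y). x \<in> S \<and> y \<in> S \<and> (\<alpha> x, \<alpha> y) \<in> same_cycle}"
    proof (rule equivI)
      show "refl_on S {(x, y). x \<in> S \<and> y \<in> S \<and> (\<alpha> x, \<alpha> y) \<in> same_cycle}"
        by (auto simp: refl_on_def \<alpha>_in generated_equiv_refl)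
      show "sym {(x, y). x \<in> S \<and> y \<in> S \<and> (\<alpha> x, \<alpha> y) \<in> same_cycle}"
        by (auto simp: sym_def intro: generated_equiv_sym)
      show "trans {(x, y). x \<in> S \<and> y \<in> S \<and> (\<alpha> x, \<alpha> y) \<in> same_cycle}"
        unfolding trans_def by (blast intro: generated_equiv_trans)
    qed auto
    fix x y assume xy: "x \<in> S" "y \<in> S" "y = turn x"
    have "(\<alpha> y, \<alpha> x) \<in> same_cycle"
      using xy by (intro generated_equiv_base) (auto simp: \<alpha>_in \<alpha>_\<alpha> B.\<alpha>_\<alpha>)
    then have "(\<alpha> x, \<alpha> y) \<in> same_cycle" by (rule generated_equiv_sym)
    then show "(x, y) \<in> {(x, y). x \<in> S \<and> y \<in> S \<and> (\<alpha> x, \<alpha> y) \<in> same_cycle}"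
      using xy(1,2) by simp
  qed
  then show ?thesis using assms by blast
qed

lemma same_cycle_subset_linked: "same_cycle \<subseteq> linked \<beta>"
  by (rule orbit_subset_linked(2)[OF B.bij_\<alpha>])

lemma linked_\<alpha>: "x \<in> S \<Longrightarrow> (x, \<alpha> x) \<in> linked \<beta>"
  by (rule generated_equiv_base) (auto simp: \<alpha>_in)

lemma linked_\<beta>: "x \<in> S \<Longrightarrow> (x, \<beta> x) \<in> linked \<beta>"
  by (rule generated_equiv_base) (auto simp: B.\<alpha>_in)

text \<open>A circle consists of a cycle of \<open>turn\<close> and its image under
  \<open>\<alpha>\<close>, the walk in the opposite direction.\<close>

lemma linked_cases:
  assumes "(x, y) \<in> linked \<beta>"
  shows "(x, y) \<in> same_cycle \<or> (x, \<alpha> y) \<in> same_cycle"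
proof -
  let ?E = "{(x, y). x \<in> S \<and> y \<in> S \<and> ((x, y) \<in> same_cycle \<or> (x, \<alpha> y) \<in> same_cycle)}"
  have flip: "(y, \<alpha> x) \<in> same_cycle" if "(x, \<alpha> y) \<in> same_cycle" "y \<in> S" for x y
    using same_cycle_\<alpha>[OF that(1)] \<alpha>_\<alpha>[OF that(2)] generated_equiv_sym by metis
  have "linked \<beta> \<subseteq> ?E"
  proof (rule generated_equiv_least)
    show "equiv S ?E"
    proof (rule equivI)
      show "refl_on S ?E" by (auto simp: refl_on_def generated_equiv_refl)
      show "sym ?E"
      proof (rule symI)
        fix x y assume "(x, y) \<in> ?E"
        then have *: "x \<in> S" "y \<in> S" "(x, y) \<in> same_cycle \<or> (x, \<alpha> y) \<in> same_cycle" by simp_all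
        then have "(y, x) \<in> same_cycle \<or> (y, \<alpha> x) \<in> same_cycle"
          using flip[OF _ *(2), of x] generated_equiv_sym[of x y] by blast
        then show "(y, x) \<in> ?E" using *(1,2) by simp
      qed
      show "trans ?E"
      proof (rule transI)
        fix x y z assume "(x, y) \<in> ?E" "(y, z) \<in> ?E"
        then have S: "x \<in> S" "z \<in> S" and xy: "(x, y) \<in> same_cycle \<or> (x, \<alpha> y) \<in> same_cycle"
          and yz: "(y, z) \<in> same_cycle \<or> (y, \<alpha> z) \<in> same_cycle" by simp_all
        have zz: "\<alpha> (\<alpha> z) = z" by (rule \<alpha>_\<alpha>[OF S(2)])
        have "(x, z) \<in> same_cycle \<or> (x, \<alpha> z) \<in> same_cycle"
          using xy
        proof
          assume "(x, y) \<in> same_cycle"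
          then show ?thesis using yz generated_equiv_trans[of x y] by blast
        next
          assume *: "(x, \<alpha> y) \<in> same_cycle"
          from yz have "(\<alpha> y, \<alpha> z) \<in> same_cycle \<or> (\<alpha> y, z) \<in> same_cycle"
            using same_cycle_\<alpha>[of y z] same_cycle_\<alpha>[of y "\<alpha> z"] unfolding zz by blast
          then show ?thesis using generated_equiv_trans[OF *] by blast
        qed
        then show "(x, z) \<in> ?E" using S by simp
      qed
    qed auto
    fix x y assume xy: "x \<in> S" "y \<in> S" "y = \<beta> x \<or> y = \<alpha> x"
    show "(x, y) \<in> ?E"
    proof (cases "y = \<alpha> x")
      case True
      then show ?thesis using xy \<alpha>_\<alpha> by (auto intro: generated_equiv_refl)
    next
      case False
      then have y: "y = \<beta> x" using xy by blast
      have "(\<alpha> x, y) \<in> same_cycle"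
        using xy y by (intro generated_equiv_base) (auto simp: \<alpha>_in \<alpha>_\<alpha>)
      from same_cycle_\<alpha>[OF this] show ?thesis using xy \<alpha>_\<alpha> by auto
    qed
  qed
  then show ?thesis using assms by blast
qed

lemma turn_funpow_\<alpha>:
  assumes "x \<in> S"
  shows "\<alpha> ((turn ^^ n) (\<alpha> ((turn ^^ n) x))) = x"
  using assms
proof (induction n arbitrary: x)
  case (Suc n)
  have a: "(turn ^^ n) x \<in> S" using funpow_in[OF bij_turn Suc.prems] .
  have tx: "turn x \<in> S" using Suc.prems \<alpha>_in B.\<alpha>_in by simp
  have "(turn ^^ Suc n) x = (turn ^^ n) (turn x)" by (simp add: funpow_swap1)
  then have "\<alpha> ((turn ^^ Suc n) (\<alpha> ((turn ^^ Suc n) x))) = \<alpha> (turn ((turn ^^ n) (\<alpha> ((turn ^^ n) (turn x)))))"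
    by simp
  also have "(turn ^^ n) (\<alpha> ((turn ^^ n) (turn x))) = \<alpha> (turn x)"
    using Suc.IH[OF tx] \<alpha>_\<alpha> funpow_in[OF bij_turn] \<alpha>_in tx by metis
  also have "\<alpha> (turn (\<alpha> (turn x))) = x"
    using Suc.prems \<alpha>_\<alpha> B.\<alpha>_\<alpha> \<alpha>_in B.\<alpha>_in by simp
  finally show ?case .
qed (simp add: \<alpha>_\<alpha>)

text \<open>A cycle of \<open>turn\<close> meeting its own reversal would contain a point fixed by one of the two
  involutions, half-way between \<open>x\<close> and \<open>\<alpha> x\<close>.\<close>

lemma same_cycle_not_reversed:
  assumes x: "x \<in> S"
  shows "(x, \<alpha> x) \<notin> same_cycle"
proof
  assume "(x, \<alpha> x) \<in> same_cycle"
  then obtain n where n: "\<alpha> x = (turn ^^ n) x" using same_orbit_iff[OF fin bij_turn x] by blast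
  have S: "(turn ^^ k) x \<in> S" for k using funpow_in[OF bij_turn x] .
  have inj: "u = v" if "(turn ^^ m) u = (turn ^^ m) v" "u \<in> S" "v \<in> S" for u v m
    using that by (rule funpow_cancel [OF bij_turn])
  define m where "m = n div 2"
  let ?y = "(turn ^^ m) x"
  have y: "?y \<in> S" by (rule S)
  have rev: "(turn ^^ m) (\<alpha> ?y) = \<alpha> x"
    using turn_funpow_\<alpha>[OF x, of m] \<alpha>_\<alpha> funpow_in[OF bij_turn \<alpha>_in[OF y]] by metis
  show False
  proof (cases "even n")
    case True
    then have "n = m + m" unfolding m_def by (metis even_two_times_div_two mult_2)
    then have "(turn ^^ m) (\<alpha> ?y) = (turn ^^ m) ?y" using n rev by (simp add: funpow_add)
    then have "\<alpha> ?y = ?y" using inj y \<alpha>_in by blast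
    then show False using \<alpha>_ne[OF y] by simp
  next
    case False
    then have "n = m + Suc m" by (simp add: m_def) presburger
    then have "(turn ^^ n) x = (turn ^^ m) (turn ?y)" by (simp only: funpow_add funpow.simps(2) o_apply)
    then have "(turn ^^ m) (\<alpha> ?y) = (turn ^^ m) (turn ?y)" using n rev by simp
    moreover have "turn ?y \<in> S" using \<alpha>_in[OF y] B.\<alpha>_in by simp
    ultimately have "\<alpha> ?y = turn ?y" using inj \<alpha>_in[OF y] by blast
    then have "\<beta> (\<alpha> ?y) = \<alpha> ?y" by simp
    then show False using B.\<alpha>_ne[OF \<alpha>_in[OF y]] by simp
  qed
qed

text \<open>A dart is coloured when it lies on the \<open>turn\<close> cycle of the representative
  chosen on its circle; the reversed cycle is different by
  \<open>same_cycle_not_reversed\<close>.\<close>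

lemma exists_alternating: "\<exists>P. alternating P"
proof -
  \<comment> \<open>The choice depends on \<open>x\<close> only through its class, so all darts of
    one circle share the representative.\<close>
  define r where "r x = (SOME y. (x, y) \<in> linked \<beta>)" for x
  define P where "P x \<longleftrightarrow> (r x, x) \<in> same_cycle" for x
  have r: "(x, r x) \<in> linked \<beta>" if "x \<in> S" for x
    unfolding r_def using generated_equiv_refl[OF that] by (rule someI)
  have r_eq: "r x = r y" if "(x, y) \<in> linked \<beta>" for x y
  proof -
    have "(x, z) \<in> linked \<beta> \<longleftrightarrow> (y, z) \<in> linked \<beta>" for z
      using generated_equiv_trans[OF that] generated_equiv_trans[OF generated_equiv_sym[OF that]] by blast
    then show ?thesis by (simp add: r_def)
  qed
  have flip: "P (\<alpha> x) \<noteq> P x" if x: "x \<in> S" for x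
  proof -
    have rx: "r (\<alpha> x) = r x" using r_eq[OF linked_\<alpha>[OF x]] by simp
    have "(r x, x) \<in> same_cycle \<or> (r x, \<alpha> x) \<in> same_cycle"
      using linked_cases[OF generated_equiv_sym[OF r[OF x]]] .
    moreover have "\<not> ((r x, x) \<in> same_cycle \<and> (r x, \<alpha> x) \<in> same_cycle)"
      using same_cycle_not_reversed[OF x] generated_equiv_trans[OF generated_equiv_sym[of "r x" x]] by blast
    ultimately show ?thesis unfolding P_def rx by blast
  qed
  have turn: "P (turn x) = P x" if x: "x \<in> S" for x
  proof -
    have tx: "turn x \<in> S" using x \<alpha>_in B.\<alpha>_in by simp
    have xt: "(x, turn x) \<in> same_cycle" using x tx by (intro generated_equiv_base) auto
    have "r (turn x) = r x" using r_eq[OF subsetD[OF same_cycle_subset_linked xt]] by simp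
    then show ?thesis
      unfolding P_def
      using generated_equiv_trans[OF _ xt] generated_equiv_trans[OF _ generated_equiv_sym[OF xt]] by auto
  qed
  have "P (\<beta> x) \<noteq> P x" if x: "x \<in> S" for x
    using turn[OF \<alpha>_in[OF x]] flip[OF x] \<alpha>_\<alpha>[OF x] by simp
  then show ?thesis using flip unfolding alternating_def by blast
qed

lemma alternating_same_cycle:
  assumes P: "alternating P" and xy: "(x, y) \<in> same_cycle"
  shows "P x = P y"
proof -
  have "same_cycle \<subseteq> {(x, y). x \<in> S \<and> y \<in> S \<and> P x = P y}"
  proof (rule generated_equiv_least)
    show "equiv S {(x, y). x \<in> S \<and> y \<in> S \<and> P x = P y}"
      by (rule equivI) (auto simp: refl_on_def sym_def trans_def)
    show "(x, y) \<in> {(x, y). x \<in> S \<and> y \<in> S \<and> P x = P y}" if "x \<in> S" "y \<in> S" "y = turn x" for x y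
      using that P \<alpha>_in unfolding alternating_def by auto
  qed
  then show ?thesis using xy by blast
qed

lemma alternating_linked:
  assumes P: "alternating P" and xy: "(x, y) \<in> linked \<beta>" and eq: "P x = P y"
  shows "(x, y) \<in> same_cycle"
proof -
  have y: "y \<in> S" using generated_equiv_in[OF xy] by blast
  have "(x, \<alpha> y) \<notin> same_cycle"
    using alternating_same_cycle[OF P, of x "\<alpha> y"] P y eq unfolding alternating_def by blast
  then show ?thesis using linked_cases[OF xy] by blast
qed

text \<open>Every circle contains exactly one coloured cycle; \<open>h\<close> sends an uncoloured
  dart to its coloured neighbour along the arc.\<close>

lemma component_count_alternating:
  assumes P: "alternating P"
  shows "class_count (\<lambda>x y. y = \<beta> x \<or> y = \<alpha> x) S = class_count (graph_of turn) {x \<in> S. P x}"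
proof -
  let ?T = "{x \<in> S. P x}"
  define h where "h x = (if P x then x else \<alpha> x)" for x
  have cl: "turn x \<in> ?T" if "x \<in> ?T" for x
    using that P \<alpha>_in B.\<alpha>_in unfolding alternating_def by auto
  have hT: "h x \<in> ?T" if "x \<in> S" for x
    using that P \<alpha>_in unfolding alternating_def h_def by auto
  have hl: "(x, h x) \<in> linked \<beta>" if "x \<in> S" for x
    using that linked_\<alpha> by (simp add: h_def generated_equiv_refl)
  have restrict: "(x, y) \<in> generated_equiv (graph_of turn) ?T \<longleftrightarrow> (x, y) \<in> same_cycle" if "x \<in> ?T" for x y
  proof -
    have "same_cycle `` {x} = generated_equiv (graph_of turn) ?T `` {x}"
      by (rule same_orbit_closed_subset(2)[OF fin bij_turn _ cl that]) auto
    then show ?thesis by blast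
  qed
  show ?thesis
    unfolding gen_classes_def
  proof (rule card_quotient_image[OF equiv_generated_equiv equiv_generated_equiv])
    show "h ` S = ?T"
    proof
      show "?T \<subseteq> h ` S" by (auto simp: h_def image_iff intro!: bexI)
    qed (use hT in blast)
    fix x y assume xy: "x \<in> S" "y \<in> S"
    show "(x, y) \<in> linked \<beta> \<longleftrightarrow> (h x, h y) \<in> generated_equiv (graph_of turn) ?T"
      unfolding restrict[OF hT[OF xy(1)]]
    proof
      assume "(x, y) \<in> linked \<beta>"
      from generated_equiv_trans[OF generated_equiv_sym[OF hl[OF xy(1)]] generated_equiv_trans[OF this hl[OF xy(2)]]]
      have "(h x, h y) \<in> linked \<beta>" .
      then show "(h x, h y) \<in> same_cycle"
        by (rule alternating_linked[OF P]) (use hT xy in auto)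
    next
      assume "(h x, h y) \<in> same_cycle"
      then have "(h x, h y) \<in> linked \<beta>" using same_cycle_subset_linked by blast
      from generated_equiv_trans[OF hl[OF xy(1)] generated_equiv_trans[OF this generated_equiv_sym[OF hl[OF xy(2)]]]]
      show "(x, y) \<in> linked \<beta>" .
    qed
  qed
qed

end

section \<open>Smoothings of a planar diagram\<close>

lemma generated_equiv_graph_cong:
  assumes "\<And>x. x \<in> S \<Longrightarrow> f x = g x"
  shows "generated_equiv (graph_of f) S = generated_equiv (graph_of g) S"
    and "generated_equiv (\<lambda>x y. y = f x \<or> Q x y) S = generated_equiv (\<lambda>x y. y = g x \<or> Q x y) S"
  by (rule generated_equiv_eqI; use assms in \<open>auto intro: generated_equiv_base\<close>)+

definition smooth :: "state \<Rightarrow> dart \<Rightarrow> dart" where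
  "smooth s d = (fst d, smoothing_arc (s (fst d)) (snd d))"

text \<open>The lower of the two opposite darts that are exchanged: exchanging 0 and 2 after
  \<open>rot\<close> pairs 0 with 1 and 2 with 3, exchanging 1 and 3 pairs 1 with 2 and 3 with
  0.\<close>

fun fork :: "label \<Rightarrow> nat" where
  "fork LabelA = 0"
| "fork LabelB = 1"

text \<open>The crossings in \<open>X\<close> are kept as vertices, the others are smoothed by \<open>s\<close>. A smoothing
  arises from the rotation at the crossing by exchanging two opposite darts.\<close>

definition resolve :: "state \<Rightarrow> nat set \<Rightarrow> dart \<Rightarrow> dart" where
  "resolve s X d =
     (if fst d \<in> X then rot d
      else exchange (fst d, fork (s (fst d))) (fst d, fork (s (fst d)) + 2) (rot d))"

lemma less_4_cases:
  assumes "(p::nat) < 4"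
  obtains "p = 0" | "p = 1" | "p = 2" | "p = 3"
  using assms by linarith

lemma resolve_empty:
  assumes "snd d < 4"
  shows "resolve s {} d = smooth s d"
proof (cases d)
  case (Pair x p)
  then have "p < 4" using assms by simp
  then show ?thesis
    by (cases rule: less_4_cases; cases "s x")
       (simp_all add: Pair resolve_def smooth_def rot_def Transposition.transpose_def)
qed

lemma resolve_notin:
  assumes "snd d < 4" "fst d \<notin> X"
  shows "resolve s X d = smooth s d"
  using resolve_empty[OF assms(1), of s] assms(2) by (simp add: resolve_def)

text \<open>Smoothing one more vertex is a single transposition, so the splitting lemmas for
  permutations apply; darts at other crossings are untouched.\<close>

lemma resolve_remove:
  assumes "x \<in> X"
  shows "resolve s (X - {x}) = exchange (x, fork (s x)) (x, fork (s x) + 2) \<circ> resolve s X"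
proof
  fix d :: dart
  show "resolve s (X - {x}) d = (exchange (x, fork (s x)) (x, fork (s x) + 2) \<circ> resolve s X) d"
  proof (cases "fst d = x")
    case True
    then show ?thesis using assms by (simp add: resolve_def)
  next
    case False
    have "fst (resolve s X d) = fst d"
      by (cases d) (auto simp: resolve_def rot_def Transposition.transpose_def)
    then have "exchange (x, fork (s x)) (x, fork (s x) + 2) (resolve s X d) = resolve s X d"
      using False by (auto simp: Transposition.transpose_def)
    then show ?thesis using False by (simp add: resolve_def)
  qed
qed

lemma smooth_smooth: "snd d < 4 \<Longrightarrow> smooth s (smooth s d) = d"
  by (cases d; cases "s (fst d)") (auto simp: smooth_def elim!: less_4_cases)

lemma smooth_neq: "snd d < 4 \<Longrightarrow> smooth s d \<noteq> d"
  by (cases d; cases "s (fst d)") (auto simp: smooth_def elim!: less_4_cases)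

lemma snd_smooth_less: "snd d < 4 \<Longrightarrow> snd (smooth s d) < 4"
  by (cases d; cases "s (fst d)") (auto simp: smooth_def elim!: less_4_cases)

lemma fst_smooth [simp]: "fst (smooth s d) = fst d"
  by (simp add: smooth_def)

locale plane_diagram =
  fixes D :: diagram
  assumes link: "link_diagram D"
begin

lemma dart_iff [simp]: "(x, p) \<in> darts D \<longleftrightarrow> x < ncr D \<and> p < 4"
  by (auto simp: darts_def)

lemma dartD: "d \<in> darts D \<Longrightarrow> fst d < ncr D \<and> snd d < 4"
  by (cases d) auto

lemma fst_image_darts: "fst ` darts D = {..<ncr D}"
  by (simp add: darts_def lessThan_empty_iff)

lemma finite_darts: "finite (darts D)"
  by (simp add: darts_def)

lemma card_darts: "card (darts D) = 4 * ncr D"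
  by (simp add: darts_def card_cartesian_product)

sublocale arc_involution "darts D" "arc_end D"
  using link finite_darts by unfold_locales (auto simp: link_diagram_def)

lemma arc_involution_smooth: "arc_involution (darts D) (smooth s)"
proof
  show "smooth s d \<in> darts D" if "d \<in> darts D" for d
    using dartD[OF that] snd_smooth_less[of d s] by (cases "smooth s d") (auto simp: smooth_def)
qed (use finite_darts smooth_smooth smooth_neq dartD in auto)

lemma arc_involutions_smooth: "arc_involutions (darts D) (arc_end D) (smooth s)"
  by (intro arc_involutions.intro arc_involution_axioms arc_involutions_axioms.intro arc_involution_smooth)

lemma bij_resolve: "bij_betw (resolve s X) (darts D) (darts D)"
proof (rule bij_betw_byWitness[where f' = "\<lambda>d. if fst d \<in> X then (fst d, (snd d + 3) mod 4) else smooth s d"])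
  let ?g = "\<lambda>d. if fst d \<in> X then (fst d, (snd d + 3) mod 4) else smooth s d"
  show "\<forall>d\<in>darts D. ?g (resolve s X d) = d"
  proof
    fix d assume d: "d \<in> darts D"
    show "?g (resolve s X d) = d"
    proof (cases "fst d \<in> X")
      case True
      have "((snd d + 1) mod 4 + 3) mod 4 = snd d" using dartD[OF d] by presburger
      then show ?thesis using True by (cases d) (auto simp: resolve_def rot_def)
    next
      case False
      then show ?thesis using resolve_notin dartD[OF d] smooth_smooth by simp
    qed
  qed
  show "\<forall>d\<in>darts D. resolve s X (?g d) = d"
  proof
    fix d assume d: "d \<in> darts D"
    show "resolve s X (?g d) = d"
    proof (cases "fst d \<in> X")
      case True
      have "((snd d + 3) mod 4 + 1) mod 4 = snd d" using dartD[OF d] by presburger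
      then show ?thesis using True by (cases d) (auto simp: resolve_def rot_def)
    next
      case False
      then show ?thesis using resolve_notin[of "smooth s d" X s] dartD[OF d] smooth_smooth snd_smooth_less by simp
    qed
  qed
  have r: "resolve s X d \<in> darts D" if d: "d \<in> darts D" for d
  proof (cases "fst d \<in> X")
    case True
    then show ?thesis using dartD[OF d] by (cases d) (auto simp: resolve_def rot_def)
  next
    case False
    then show ?thesis
      using resolve_notin dartD[OF d] arc_involution.\<alpha>_in[OF arc_involution_smooth d] by simp
  qed
  then show "resolve s X ` darts D \<subseteq> darts D" by blast
  have "?g d \<in> darts D" if d: "d \<in> darts D" for d
    using arc_involution.\<alpha>_in[OF arc_involution_smooth d, of s] dartD[OF d] by auto
  then show "?g ` darts D \<subseteq> darts D" by blast
qed

lemma rot_same_orbit: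
  assumes "x \<in> X" "x < ncr D" "p < 4" "q < 4"
  shows "((x, p), (x, q)) \<in> generated_equiv (graph_of (resolve s X)) (darts D)"
proof -
  let ?E = "generated_equiv (graph_of (resolve s X)) (darts D)"
  have step: "((x, r), (x, Suc r)) \<in> ?E" if "r < 3" for r
    using that assms by (intro generated_equiv_base) (auto simp: resolve_def rot_def)
  have "((x, 0), (x, r)) \<in> ?E" if "r < 4" for r
    using that
  proof (induction r)
    case (Suc r)
    then show ?case using generated_equiv_trans[OF Suc.IH step] by simp
  qed (use assms in \<open>simp add: generated_equiv_refl\<close>)
  then show ?thesis using assms(3,4) generated_equiv_sym generated_equiv_trans by metis
qed

lemma rot_linked:
  assumes "x \<in> X" "x < ncr D" "p < 4" "q < 4"
  shows "((x, p), (x, q)) \<in> linked (resolve s X)"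
  using rot_same_orbit[OF assms] orbit_subset_linked(1)[OF bij_resolve] by blast

lemma orbit_count_rot: "class_count (graph_of rot) (darts D) = ncr D"
proof -
  have iff: "(d, e) \<in> generated_equiv (graph_of rot) (darts D) \<longleftrightarrow> (fst d, fst e) \<in> Id_on {..<ncr D}"
    if "d \<in> darts D" "e \<in> darts D" for d e
  proof
    have "generated_equiv (graph_of rot) (darts D) \<subseteq> {(d, e). d \<in> darts D \<and> e \<in> darts D \<and> fst d = fst e}"
    proof (rule generated_equiv_least)
      show "equiv (darts D) {(d, e). d \<in> darts D \<and> e \<in> darts D \<and> fst d = fst e}"
        by (rule equivI) (auto simp: refl_on_def sym_def trans_def)
    qed (auto simp: rot_def)
    moreover assume "(d, e) \<in> generated_equiv (graph_of rot) (darts D)"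
    ultimately show "(fst d, fst e) \<in> Id_on {..<ncr D}" using dartD by fastforce
  next
    assume *: "(fst d, fst e) \<in> Id_on {..<ncr D}"
    \<comment> \<open>With all crossings kept, every state gives \<open>rot\<close> on the darts,
      hence the arbitrary state \<open>undefined\<close>.\<close>
    have eq: "generated_equiv (graph_of (resolve undefined {..<ncr D})) (darts D) = generated_equiv (graph_of rot) (darts D)"
      by (rule generated_equiv_eqI) (auto simp: resolve_def intro!: generated_equiv_base dest: dartD)
    show "(d, e) \<in> generated_equiv (graph_of rot) (darts D)"
      using rot_same_orbit[of "fst d" "{..<ncr D}" "snd d" "snd e" undefined] * dartD[OF that(1)] dartD[OF that(2)]
      by (cases d, cases e) (auto simp: eq)
  qed
  have "class_count (graph_of rot) (darts D) = card ({..<ncr D} // Id_on {..<ncr D})"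
    unfolding gen_classes_def
  proof (rule card_quotient_image[OF equiv_generated_equiv _ _ iff])
    show "equiv {..<ncr D} (Id_on {..<ncr D})"
      by (rule equivI) (auto simp: refl_on_def sym_def trans_def)
    show "fst ` darts D = {..<ncr D}" by (rule fst_image_darts)
  qed auto
  also have "{..<ncr D} // Id_on {..<ncr D} = (\<lambda>x. {x}) ` {..<ncr D}"
    by (auto simp: quotient_def)
  also have "card \<dots> = ncr D" by (subst card_image) auto
  finally show ?thesis .
qed

text \<open>The darts at a crossing are all equivalent, so \<open>fst\<close> induces a bijection
  between the classes of darts and the classes of crossings.\<close>

lemma component_count_rot:
  "class_count (\<lambda>d e. e = rot d \<or> e = arc_end D d) (darts D) = card (graph_components D)"
proof -
  let ?R = "\<lambda>x y. \<exists>p<4. fst (arc_end D (x, p)) = y"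
  let ?L = "generated_equiv (\<lambda>d e. e = rot d \<or> e = arc_end D d) (darts D)"
  let ?E' = "generated_equiv ?R {..<ncr D}"
  have at: "((x, p), (x, q)) \<in> ?L" if "x < ncr D" "p < 4" "q < 4" for x p q
  proof -
    have "generated_equiv (graph_of (resolve undefined {..<ncr D})) (darts D) \<subseteq> ?L"
      by (rule generated_equiv_mono) (auto simp: resolve_def intro!: generated_equiv_base dest: dartD)
    then show ?thesis using rot_same_orbit[of x "{..<ncr D}" p q undefined] that by auto
  qed
  have iff: "(d, e) \<in> ?L \<longleftrightarrow> (fst d, fst e) \<in> ?E'" if de: "d \<in> darts D" "e \<in> darts D" for d e
  proof
    let ?Q = "{(d, e). d \<in> darts D \<and> e \<in> darts D \<and> (fst d, fst e) \<in> ?E'}"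
    have "?L \<subseteq> ?Q"
    proof (rule generated_equiv_least)
      show "equiv (darts D) ?Q"
      proof (rule equivI)
        show "refl_on (darts D) ?Q" by (auto simp: refl_on_def intro: generated_equiv_refl dest: dartD)
        show "sym ?Q" by (auto simp: sym_def intro: generated_equiv_sym)
        show "trans ?Q" unfolding trans_def by (blast intro: generated_equiv_trans)
      qed auto
      fix d e assume de: "d \<in> darts D" "e \<in> darts D" "e = rot d \<or> e = arc_end D d"
      have "(fst d, fst e) \<in> ?E'"
        using de(3)
      proof
        assume "e = rot d"
        then show ?thesis using dartD[OF de(1)] by (cases d) (auto simp: rot_def generated_equiv_refl)
      next
        assume "e = arc_end D d"
        then show ?thesis using dartD[OF de(1)] dartD[OF de(2)]
          by (intro generated_equiv_base) (auto intro: exI[of _ "snd d"])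
      qed
      then show "(d, e) \<in> ?Q" using de by simp
    qed
    moreover assume "(d, e) \<in> ?L"
    ultimately show "(fst d, fst e) \<in> ?E'" by blast
  next
    let ?Q = "{(x, y). x < ncr D \<and> y < ncr D \<and> ((x, 0), (y, 0)) \<in> ?L}"
    have "?E' \<subseteq> ?Q"
    proof (rule generated_equiv_least)
      show "equiv {..<ncr D} ?Q"
      proof (rule equivI)
        show "refl_on {..<ncr D} ?Q" by (auto simp: refl_on_def intro: generated_equiv_refl)
        show "sym ?Q" by (auto simp: sym_def intro: generated_equiv_sym)
        show "trans ?Q" unfolding trans_def by (blast intro: generated_equiv_trans)
      qed auto
      fix x y assume xy: "x \<in> {..<ncr D}" "y \<in> {..<ncr D}" "?R x y"
      then obtain p where p: "p < 4" "fst (arc_end D (x, p)) = y" by blast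
      have xp: "(x, p) \<in> darts D" using xy p by simp
      obtain q where q: "arc_end D (x, p) = (y, q)" using p(2) by (cases "arc_end D (x, p)") auto
      have yq: "(y, q) \<in> darts D" using \<alpha>_in[OF xp] q by simp
      have "((x, p), (y, q)) \<in> ?L" using xp yq q by (intro generated_equiv_base) auto
      moreover have "((x, 0), (x, p)) \<in> ?L" "((y, q), (y, 0)) \<in> ?L" using at xp yq by auto
      ultimately have "((x, 0), (y, 0)) \<in> ?L" by (meson generated_equiv_trans)
      then show "(x, y) \<in> ?Q" using xy by simp
    qed
    moreover assume "(fst d, fst e) \<in> ?E'"
    ultimately have "((fst d, 0), (fst e, 0)) \<in> ?L" by blast
    moreover have "(d, (fst d, 0)) \<in> ?L" "((fst e, 0), e) \<in> ?L"
      using at[of "fst d" "snd d" 0] at[of "fst e" 0 "snd e"] dartD[OF de(1)] dartD[OF de(2)] by auto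
    ultimately show "(d, e) \<in> ?L" by (meson generated_equiv_trans)
  qed
  show ?thesis
    unfolding graph_components_def gen_classes_def
  proof (rule card_quotient_image[OF equiv_generated_equiv equiv_generated_equiv _ iff])
    show "fst ` darts D = {..<ncr D}" by (rule fst_image_darts)
  qed auto
qed

text \<open>Planarity in disguise: the formula in \<open>link_diagram\<close> has
  \<open>V = ncr D\<close> and \<open>E = 2 * ncr D\<close>, hence \<open>V + F - 2 C = E\<close>
  for \<open>C\<close> components.\<close>

lemma euler_count_rot: "euler_count (darts D) (arc_end D) rot = 2 * int (ncr D)"
proof -
  have "class_count (graph_of (rot \<circ> arc_end D)) (darts D) = card (face_walks D)"
    by (simp add: face_walks_def)
  then show ?thesis
    using link unfolding euler_count_def orbit_count_rot component_count_rot link_diagram_def by simp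
qed

text \<open>With \<open>n\<close> crossings there are \<open>4 * n\<close> vertices of one dart
  each, and the \<open>2 * n\<close> arcs are at once the faces and the components, so the count is
  \<open>4 * n + 2 * n - 4 * n\<close>.\<close>

lemma euler_count_id: "euler_count (darts D) (arc_end D) id = 2 * int (ncr D)"
proof -
  have g: "generated_equiv (\<lambda>x y. y = id x \<or> Q x y) (darts D) = generated_equiv Q (darts D)" for Q
    by (rule generated_equiv_eqI) (auto intro: generated_equiv_base generated_equiv_refl)
  have "generated_equiv (graph_of id) (darts D) = Id_on (darts D)"
  proof
    show "generated_equiv (graph_of id) (darts D) \<subseteq> Id_on (darts D)"
      by (rule generated_equiv_least) (auto intro!: equivI simp: refl_on_def sym_def trans_def)
  qed (auto intro: generated_equiv_refl)
  then have "gen_classes (graph_of id) (darts D) = (\<lambda>x. {x}) ` darts D"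
    by (auto simp: gen_classes_def quotient_def)
  then have "class_count (graph_of id) (darts D) = 4 * ncr D"
    using card_darts by (simp add: card_image)
  moreover have "2 * class_count (graph_of (arc_end D)) (darts D) = 4 * ncr D"
    using arc_involution_count[OF arc_involution_axioms] card_darts by simp
  moreover have "class_count (\<lambda>x y. y = id x \<or> y = arc_end D x) (darts D) = class_count (graph_of (arc_end D)) (darts D)"
    using g[of "graph_of (arc_end D)"] by (simp add: gen_classes_def)
  ultimately show ?thesis by (simp add: euler_count_def)
qed

lemma euler_count_remove:
  assumes "x \<in> X" "x < ncr D"
  shows "euler_count (darts D) (arc_end D) (resolve s X) \<le> euler_count (darts D) (arc_end D) (resolve s (X - {x}))"
proof -
  have f: "fork (s x) + 2 < 4" by (cases "s x") auto
  show ?thesis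
    unfolding resolve_remove[OF assms(1)]
    by (rule euler_count_split(1)[OF bij_resolve]) (use assms f rot_same_orbit in auto)
qed

text \<open>Every partial smoothing lies between the full rotation and the identity in a chain of
  splittings that never lowers the count, and both extremes have the same value. So planarity is
  preserved.\<close>

lemma euler_count_resolve:
  assumes "X \<subseteq> {..<ncr D}"
  shows "euler_count (darts D) (arc_end D) (resolve s X) = 2 * int (ncr D)"
proof (rule antisym)
  show "euler_count (darts D) (arc_end D) (resolve s X) \<le> 2 * int (ncr D)"
    using euler_count_le_id[OF bij_resolve] euler_count_id by simp
  have "2 * int (ncr D) \<le> euler_count (darts D) (arc_end D) (resolve s ({..<ncr D} - Y))"
    if "finite Y" "Y \<subseteq> {..<ncr D}" for Y
    using that
  proof (induction Y rule: finite_induct)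
    case empty
    have full: "resolve s {..<ncr D} d = rot d" if "d \<in> darts D" for d
      using dartD[OF that] by (simp add: resolve_def)
    have full': "(resolve s {..<ncr D} \<circ> arc_end D) d = (rot \<circ> arc_end D) d" if "d \<in> darts D" for d
      using full[OF \<alpha>_in[OF that]] by simp
    have "euler_count (darts D) (arc_end D) (resolve s {..<ncr D}) = euler_count (darts D) (arc_end D) rot"
      unfolding euler_count_def gen_classes_def
      using generated_equiv_graph_cong(1)[OF full] generated_equiv_graph_cong(2)[OF full, where Q = "graph_of (arc_end D)"]
        generated_equiv_graph_cong(1)[OF full'] by simp
    then show ?case using euler_count_rot by simp
  next
    case (insert x Y)
    have "{..<ncr D} - insert x Y = ({..<ncr D} - Y) - {x}" by blast
    then show ?case
      using insert euler_count_remove[of x "{..<ncr D} - Y" s] by auto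
  qed
  from this[of "{..<ncr D} - X"] assms
  show "2 * int (ncr D) \<le> euler_count (darts D) (arc_end D) (resolve s X)"
    by (simp add: double_diff)
qed

text \<open>The equality case of \<open>euler_count_split\<close>, which plays the part of the
  Jordan curve theorem: a face that meets a vertex at both forked darts is cut through by the
  smoothing, and the component falls apart there.\<close>

lemma face_at_crossing:
  assumes X: "X \<subseteq> {..<ncr D}" "x \<in> X"
    and face: "((x, fork (s x)), (x, fork (s x) + 2)) \<in> generated_equiv (graph_of (resolve s X \<circ> arc_end D)) (darts D)"
  shows "((x, fork (s x)), (x, fork (s x) + 2)) \<notin> linked (resolve s (X - {x}))"
proof -
  have f: "fork (s x) + 2 < 4" by (cases "s x") auto
  have "euler_count (darts D) (arc_end D) (resolve s (X - {x})) = euler_count (darts D) (arc_end D) (resolve s X)"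
    using X by (subst (1 2) euler_count_resolve) auto
  then show ?thesis
    unfolding resolve_remove[OF X(2)]
    by (intro euler_count_split(2)[OF bij_resolve _ _ _ _ _ face]) (use X f rot_same_orbit in auto)
qed

text \<open>A smoothed crossing contributes two arcs, a kept one a single vertex.\<close>

lemma vertex_count_resolve:
  assumes "X \<subseteq> {..<ncr D}"
  shows "class_count (graph_of (resolve s X)) (darts D) + card X = 2 * ncr D"
proof -
  have "finite X" using assms finite_subset by blast
  then show ?thesis using assms
  proof (induction X rule: finite_induct)
    case empty
    have "generated_equiv (graph_of (resolve s {})) (darts D) = generated_equiv (graph_of (smooth s)) (darts D)"
      by (rule generated_equiv_eqI) (auto simp: resolve_empty intro!: generated_equiv_base dest: dartD)
    then show ?case
      using arc_involution_count[OF arc_involution_smooth] card_darts by (simp add: gen_classes_def)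
  next
    case (insert x X)
    have f: "fork (s x) + 2 < 4" by (cases "s x") auto
    have rm: "resolve s X = exchange (x, fork (s x)) (x, fork (s x) + 2) \<circ> resolve s (insert x X)"
      using resolve_remove[of x "insert x X" s] insert by simp
    have "((x, fork (s x)), (x, fork (s x) + 2)) \<in> generated_equiv (graph_of (resolve s (insert x X))) (darts D)"
      using rot_same_orbit f insert by auto
    then have "int (class_count (graph_of (resolve s X)) (darts D)) = int (class_count (graph_of (resolve s (insert x X))) (darts D)) + 1"
      unfolding rm using orbit_count_transpose[OF finite_darts bij_resolve, of "(x, fork (s x))" "(x, fork (s x) + 2)" s "insert x X"] insert f
      by auto
    then show ?case using insert by simp
  qed
qed

end

section \<open>Counting the circles of a state\<close>

definition state_of :: "diagram \<Rightarrow> nat set \<Rightarrow> state" where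
  "state_of D B = (\<lambda>x\<in>{..<ncr D}. if x \<in> B then LabelB else LabelA)"

lemma state_of_empty: "state_of D {} = state_A D"
  by (simp add: state_of_def state_A_def)

lemma label_cases: "l \<noteq> LabelA \<Longrightarrow> l = LabelB"
  by (cases l) auto

context plane_diagram begin

abbreviation "circ s \<equiv> linked (smooth s)"
abbreviation "sA \<equiv> state_A D"

lemma dart_circles_eq: "dart_circles D s = gen_classes (\<lambda>d e. e = smooth s d \<or> e = arc_end D d) (darts D)"
  unfolding dart_circles_def smooth_def by (subst disj_commute) (rule refl)

lemma finite_dart_circles: "finite (dart_circles D s)"
  unfolding dart_circles_eq by (rule finite_gen_classes[OF finite_darts])

lemma smooth_A:
  assumes "x < ncr D" "s x = LabelA"
  shows "smooth s (x, 0) = (x, 1)" "smooth s (x, 1) = (x, 0)" "smooth s (x, 2) = (x, 3)" "smooth s (x, 3) = (x, 2)"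
  using assms by (simp_all add: smooth_def)

lemma smooth_B:
  assumes "x < ncr D" "s x = LabelB"
  shows "smooth s (x, 1) = (x, 2)" "smooth s (x, 2) = (x, 1)" "smooth s (x, 3) = (x, 0)" "smooth s (x, 0) = (x, 3)"
  using assms by (simp_all add: smooth_def)

lemma pair_at_crossing:
  assumes "fst d = x" "fst e = x" "d \<in> darts D" "e \<in> darts D"
    and "\<And>p q. p < 4 \<Longrightarrow> q < 4 \<Longrightarrow> ((x, p), (x, q)) \<in> E"
  shows "(d, e) \<in> E"
  using assms dartD[of d] dartD[of e] by (cases d; cases e) simp

lemma circ_smooth: "d \<in> darts D \<Longrightarrow> (d, smooth s d) \<in> circ s"
  by (rule generated_equiv_base) (auto simp: arc_involution.\<alpha>_in[OF arc_involution_smooth])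

lemma circ_arc: "d \<in> darts D \<Longrightarrow> (d, arc_end D d) \<in> circ s"
  by (rule generated_equiv_base) (auto intro: \<alpha>_in)

lemma circ_A:
  assumes "x < ncr D" "s x = LabelA"
  shows "((x, 0), (x, 1)) \<in> circ s" "((x, 2), (x, 3)) \<in> circ s"
  using circ_smooth[of "(x, 0)" s] circ_smooth[of "(x, 2)" s] assms smooth_A[of x s] by auto

lemma circ_B:
  assumes "x < ncr D" "s x = LabelB"
  shows "((x, 1), (x, 2)) \<in> circ s" "((x, 3), (x, 0)) \<in> circ s"
  using circ_smooth[of "(x, 1)" s] circ_smooth[of "(x, 3)" s] assms smooth_B[of x s] by auto

text \<open>If a circle passes a crossing only once, then its two ends there are also connected by the
  rest of the circle, which does not see how this crossing is smoothed.\<close>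

lemma detour:
  assumes d: "d \<in> darts D"
    and once: "\<And>p. p < 4 \<Longrightarrow> (d, (fst d, p)) \<in> circ s \<Longrightarrow> (fst d, p) = d \<or> (fst d, p) = smooth s d"
    and agree: "\<And>y. y < ncr D \<Longrightarrow> y \<noteq> fst d \<Longrightarrow> s y = t y"
  shows "(d, smooth s d) \<in> circ t"
proof -
  interpret I: arc_involutions "darts D" "arc_end D" "smooth s" by (rule arc_involutions_smooth)
  obtain P where P: "I.alternating P" using I.exists_alternating by blast
  obtain n where n: "n > 0" "(I.turn ^^ n) d = d" "\<forall>j. 0 < j \<and> j < n \<longrightarrow> (I.turn ^^ j) d \<noteq> d \<and> (I.turn ^^ j) d \<noteq> d"
    by (rule first_hit[OF finite_darts I.bij_turn d disjI1[OF refl]])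
  have S: "(I.turn ^^ j) d \<in> darts D" for j using funpow_in[OF I.bij_turn d] .
  have sc: "(d, (I.turn ^^ j) d) \<in> I.same_cycle" for j
    using same_orbit_iff[OF finite_darts I.bij_turn d] by blast
  have avoid: "fst ((I.turn ^^ j) d) \<noteq> fst d" if "0 < j" "j < n" for j
  proof
    assume eq: "fst ((I.turn ^^ j) d) = fst d"
    let ?e = "(I.turn ^^ j) d"
    have "?e = (fst d, snd ?e)" by (metis eq prod.collapse)
    moreover have "(d, ?e) \<in> circ s" using sc I.same_cycle_subset_linked by blast
    ultimately have "?e = d \<or> ?e = smooth s d"
      using once[of "snd ?e"] dartD[OF S[of j]] by metis
    moreover have "?e \<noteq> d" using n(3) that by blast
    moreover have "?e \<noteq> smooth s d"
      using I.alternating_same_cycle[OF P sc[of j]] P d unfolding I.alternating_def by metis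
    ultimately show False by blast
  qed
  have walk: "(d, (I.turn ^^ j) d) \<in> circ t" if "j < n" for j
    using that
  proof (induction j)
    case 0
    then show ?case using d by (simp add: generated_equiv_refl)
  next
    case (Suc j)
    let ?e = "(I.turn ^^ j) d"
    have "fst (arc_end D ?e) \<noteq> fst d" using avoid[of "Suc j"] Suc.prems by simp
    then have "smooth s (arc_end D ?e) = smooth t (arc_end D ?e)"
      using agree[of "fst (arc_end D ?e)"] dartD[OF \<alpha>_in[OF S[of j]]] by (simp add: smooth_def)
    then have "(arc_end D ?e, (I.turn ^^ Suc j) d) \<in> circ t"
      using circ_smooth[OF \<alpha>_in[OF S[of j]], of t] by simp
    then show ?case
      using Suc circ_arc[OF S[of j], of t] by (meson Suc_lessD generated_equiv_trans)
  qed
  obtain m where m: "n = Suc m" using n(1) gr0_implies_Suc by blast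
  let ?e = "(I.turn ^^ m) d"
  have "smooth s (arc_end D ?e) = d" using n(2) m by simp
  then have "arc_end D ?e = smooth s d"
    using I.B.\<alpha>_\<alpha>[OF \<alpha>_in[OF S[of m]]] by metis
  moreover have "m < n" using m by simp
  from generated_equiv_trans[OF walk[OF this] circ_arc[OF S[of m]]]
  have "(d, arc_end D ?e) \<in> circ t" .
  ultimately show ?thesis by simp
qed

lemma at_crossing_connected:
  assumes x: "x < ncr D" and E: "equiv (darts D) E"
    and "((x, 0), (x, 1)) \<in> E" "((x, 2), (x, 3)) \<in> E" "((x, 1), (x, 2)) \<in> E"
    and p: "p < 4" "q < 4"
  shows "((x, p), (x, q)) \<in> E"
proof -
  have s: "(v, u) \<in> E" if "(u, v) \<in> E" for u v using E that by (meson equivE symE)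
  have t: "(u, w) \<in> E" if "(u, v) \<in> E" "(v, w) \<in> E" for u v w using E that by (meson equivE transE)
  have r: "((x, r), (x, r)) \<in> E" if "r < 4" for r using E that x by (meson dart_iff equivE refl_onD)
  note e02 = t[OF assms(3,5)]
  note e03 = t[OF e02 assms(4)]
  have z: "((x, 0), (x, r)) \<in> E" if "r < 4" for r
    by (rule less_4_cases[OF that]; hypsubst; rule r[OF zero_less_numeral] assms(3) e02 e03)
  show ?thesis by (rule t[OF s[OF z[OF p(1)]] z[OF p(2)]])
qed

context
  fixes s t :: state and x :: nat
  assumes x: "x < ncr D" and sx: "s x = LabelA" and tx: "t x = LabelB"
    and off: "\<And>y. y < ncr D \<Longrightarrow> y \<noteq> x \<Longrightarrow> s y = t y"
begin

text \<open>Two different circles meeting at \<open>x\<close> are merged by changing the label. That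
  the new state still joins the former partners 0, 1 and 2, 3 is the content of
  \<open>detour\<close>: each of the two circles passes \<open>x\<close> only once.\<close>

lemma linked_flip:
  assumes n: "((x, 0), (x, 2)) \<notin> circ s"
  shows "circ t = generated_equiv (joined (\<lambda>d e. e = smooth s d \<or> e = arc_end D d) (x, 0) (x, 2)) (darts D)"
    (is "_ = ?J")
proof (rule generated_equiv_eqI)
  have subJ: "circ s \<subseteq> ?J"
    by (rule generated_equiv_mono) (auto simp: joined_def intro: generated_equiv_base)
  have j02: "((x, 0), (x, 2)) \<in> ?J" using x by (intro generated_equiv_base) (auto simp: joined_def)
  have j01: "((x, 0), (x, 1)) \<in> ?J" "((x, 2), (x, 3)) \<in> ?J" using circ_A[of x s, OF x sx] subJ by auto
  have j12: "((x, 1), (x, 2)) \<in> ?J" using generated_equiv_trans[OF generated_equiv_sym[OF j01(1)] j02] .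
  have J: "((x, p), (x, q)) \<in> ?J" if "p < 4" "q < 4" for p q
    by (rule at_crossing_connected[OF x equiv_generated_equiv j01 j12 that])
  fix d e assume de: "d \<in> darts D" "e \<in> darts D"
  show "(d, e) \<in> ?J" if e: "e = smooth t d \<or> e = arc_end D d"
  proof (cases "e = arc_end D d")
    case True
    then show ?thesis using circ_arc[OF de(1)] subJ by blast
  next
    case False
    then have e: "e = smooth t d" using e by blast
    show ?thesis
    proof (cases "fst d = x")
      case True
      then show ?thesis by (intro pair_at_crossing[OF _ _ de J]) (simp_all add: e)
    next
      case False
      then have "smooth t d = smooth s d" using off[of "fst d"] dartD[OF de(1)] by (simp add: smooth_def)
      then show ?thesis using circ_smooth[OF de(1), of s] subJ e by auto
    qed
  qed
next
  have far: "((x, p), (x, q)) \<notin> circ s" if "p \<in> {0, 1}" "q \<in> {2, 3}" for p q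
  proof
    assume pq: "((x, p), (x, q)) \<in> circ s"
    have "((x, 0), (x, p)) \<in> circ s"
      using that circ_A(1)[of x s, OF x sx] x by (auto intro: generated_equiv_refl)
    moreover have "((x, q), (x, 2)) \<in> circ s"
      using that circ_A(2)[of x s, OF x sx] x by (auto intro: generated_equiv_refl generated_equiv_sym)
    ultimately show False using n generated_equiv_trans[OF generated_equiv_trans[OF _ pq]] by blast
  qed
  have t01: "((x, 0), (x, 1)) \<in> circ t"
    using detour[of "(x, 0)" s t] smooth_A[of x s, OF x sx] x off far[of 0]
    by (force elim!: less_4_cases)
  have t23: "((x, 2), (x, 3)) \<in> circ t"
    using detour[of "(x, 2)" s t] smooth_A[of x s, OF x sx] x off far[of _ 2] generated_equiv_sym
    by (force elim!: less_4_cases)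
  have T: "((x, p), (x, q)) \<in> circ t" if "p < 4" "q < 4" for p q
    by (rule at_crossing_connected[OF x equiv_generated_equiv t01 t23 circ_B(1)[of x t, OF x tx] that])
  fix d e assume de: "d \<in> darts D" "e \<in> darts D"
  show "(d, e) \<in> circ t"
    if j: "joined (\<lambda>d e. e = smooth s d \<or> e = arc_end D d) (x, 0) (x, 2) d e"
  proof (cases "fst d = x \<and> fst e = x")
    case True
    then show ?thesis by (intro pair_at_crossing[OF _ _ de T]) simp_all
  next
    case False
    then have "e = arc_end D d \<or> e = smooth s d \<and> fst d \<noteq> x" using j by (auto simp: joined_def)
    then show ?thesis
    proof
      assume e: "e = smooth s d \<and> fst d \<noteq> x"
      then have "smooth t d = smooth s d" using off[of "fst d"] dartD[OF de(1)] by (simp add: smooth_def)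
      then show ?thesis using circ_smooth[OF de(1), of t] e by simp
    qed (use circ_arc[OF de(1)] in simp)
  qed
qed

lemma dart_circles_flip:
  assumes n: "((x, 0), (x, 2)) \<notin> circ s"
  shows "dart_circles D t = insert (circ s `` {(x, 0)} \<union> circ s `` {(x, 2)})
           (dart_circles D s - {circ s `` {(x, 0)}, circ s `` {(x, 2)}})"
    and "card (dart_circles D s) = Suc (card (dart_circles D t))"
proof -
  have e: "dart_circles D t = gen_classes (joined (\<lambda>d e. e = smooth s d \<or> e = arc_end D d) (x, 0) (x, 2)) (darts D)"
    unfolding dart_circles_eq gen_classes_def linked_flip[OF n] ..
  show "dart_circles D t = insert (circ s `` {(x, 0)} \<union> circ s `` {(x, 2)})
           (dart_circles D s - {circ s `` {(x, 0)}, circ s `` {(x, 2)}})"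
    unfolding e unfolding dart_circles_eq by (rule gen_classes_joined) (use x n in auto)
  show "card (dart_circles D s) = Suc (card (dart_circles D t))"
    unfolding e unfolding dart_circles_eq
    using class_count_joined[OF finite_darts, of "(x, 0)" "(x, 2)" "\<lambda>d e. e = smooth s d \<or> e = arc_end D d"] x n by simp
qed

text \<open>Joining one further pair of darts at \<open>x\<close> connects all four darts in either
  state, 0 with 2 for the A-label and 0 with 1 for the B-label, and then the two relations coincide.
  Each join lowers the count by at most one.\<close>

lemma card_dart_circles_flip_le: "card (dart_circles D t) \<le> Suc (card (dart_circles D s))"
proof -
  let ?Rs = "\<lambda>d e. e = smooth s d \<or> e = arc_end D d" and ?Rt = "\<lambda>d e. e = smooth t d \<or> e = arc_end D d"
  let ?Js = "generated_equiv (joined ?Rs (x, 0) (x, 2)) (darts D)"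
  let ?Jt = "generated_equiv (joined ?Rt (x, 0) (x, 1)) (darts D)"
  have subs: "circ s \<subseteq> ?Js" "circ t \<subseteq> ?Jt"
    by (rule generated_equiv_mono; auto simp: joined_def intro: generated_equiv_base)+
  have s02: "((x, 0), (x, 2)) \<in> ?Js" and t01: "((x, 0), (x, 1)) \<in> ?Jt"
    using x by (auto intro!: generated_equiv_base simp: joined_def)
  have s01: "((x, 0), (x, 1)) \<in> ?Js" "((x, 2), (x, 3)) \<in> ?Js" using circ_A[of x s, OF x sx] subs by auto
  have s12: "((x, 1), (x, 2)) \<in> ?Js" using generated_equiv_trans[OF generated_equiv_sym[OF s01(1)] s02] .
  have t12: "((x, 1), (x, 2)) \<in> ?Jt" "((x, 3), (x, 0)) \<in> ?Jt" using circ_B[of x t, OF x tx] subs by auto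
  have t23: "((x, 2), (x, 3)) \<in> ?Jt"
    using t12 t01 by (meson generated_equiv_sym generated_equiv_trans)
  have Js: "((x, p), (x, q)) \<in> ?Js" if "p < 4" "q < 4" for p q
    by (rule at_crossing_connected[OF x equiv_generated_equiv s01 s12 that])
  have Jt: "((x, p), (x, q)) \<in> ?Jt" if "p < 4" "q < 4" for p q
    by (rule at_crossing_connected[OF x equiv_generated_equiv t01 t23 t12(1) that])
  have off_eq: "smooth t d = smooth s d" if "d \<in> darts D" "fst d \<noteq> x" for d
    using off[of "fst d"] dartD[OF that(1)] that(2) by (simp add: smooth_def)
  have gen: "(d, e) \<in> E" if "d \<in> darts D" "e \<in> darts D" and j: "joined (\<lambda>d e. e = smooth u d \<or> e = arc_end D d) (x, 0) (x, r) d e"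
      and at: "\<And>p q. p < 4 \<Longrightarrow> q < 4 \<Longrightarrow> ((x, p), (x, q)) \<in> E"
      and uv: "\<And>d. d \<in> darts D \<Longrightarrow> fst d \<noteq> x \<Longrightarrow> smooth u d = smooth v d" and cE: "circ v \<subseteq> E" for d e E u v r
  proof (cases "fst d = x \<and> fst e = x")
    case True
    then show ?thesis by (intro pair_at_crossing[OF _ _ that(1,2) at]) simp_all
  next
    case False
    then have "e = arc_end D d \<or> e = smooth u d \<and> fst d \<noteq> x" using j by (auto simp: joined_def)
    then show ?thesis
    proof
      assume "e = smooth u d \<and> fst d \<noteq> x"
      then show ?thesis using uv[OF that(1)] circ_smooth[OF that(1), of v] cE by auto
    qed (use circ_arc[OF that(1), of v] cE in auto)
  qed
  have "?Js = ?Jt"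
  proof (rule generated_equiv_eqI)
    fix d e assume de: "d \<in> darts D" "e \<in> darts D"
    show "(d, e) \<in> ?Jt" if "joined ?Rs (x, 0) (x, 2) d e"
      by (rule gen[OF de that Jt _ subs(2)]) (use off_eq in auto)
    show "(d, e) \<in> ?Js" if "joined ?Rt (x, 0) (x, 1) d e"
      by (rule gen[OF de that Js _ subs(1)]) (use off_eq in auto)
  qed
  then have "class_count (joined ?Rs (x, 0) (x, 2)) (darts D) = class_count (joined ?Rt (x, 0) (x, 1)) (darts D)"
    by (simp add: gen_classes_def)
  then show ?thesis
    unfolding dart_circles_eq
    using class_count_joined[OF finite_darts, of "(x, 0)" "(x, 2)" ?Rs] class_count_joined[OF finite_darts, of "(x, 0)" "(x, 1)" ?Rt] x
    by (auto split: if_splits)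
qed

end

lemma sA_label [simp]: "x < ncr D \<Longrightarrow> sA x = LabelA"
  by (simp add: state_A_def)

lemma ends_eq:
  assumes x: "x < ncr D"
  shows "ends (state_graph_A D) x = {Inl (circ sA `` {(x, 0)}), Inl (circ sA `` {(x, 2)})}"
proof -
  have c: "circ sA `` {(x, 1)} = circ sA `` {(x, 0)}" "circ sA `` {(x, 3)} = circ sA `` {(x, 2)}"
    using circ_A[of x sA] x generated_equiv_class_eq_iff[of _ "darts D"] by (auto simp: generated_equiv_sym)
  have "C \<in> dart_circles D sA \<and> C \<inter> {(x, 0), (x, 1), (x, 2), (x, 3)} \<noteq> {} \<longleftrightarrow>
        C = circ sA `` {(x, 0)} \<or> C = circ sA `` {(x, 2)}" for C
  proof
    assume C: "C \<in> dart_circles D sA \<and> C \<inter> {(x, 0), (x, 1), (x, 2), (x, 3)} \<noteq> {}"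
    then obtain d where d: "C = circ sA `` {d}" unfolding dart_circles_eq gen_classes_def quotient_def by blast
    from C obtain e where e: "e \<in> C" "e \<in> {(x, 0), (x, 1), (x, 2), (x, 3)}" by blast
    have "(d, e) \<in> circ sA" using e(1) d by simp
    then have C: "C = circ sA `` {e}" unfolding d by (rule equiv_class_eq[OF equiv_generated_equiv])
    have "e = (x, 0) \<or> e = (x, 1) \<or> e = (x, 2) \<or> e = (x, 3)" using e(2) by simp
    then show "C = circ sA `` {(x, 0)} \<or> C = circ sA `` {(x, 2)}"
      using C c by (elim disjE) simp_all
  next
    assume *: "C = circ sA `` {(x, 0)} \<or> C = circ sA `` {(x, 2)}"
    then have "C \<in> dart_circles D sA"
      unfolding dart_circles_eq gen_classes_def using x by (auto intro: quotientI)
    moreover have "(x, 0) \<in> circ sA `` {(x, 0)}" "(x, 2) \<in> circ sA `` {(x, 2)}"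
      using x by (auto intro: generated_equiv_refl)
    ultimately show "C \<in> dart_circles D sA \<and> C \<inter> {(x, 0), (x, 1), (x, 2), (x, 3)} \<noteq> {}" using * by blast
  qed
  then show ?thesis by (auto simp: state_graph_A_def)
qed

lemma edges_eq: "edges (state_graph_A D) = {..<ncr D}"
  by (simp add: state_graph_A_def)

abbreviation "par \<equiv> parallel (state_graph_A D)"

lemma parallel_connected:
  assumes "x < ncr D" "y < ncr D" "par x y"
  shows "((x, 0), (y, 0)) \<in> circ sA \<and> ((x, 2), (y, 2)) \<in> circ sA \<or> ((x, 0), (y, 2)) \<in> circ sA \<and> ((x, 2), (y, 0)) \<in> circ sA"
proof -
  have iff: "circ sA `` {(x, p)} = circ sA `` {(y, q)} \<longleftrightarrow> ((x, p), (y, q)) \<in> circ sA" if "p < 4" "q < 4" for p q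
    using assms that by (intro generated_equiv_class_eq_iff) auto
  have "{circ sA `` {(x, 0)}, circ sA `` {(x, 2)}} = {circ sA `` {(y, 0)}, circ sA `` {(y, 2)}}"
    using assms(3) unfolding parallel_def ends_eq[OF assms(1)] ends_eq[OF assms(2)]
    by (auto simp: doubleton_eq_iff)
  then show ?thesis using iff by (auto simp: doubleton_eq_iff)
qed

end

locale adequate_diagram = plane_diagram +
  assumes adequate: "A_adequate D"
begin

lemma ends_distinct:
  assumes x: "x < ncr D"
  shows "((x, 0), (x, 2)) \<notin> circ sA"
proof
  assume "((x, 0), (x, 2)) \<in> circ sA"
  then have "circ sA `` {(x, 0)} = circ sA `` {(x, 2)}"
    by (rule equiv_class_eq[OF equiv_generated_equiv])
  then have "loop_edge (state_graph_A D) x"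
    unfolding loop_edge_def ends_eq[OF x] by auto
  then show False using adequate x by (auto simp: A_adequate_def edges_eq)
qed

text \<open>By adequacy the two arcs at a crossing belong to different circles, so a circle of
  \<open>s_A\<close> meets a crossing in at most one smoothing arc.\<close>

lemma near:
  assumes "x < ncr D" "p < 4" "q < 4" "((x, p), (x, q)) \<in> circ sA"
  shows "q = p \<or> (x, q) = smooth sA (x, p)"
proof -
  note n = ends_distinct[OF assms(1)] and c = circ_A[of x sA, OF assms(1) sA_label[OF assms(1)]]
    and sm = smooth_A[of x sA, OF assms(1) sA_label[OF assms(1)]]
  have far: "\<not> (a \<in> {0, 1} \<and> b \<in> {2, 3})" if "((x, a), (x, b)) \<in> circ sA" for a b
  proof
    assume ab: "a \<in> {0, 1} \<and> b \<in> {2, 3}"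
    have "((x, 0), (x, a)) \<in> circ sA" "((x, b), (x, 2)) \<in> circ sA"
      using ab c assms(1) by (auto intro: generated_equiv_refl generated_equiv_sym)
    then show False using n generated_equiv_trans[OF generated_equiv_trans[OF _ that]] by blast
  qed
  show ?thesis
    using far[OF assms(4)] far[OF generated_equiv_sym[OF assms(4)]] assms(2,3) sm
    by (elim less_4_cases) auto
qed

text \<open>Keeping a crossing as a vertex joins all four of its darts, so it connects at least as
  much as smoothing it.\<close>

lemma circ_sA_subset_resolve: "circ sA \<subseteq> linked (resolve sA X)"
proof (rule generated_equiv_mono)
  fix d e assume de: "d \<in> darts D" "e \<in> darts D" "e = smooth sA d \<or> e = arc_end D d"
  show "(d, e) \<in> linked (resolve sA X)"
  proof (cases "e = arc_end D d")
    case True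
    then show ?thesis using de by (intro generated_equiv_base) auto
  next
    case False
    then have e: "e = smooth sA d" using de by blast
    show ?thesis
    proof (cases "fst d \<in> X")
      case True
      have lt: "fst d < ncr D" using dartD[OF de(1)] by simp
      show ?thesis by (rule pair_at_crossing[OF _ _ de(1,2) rot_linked[OF True lt]]) (simp_all add: e)
    next
      case False
      then have "resolve sA X d = e" using e resolve_notin dartD[OF de(1)] by simp
      then show ?thesis using de by (intro generated_equiv_base) auto
    qed
  qed
qed

text \<open>Along a common circle, two parallel chords attach on the same side. Otherwise, keeping just
  these two crossings as vertices, the face walk along the circle passes both corners of the
  A-smoothing at the second crossing, so by planarity this smoothing would disconnect the two
  circles, which still touch at the first crossing.\<close>

lemma parallel_sides:
  assumes x: "x1 < ncr D" "x2 < ncr D" "x1 \<noteq> x2" and par: "par x1 x2"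
    and P: "arc_involutions.alternating (darts D) (arc_end D) (smooth sA) P"
    and p: "p1 < 4" "p2 < 4" "odd p1" "even p2"
    and same: "((x1, p1), (x2, p2)) \<in> circ sA" and Peq: "P (x1, p1) = P (x2, p2)"
  shows False
proof -
  interpret I: arc_involutions "darts D" "arc_end D" "smooth sA" by (rule arc_involutions_smooth)
  let ?d1 = "(x1, p1)" and ?d2 = "(x2, p2)" and ?X = "{x1, x2}"
  let ?f = "resolve sA ?X \<circ> arc_end D"
  let ?F = "generated_equiv (graph_of ?f) (darts D)"
  have d: "?d1 \<in> darts D" "?d2 \<in> darts D" using x p by auto
  have cyc: "(?d1, ?d2) \<in> I.same_cycle" by (rule I.alternating_linked[OF P same Peq])
  have bijf: "bij_betw ?f (darts D) (darts D)" by (rule bij_comp_\<alpha>[OF bij_resolve])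
  \<comment> \<open>The face walk and \<open>turn\<close> differ only at the two kept crossings, so
    from \<open>u\<close> they coincide up to the arc that leads into the crossing of
    \<open>v\<close>.\<close>
  have reach: "\<exists>e. (u, e) \<in> ?F \<and> e \<in> darts D \<and> arc_end D e = smooth sA v"
    if u: "u \<in> darts D" "v \<in> darts D" "fst u \<in> ?X" "fst v \<in> ?X" "fst u \<noteq> fst v" and uv: "(u, v) \<in> I.same_cycle" for u v
  proof -
    obtain n where n: "n > 0" "(I.turn ^^ n) u = v" "\<forall>j. 0 < j \<and> j < n \<longrightarrow> (I.turn ^^ j) u \<noteq> v \<and> (I.turn ^^ j) u \<noteq> u"
      by (rule first_hit[OF finite_darts I.bij_turn u(1) disjI2[OF uv]])
    have S: "(I.turn ^^ j) u \<in> darts D" for j using funpow_in[OF I.bij_turn u(1)] .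
    have sc: "(u, (I.turn ^^ j) u) \<in> I.same_cycle" for j
      using same_orbit_iff[OF finite_darts I.bij_turn u(1)] by blast
    \<comment> \<open>In a fixed direction a circle meets a crossing at one dart only: the other
      dart of this circle at the crossing has the opposite colour.\<close>
    have hit: "w = (I.turn ^^ j) u" if w: "w \<in> darts D" "(u, w) \<in> I.same_cycle" and eq: "fst ((I.turn ^^ j) u) = fst w" for w j
    proof -
      let ?e = "(I.turn ^^ j) u"
      have we: "(w, ?e) \<in> I.same_cycle" by (rule generated_equiv_trans[OF generated_equiv_sym[OF w(2)] sc])
      have we': "w = (fst w, snd w)" "?e = (fst w, snd ?e)"
        by (simp_all only: prod_eq_iff fst_conv snd_conv eq)
      have "(w, ?e) \<in> circ sA" by (rule subsetD[OF I.same_cycle_subset_linked we])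
      then have "((fst w, snd w), (fst w, snd ?e)) \<in> circ sA" using we' by simp
      from near[OF _ _ _ this] have "snd ?e = snd w \<or> (fst w, snd ?e) = smooth sA (fst w, snd w)"
        using dartD[OF w(1)] dartD[OF S[of j]] by simp
      then have "?e = w \<or> ?e = smooth sA w" by (simp add: prod_eq_iff eq)
      moreover have "?e \<noteq> smooth sA w"
      proof
        assume "?e = smooth sA w"
        then have "P (smooth sA w) = P w" using I.alternating_same_cycle[OF P we] by simp
        then show False using P w(1) unfolding I.alternating_def by simp
      qed
      ultimately show ?thesis by blast
    qed
    have avoid: "fst ((I.turn ^^ j) u) \<notin> ?X" if j: "0 < j" "j < n" for j
    proof
      assume "fst ((I.turn ^^ j) u) \<in> ?X"
      then have "fst ((I.turn ^^ j) u) = fst u \<or> fst ((I.turn ^^ j) u) = fst v" using u(3-5) by auto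
      then have "(I.turn ^^ j) u = u \<or> (I.turn ^^ j) u = v"
        using hit[of u j] hit[of v j] u uv generated_equiv_refl by metis
      then show False using n(3) j by blast
    qed
    obtain m where m: "n = Suc m" using n(1) gr0_implies_Suc by blast
    have agree: "(?f ^^ m) u = (I.turn ^^ m) u"
    proof (rule funpow_agree)
      fix j assume "j < m"
      then have "fst (arc_end D ((I.turn ^^ j) u)) \<notin> ?X" using avoid[of "Suc j"] m by simp
      then show "?f ((I.turn ^^ j) u) = I.turn ((I.turn ^^ j) u)"
        using resolve_notin[of "arc_end D ((I.turn ^^ j) u)" ?X sA] dartD[OF \<alpha>_in[OF S[of j]]] by simp
    qed
    let ?e = "(I.turn ^^ m) u"
    have "(u, ?e) \<in> ?F" using same_orbit_iff[OF finite_darts bijf u(1)] agree by metis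
    moreover have "smooth sA (arc_end D ?e) = v" using n(2) m by simp
    then have "arc_end D ?e = smooth sA v" using I.B.\<alpha>_\<alpha>[OF \<alpha>_in[OF S[of m]]] by metis
    ultimately show ?thesis using S by blast
  qed
  obtain e where e: "(?d1, e) \<in> ?F" "e \<in> darts D" "arc_end D e = smooth sA ?d2"
    using reach[OF d _ _ _ cyc] x by auto
  obtain e' where e': "(?d2, e') \<in> ?F" "e' \<in> darts D" "arc_end D e' = smooth sA ?d1"
    using reach[OF d(2,1) _ _ _ generated_equiv_sym[OF cyc]] x by auto
  \<comment> \<open>The parities decide how the rotation continues: from the A-partner of an even
    dart it moves on to the dart opposite to that one, whereas from the A-partner of an odd dart it
    returns to that dart.\<close>
  have fe: "?f e = (x2, (p2 + 2) mod 4)"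
    unfolding comp_apply e(3) using p(2,4) x(2)
    by (elim less_4_cases) (simp_all add: resolve_def smooth_def rot_def)
  have fe': "?f e' = ?d1"
    unfolding comp_apply e'(3) using p(1,3) x(1)
    by (elim less_4_cases) (simp_all add: resolve_def smooth_def rot_def)
  have "(e, ?f e) \<in> ?F" "(e', ?f e') \<in> ?F"
    by (rule generated_equiv_base[OF _ bij_betwE[OF bijf, rule_format] refl]; rule e(2) e'(2))+
  then have "(e, (x2, (p2 + 2) mod 4)) \<in> ?F" "(e', ?d1) \<in> ?F" unfolding fe fe' .
  from generated_equiv_trans[OF e'(1) generated_equiv_trans[OF this(2) generated_equiv_trans[OF e(1) this(1)]]]
  have "(?d2, (x2, (p2 + 2) mod 4)) \<in> ?F" .
  moreover have "(p2 = 0 \<and> (p2 + 2) mod 4 = 2) \<or> (p2 = 2 \<and> (p2 + 2) mod 4 = 0)"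
    using p(2,4) by (elim less_4_cases) auto
  ultimately have "((x2, 0), (x2, 2)) \<in> ?F \<or> ((x2, 2), (x2, 0)) \<in> ?F" by metis
  then have "((x2, 0), (x2, 2)) \<in> ?F" by (elim disjE) (simp_all only: generated_equiv_sym)
  moreover have fk: "fork (sA x2) = 0" using x(2) by simp
  ultimately have "((x2, 0), (x2, 2)) \<notin> linked (resolve sA (?X - {x2}))"
    by (intro face_at_crossing[of ?X x2 sA, unfolded fk add_0]) (use x in auto)
  \<comment> \<open>The two circles at \<open>x2\<close> are also the two circles at
    \<open>x1\<close>, which is still a vertex.\<close>
  moreover have "((x2, 0), (x2, 2)) \<in> linked (resolve sA (?X - {x2}))"
  proof -
    have "((x1, 0), (x1, 2)) \<in> linked (resolve sA (?X - {x2}))"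
      using rot_linked[of x1 "?X - {x2}" 0 2] x by simp
    note x1L = this and sub = subsetD[OF circ_sA_subset_resolve[of "?X - {x2}"]]
    show ?thesis
      using parallel_connected[OF x(1,2) par]
    proof
      assume "((x1, 0), (x2, 0)) \<in> circ sA \<and> ((x1, 2), (x2, 2)) \<in> circ sA"
      then show ?thesis
        using generated_equiv_trans[OF generated_equiv_sym[OF sub] generated_equiv_trans[OF x1L sub]] by blast
    next
      assume "((x1, 0), (x2, 2)) \<in> circ sA \<and> ((x1, 2), (x2, 0)) \<in> circ sA"
      then show ?thesis
        using generated_equiv_trans[OF generated_equiv_sym[OF sub] generated_equiv_trans[OF generated_equiv_sym[OF x1L] sub]] by blast
    qed
  qed
  ultimately show False by blast
qed

end

context adequate_diagram begin

text \<open>Euler's formula for the plane graph that keeps the crossings of \<open>S\<close>: with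
  \<open>n\<close> crossings and \<open>a\<close> circles of \<open>s_A\<close> there are
  \<open>2 * n - card S\<close> vertices, \<open>a - 1\<close> components because all chords join
  the same pair of circles, and as many faces as circles in the two states together.\<close>

lemma circles_parallel:
  assumes S: "S \<noteq> {}" "S \<subseteq> {..<ncr D}" and par: "\<And>x y. x \<in> S \<Longrightarrow> y \<in> S \<Longrightarrow> par x y"
  shows "card (dart_circles D (state_of D S)) + 2 = card (dart_circles D sA) + card S"
proof -
  let ?sS = "state_of D S"
  interpret I: arc_involutions "darts D" "arc_end D" "smooth sA" by (rule arc_involutions_smooth)
  interpret J: arc_involutions "darts D" "arc_end D" "smooth ?sS" by (rule arc_involutions_smooth)
  obtain x1 where x1: "x1 \<in> S" using S(1) by blast
  have x1c: "x1 < ncr D" using x1 S(2) by blast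
  obtain P where P: "I.alternating P" using I.exists_alternating by blast
  \<comment> \<open>On the circle through the odd dart at \<open>x1\<close>, agreement of colours is
    decided by parity at all chords of \<open>S\<close>; \<open>parallel_sides\<close> excludes the
    opposite placement.\<close>
  have side: "(P (x, p) = P (x1, b)) = odd p"
    if x: "x \<in> S" and p: "p < 4" and b: "b < 4" "odd b" and l: "((x1, b), (x, p)) \<in> circ sA" for x p b
  proof (cases "x = x1")
    case True
    have "p = b \<or> (x1, p) = smooth sA (x1, b)" using near[OF x1c b(1) p] l True by simp
    moreover have "P (smooth sA (x1, b)) \<noteq> P (x1, b)"
      using P x1c b(1) unfolding I.alternating_def by simp
    moreover have "even p" if "(x1, p) = smooth sA (x1, b)"
      using that b x1c by (elim less_4_cases) (auto simp: smooth_def)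
    ultimately show ?thesis using True b(2) by auto
  next
    case False
    have xc: "x < ncr D" using x S(2) by blast
    have no: "P (x1, b) \<noteq> P (x, q)" if "q < 4" "even q" "((x1, b), (x, q)) \<in> circ sA" for q
    proof
      assume "P (x1, b) = P (x, q)"
      from parallel_sides[OF x1c xc _ par[OF x1 x] P b(1) that(1) b(2) that(2,3) this] False show False by simp
    qed
    show ?thesis
    proof (cases "even p")
      case True
      then show ?thesis using no[OF p True l] by simp
    next
      case od: False
      define q where "q = smoothing_arc LabelA p"
      have q: "q < 4" "even q" "smooth sA (x, p) = (x, q)"
        using p od xc unfolding q_def by (elim less_4_cases; simp add: smooth_def)+
      have d: "(x, p) \<in> darts D" using xc p by simp
      have "((x1, b), (x, q)) \<in> circ sA"
        using generated_equiv_trans[OF l circ_smooth[OF d]] q(3) by simp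
      from no[OF q(1,2) this] have "P (x1, b) \<noteq> P (x, q)" .
      moreover have "P (smooth sA (x, p)) \<noteq> P (x, p)" using P d unfolding I.alternating_def by blast
      then have "P (x, q) \<noteq> P (x, p)" unfolding q(3) .
      ultimately show ?thesis using od by auto
    qed
  qed
  define L where "L b d \<longleftrightarrow> ((x1, b), d) \<in> circ sA" for b d
  \<comment> \<open>The direction of each of the two circles is normalized so that the odd darts at
    \<open>S\<close> become the coloured ones; other circles keep their direction.\<close>
  define P' where "P' d \<longleftrightarrow> (if L 1 d then P d = P (x1, 1) else if L 3 d then P d = P (x1, 3) else P d)" for d
  have L: "L b (smooth sA d) = L b d" "L b (arc_end D d) = L b d" if d: "d \<in> darts D" for b d
    using generated_equiv_trans[OF _ circ_smooth[OF d, of sA], of "(x1, b)"]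
      generated_equiv_trans[OF _ generated_equiv_sym[OF circ_smooth[OF d, of sA]], of "(x1, b)"]
      generated_equiv_trans[OF _ circ_arc[OF d, of sA], of "(x1, b)"]
      generated_equiv_trans[OF _ generated_equiv_sym[OF circ_arc[OF d, of sA]], of "(x1, b)"]
    unfolding L_def by blast+
  have P'A: "I.alternating P'"
    using P L unfolding I.alternating_def P'_def by auto
  have P'S: "P' (x, p) = odd p" if x: "x \<in> S" and p: "p < 4" for x p
  proof -
    have xc: "x < ncr D" using x S(2) by blast
    have c: "((x1, 1), (x1, 0)) \<in> circ sA" "((x1, 3), (x1, 2)) \<in> circ sA" "((x, 0), (x, 1)) \<in> circ sA" "((x, 2), (x, 3)) \<in> circ sA"
      using circ_A[of x1 sA, OF x1c] circ_A[of x sA, OF xc] x1c xc by (auto intro: generated_equiv_sym)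
    note tr = generated_equiv_trans[where S = "darts D"]
    have "\<exists>b\<in>{1, 3}. \<exists>r\<in>{0, 2}. ((x1, b), (x, r)) \<in> circ sA \<and> ((x, r), (x, p)) \<in> circ sA"
    proof -
      obtain r where r: "r \<in> {0, 2}" "((x, r), (x, p)) \<in> circ sA"
      proof (cases "p < 2")
        case True
        then have "p = 0 \<or> p = 1" by linarith
        then show thesis using that[of 0] c(3) generated_equiv_refl[of "(x, 0)" "darts D"] xc by auto
      next
        case False
        then have "p = 2 \<or> p = 3" using p by linarith
        then show thesis using that[of 2] c(4) generated_equiv_refl[of "(x, 2)" "darts D"] xc by auto
      qed
      have "((x1, 1), (x, r)) \<in> circ sA \<or> ((x1, 3), (x, r)) \<in> circ sA"
        using parallel_connected[OF x1c xc par[OF x1 x]] tr[OF c(1), of "(x, r)"] tr[OF c(2), of "(x, r)"] r(1) by auto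
      then show ?thesis using r by blast
    qed
    then have "L 1 (x, p) \<or> L 3 (x, p)" unfolding L_def using tr by blast
    then show ?thesis
      using side[OF x p, of 1] side[OF x p, of 3] unfolding P'_def L_def by auto
  qed
  \<comment> \<open>Both smoothings change the parity of a dart, so the normalized colouring
    alternates for the second state too.\<close>
  have swap: "P' (smooth ?sS d) \<noteq> P' d" if d: "d \<in> darts D" for d
  proof (cases "fst d \<in> S")
    case True
    obtain x p where dp: "d = (x, p)" by (cases d)
    have xp: "x \<in> S" "p < 4" "x < ncr D" using True d dp by auto
    have q: "smooth ?sS d = (x, smoothing_arc LabelB p)" using xp dp by (simp add: smooth_def state_of_def)
    have "smoothing_arc LabelB p < 4" "odd (smoothing_arc LabelB p) \<noteq> odd p" using xp(2) by (auto elim!: less_4_cases)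
    then show ?thesis using P'S[OF xp(1,2)] P'S[OF xp(1), of "smoothing_arc LabelB p"] unfolding q by (simp add: dp)
  next
    case False
    then have "smooth ?sS d = smooth sA d" using dartD[OF d] by (simp add: smooth_def state_of_def state_A_def)
    then show ?thesis using P'A d unfolding I.alternating_def by simp
  qed
  have P'B: "J.alternating P'"
    using swap P'A unfolding I.alternating_def J.alternating_def by blast
  then have nP'B: "J.alternating (\<lambda>d. \<not> P' d)" unfolding J.alternating_def by blast
  let ?\<phi> = "resolve sA S \<circ> arc_end D"
  \<comment> \<open>At a kept crossing \<open>rot\<close> raises the index by one, which is the
    A-smoothing on even and the B-smoothing on odd darts. Since the arc reverses the colour, the
    face walk runs along \<open>s_A\<close> from coloured darts and along the other state from the
    rest.\<close>
  have step: "?\<phi> d = (if P' d then smooth sA (arc_end D d) else smooth ?sS (arc_end D d))" if d: "d \<in> darts D" for d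
  proof -
    let ?e = "arc_end D d"
    have e: "?e \<in> darts D" using \<alpha>_in[OF d] .
    have Pe: "P' ?e \<noteq> P' d" using P'A d unfolding I.alternating_def by blast
    show ?thesis
    proof (cases "fst ?e \<in> S")
      case True
      obtain x p where ep: "?e = (x, p)" by (cases ?e)
      have xp: "x \<in> S" "p < 4" "x < ncr D" using True e ep by auto
      have "P' d = even p" using Pe P'S[OF xp(1,2)] ep by auto
      then show ?thesis using xp(2) unfolding comp_def ep
        by (elim less_4_cases) (use xp in \<open>simp_all add: resolve_def rot_def smooth_def state_of_def\<close>)
    next
      case False
      then show ?thesis
        using resolve_notin[of ?e S sA] dartD[OF e] by (simp add: smooth_def state_of_def state_A_def)
    qed
  qed
  have keep: "P' (?\<phi> d) = P' d" if d: "d \<in> darts D" for d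
  proof -
    have e: "arc_end D d \<in> darts D" using \<alpha>_in[OF d] .
    have "P' (arc_end D d) \<noteq> P' d" "P' (smooth sA (arc_end D d)) \<noteq> P' (arc_end D d)"
        "P' (smooth ?sS (arc_end D d)) \<noteq> P' (arc_end D d)"
      using P'A swap[OF e] d e unfolding I.alternating_def by blast+
    then show ?thesis unfolding step[OF d] by auto
  qed
  have "class_count (graph_of ?\<phi>) (darts D) =
      class_count (graph_of ?\<phi>) {d \<in> darts D. P' d} + class_count (graph_of ?\<phi>) {d \<in> darts D. \<not> P' d}"
    by (rule orbit_count_partition[of _ _ P', OF finite_darts bij_comp_\<alpha>[OF bij_resolve] keep])
  moreover have "class_count (graph_of ?\<phi>) {d \<in> darts D. P' d} = card (dart_circles D sA)"
  proof -
    have "generated_equiv (graph_of ?\<phi>) {d \<in> darts D. P' d} = generated_equiv (graph_of I.turn) {d \<in> darts D. P' d}"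
      by (rule generated_equiv_graph_cong(1)) (use step in auto)
    then have "class_count (graph_of ?\<phi>) {d \<in> darts D. P' d} = class_count (graph_of I.turn) {d \<in> darts D. P' d}"
      unfolding gen_classes_def by (simp only:)
    then show ?thesis
      unfolding dart_circles_eq I.component_count_alternating[OF P'A] .
  qed
  moreover have "class_count (graph_of ?\<phi>) {d \<in> darts D. \<not> P' d} = card (dart_circles D ?sS)"
  proof -
    have "generated_equiv (graph_of ?\<phi>) {d \<in> darts D. \<not> P' d} = generated_equiv (graph_of J.turn) {d \<in> darts D. \<not> P' d}"
      by (rule generated_equiv_graph_cong(1)) (use step in auto)
    then have "class_count (graph_of ?\<phi>) {d \<in> darts D. \<not> P' d} = class_count (graph_of J.turn) {d \<in> darts D. \<not> P' d}"
      unfolding gen_classes_def by (simp only:)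
    then show ?thesis
      unfolding dart_circles_eq J.component_count_alternating[OF nP'B] .
  qed
  ultimately have faces: "class_count (graph_of ?\<phi>) (darts D) = card (dart_circles D sA) + card (dart_circles D ?sS)"
    by simp
  let ?R = "\<lambda>d e. e = smooth sA d \<or> e = arc_end D d"
  let ?J = "generated_equiv (joined ?R (x1, 0) (x1, 2)) (darts D)"
  have subJ: "circ sA \<subseteq> ?J"
    by (rule generated_equiv_mono) (auto simp: joined_def intro: generated_equiv_base)
  have J1: "((x1, 0), (x1, 2)) \<in> ?J" using x1c by (intro generated_equiv_base) (auto simp: joined_def)
  have JS: "((x, p), (x, q)) \<in> ?J" if x: "x \<in> S" and pq: "p < 4" "q < 4" for x p q
  proof -
    have xc: "x < ncr D" using x S(2) by blast
    note tr = generated_equiv_trans and sy = generated_equiv_sym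
    have c: "((x, 0), (x, 1)) \<in> ?J" "((x, 2), (x, 3)) \<in> ?J"
      using circ_A[of x sA, OF xc] xc subJ by auto
    have J02: "((x, 0), (x, 2)) \<in> ?J"
      using parallel_connected[OF x1c xc par[OF x1 x]]
    proof
      assume "((x1, 0), (x, 0)) \<in> circ sA \<and> ((x1, 2), (x, 2)) \<in> circ sA"
      then have a: "((x1, 0), (x, 0)) \<in> ?J" "((x1, 2), (x, 2)) \<in> ?J" using subJ by auto
      show ?thesis by (rule tr[OF sy[OF a(1)] tr[OF J1 a(2)]])
    next
      assume "((x1, 0), (x, 2)) \<in> circ sA \<and> ((x1, 2), (x, 0)) \<in> circ sA"
      then have a: "((x1, 0), (x, 2)) \<in> ?J" "((x1, 2), (x, 0)) \<in> ?J" using subJ by auto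
      show ?thesis by (rule tr[OF sy[OF a(2)] tr[OF sy[OF J1] a(1)]])
    qed
    show ?thesis
      by (rule at_crossing_connected[OF xc equiv_generated_equiv c tr[OF sy[OF c(1)] J02] pq])
  qed
  \<comment> \<open>All chords of \<open>S\<close> join the same two circles, so a single one
    already accounts for all connections.\<close>
  have "linked (resolve sA S) = ?J"
  proof (rule generated_equiv_eqI)
    fix d e assume de: "d \<in> darts D" "e \<in> darts D"
    show "(d, e) \<in> ?J" if r: "e = resolve sA S d \<or> e = arc_end D d"
    proof (cases "e = arc_end D d")
      case True
      then show ?thesis using circ_arc[OF de(1)] subJ by blast
    next
      case False
      then have e: "e = resolve sA S d" using r by blast
      show ?thesis
      proof (cases "fst d \<in> S")
        case True
        then have "fst e = fst d" unfolding e by (cases d) (simp add: resolve_def rot_def)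
        then show ?thesis by (intro pair_at_crossing[OF refl _ de JS[OF True]])
      next
        case False
        then have "e = smooth sA d" unfolding e using resolve_notin dartD[OF de(1)] by simp
        then show ?thesis using circ_smooth[OF de(1), of sA] subJ by blast
      qed
    qed
    show "(d, e) \<in> linked (resolve sA S)" if j: "joined ?R (x1, 0) (x1, 2) d e"
    proof (cases "?R d e")
      case True
      then have "(d, e) \<in> circ sA" using de by (intro generated_equiv_base) auto
      then show ?thesis using circ_sA_subset_resolve by blast
    next
      case False
      then have "d = (x1, 0) \<and> e = (x1, 2)" using j by (auto simp: joined_def)
      then show ?thesis using rot_linked[OF x1 x1c, of 0 2 sA] by simp
    qed
  qed
  then have "class_count (\<lambda>d e. e = resolve sA S d \<or> e = arc_end D d) (darts D) = class_count (joined ?R (x1, 0) (x1, 2)) (darts D)"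
    by (simp add: gen_classes_def)
  moreover have "card (dart_circles D sA) = class_count (joined ?R (x1, 0) (x1, 2)) (darts D) + 1"
    unfolding dart_circles_eq
    using class_count_joined[OF finite_darts, of "(x1, 0)" "(x1, 2)" ?R] x1c ends_distinct[OF x1c] by simp
  ultimately show ?thesis
    using euler_count_resolve[OF S(2), of sA] vertex_count_resolve[OF S(2), of sA] faces
    unfolding euler_count_def by simp
qed

lemma circles_insert_le:
  assumes "x \<notin> S" "x < ncr D"
  shows "card (dart_circles D (state_of D (insert x S))) \<le> Suc (card (dart_circles D (state_of D S)))"
  by (rule card_dart_circles_flip_le[OF assms(2)]) (use assms in \<open>auto simp: state_of_def\<close>)

text \<open>Starting from a single crossing, each further change of label creates at most one
  circle.\<close>

lemma circles_bound:
  assumes S: "S \<noteq> {}" "S \<subseteq> {..<ncr D}"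
  shows "card (dart_circles D (state_of D S)) + 2 \<le> card (dart_circles D sA) + card S"
proof -
  have "finite S" using S(2) finite_subset by blast
  then show ?thesis using S
  proof (induction rule: finite_ne_induct)
    case (singleton x)
    then show ?case using circles_parallel[of "{x}"] by (simp add: parallel_def)
  next
    case (insert x F)
    then show ?case using circles_insert_le[of x F] by simp
  qed
qed

text \<open>After the label at \<open>x\<close> has merged two circles, a chord \<open>y\<close> not
  parallel to \<open>x\<close> still joins distinct circles, so the first two changes both merge;
  each later one adds at most one circle.\<close>

lemma circles_bound_not_parallel:
  assumes S: "S \<subseteq> {..<ncr D}" and xy: "x \<in> S" "y \<in> S" and np: "\<not> par x y"
  shows "card (dart_circles D (state_of D S)) + 4 \<le> card (dart_circles D sA) + card S"
proof -
  have x: "x < ncr D" and y: "y < ncr D" using S xy by auto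
  have ne: "x \<noteq> y" using np by (auto simp: parallel_def)
  have fin: "finite T" if "T \<subseteq> {..<ncr D}" for T using that finite_subset by blast
  let ?sx = "state_of D {x}"
  have circ: "circ ?sx = generated_equiv (joined (\<lambda>d e. e = smooth sA d \<or> e = arc_end D d) (x, 0) (x, 2)) (darts D)"
    by (rule linked_flip[OF x _ _ _ ends_distinct[OF x]]) (use x in \<open>auto simp: state_of_def state_A_def\<close>)
  have xd: "(x, 0) \<in> darts D" "(x, 2) \<in> darts D" using x by simp_all
  have "((y, 0), (y, 2)) \<notin> circ ?sx"
  proof
    assume "((y, 0), (y, 2)) \<in> circ ?sx"
    then have "((y, 0), (y, 2)) \<in> circ sA \<or> ((y, 0), (x, 0)) \<in> circ sA \<and> ((x, 2), (y, 2)) \<in> circ sA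
        \<or> ((y, 0), (x, 2)) \<in> circ sA \<and> ((x, 0), (y, 2)) \<in> circ sA"
      unfolding circ generated_equiv_joined_iff[OF xd] .
    then have "circ sA `` {(y, 0)} = circ sA `` {(x, 0)} \<and> circ sA `` {(x, 2)} = circ sA `` {(y, 2)}
        \<or> circ sA `` {(y, 0)} = circ sA `` {(x, 2)} \<and> circ sA `` {(x, 0)} = circ sA `` {(y, 2)}"
      using ends_distinct[OF y] by (elim disjE conjE) (simp_all add: equiv_class_eq[OF equiv_generated_equiv])
    then have "par x y" unfolding parallel_def ends_eq[OF x] ends_eq[OF y] by auto
    then show False using np by simp
  qed
  then have "card (dart_circles D ?sx) = Suc (card (dart_circles D (state_of D {x, y})))"
    by (intro dart_circles_flip(2)[OF y]) (use x y ne in \<open>auto simp: state_of_def\<close>)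
  moreover have "card (dart_circles D ?sx) + 2 = card (dart_circles D sA) + 1"
    using circles_parallel[of "{x}"] x by (simp add: parallel_def)
  ultimately have two: "card (dart_circles D (state_of D {x, y})) + 4 \<le> card (dart_circles D sA) + 2" by simp
  have "finite (S - {x, y})" using fin[OF S] by simp
  moreover have "S - {x, y} \<subseteq> {..<ncr D} - {x, y}" using S by blast
  ultimately have "card (dart_circles D (state_of D ({x, y} \<union> (S - {x, y})))) + 4 \<le> card (dart_circles D sA) + (2 + card (S - {x, y}))"
  proof (induction rule: finite_induct)
    case empty
    then show ?case using two by simp
  next
    case (insert z F)
    then have "z \<notin> {x, y} \<union> F" "z < ncr D" by auto
    from circles_insert_le[OF this] have "card (dart_circles D (state_of D ({x, y} \<union> insert z F))) \<le> Suc (card (dart_circles D (state_of D ({x, y} \<union> F))))"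
      by simp
    then show ?case using insert by simp
  qed
  moreover have "{x, y} \<union> (S - {x, y}) = S" using xy by blast
  moreover have "2 + card (S - {x, y}) = card S"
    using card_Diff_subset[of "{x, y}" S] card_mono[OF fin[OF S], of "{x, y}"] xy ne by auto
  ultimately show ?thesis by simp
qed

end

section \<open>The almost-extreme Khovanov complex\<close>

definition plus_state :: "diagram \<Rightarrow> nat set \<Rightarrow> enhanced_state" where
  "plus_state D B = (state_of D B, \<lambda>C \<in> circles D (state_of D B). 1)"

definition minus_state :: "diagram \<Rightarrow> circle \<Rightarrow> enhanced_state" where
  "minus_state D T = (state_A D, \<lambda>C \<in> circles D (state_A D). if C = T then - 1 else 1)"

definition B_crossings :: "diagram \<Rightarrow> state \<Rightarrow> nat set" where
  "B_crossings D s = {x. x < ncr D \<and> s x = LabelB}"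

lemma B_crossings_subset: "B_crossings D s \<subseteq> {..<ncr D}"
  by (auto simp: B_crossings_def)

lemma finite_subset_crossings: "B \<subseteq> {..<ncr D} \<Longrightarrow> finite B"
  using finite_subset by blast

lemma B_crossings_state_of [simp]: "B \<subseteq> {..<ncr D} \<Longrightarrow> B_crossings D (state_of D B) = B"
  by (auto simp: B_crossings_def state_of_def)

lemma state_of_B_crossings:
  assumes "s \<in> states D"
  shows "state_of D (B_crossings D s) = s"
proof
  fix x
  show "state_of D (B_crossings D s) x = s x"
    using assms by (cases "x < ncr D"; cases "s x")
      (auto simp: state_of_def B_crossings_def states_def PiE_def extensional_def)
qed

lemma state_of_in: "state_of D B \<in> states D"
  by (simp add: states_def state_of_def)

lemma sigma_eq:
  shows "sigma D s = int (ncr D) - 2 * int (card (B_crossings D s))"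
proof -
  let ?A = "{x. x < ncr D \<and> s x = LabelA}"
  have "?A \<union> B_crossings D s = {..<ncr D}"
    by (auto simp: B_crossings_def intro: label_cases)
  moreover have "card (?A \<union> B_crossings D s) = card ?A + card (B_crossings D s)"
    by (intro card_Un_disjoint) (auto simp: B_crossings_def)
  ultimately have "card ?A + card (B_crossings D s) = ncr D" by simp
  then show ?thesis by (simp add: sigma_def B_crossings_def)
qed

context adequate_diagram begin

lemma finite_circles: "finite (circles D s)"
  by (simp add: circles_def finite_dart_circles)

lemma card_circles: "card (circles D s) = card (dart_circles D s) + free_circles D"
proof -
  have "card (circles D s) = card (Inl ` dart_circles D s :: circle set) + card (Inr ` {..<free_circles D} :: circle set)"
    unfolding circles_def by (intro card_Un_disjoint) (auto simp: finite_dart_circles)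
  then show ?thesis by (simp add: card_image)
qed

lemma tau_eq:
  assumes "S \<in> enhanced_states D"
  shows "tau D S = int (card (circles D (fst S))) - 2 * int (card {C \<in> circles D (fst S). snd S C = - 1})"
proof -
  let ?Z = "circles D (fst S)"
  have "snd S C = 1 - 2 * (if snd S C = - 1 then 1 else 0)" if "C \<in> ?Z" for C
    using assms that by (auto simp: enhanced_states_def dest!: PiE_mem)
  then have "tau D S = (\<Sum>C\<in>?Z. 1 - 2 * (if snd S C = - 1 then 1 else 0))"
    unfolding tau_def by (rule sum.cong[OF refl])
  also have "\<dots> = int (card ?Z) - 2 * (\<Sum>C\<in>?Z. if snd S C = - 1 then 1 else 0)"
    by (simp add: sum_subtractf sum_distrib_left)
  also have "(\<Sum>C\<in>?Z. if snd S C = - 1 then 1 else (0::int)) = int (card {C \<in> ?Z. snd S C = - 1})"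
    using finite_circles by (simp add: sum.If_cases Int_def)
  finally show ?thesis .
qed

abbreviation "weight \<equiv> card (circles D sA)"

abbreviation parallel_set :: "nat set \<Rightarrow> bool" where
  "parallel_set B \<equiv> B \<noteq> {} \<and> B \<subseteq> {..<ncr D} \<and> (\<forall>x\<in>B. \<forall>y\<in>B. par x y)"

lemma card_circles_bound:
  assumes "B \<noteq> {}" "B \<subseteq> {..<ncr D}"
  shows "card (circles D (state_of D B)) + 2 \<le> weight + card B"
    and "\<not> parallel_set B \<Longrightarrow> card (circles D (state_of D B)) + 4 \<le> weight + card B"
    and "parallel_set B \<Longrightarrow> card (circles D (state_of D B)) + 2 = weight + card B"
  using circles_bound[OF assms] circles_bound_not_parallel[OF assms(2)] circles_parallel[OF assms] assms
  unfolding card_circles by auto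

lemma j_degree_eq:
  assumes "S \<in> enhanced_states D"
  shows "j_degree D S = int (ncr D) - 2 * int (card (B_crossings D (fst S)))
     + 2 * int (card (circles D (fst S))) - 4 * int (card {C \<in> circles D (fst S). snd S C = - 1})"
  unfolding j_degree_def tau_eq[OF assms] sigma_eq by simp

lemma enhanced_state_fst:
  assumes "S \<in> enhanced_states D"
  shows "fst S = state_of D (B_crossings D (fst S))"
  using assms state_of_B_crossings[of "fst S" D] by (auto simp: enhanced_states_def)

lemma plus_state_in: "plus_state D B \<in> enhanced_states D"
  by (simp add: plus_state_def enhanced_states_def state_of_in)

lemma minus_state_in: "minus_state D T \<in> enhanced_states D"
  using state_of_in[of D "{}"] by (simp add: minus_state_def enhanced_states_def state_of_empty)

lemma plus_state_unique:
  assumes "S \<in> enhanced_states D" "{C \<in> circles D (fst S). snd S C = - 1} = {}"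
  shows "S = plus_state D (B_crossings D (fst S))"
proof -
  have 1: "snd S \<in> circles D (fst S) \<rightarrow>\<^sub>E {1, - 1}" using assms(1) by (auto simp: enhanced_states_def)
  have "snd S = (\<lambda>C \<in> circles D (fst S). 1)"
    using assms(2) PiE_mem[OF 1] PiE_arb[OF 1] by (auto simp: fun_eq_iff restrict_def)
  then show ?thesis
    unfolding plus_state_def enhanced_state_fst[OF assms(1), symmetric] by (simp add: prod_eq_iff)
qed

lemma minus_state_unique:
  assumes "S \<in> enhanced_states D" "{C \<in> circles D (fst S). snd S C = - 1} = {T}" "B_crossings D (fst S) = {}"
  shows "S = minus_state D T"
proof -
  have s: "fst S = sA" using enhanced_state_fst[OF assms(1)] assms(3) by (simp add: state_of_empty)
  have 1: "snd S \<in> circles D (fst S) \<rightarrow>\<^sub>E {1, - 1}" using assms(1) by (auto simp: enhanced_states_def)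
  have "snd S = (\<lambda>C \<in> circles D (fst S). if C = T then - 1 else 1)"
    using assms(2) PiE_mem[OF 1] PiE_arb[OF 1] by (auto simp: fun_eq_iff restrict_def)
  then show ?thesis unfolding minus_state_def by (simp add: prod_eq_iff s)
qed

lemma finite_enhanced_states: "finite (enhanced_states D)"
  unfolding enhanced_states_def states_def
  by (intro finite_SigmaI finite_PiE) (auto simp: finite_circles)

lemma fst_plus_state [simp]: "fst (plus_state D B) = state_of D B"
  by (simp add: plus_state_def)

lemma fst_minus_state [simp]: "fst (minus_state D T) = sA"
  by (simp add: minus_state_def)

lemma B_crossings_sA [simp]: "B_crossings D sA = {}"
  by (auto simp: B_crossings_def)

lemma j_degree_plus_state:
  assumes "B \<subseteq> {..<ncr D}"
  shows "j_degree D (plus_state D B) = int (ncr D) - 2 * int (card B) + 2 * int (card (circles D (state_of D B)))"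
proof -
  have *: "{C \<in> circles D (state_of D B). snd (plus_state D B) C = - 1} = {}" by (auto simp: plus_state_def)
  show ?thesis
    unfolding j_degree_eq[OF plus_state_in] fst_plus_state B_crossings_state_of[OF assms] * by simp
qed

lemma j_degree_minus_state:
  assumes "T \<in> circles D sA"
  shows "j_degree D (minus_state D T) = int (ncr D) + 2 * int weight - 4"
proof -
  have "{C \<in> circles D sA. snd (minus_state D T) C = - 1} = {T}" using assms by (auto simp: minus_state_def)
  then show ?thesis unfolding j_degree_eq[OF minus_state_in] by simp
qed

text \<open>Attained by the all-plus state on \<open>s_A\<close>. With at least one B-label, the
  bound on the number of circles costs at least 4, which is exactly the step down to
  \<open>j_almax\<close>.\<close>

lemma j_max_eq: "j_max D = int (ncr D) + 2 * int weight"
  unfolding j_max_def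
proof (rule Max_eqI)
  show "finite (j_degree D ` enhanced_states D)" using finite_enhanced_states by simp
  have "j_degree D (plus_state D {}) = int (ncr D) + 2 * int weight"
    by (subst j_degree_plus_state) (simp_all add: state_of_empty)
  then show "int (ncr D) + 2 * int weight \<in> j_degree D ` enhanced_states D"
    using plus_state_in by (metis imageI)
  fix j assume "j \<in> j_degree D ` enhanced_states D"
  then obtain S where S: "S \<in> enhanced_states D" and j: "j = j_degree D S" by blast
  let ?B = "B_crossings D (fst S)"
  show "j \<le> int (ncr D) + 2 * int weight"
  proof (cases "?B = {}")
    case True
    then have "fst S = sA" using enhanced_state_fst[OF S] by (simp add: state_of_empty)
    then show ?thesis unfolding j j_degree_eq[OF S] by simp
  next
    case False
    from card_circles_bound(1)[OF False B_crossings_subset] show ?thesis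
      unfolding j j_degree_eq[OF S] enhanced_state_fst[OF S, symmetric] by simp
  qed
qed

text \<open>Each negative sign lowers \<open>j\<close> by 4, and so does a nonempty set of parallel
  B-crossings; a nonempty set that is not parallel lowers it by at least 8. Hence the drop of 4 has
  exactly one cause.\<close>

lemma almax_cases:
  assumes S: "S \<in> enhanced_states D" and j: "j_degree D S = j_almax D"
  shows "B_crossings D (fst S) = {} \<and> (\<exists>T\<in>circles D sA. S = minus_state D T) \<or>
         parallel_set (B_crossings D (fst S)) \<and> S = plus_state D (B_crossings D (fst S))"
proof -
  let ?B = "B_crossings D (fst S)" and ?N = "{C \<in> circles D (fst S). snd S C = - 1}"
  have j: "int (ncr D) - 2 * int (card ?B) + 2 * int (card (circles D (fst S))) - 4 * int (card ?N)
      = int (ncr D) + 2 * int weight - 4"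
    using j unfolding j_degree_eq[OF S] j_almax_def j_max_eq .
  show ?thesis
  proof (cases "?B = {}")
    case True
    then have s: "fst S = sA" using enhanced_state_fst[OF S] by (simp add: state_of_empty)
    have "card ?N = 1" using j unfolding True by (simp add: s)
    then obtain T where T: "?N = {T}" by (rule card_1_singletonE)
    then have "T \<in> circles D sA" using s by auto
    then show ?thesis using minus_state_unique[OF S T True] True by blast
  next
    case False
    note b = card_circles_bound[OF False B_crossings_subset, unfolded enhanced_state_fst[OF S, symmetric]]
    have p: "parallel_set ?B"
    proof (rule ccontr)
      assume "\<not> parallel_set ?B"
      from b(2)[OF this] j show False by simp
    qed
    have "card ?N = 0" using b(3)[OF p] j by simp
    then have "?N = {}" using finite_circles by simp
    then show ?thesis using plus_state_unique[OF S] p by blast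
  qed
qed

lemma j_degree_almax:
  shows "T \<in> circles D sA \<Longrightarrow> j_degree D (minus_state D T) = j_almax D"
    and "parallel_set B \<Longrightarrow> j_degree D (plus_state D B) = j_almax D"
  using card_circles_bound(3)[of B]
  by (simp_all add: j_almax_def j_max_eq j_degree_minus_state j_degree_plus_state)

lemma i_degree_almax:
  shows "i_degree D (minus_state D T) = int (ncr D)"
    and "B \<subseteq> {..<ncr D} \<Longrightarrow> i_degree D (plus_state D B) = int (ncr D) - 2 * int (card B)"
  by (simp_all add: i_degree_def sigma_eq)

text \<open>In the regrading \<open>k\<close> is the number of B-labels, since
  \<open>i_degree\<close> is \<open>ncr D - 2 * k\<close>.\<close>

definition almax_states :: "int \<Rightarrow> enhanced_state set" where
  "almax_states q = (if q = int (ncr D) - 1 then minus_state D ` circles D sA else {}) \<union>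
     plus_state D ` {B. parallel_set B \<and> q = int (ncr D) - 1 - int (card B)}"

lemma almost_extreme_group:
  "Grp (almost_extreme_complex D) q = free_Abelian_group (almax_states q)"
proof -
  let ?i = "int (ncr D) - 2 * (int (ncr D) - 1 - q)"
  have "{S \<in> enhanced_states D. i_degree D S = ?i \<and> j_degree D S = j_almax D} = almax_states q"
  proof (intro equalityI subsetI)
    fix S assume "S \<in> {S \<in> enhanced_states D. i_degree D S = ?i \<and> j_degree D S = j_almax D}"
    then have S: "S \<in> enhanced_states D" "i_degree D S = ?i" "j_degree D S = j_almax D" by auto
    from almax_cases[OF S(1,3)] show "S \<in> almax_states q"
    proof
      assume "B_crossings D (fst S) = {} \<and> (\<exists>T\<in>circles D sA. S = minus_state D T)"
      then show ?thesis using S(2) by (auto simp: almax_states_def i_degree_almax)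
    next
      assume a: "parallel_set (B_crossings D (fst S)) \<and> S = plus_state D (B_crossings D (fst S))"
      then have "q = int (ncr D) - 1 - int (card (B_crossings D (fst S)))"
        using S(2) by (simp add: i_degree_def sigma_eq)
      then show ?thesis using a by (auto simp: almax_states_def)
    qed
  next
    fix S assume "S \<in> almax_states q"
    then show "S \<in> {S \<in> enhanced_states D. i_degree D S = ?i \<and> j_degree D S = j_almax D}"
      unfolding almax_states_def
    proof (elim UnE)
      assume "S \<in> (if q = int (ncr D) - 1 then minus_state D ` circles D sA else {})"
      then have q: "q = int (ncr D) - 1" and "S \<in> minus_state D ` circles D sA"
        by (simp_all split: if_splits)
      then obtain T where T: "T \<in> circles D sA" "S = minus_state D T" by blast
      then show ?thesis using j_degree_almax(1)[OF T(1)] q by (simp add: minus_state_in i_degree_almax)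
    next
      assume "S \<in> plus_state D ` {B. parallel_set B \<and> q = int (ncr D) - 1 - int (card B)}"
      then obtain B where B: "parallel_set B" "S = plus_state D B" "q = int (ncr D) - 1 - int (card B)" by blast
      then show ?thesis using j_degree_almax(2)[OF B(1)] by (simp add: plus_state_in i_degree_almax)
    qed
  qed
  then show ?thesis by (simp add: almost_extreme_complex_def khovanov_group_def Let_def)
qed

lemma almost_extreme_Diff: "Diff (almost_extreme_complex D) q = khovanov_diff D"
  by (simp add: almost_extreme_complex_def)

lemma khovanov_diff_of:
  assumes adj: "\<And>x T. adjacent_at D x S T \<longleftrightarrow> x \<in> X \<and> T = t x" and inj: "inj_on t X" and fin: "finite X"
  shows "khovanov_diff D (frag_of S) =
     (\<Sum>x\<in>X. frag_cmul ((- 1) ^ card {y. x < y \<and> y < ncr D \<and> fst S y = LabelB}) (frag_of (t x)))"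
proof -
  have sub: "t ` X \<subseteq> enhanced_states D" using adj by (auto simp: adjacent_at_def)
  have "khovanov_diff D (frag_of S) = (\<Sum>T \<in> enhanced_states D. frag_cmul (incidence D S T) (frag_of T))"
    by (simp add: khovanov_diff_def)
  also have "\<dots> = (\<Sum>T \<in> t ` X. frag_cmul (incidence D S T) (frag_of T))"
    by (rule sum.mono_neutral_right[OF finite_enhanced_states sub]) (auto simp: incidence_def adj)
  also have "\<dots> = (\<Sum>x\<in>X. frag_cmul (incidence D S (t x)) (frag_of (t x)))"
    by (simp add: sum.reindex[OF inj])
  also have "\<dots> = (\<Sum>x\<in>X. frag_cmul ((- 1) ^ card {y. x < y \<and> y < ncr D \<and> fst S y = LabelB}) (frag_of (t x)))"
  proof (rule sum.cong[OF refl])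
    fix x assume x: "x \<in> X"
    \<comment> \<open>Injectivity of \<open>t\<close> makes the changed crossing unique, so the
      description in \<open>incidence\<close> picks it out.\<close>
    have "(THE x'. adjacent_at D x' S (t x)) = x"
      using x inj by (intro the_equality) (auto simp: adj inj_on_def)
    moreover have "\<exists>x'. adjacent_at D x' S (t x)" using x adj by blast
    ultimately show "frag_cmul (incidence D S (t x)) (frag_of (t x)) =
        frag_cmul ((- 1) ^ card {y. x < y \<and> y < ncr D \<and> fst S y = LabelB}) (frag_of (t x))"
      by (simp add: incidence_def)
  qed
  finally show ?thesis .
qed

lemma plus_state_inj: "B \<subseteq> {..<ncr D} \<Longrightarrow> B' \<subseteq> {..<ncr D} \<Longrightarrow> plus_state D B = plus_state D B' \<Longrightarrow> B = B'"
  by (metis B_crossings_state_of fst_plus_state)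

text \<open>By adequacy the change at \<open>x\<close> merges the two circles there and leaves all
  others; the merged circle is new, because no circle of \<open>s_A\<close> passes both arcs at
  \<open>x\<close>.\<close>

lemma circle_survives:
  assumes x: "x < ncr D" and T: "T \<in> circles D sA"
  shows "T \<in> circles D (state_of D {x}) \<longleftrightarrow> T \<notin> ends (state_graph_A D) x"
proof (cases T)
  case (Inr n)
  then show ?thesis using T by (auto simp: circles_def ends_eq[OF x])
next
  case (Inl C)
  let ?A = "circ sA `` {(x, 0)}" and ?A' = "circ sA `` {(x, 2)}"
  have C: "C \<in> dart_circles D sA" using T Inl by (auto simp: circles_def)
  have eq: "dart_circles D (state_of D {x}) = insert (?A \<union> ?A') (dart_circles D sA - {?A, ?A'})"
    by (rule dart_circles_flip(1)[OF x _ _ _ ends_distinct[OF x]]) (use x in \<open>auto simp: state_of_def state_A_def\<close>)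
  have "C \<noteq> ?A \<union> ?A'"
  proof
    assume e: "C = ?A \<union> ?A'"
    have A: "?A \<in> darts D // circ sA" using x by (intro quotientI) simp
    have "(x, 0) \<in> ?A" "(x, 2) \<in> ?A'" using x by (simp_all add: generated_equiv_refl)
    then have "C \<inter> ?A \<noteq> {}" and m: "(x, 2) \<in> C" using e by blast+
    then have "C = ?A"
      using quotient_disj[OF equiv_generated_equiv C[unfolded dart_circles_eq gen_classes_def] A] by blast
    then show False using m ends_distinct[OF x] by simp
  qed
  then show ?thesis using C unfolding Inl ends_eq[OF x] circles_def eq by auto
qed

lemma adjacent_flip:
  assumes "adjacent_at D x S T"
  shows "B_crossings D (fst T) = insert x (B_crossings D (fst S))" "x < ncr D" "x \<notin> B_crossings D (fst S)"
  using assms by (auto simp: adjacent_at_def B_crossings_def)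

text \<open>The target has a B-label and the same \<open>j\<close>, so by the classification it can
  only be an all-plus state; signs are not traced through merging circles.\<close>

lemma adjacent_plus_state:
  assumes adj: "adjacent_at D x S T" and j: "j_degree D S = j_almax D"
  shows "parallel_set (B_crossings D (fst T))" "T = plus_state D (insert x (B_crossings D (fst S)))"
proof -
  have "T \<in> enhanced_states D" "j_degree D T = j_almax D" using adj j by (simp_all add: adjacent_at_def)
  from almax_cases[OF this] adjacent_flip(1)[OF adj]
  show "parallel_set (B_crossings D (fst T))" "T = plus_state D (insert x (B_crossings D (fst S)))" by auto
qed

text \<open>If \<open>x\<close> is not on \<open>T\<close>, the negative circle survives with its
  sign, which an all-plus target does not allow.\<close>

lemma adjacent_minus:
  assumes T: "T \<in> circles D sA"
  shows "adjacent_at D x (minus_state D T) U \<longleftrightarrow>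
    x \<in> {x. x < ncr D \<and> T \<in> ends (state_graph_A D) x} \<and> U = plus_state D {x}"
proof
  assume adj: "adjacent_at D x (minus_state D T) U"
  have U: "U = plus_state D {x}" using adjacent_plus_state(2)[OF adj j_degree_almax(1)[OF T]] by simp
  have x: "x < ncr D" using adjacent_flip(2)[OF adj] .
  have "T \<in> ends (state_graph_A D) x"
  proof (rule ccontr)
    assume "T \<notin> ends (state_graph_A D) x"
    then have "T \<in> circles D (state_of D {x})" using circle_survives[OF x T] by blast
    then have "snd (minus_state D T) T = snd (plus_state D {x}) T"
      using adj T unfolding adjacent_at_def U by simp
    then show False using T \<open>T \<in> circles D (state_of D {x})\<close> by (simp add: minus_state_def plus_state_def)
  qed
  then show "x \<in> {x. x < ncr D \<and> T \<in> ends (state_graph_A D) x} \<and> U = plus_state D {x}" using U x by simp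
next
  assume a: "x \<in> {x. x < ncr D \<and> T \<in> ends (state_graph_A D) x} \<and> U = plus_state D {x}"
  then have x: "x < ncr D" and e: "T \<in> ends (state_graph_A D) x" and U: "U = plus_state D {x}" by auto
  have p: "parallel_set {x}" using x by (simp add: parallel_def)
  have nT: "T \<notin> circles D (state_of D {x})" using circle_survives[OF x T] e by blast
  show "adjacent_at D x (minus_state D T) U"
    unfolding adjacent_at_def U
  proof (intro conjI)
    show "i_degree D (plus_state D {x}) = i_degree D (minus_state D T) - 2"
      using x by (subst i_degree_almax) (simp_all add: i_degree_almax)
    show "j_degree D (plus_state D {x}) = j_degree D (minus_state D T)"
      using j_degree_almax(1)[OF T] j_degree_almax(2)[OF p] by simp
    show "\<forall>C\<in>circles D (fst (minus_state D T)) \<inter> circles D (fst (plus_state D {x})).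
       snd (minus_state D T) C = snd (plus_state D {x}) C"
      using nT by (auto simp: minus_state_def plus_state_def)
  qed (use x in \<open>auto simp: minus_state_in plus_state_in state_of_def\<close>)
qed

lemma adjacent_plus:
  assumes B: "parallel_set B"
  shows "adjacent_at D x (plus_state D B) U \<longleftrightarrow>
    x \<in> {x. x \<notin> B \<and> parallel_set (insert x B)} \<and> U = plus_state D (insert x B)"
proof
  assume adj: "adjacent_at D x (plus_state D B) U"
  have BB: "B_crossings D (fst (plus_state D B)) = B" using B by simp
  from adjacent_plus_state[OF adj j_degree_almax(2)[OF B]] adjacent_flip[OF adj]
  show "x \<in> {x. x \<notin> B \<and> parallel_set (insert x B)} \<and> U = plus_state D (insert x B)"
    unfolding BB by simp
next
  assume a: "x \<in> {x. x \<notin> B \<and> parallel_set (insert x B)} \<and> U = plus_state D (insert x B)"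
  then have x: "x \<notin> B" "x < ncr D" and p: "parallel_set (insert x B)" and U: "U = plus_state D (insert x B)" by auto
  show "adjacent_at D x (plus_state D B) U"
    unfolding adjacent_at_def U
  proof (intro conjI)
    show "i_degree D (plus_state D (insert x B)) = i_degree D (plus_state D B) - 2"
      using p B x finite_subset_crossings[of B D] by (simp add: i_degree_almax)
    show "j_degree D (plus_state D (insert x B)) = j_degree D (plus_state D B)"
      using j_degree_almax(2)[OF B] j_degree_almax(2)[OF p] by simp
    show "\<forall>C\<in>circles D (fst (plus_state D B)) \<inter> circles D (fst (plus_state D (insert x B))).
       snd (plus_state D B) C = snd (plus_state D (insert x B)) C"
      by (auto simp: plus_state_def)
  qed (use x in \<open>auto simp: plus_state_in state_of_def\<close>)
qed

lemma diff_minus_state: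
  assumes T: "T \<in> circles D sA"
  shows "khovanov_diff D (frag_of (minus_state D T)) =
    (\<Sum>x | x < ncr D \<and> T \<in> ends (state_graph_A D) x. frag_of (plus_state D {x}))"
proof -
  let ?X = "{x. x < ncr D \<and> T \<in> ends (state_graph_A D) x}"
  have e: "{y. x < y \<and> y < ncr D \<and> sA y = LabelB} = {}" for x by auto
  have "inj_on (\<lambda>x. plus_state D {x}) ?X"
  proof (rule inj_onI)
    fix x y assume xy: "x \<in> ?X" "y \<in> ?X" and eq: "plus_state D {x} = plus_state D {y}"
    have "{x} = {y}" by (rule plus_state_inj[OF _ _ eq]) (use xy in auto)
    then show "x = y" by simp
  qed
  moreover have "finite ?X" by simp
  ultimately show ?thesis
    by (subst khovanov_diff_of[OF adjacent_minus[OF T]]) (simp_all only: fst_minus_state e card.empty power_0 frag_cmul_one)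
qed

lemma diff_plus_state:
  assumes B: "parallel_set B"
  shows "khovanov_diff D (frag_of (plus_state D B)) =
    (\<Sum>x | x \<notin> B \<and> parallel_set (insert x B).
       frag_cmul ((- 1) ^ card {y \<in> B. x < y}) (frag_of (plus_state D (insert x B))))"
proof -
  have "{y. x < y \<and> y < ncr D \<and> state_of D B y = LabelB} = {y \<in> B. x < y}" for x
    using B by (auto simp: state_of_def)
  moreover have "inj_on (\<lambda>x. plus_state D (insert x B)) {x. x \<notin> B \<and> parallel_set (insert x B)}"
  proof (rule inj_onI)
    fix x y assume xy: "x \<in> {x. x \<notin> B \<and> parallel_set (insert x B)}" "y \<in> {x. x \<notin> B \<and> parallel_set (insert x B)}"
      and e: "plus_state D (insert x B) = plus_state D (insert y B)"
    have "insert x B = insert y B" by (rule plus_state_inj[OF _ _ e]) (use xy in auto)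
    then show "x = y" using xy by blast
  qed
  moreover have "finite {x. x \<notin> B \<and> parallel_set (insert x B)}"
    by (rule finite_subset[of _ "{..<ncr D}"]) auto
  ultimately show ?thesis by (subst khovanov_diff_of[OF adjacent_plus[OF B]]) simp_all
qed

end

text \<open>\<open>C\<close> is exhibited as a deformation retract of \<open>M\<close> by data on
  generators. Two properties are consequences: \<open>d d = 0\<close> on \<open>C\<close>, since
  \<open>g\<close> commutes with the differentials and \<open>g f = id\<close>, and compatibility of
  \<open>f\<close>, where the condition \<open>h d f = 0\<close> removes a homotopy term.\<close>

lemma chain_homotopy_equivalent_free:
  assumes M: "is_chain_complex M"
    and GM: "\<And>q. Grp M q = free_Abelian_group (T q)" and DM: "\<And>q. Diff M q = frag_extend (dM q)"
    and GC: "\<And>q. Grp C q = free_Abelian_group (S q)" and DC: "\<And>q. Diff C q = frag_extend (dC q)"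
    and dC: "\<And>q s. s \<in> S q \<Longrightarrow> Poly_Mapping.keys (dC q s) \<subseteq> S (q - 1)"
    and f: "\<And>q s. s \<in> S q \<Longrightarrow> Poly_Mapping.keys (f q s) \<subseteq> T q"
    and g: "\<And>q t. t \<in> T q \<Longrightarrow> Poly_Mapping.keys (g q t) \<subseteq> S q"
    and h: "\<And>q t. t \<in> T q \<Longrightarrow> Poly_Mapping.keys (h q t) \<subseteq> T (q + 1)"
    and gd: "\<And>q t. t \<in> T q \<Longrightarrow> frag_extend (dC q) (g q t) = frag_extend (g (q - 1)) (dM q t)"
    and gf: "\<And>q s. s \<in> S q \<Longrightarrow> frag_extend (g q) (f q s) = frag_of s"
    and fg: "\<And>q t. t \<in> T q \<Longrightarrow> frag_extend (f q) (g q t) =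
               frag_of t + (frag_extend (dM (q + 1)) (h q t) + frag_extend (h (q - 1)) (dM q t))"
    and hdf: "\<And>q s. s \<in> S q \<Longrightarrow> frag_extend (h (q - 1)) (frag_extend (dM q) (f q s)) = 0"
  shows "chain_homotopy_equivalent C M"
proof -
  let ?F = "\<lambda>q. frag_extend (f q)" and ?G = "\<lambda>q. frag_extend (g q)" and ?H = "\<lambda>q. frag_extend (h q)"
    and ?d = "\<lambda>q. frag_extend (dC q)" and ?D = "\<lambda>q. frag_extend (dM q)"
  have hom: "frag_extend k \<in> hom (free_Abelian_group A) (free_Abelian_group B)"
    if "\<And>a. a \<in> A \<Longrightarrow> Poly_Mapping.keys (k a) \<subseteq> B" for k :: "'x \<Rightarrow> 'y \<Rightarrow>\<^sub>0 int" and A B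
  proof (rule homI)
    fix x assume "x \<in> carrier (free_Abelian_group A)"
    then show "frag_extend k x \<in> carrier (free_Abelian_group B)"
      using that order_trans[OF keys_frag_extend] by (fastforce intro!: order_trans[OF keys_frag_extend])
  qed (simp add: frag_extend_add)
  have cong: "frag_extend k x = frag_extend l x"
    if "Poly_Mapping.keys x \<subseteq> A" "\<And>a. a \<in> A \<Longrightarrow> k a = l a" for k l :: "'x \<Rightarrow> 'y \<Rightarrow>\<^sub>0 int" and A x
    using that by (intro frag_extend_eq) auto
  have add: "frag_extend (\<lambda>a. k a + l a) x = frag_extend k x + frag_extend l x"
    for k l :: "'x \<Rightarrow> 'y \<Rightarrow>\<^sub>0 int" and x
    by (simp add: frag_extend_def frag_cmul_distrib2 sum.distrib)
  have ide: "frag_extend frag_of x = x" for x :: "'z \<Rightarrow>\<^sub>0 int" by (rule frag_expansion[symmetric])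
  have DM_in: "Poly_Mapping.keys (?D q x) \<subseteq> T (q - 1)" if "Poly_Mapping.keys x \<subseteq> T q" for q x
  proof -
    have "?D q \<in> hom (free_Abelian_group (T q)) (free_Abelian_group (T (q - 1)))"
      using is_chain_complexD(2)[OF M, of q] unfolding GM DM .
    from hom_in_carrier[OF this, of x] show ?thesis using that by simp
  qed
  have dM: "Poly_Mapping.keys (dM q t) \<subseteq> T (q - 1)" if "t \<in> T q" for q t
    using DM_in[of "frag_of t" q] that by simp
  have DD: "?D (q - 1) (?D q x) = 0" if "Poly_Mapping.keys x \<subseteq> T q" for q x
    using M that unfolding is_chain_complex_def GM DM by simp
  have F_in: "Poly_Mapping.keys (?F q x) \<subseteq> T q" if "Poly_Mapping.keys x \<subseteq> S q" for q x
    using that f by (intro order_trans[OF keys_frag_extend] UN_least) auto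
  have G_in: "Poly_Mapping.keys (?G q x) \<subseteq> S q" if "Poly_Mapping.keys x \<subseteq> T q" for q x
    using that g by (intro order_trans[OF keys_frag_extend] UN_least) auto
  have d_in: "Poly_Mapping.keys (?d q x) \<subseteq> S (q - 1)" if "Poly_Mapping.keys x \<subseteq> S q" for q x
    using that dC by (intro order_trans[OF keys_frag_extend] UN_least) auto
  have GD: "?d q (?G q x) = ?G (q - 1) (?D q x)" if "Poly_Mapping.keys x \<subseteq> T q" for q x
    unfolding frag_extend_frag_extend by (rule cong[OF that gd])
  have GF: "?G q (?F q x) = x" if "Poly_Mapping.keys x \<subseteq> S q" for q x
    unfolding frag_extend_frag_extend by (subst ide[of x, symmetric]) (rule cong[OF that gf])
  have FG: "?F q (?G q x) = x + (?D (q + 1) (?H q x) + ?H (q - 1) (?D q x))" if "Poly_Mapping.keys x \<subseteq> T q" for q x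
  proof -
    have "?F q (?G q x) = frag_extend (\<lambda>t. frag_of t + (?D (q + 1) (h q t) + ?H (q - 1) (dM q t))) x"
      unfolding frag_extend_frag_extend by (rule cong[OF that fg])
    then show ?thesis by (simp add: add ide frag_extend_frag_extend)
  qed
  have HDF: "?H (q - 1) (?D q (?F q x)) = 0" if "Poly_Mapping.keys x \<subseteq> S q" for q x
  proof -
    show ?thesis
      unfolding frag_extend_frag_extend
      by (rule frag_extend_eq_0) (use that hdf in \<open>auto simp: frag_extend_frag_extend\<close>)
  qed
  have dd: "?d (q - 1) (?d q x) = 0" if x: "Poly_Mapping.keys x \<subseteq> S q" for q x
  proof -
    have "?d (q - 1) (?d q x) = ?d (q - 1) (?d q (?G q (?F q x)))" by (simp only: GF[OF x])
    also have "\<dots> = ?G (q - 1 - 1) (?D (q - 1) (?D q (?F q x)))"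
      by (simp only: GD[OF F_in[OF x]] GD[OF DM_in[OF F_in[OF x]]])
    also have "\<dots> = 0" by (simp only: DD[OF F_in[OF x]] frag_extend_0)
    finally show ?thesis .
  qed
  \<comment> \<open>\<open>f d = f d g f = f g d f\<close>; in the homotopy formula for
    \<open>f g\<close> one correction vanishes by \<open>h d f = 0\<close> and the other by
    \<open>d d = 0\<close>.\<close>
  have FD: "?D q (?F q x) = ?F (q - 1) (?d q x)" if x: "Poly_Mapping.keys x \<subseteq> S q" for q x
  proof -
    have "?F (q - 1) (?d q x) = ?F (q - 1) (?G (q - 1) (?D q (?F q x)))"
      using GD[OF F_in[OF x]] GF[OF x] by simp
    also have "\<dots> = ?D q (?F q x) + (?D (q - 1 + 1) (?H (q - 1) (?D q (?F q x))) + ?H (q - 1 - 1) (?D (q - 1) (?D q (?F q x))))"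
      by (rule FG[OF DM_in[OF F_in[OF x]]])
    also have "\<dots> = ?D q (?F q x)" by (simp only: HDF[OF x] DD[OF F_in[OF x]] frag_extend_0 add_0_right)
    finally show ?thesis ..
  qed
  have C: "is_chain_complex C"
    unfolding is_chain_complex_def GC DC
    by (intro allI conjI ballI abelian_free_Abelian_group hom[OF dC]) (simp_all add: dd)
  have cf: "complex_map C M ?F"
    unfolding complex_map_def GC DC GM DM by (intro allI conjI ballI hom[OF f]) (simp_all add: FD)
  have cg: "complex_map M C ?G"
    unfolding complex_map_def GC DC GM DM by (intro allI conjI ballI hom[OF g]) (simp_all add: GD)
  have "complex_homotopic C C (\<lambda>q. ?G q \<circ> ?F q) (\<lambda>q. id)"
    unfolding complex_homotopic_def GC DC
    by (intro exI[of _ "\<lambda>q. frag_extend (\<lambda>_. 0)"] allI conjI ballI hom) (simp_all add: GF frag_extend_eq_0)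
  moreover have "complex_homotopic M M (\<lambda>q. ?F q \<circ> ?G q) (\<lambda>q. id)"
    unfolding complex_homotopic_def GM DM
    by (intro exI[of _ ?H] allI conjI ballI hom[OF h]) (simp_all add: FG)
  ultimately show ?thesis
    unfolding chain_homotopy_equivalent_def using C M cf cg by blast
qed

section \<open>Sorted edge lists and signs\<close>

lemma sorted_list_of_set_strict: "sorted_wrt (<) w \<Longrightarrow> sorted_list_of_set (set w) = w" for w :: "nat list"
  by (simp add: strict_sorted_iff sorted_list_of_set.idem_if_sorted_distinct)

lemma card_less_nth:
  assumes w: "sorted_wrt (<) (w :: nat list)" and i: "i < length w"
  shows "card {y \<in> set w. y < w ! i} = i"
proof -
  have mono: "w ! j < w ! l" if "j < l" "l < length w" for j l using sorted_wrt_nth_less[OF w that] .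
  have "{y \<in> set w. y < w ! i} = (!) w ` {..<i}"
  proof
    show "{y \<in> set w. y < w ! i} \<subseteq> (!) w ` {..<i}"
    proof
      fix y assume "y \<in> {y \<in> set w. y < w ! i}"
      then obtain j where j: "j < length w" "y = w ! j" "w ! j < w ! i" by (auto simp: in_set_conv_nth)
      then have "\<not> i < j" "j \<noteq> i" using mono[of i j] by auto
      then have "j < i" by simp
      then show "y \<in> (!) w ` {..<i}" using j by blast
    qed
  qed (use mono i in auto)
  moreover have "inj_on ((!) w) {..<i}"
    using w i by (intro inj_on_nth) (auto simp: strict_sorted_iff)
  ultimately show ?thesis by (simp add: card_image)
qed

text \<open>The cell of the all-plus state with B-labels \<open>B\<close> corresponds to this state up to the
  sign \<open>twist B\<close>, which turns the Khovanov signs into those of the face maps.\<close>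

definition twist :: "nat set \<Rightarrow> int" where
  "twist B = (- 1) ^ (\<Sum>B + \<Sum>{..<card B})"

lemma twist_empty [simp]: "twist {} = 1"
  by (simp add: twist_def)

lemma twist_twist [simp]: "twist B * twist B = 1"
  by (simp add: twist_def flip: power_add mult_2)

lemma twist_insert:
  assumes "finite B" "x \<notin> B"
  shows "twist (insert x B) = twist B * (- 1) ^ (x + card B)"
  using assms by (simp add: twist_def power_add lessThan_Suc ac_simps)

text \<open>Let \<open>i\<close> crossings outside \<open>B\<close> and \<open>a\<close> crossings
  of \<open>B\<close> lie below \<open>x\<close>, and \<open>b\<close> crossings of \<open>B\<close>
  above it. Then \<open>x = i + a\<close> and \<open>card B = a + b\<close>, so the exponent
  \<open>i + x + card B\<close> is \<open>2 * (i + a) + b\<close>, of the parity of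
  \<open>b\<close>: the face index \<open>i\<close> is traded for the Khovanov exponent
  \<open>b\<close>.\<close>

lemma twist_sign:
  assumes B: "B \<subseteq> {..<c}" "x < c" "x \<notin> B"
  shows "(- 1) ^ card {y \<in> {..<c} - B. y < x} * twist (insert x B) = twist B * (- 1) ^ card {y \<in> B. x < y}"
proof -
  have fin: "finite B" using B(1) finite_subset by blast
  let ?i = "card {y \<in> {..<c} - B. y < x}" and ?a = "card {y \<in> B. y < x}" and ?b = "card {y \<in> B. x < y}"
  have "{..<x} = {y \<in> {..<c} - B. y < x} \<union> {y \<in> B. y < x}" using B by auto
  then have "card {..<x} = card ({y \<in> {..<c} - B. y < x} \<union> {y \<in> B. y < x})" by simp
  also have "\<dots> = ?i + ?a" by (rule card_Un_disjoint) (use fin in auto)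
  finally have x: "x = ?i + ?a" by simp
  have "{y \<in> B. y < x} \<inter> {y \<in> B. x < y} = {}" by (simp add: disjoint_iff)
  moreover have "finite {y \<in> B. y < x}" "finite {y \<in> B. x < y}" using fin by simp_all
  ultimately have "?a + ?b = card ({y \<in> B. y < x} \<union> {y \<in> B. x < y})"
    by (simp only: card_Un_disjoint)
  also have "{y \<in> B. y < x} \<union> {y \<in> B. x < y} = B"
    using B(3) by (auto simp: set_eq_iff intro: linorder_neqE_nat)
  finally have "card B = ?a + ?b" by (rule sym)
  moreover have "i + (z + n) = 2 * (i + a) + b" if "z = i + a" "n = a + b" for z n i a b :: nat
    using that by simp
  ultimately have "?i + (x + card B) = 2 * (?i + ?a) + ?b" using x by blast
  then have "(- 1 :: int) ^ (?i + (x + card B)) = (- 1) ^ (2 * (?i + ?a) + ?b)" by (rule arg_cong)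
  then have "(- 1 :: int) ^ ?i * (- 1) ^ (x + card B) = (- 1) ^ ?b"
    unfolding power_add[of _ ?i] by (simp add: power_add)
  then show ?thesis unfolding twist_insert[OF fin B(3)] by (simp add: ac_simps)
qed

section \<open>Comparison of the Khovanov complex with the cells\<close>

locale connected_adequate_diagram = adequate_diagram +
  assumes connected: "connected_diagram D"
begin

abbreviation "X \<equiv> presimplicial_of D"

lemma finite_graph_components: "finite (graph_components D)"
  unfolding graph_components_def by (rule finite_gen_classes) simp

lemma free_circles_crossings:
  assumes "ncr D > 0"
  shows "free_circles D = 0"
proof -
  have "graph_components D \<noteq> {}"
    using assms by (auto simp: graph_components_def gen_classes_def quotient_def)
  then have "card (graph_components D) > 0" using finite_graph_components by (simp add: card_gt_0_iff)
  then show ?thesis using connected by (simp add: connected_diagram_def)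
qed

lemma circles_no_crossings:
  assumes "ncr D = 0"
  shows "circles D sA = {Inr 0}"
proof -
  have "card (graph_components D) = 0" using assms by (simp add: graph_components_def gen_classes_def quotient_def)
  then have "free_circles D = 1" using connected by (simp add: connected_diagram_def)
  moreover have "dart_circles D sA = {}"
    using assms by (simp add: dart_circles_def gen_classes_def quotient_def darts_def)
  ultimately show ?thesis by (auto simp: circles_def)
qed

text \<open>A connected diagram with a crossing has no free circles, so every circle of
  \<open>s_A\<close> meets a crossing and is an end of some edge, hence of all edges parallel to
  it.\<close>

lemma all_parallel_ends:
  assumes par: "parallel_set {..<ncr D}" and T: "T \<in> circles D sA" and x: "x < ncr D"
  shows "T \<in> ends (state_graph_A D) x"
proof -
  obtain C where C: "T = Inl C" "C \<in> dart_circles D sA"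
    using T free_circles_crossings x by (auto simp: circles_def)
  obtain d where d: "d \<in> darts D" "C = circ sA `` {d}"
    using C(2) unfolding dart_circles_eq gen_classes_def by (rule quotientE)
  then have "d \<in> C" by (simp add: generated_equiv_refl)
  obtain y p where yp: "d = (y, p)" by (cases d)
  have y: "y < ncr D" and p: "p < 4" using d(1) yp by auto
  have "d \<in> {(y, 0), (y, 1), (y, 2), (y, 3)}" using p unfolding yp by (elim less_4_cases) simp_all
  then have "C \<inter> {(y, 0), (y, 1), (y, 2), (y, 3)} \<noteq> {}" using \<open>d \<in> C\<close> by blast
  then have "T \<in> ends (state_graph_A D) y" using C unfolding state_graph_A_def by simp
  then show ?thesis using par x y unfolding parallel_def by (metis lessThan_iff)
qed

lemma ends_subset: "ends (state_graph_A D) x \<subseteq> circles D sA"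
  by (auto simp: state_graph_A_def circles_def)

lemma card_ends: "x < ncr D \<Longrightarrow> card (ends (state_graph_A D) x) = 2"
  using ends_distinct[of x] generated_equiv_class_eq_iff[of "(x, 0)" "darts D" "(x, 2)"]
  by (simp add: ends_eq)

lemma Vertex_simplex: "Vertex T \<in> simplices X k \<longleftrightarrow> k + 1 = ncr D \<and> T \<in> circles D sA"
  by (auto simp: presimplicial_of_def state_simplices_def state_graph_A_def Let_def split: if_splits)

text \<open>States are indexed by their B-crossings, simplices by the remaining edges in increasing
  order; this passes to the complement.\<close>

definition edge_list :: "nat set \<Rightarrow> nat list" where
  "edge_list B = sorted_list_of_set ({..<ncr D} - B)"

lemma edge_list:
  assumes "B \<subseteq> {..<ncr D}"
  shows "set (edge_list B) = {..<ncr D} - B" "sorted_wrt (<) (edge_list B)" "length (edge_list B) = ncr D - card B"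
  using assms finite_subset_crossings[of B D] card_Diff_subset[of B "{..<ncr D}"]
  by (simp_all add: edge_list_def)

lemma edge_list_eq:
  assumes "sorted_wrt (<) w" "set w = {..<ncr D} - B"
  shows "w = edge_list B"
  using sorted_list_of_set_strict[OF assms(1)] by (simp add: edge_list_def assms(2))

lemma parallel_set_card:
  assumes "parallel_set B" "B \<noteq> {..<ncr D}"
  shows "0 < card B" "card B < ncr D"
proof -
  show "0 < card B" using assms finite_subset_crossings[of B D] by (simp add: card_gt_0_iff)
  have "B \<subset> {..<ncr D}" using assms by blast
  from psubset_card_mono[OF _ this] show "card B < ncr D" by simp
qed

text \<open>The full set of crossings is excluded: its complement is empty and would be a simplex of
  dimension -1. The state with all labels B is matched with the augmentation instead.\<close>

lemma Edges_simplex: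
  "Edges w \<in> simplices X k \<longleftrightarrow>
     (\<exists>B. w = edge_list B \<and> parallel_set B \<and> B \<noteq> {..<ncr D} \<and> k + 1 + card B = ncr D)"
proof
  assume a: "Edges w \<in> simplices X k"
  then have w: "length w = k + 1" "k + 1 < ncr D" "sorted_wrt (<) w" "set w \<subseteq> {..<ncr D}"
    "\<forall>e \<in> {..<ncr D} - set w. \<forall>e' \<in> {..<ncr D} - set w. par e e'"
    by (auto simp: presimplicial_of_def state_simplices_def edges_eq Let_def split: if_splits)
  let ?B = "{..<ncr D} - set w"
  have "card (set w) = k + 1" using w(1,3) by (simp add: strict_sorted_iff distinct_card)
  then have k: "k + 1 + card ?B = ncr D" using w(4) w(2) by (simp add: card_Diff_subset)
  then have "card ?B \<noteq> 0" using w(2) by linarith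
  then have "?B \<noteq> {}" by (metis card.empty)
  then have "parallel_set ?B" using w(5) by blast
  moreover have "card ?B \<noteq> card {..<ncr D}" using k by simp
  then have "?B \<noteq> {..<ncr D}" by metis
  moreover have "set w = {..<ncr D} - ?B" using w(4) by auto
  ultimately show "\<exists>B. w = edge_list B \<and> parallel_set B \<and> B \<noteq> {..<ncr D} \<and> k + 1 + card B = ncr D"
    using edge_list_eq[OF w(3), of ?B] k by blast
next
  assume "\<exists>B. w = edge_list B \<and> parallel_set B \<and> B \<noteq> {..<ncr D} \<and> k + 1 + card B = ncr D"
  then obtain B where w: "w = edge_list B" and B: "parallel_set B" "B \<noteq> {..<ncr D}" "k + 1 + card B = ncr D" by blast
  have "B \<subseteq> {..<ncr D}" using B(1) by blast
  note e = edge_list[OF this]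
  have "{..<ncr D} - set w = B" unfolding w e(1) using B(1) by blast
  moreover have "k + 1 < ncr D" using B(3) parallel_set_card(1)[OF B(1,2)] by simp
  ultimately show "Edges w \<in> simplices X k"
    using B e by (simp add: presimplicial_of_def state_simplices_def edges_eq w)
qed

lemma face_Vertex:
  assumes "i < ncr D"
  shows "face X k i (Vertex T) = (if T \<in> ends (state_graph_A D) i then Some (Edges (edge_list {i})) else None)"
proof -
  have s: "sorted_wrt (<) [0..<ncr D]" and l: "i < length [0..<ncr D]" using assms by auto
  have "set (omit i [0..<ncr D]) = {..<ncr D} - {i}"
    using set_omit(1)[OF s l] assms by (simp add: atLeast0LessThan)
  from edge_list_eq[OF set_omit(2)[OF s l] this] show ?thesis
    by (simp add: presimplicial_of_def)
qed

lemma parallel_set_insert: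
  assumes "parallel_set B" "x < ncr D"
  shows "parallel_set (insert x B) \<longleftrightarrow> (\<forall>e\<in>B. par x e)"
proof
  assume "\<forall>e\<in>B. par x e"
  then have e: "ends (state_graph_A D) x = ends (state_graph_A D) u" if "u \<in> insert x B" for u
    using that by (auto simp: parallel_def)
  have "par u v" if "u \<in> insert x B" "v \<in> insert x B" for u v
    unfolding parallel_def e[OF that(1), symmetric] by (rule e[OF that(2)])
  moreover have "insert x B \<subseteq> {..<ncr D}" using assms by simp
  ultimately show "parallel_set (insert x B)" by blast
next
  assume p: "parallel_set (insert x B)"
  show "\<forall>e\<in>B. par x e"
  proof
    fix e assume "e \<in> B"
    then show "par x e" using p by blast
  qed
qed

lemma face_Edges:
  assumes B: "parallel_set B" and i: "i < length (edge_list B)"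
  shows "face X k i (Edges (edge_list B)) =
     (if parallel_set (insert (edge_list B ! i) B) then Some (Edges (edge_list (insert (edge_list B ! i) B))) else None)"
proof -
  have sub: "B \<subseteq> {..<ncr D}" using B by blast
  note e = edge_list[OF sub]
  have x: "edge_list B ! i \<in> {..<ncr D} - B" using nth_mem[OF i] e(1) by simp
  have "{..<ncr D} - set (edge_list B) = B" using e(1) sub by blast
  moreover have "omit i (edge_list B) = edge_list (insert (edge_list B ! i) B)"
    using set_omit[OF e(2) i] by (intro edge_list_eq) (auto simp: e(1))
  moreover have "parallel_set (insert (edge_list B ! i) B) \<longleftrightarrow> (\<forall>e\<in>B. par (edge_list B ! i) e)"
    using parallel_set_insert[OF B] x by blast
  ultimately show ?thesis by (simp add: presimplicial_of_def edges_eq)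
qed

text \<open>Every edge has exactly two ends, so of two nonparallel edges one has an end
  \<open>T\<close> that the other lacks, and the corresponding face of \<open>T\<close> is
  undefined. Conversely an undefined face of a vertex or of an edge list exhibits nonparallel
  edges.\<close>

lemma proper_iff: "proper X \<longleftrightarrow> 2 \<le> ncr D \<and> \<not> parallel_set {..<ncr D}"
proof
  assume "proper X"
  then obtain k i a where a: "a \<in> simplices X (Suc k)" "i \<le> Suc k" "face X (Suc k) i a = None"
    unfolding proper_def by blast
  show "2 \<le> ncr D \<and> \<not> parallel_set {..<ncr D}"
  proof (cases a)
    case (Vertex T)
    then have n: "ncr D = k + 2" "T \<in> circles D sA" using a(1) Vertex_simplex by auto
    then have "T \<notin> ends (state_graph_A D) i" using a(2,3) face_Vertex[of i "Suc k" T] Vertex by auto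
    then show ?thesis using all_parallel_ends[OF _ n(2), of i] a(2) n(1) by auto
  next
    case (Edges w)
    then obtain B where B: "w = edge_list B" "parallel_set B" "B \<noteq> {..<ncr D}" "Suc k + 1 + card B = ncr D"
      using a(1) Edges_simplex by blast
    have sub: "B \<subseteq> {..<ncr D}" using B(2) by blast
    have i: "i < length (edge_list B)" using a(2) edge_list(3)[OF sub] B(4) by simp
    have x: "edge_list B ! i < ncr D" using nth_mem[OF i] edge_list(1)[OF sub] by simp
    have "\<not> parallel_set (insert (edge_list B ! i) B)"
      using a(3) face_Edges[OF B(2) i, of "Suc k"] unfolding Edges B(1) by (auto split: if_splits)
    then obtain e where "e \<in> B" "\<not> par (edge_list B ! i) e" using parallel_set_insert[OF B(2) x] by blast
    then have "\<not> parallel_set {..<ncr D}" using x sub by auto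
    then show ?thesis using B(4) by simp
  qed
next
  assume a: "2 \<le> ncr D \<and> \<not> parallel_set {..<ncr D}"
  then obtain k where k: "ncr D = Suc (Suc k)" by (metis add_2_eq_Suc le_Suc_ex)
  obtain x y where xy: "x < ncr D" "y < ncr D" "\<not> par x y" using a k by auto
  have "\<not> ends (state_graph_A D) x \<subseteq> ends (state_graph_A D) y"
    using xy card_subset_eq[of "ends (state_graph_A D) y" "ends (state_graph_A D) x"] card_ends
    by (auto simp: parallel_def ends_eq)
  then obtain T where T: "T \<in> ends (state_graph_A D) x" "T \<notin> ends (state_graph_A D) y" by blast
  have "Vertex T \<in> simplices X (Suc k)" using T(1) ends_subset Vertex_simplex k by auto
  moreover have "face X (Suc k) y (Vertex T) = None" using face_Vertex[OF xy(2)] T(2) by simp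
  moreover have "y \<le> Suc k" using xy(2) k by simp
  ultimately show "proper X" unfolding proper_def by blast
qed

definition edge_cell :: "nat set \<Rightarrow> circle state_simplex cell_index" where
  "edge_cell B = Some (ncr D - 1 - card B, Edges (edge_list B))"

abbreviation vertex_cell :: "circle \<Rightarrow> circle state_simplex cell_index" where
  "vertex_cell T \<equiv> Some (ncr D - 1, Vertex T)"

lemma chain_cells_cases:
  assumes "u \<in> chain_cells X q"
  obtains (Vertex) T where "u = vertex_cell T" "T \<in> circles D sA" "0 < ncr D" "q = int (ncr D) - 1"
  | (Edge) B where "u = edge_cell B" "parallel_set B" "B \<noteq> {..<ncr D}" "q = int (ncr D) - 1 - int (card B)"
  | (Augmentation) "u = None" "q = - 1"
  | (Base) "u = None" "q = 0" "proper X"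
proof (cases "q = - 1")
  case True
  then show ?thesis using assms Augmentation by (simp add: chain_cells_def)
next
  case False
  then have u: "u \<in> cell_indices X" "int (cell_dim u) = q" using assms by (auto simp: chain_cells_def)
  show ?thesis
  proof (cases u)
    case None
    then show ?thesis using u Base by (auto simp: cell_indices_def split: if_splits)
  next
    case (Some z)
    obtain k a where z: "z = (k, a)" by (cases z)
    have a: "a \<in> simplices X k" and q: "q = int k" using u Some z by (auto simp: cell_indices_def split: if_splits)
    show ?thesis
    proof (cases a)
      fix T assume "a = Vertex T"
      then show ?thesis using a q Vertex[of T] Vertex_simplex[of T k] Some z by auto
    next
      fix w assume w: "a = Edges w"
      then obtain B where B: "w = edge_list B" "parallel_set B" "B \<noteq> {..<ncr D}" "k + 1 + card B = ncr D"
        using a Edges_simplex by blast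
      have "k = ncr D - 1 - card B" using B(4) by simp
      then have "u = edge_cell B" using Some z w B(1) by (simp add: edge_cell_def)
      moreover have "q = int (ncr D) - 1 - int (card B)" using q B(4) by simp
      ultimately show ?thesis using Edge B(2,3) by blast
    qed
  qed
qed

lemma vertex_cell_in: "T \<in> circles D sA \<Longrightarrow> 0 < ncr D \<Longrightarrow> vertex_cell T \<in> chain_cells X (int (ncr D) - 1)"
  using Vertex_simplex[of T "ncr D - 1"] by (auto simp: chain_cells_def cell_indices_def)

lemma edge_cell_in:
  assumes "parallel_set B" "B \<noteq> {..<ncr D}"
  shows "edge_cell B \<in> chain_cells X (int (ncr D) - 1 - int (card B))"
proof -
  have "Edges (edge_list B) \<in> simplices X (ncr D - 1 - card B)"
    using assms parallel_set_card[OF assms] by (auto simp: Edges_simplex)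
  then show ?thesis
    using parallel_set_card[OF assms] by (auto simp: chain_cells_def cell_indices_def edge_cell_def)
qed

lemma augmentation_in: "None \<in> chain_cells X (- 1)"
  by (simp add: chain_cells_def)

lemma base_in: "proper X \<Longrightarrow> None \<in> chain_cells X 0"
  by (simp add: chain_cells_def cell_indices_def)

text \<open>In the proper case base point and augmentation belong to the contractible summand and go
  to 0. Otherwise the generator in degree -1 stands for the state with all labels B or, for the
  diagram without crossings, for its one circle \<open>Inr 0\<close> with negative sign.\<close>

definition from_cell :: "int \<Rightarrow> circle state_simplex cell_index \<Rightarrow> enhanced_state \<Rightarrow>\<^sub>0 int" where
  "from_cell q u = (case u of
     Some (k, Vertex T) \<Rightarrow> frag_of (minus_state D T)
   | Some (k, Edges w) \<Rightarrow>
       frag_cmul (twist ({..<ncr D} - set w)) (frag_of (plus_state D ({..<ncr D} - set w)))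
   | None \<Rightarrow> if q = - 1 \<and> \<not> proper X then
       (if ncr D = 0 then frag_of (minus_state D (Inr 0))
        else frag_cmul (twist {..<ncr D}) (frag_of (plus_state D {..<ncr D}))) else 0)"

lemma from_cell_vertex [simp]: "from_cell q (Some (k, Vertex T)) = frag_of (minus_state D T)"
  by (simp add: from_cell_def)

lemma from_cell_edge:
  assumes "B \<subseteq> {..<ncr D}"
  shows "from_cell q (edge_cell B) = frag_cmul (twist B) (frag_of (plus_state D B))"
proof -
  have "{..<ncr D} - set (edge_list B) = B" using edge_list(1)[OF assms] assms by blast
  then show ?thesis by (simp add: from_cell_def edge_cell_def)
qed

lemma from_cell_None:
  "proper X \<or> q \<noteq> - 1 \<Longrightarrow> from_cell q None = 0"
  "ncr D = 0 \<Longrightarrow> from_cell (- 1) None = frag_of (minus_state D (Inr 0))"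
  "\<not> proper X \<Longrightarrow> 0 < ncr D \<Longrightarrow> from_cell (- 1) None = frag_cmul (twist {..<ncr D}) (frag_of (plus_state D {..<ncr D}))"
  using proper_iff by (auto simp: from_cell_def)

lemma boundary_vertex:
  assumes "T \<in> circles D sA" "2 \<le> ncr D"
  shows "frag_extend (from_cell (int (ncr D) - 2)) (cell_boundary X (vertex_cell T)) = khovanov_diff D (frag_of (minus_state D T))"
proof -
  obtain k where k: "ncr D = Suc (Suc k)" using assms(2) by (metis add_2_eq_Suc le_Suc_ex)
  let ?q = "int (ncr D) - 2"
  have "cell_boundary X (vertex_cell T) = (\<Sum>i\<le>Suc k. frag_cmul ((- 1) ^ i)
        (case face X (Suc k) i (Vertex T) of Some b \<Rightarrow> frag_of (Some (k, b)) | None \<Rightarrow> if k = 0 then frag_of None else 0))"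
    by (simp only: k diff_Suc_1 cell_boundary.simps)
  then have "frag_extend (from_cell ?q) (cell_boundary X (vertex_cell T)) = (\<Sum>i\<le>Suc k. frag_extend (from_cell ?q) (frag_cmul ((- 1) ^ i)
        (case face X (Suc k) i (Vertex T) of Some b \<Rightarrow> frag_of (Some (k, b)) | None \<Rightarrow> if k = 0 then frag_of None else 0)))"
    by (simp only: frag_extend_sum[OF finite_atMost] comp_def)
  also have "\<dots> = (\<Sum>i\<le>Suc k. if T \<in> ends (state_graph_A D) i then frag_of (plus_state D {i}) else 0)"
  proof (rule sum.cong[OF refl])
    fix i assume "i \<in> {..Suc k}"
    then have i: "i < ncr D" using k by simp
    have c: "Some (k, Edges (edge_list {i})) = edge_cell {i}" by (simp add: edge_cell_def k)
    \<comment> \<open>\<open>twist {i}\<close> is \<open>(- 1) ^ i\<close>, so the face signs cancel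
      and only plus signs remain, as in the Khovanov differential of a state without
      B-labels.\<close>
    have "(- 1) ^ i * twist {i} = 1" using twist_insert[of "{}" i] by (simp flip: power_mult_distrib)
    then have "from_cell ?q (edge_cell {i}) = frag_cmul ((- 1) ^ i) (frag_of (plus_state D {i}))"
      using i twist_insert[of "{}" i] by (subst from_cell_edge) auto
    then show "frag_extend (from_cell ?q) (frag_cmul ((- 1) ^ i)
        (case face X (Suc k) i (Vertex T) of Some b \<Rightarrow> frag_of (Some (k, b)) | None \<Rightarrow> if k = 0 then frag_of None else 0))
      = (if T \<in> ends (state_graph_A D) i then frag_of (plus_state D {i}) else 0)"
      using from_cell_None(1)[of ?q] from_cell_None(1)[of 0] k
      by (simp add: face_Vertex[OF i] c frag_extend_cmul flip: power_mult_distrib)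
  qed
  also have "\<dots> = (\<Sum>i | i < ncr D \<and> T \<in> ends (state_graph_A D) i. frag_of (plus_state D {i}))"
    unfolding k by (rule sum.mono_neutral_cong_right) auto
  also have "\<dots> = khovanov_diff D (frag_of (minus_state D T))"
    by (rule diff_minus_state[OF assms(1), symmetric])
  finally show ?thesis .
qed

text \<open>The face at position \<open>i\<close> removes an edge from the list, that is, adds it to
  \<open>B\<close>; \<open>twist_sign\<close> converts its sign. The condition on \<open>q\<close>
  keeps the base point, which replaces undefined faces when \<open>k = 0\<close>, in the kernel of
  \<open>from_cell\<close>.\<close>

lemma boundary_edge:
  assumes B: "parallel_set B" and c: "card B + 2 \<le> ncr D" and q: "q \<noteq> - 1"
  shows "frag_extend (from_cell q) (cell_boundary X (edge_cell B)) =
    frag_cmul (twist B) (khovanov_diff D (frag_of (plus_state D B)))"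
proof -
  have sub: "B \<subseteq> {..<ncr D}" using B by blast
  note e = edge_list[OF sub]
  let ?w = "edge_list B" and ?P = "\<lambda>x. parallel_set (insert x B)"
  obtain k where k: "ncr D = card B + Suc (Suc k)" using c by (metis add_2_eq_Suc' add_Suc_right le_Suc_ex add.assoc add.commute)
  have len: "length ?w = Suc (Suc k)" using e(3) k by simp
  have dist: "distinct ?w" using e(2) by (simp add: strict_sorted_iff)
  let ?t = "\<lambda>i. case face X (Suc k) i (Edges ?w) of Some b \<Rightarrow> frag_of (Some (k, b)) | None \<Rightarrow> if k = 0 then frag_of None else 0"
  let ?s = "\<lambda>x. if ?P x then frag_cmul (twist B * (- 1) ^ card {y \<in> B. x < y}) (frag_of (plus_state D (insert x B))) else 0"
  have kk: "ncr D - 1 - card B = Suc k" using k by simp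
  have "cell_boundary X (edge_cell B) = (\<Sum>i\<le>Suc k. frag_cmul ((- 1) ^ i) (?t i))"
    by (simp only: edge_cell_def kk cell_boundary.simps)
  then have "frag_extend (from_cell q) (cell_boundary X (edge_cell B)) =
      (\<Sum>i\<le>Suc k. frag_extend (from_cell q) (frag_cmul ((- 1) ^ i) (?t i)))"
    by (simp only: frag_extend_sum[OF finite_atMost] comp_def)
  also have "\<dots> = (\<Sum>i\<le>Suc k. ?s (?w ! i))"
  proof (rule sum.cong[OF refl])
    fix i assume "i \<in> {..Suc k}"
    then have i: "i < length ?w" using len by simp
    let ?x = "?w ! i"
    have x: "?x < ncr D" "?x \<notin> B" using nth_mem[OF i] e(1) by auto
    show "frag_extend (from_cell q) (frag_cmul ((- 1) ^ i) (?t i)) = ?s ?x"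
    proof (cases "?P ?x")
      case True
      have "card (insert ?x B) = Suc (card B)" using x(2) finite_subset_crossings[OF sub] by simp
      then have "Some (k, Edges (edge_list (insert ?x B))) = edge_cell (insert ?x B)"
        using k by (simp add: edge_cell_def)
      then have t: "?t i = frag_of (edge_cell (insert ?x B))" using face_Edges[OF B i, of "Suc k"] True by simp
      have "card {y \<in> {..<ncr D} - B. y < ?x} = i" using card_less_nth[OF e(2) i] unfolding e(1) .
      then have s: "(- 1) ^ i * twist (insert ?x B) = twist B * (- 1) ^ card {y \<in> B. ?x < y}"
        using twist_sign[OF sub x] by simp
      have "from_cell q (edge_cell (insert ?x B)) = frag_cmul (twist (insert ?x B)) (frag_of (plus_state D (insert ?x B)))"
        by (rule from_cell_edge) (use sub x in auto)
      then show ?thesis unfolding t if_P[OF True] by (simp only: frag_extend_cmul frag_extend_of frag_cmul_cmul s)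
    next
      case False
      have "face X (Suc k) i (Edges ?w) = None"
        using face_Edges[OF B i, of "Suc k"] unfolding if_not_P[OF False] .
      then show ?thesis using q unfolding if_not_P[OF False] by (simp add: frag_extend_cmul from_cell_None(1))
    qed
  qed
  also have "\<dots> = (\<Sum>x\<in>{..<ncr D} - B. ?s x)"
  proof (rule sum.reindex_bij_betw)
    show "bij_betw ((!) ?w) {..Suc k} ({..<ncr D} - B)"
      using dist len e(1) by (intro bij_betw_nth) (auto simp: lessThan_Suc_atMost)
  qed
  also have "\<dots> = (\<Sum>x | x \<notin> B \<and> ?P x. frag_cmul (twist B * (- 1) ^ card {y \<in> B. x < y}) (frag_of (plus_state D (insert x B))))"
    by (rule sum.mono_neutral_cong_right) auto
  also have "\<dots> = frag_cmul (twist B) (khovanov_diff D (frag_of (plus_state D B)))"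
    unfolding diff_plus_state[OF B] by (simp add: frag_cmul_sum frag_cmul_cmul)
  finally show ?thesis .
qed

text \<open>A 0-cell has the augmentation as its boundary. It matches the change of the last
  A-label, which reaches the state with all labels B when all edges are parallel, and is zero in the
  proper case.\<close>

lemma boundary_last_edge:
  assumes B: "parallel_set B" and c: "card B + 1 = ncr D"
  shows "from_cell (- 1) None = frag_cmul (twist B) (khovanov_diff D (frag_of (plus_state D B)))"
proof (cases "proper X")
  case True
  have sub: "B \<subseteq> {..<ncr D}" using B by blast
  have n: "\<not> parallel_set {..<ncr D}" using True proper_iff by blast
  have "\<not> parallel_set (insert x B)" if x: "x \<notin> B" for x
  proof
    assume p: "parallel_set (insert x B)"
    have "card (insert x B) = card {..<ncr D}" using x c finite_subset_crossings[OF sub] by simp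
    then have "insert x B = {..<ncr D}" using p by (intro card_subset_eq[OF finite_lessThan]) blast+
    then show False using n p by simp
  qed
  then have e: "{x. x \<notin> B \<and> parallel_set (insert x B)} = {}" by blast
  show ?thesis unfolding diff_plus_state[OF B] e using True by (simp add: from_cell_None(1))
next
  case False
  have sub: "B \<subseteq> {..<ncr D}" using B by blast
  have cB: "0 < card B" using B finite_subset_crossings[OF sub] by (simp add: card_gt_0_iff)
  then have full: "parallel_set {..<ncr D}" using False proper_iff c by auto
  have "card ({..<ncr D} - B) = 1" using c sub finite_subset_crossings[OF sub] by (simp add: card_Diff_subset)
  then obtain x where x: "{..<ncr D} - B = {x}" by (rule card_1_singletonE)
  have xc: "x < ncr D" "x \<notin> B" using x by auto
  have ins: "insert x B = {..<ncr D}" using x sub by blast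
  have "{z. z \<notin> B \<and> parallel_set (insert z B)} = {x}"
  proof
    show "{z. z \<notin> B \<and> parallel_set (insert z B)} \<subseteq> {x}" using x by auto
    have "parallel_set (insert x B)" unfolding ins by (rule full)
    then show "{x} \<subseteq> {z. z \<notin> B \<and> parallel_set (insert z B)}" using xc(2) by blast
  qed
  then have d: "khovanov_diff D (frag_of (plus_state D B)) =
      frag_cmul ((- 1) ^ card {y \<in> B. x < y}) (frag_of (plus_state D {..<ncr D}))"
    unfolding diff_plus_state[OF B] by (simp add: ins)
  have "twist {..<ncr D} = twist B * (- 1) ^ card {y \<in> B. x < y}"
  proof -
    have "{y \<in> {x}. y < x} = {}" by blast
    then show ?thesis using twist_sign[OF sub xc] unfolding x ins by (simp only: card.empty power_0 mult_1)
  qed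
  then show ?thesis using False c unfolding d by (simp add: from_cell_None(3) frag_cmul_cmul)
qed

end

context connected_adequate_diagram begin

text \<open>In the proper case a 0-cell is corrected by the base point so as to lie in the kernel of
  the augmentation. The full set is tested before the empty one, because without crossings they
  coincide and the negative circle belongs to degree -1.\<close>

definition to_cell :: "enhanced_state \<Rightarrow> circle state_simplex cell_index \<Rightarrow>\<^sub>0 int" where
  "to_cell S = (let B = B_crossings D (fst S) in
     if B = {..<ncr D} then frag_cmul (twist B) (frag_of None)
     else if B = {} then frag_of (vertex_cell (inv_into (circles D sA) (minus_state D) S))
     else frag_cmul (twist B)
            (frag_of (edge_cell B) - (if card B + 1 = ncr D \<and> proper X then frag_of None else 0)))"

text \<open>Contracts the summand formed by base point and augmentation. The minus sign comes from
  the convention \<open>f g = id + d h + h d\<close>, whose left side vanishes on the augmentation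
  in the proper case.\<close>

definition contraction :: "int \<Rightarrow> circle state_simplex cell_index \<Rightarrow> circle state_simplex cell_index \<Rightarrow>\<^sub>0 int" where
  "contraction q u = (if q = - 1 \<and> proper X \<and> u = None then - frag_of None else 0)"

lemma minus_state_inj: "inj_on (minus_state D) (circles D sA)"
proof (rule inj_onI)
  fix T U assume TU: "T \<in> circles D sA" "U \<in> circles D sA" and "minus_state D T = minus_state D U"
  then have "snd (minus_state D T) T = snd (minus_state D U) T" by simp
  then show "T = U" using TU by (simp add: minus_state_def split: if_splits)
qed

lemma to_cell_minus:
  assumes "T \<in> circles D sA" "0 < ncr D"
  shows "to_cell (minus_state D T) = frag_of (vertex_cell T)"
proof -
  have "{..<ncr D} \<noteq> {}" using assms(2) by blast
  then show ?thesis using inv_into_f_f[OF minus_state_inj assms(1)] by (simp add: to_cell_def Let_def)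
qed

lemma to_cell_no_crossings: "ncr D = 0 \<Longrightarrow> to_cell (minus_state D T) = frag_of None"
  by (simp add: to_cell_def Let_def)

lemma to_cell_plus:
  assumes B: "parallel_set B" "B \<noteq> {..<ncr D}"
  shows "to_cell (plus_state D B) =
    frag_cmul (twist B) (frag_of (edge_cell B) - (if card B + 1 = ncr D \<and> proper X then frag_of None else 0))"
proof -
  have "B \<subseteq> {..<ncr D}" "B \<noteq> {}" using B(1) by blast+
  then show ?thesis using B(2) by (simp add: to_cell_def Let_def)
qed

lemma to_cell_full: "to_cell (plus_state D {..<ncr D}) = frag_cmul (twist {..<ncr D}) (frag_of None)"
  by (simp add: to_cell_def Let_def)

lemma almax_states_cases:
  assumes "S \<in> almax_states q"
  obtains (Minus) T where "S = minus_state D T" "T \<in> circles D sA" "q = int (ncr D) - 1"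
  | (Plus) B where "S = plus_state D B" "parallel_set B" "B \<noteq> {..<ncr D}" "q = int (ncr D) - 1 - int (card B)"
  | (Full) "S = plus_state D {..<ncr D}" "parallel_set {..<ncr D}" "q = - 1"
proof -
  consider "S \<in> (if q = int (ncr D) - 1 then minus_state D ` circles D sA else {})"
    | B where "S = plus_state D B" "parallel_set B" "q = int (ncr D) - 1 - int (card B)"
    using assms unfolding almax_states_def by blast
  then show ?thesis
  proof cases
    case 1
    then have q: "q = int (ncr D) - 1" and "S \<in> minus_state D ` circles D sA" by (simp_all split: if_splits)
    then obtain T where "S = minus_state D T" "T \<in> circles D sA" by blast
    then show ?thesis using q Minus by blast
  next
    case (2 B)
    show ?thesis
    proof (cases "B = {..<ncr D}")
      case True
      have "q = - 1" using 2(3) unfolding True by simp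
      then show ?thesis using Full 2(1,2) unfolding True by blast
    next
      case False
      then show ?thesis using Plus 2 by blast
    qed
  qed
qed

lemma minus_state_almax: "T \<in> circles D sA \<Longrightarrow> minus_state D T \<in> almax_states (int (ncr D) - 1)"
  by (simp add: almax_states_def)

lemma plus_state_almax:
  assumes "parallel_set B"
  shows "plus_state D B \<in> almax_states (int (ncr D) - 1 - int (card B))"
  unfolding almax_states_def using assms by blast

lemma not_proper_parallel:
  assumes "\<not> proper X" "0 < ncr D"
  shows "parallel_set {..<ncr D}"
proof (cases "ncr D = 1")
  case True
  then have "{..<ncr D} = {0}" by auto
  then show ?thesis by (simp add: parallel_def)
next
  case False
  then have "2 \<le> ncr D" using assms(2) by simp
  then show ?thesis using assms(1) proper_iff by blast
qed

lemma keys_cmul_of: "Poly_Mapping.keys (frag_cmul k (frag_of x)) \<subseteq> {x}"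
  using keys_cmul[of k "frag_of x"] by simp

lemma keys_khovanov_diff:
  assumes "S \<in> almax_states q"
  shows "Poly_Mapping.keys (khovanov_diff D (frag_of S)) \<subseteq> almax_states (q - 1)"
proof -
  have plus: "Poly_Mapping.keys (khovanov_diff D (frag_of (plus_state D B))) \<subseteq> almax_states (int (ncr D) - 1 - int (card B) - 1)"
    if B: "parallel_set B" for B
    unfolding diff_plus_state[OF B]
  proof (intro order_trans[OF keys_sum] UN_least order_trans[OF keys_cmul_of])
    fix x assume x: "x \<in> {x. x \<notin> B \<and> parallel_set (insert x B)}"
    then have "card (insert x B) = Suc (card B)" using finite_subset_crossings[of B D] by simp
    moreover have "parallel_set (insert x B)" using x by blast
    ultimately show "{plus_state D (insert x B)} \<subseteq> almax_states (int (ncr D) - 1 - int (card B) - 1)"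
      using plus_state_almax[of "insert x B"] by (simp add: algebra_simps)
  qed
  from assms show ?thesis
  proof (cases rule: almax_states_cases)
    case (Minus T)
    have "plus_state D {x} \<in> almax_states (q - 1)" if "x < ncr D" for x
      using plus_state_almax[of "{x}"] that Minus(3) by (simp add: parallel_def)
    then show ?thesis
      unfolding Minus(1) diff_minus_state[OF Minus(2)]
      by (intro order_trans[OF keys_sum] UN_least) simp
  next
    case (Plus B)
    then show ?thesis using plus[OF Plus(2)] by simp
  next
    case Full
    then show ?thesis using plus[OF Full(2)] by simp
  qed
qed

lemma keys_to_cell:
  assumes "S \<in> almax_states q"
  shows "Poly_Mapping.keys (to_cell S) \<subseteq> chain_cells X q"
  using assms
proof (cases rule: almax_states_cases)
  case (Minus T)
  then show ?thesis
    using vertex_cell_in[OF Minus(2)] to_cell_minus[OF Minus(2)] to_cell_no_crossings[of T] augmentation_in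
    by (cases "ncr D = 0") simp_all
next
  case (Plus B)
  have "Poly_Mapping.keys (frag_of (edge_cell B) - (if card B + 1 = ncr D \<and> proper X then frag_of None else 0)) \<subseteq> chain_cells X q"
  proof (intro order_trans[OF keys_diff] Un_least)
    show "Poly_Mapping.keys (frag_of (edge_cell B)) \<subseteq> chain_cells X q"
      using edge_cell_in[OF Plus(2,3)] Plus(4) by simp
    show "Poly_Mapping.keys (if card B + 1 = ncr D \<and> proper X then frag_of None else 0) \<subseteq> chain_cells X q"
    proof (cases "card B + 1 = ncr D \<and> proper X")
      case True
      then have "q = 0" using Plus(4) by linarith
      then show ?thesis using base_in True by simp
    next
      case False
      show ?thesis unfolding if_not_P[OF False] by simp
    qed
  qed
  then show ?thesis
    unfolding Plus(1) to_cell_plus[OF Plus(2,3)] by (rule order_trans[OF keys_cmul])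
next
  case Full
  show ?thesis
    unfolding Full(1,3) to_cell_full using augmentation_in by (intro order_trans[OF keys_cmul_of]) simp
qed

lemma keys_from_cell:
  assumes "u \<in> chain_cells X q"
  shows "Poly_Mapping.keys (from_cell q u) \<subseteq> almax_states q"
  using assms
proof (cases rule: chain_cells_cases)
  case (Vertex T)
  then show ?thesis using minus_state_almax by simp
next
  case (Edge B)
  have "B \<subseteq> {..<ncr D}" using Edge(2) by blast
  then show ?thesis
    unfolding Edge(1) from_cell_edge[OF \<open>B \<subseteq> {..<ncr D}\<close>]
    using plus_state_almax[OF Edge(2)] Edge(4) by (intro order_trans[OF keys_cmul_of]) simp
next
  case Augmentation
  show ?thesis
  proof (cases "proper X")
    case True
    then show ?thesis using Augmentation from_cell_None(1) by simp
  next
    case False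
    show ?thesis
    proof (cases "ncr D = 0")
      case True
      then show ?thesis
        using Augmentation from_cell_None(2) minus_state_almax[of "Inr 0"] circles_no_crossings by simp
    next
      case pos: False
      have "parallel_set {..<ncr D}" by (rule not_proper_parallel[OF False neq0_conv[THEN iffD1, OF pos]])
      from plus_state_almax[OF this] show ?thesis
        unfolding Augmentation from_cell_None(3)[OF False neq0_conv[THEN iffD1, OF pos]]
        by (intro order_trans[OF keys_cmul_of]) simp
    qed
  qed
next
  case Base
  then show ?thesis using from_cell_None(1) by simp
qed

lemma from_to_cell:
  assumes "S \<in> almax_states q"
  shows "frag_extend (from_cell q) (to_cell S) = frag_of S"
  using assms
proof (cases rule: almax_states_cases)
  case (Minus T)
  show ?thesis
  proof (cases "ncr D = 0")
    case True
    then have "T = Inr 0" "q = - 1" using Minus circles_no_crossings by auto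
    then show ?thesis
      unfolding Minus(1) to_cell_no_crossings[OF True] by (simp add: from_cell_None(2)[OF True])
  next
    case False
    then show ?thesis unfolding Minus(1) using to_cell_minus[OF Minus(2)] by simp
  qed
next
  case (Plus B)
  have sub: "B \<subseteq> {..<ncr D}" using Plus(2) by blast
  have "q \<noteq> - 1" using parallel_set_card[OF Plus(2,3)] Plus(4) by linarith
  then have "frag_extend (from_cell q) (if card B + 1 = ncr D \<and> proper X then frag_of None else 0) = 0"
    using from_cell_None(1) by simp
  then show ?thesis
    unfolding Plus(1) to_cell_plus[OF Plus(2,3)]
    by (simp add: frag_extend_cmul frag_extend_diff from_cell_edge[OF sub])
next
  case Full
  have "0 < ncr D" using Full(2) by auto
  moreover have "\<not> proper X" using Full(2) proper_iff by blast
  ultimately show ?thesis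
    unfolding Full(1,3) to_cell_full by (simp add: frag_extend_cmul from_cell_None(3))
qed

lemma cell_boundary_edge_dim0:
  assumes "card B + 1 = ncr D"
  shows "cell_boundary X (edge_cell B) = frag_of None"
proof -
  have "ncr D - 1 - card B = 0" using assms by simp
  then show ?thesis by (simp add: edge_cell_def)
qed

abbreviation cell_diff :: "int \<Rightarrow> circle state_simplex cell_index \<Rightarrow> circle state_simplex cell_index \<Rightarrow>\<^sub>0 int" where
  "cell_diff q \<equiv> (if 0 \<le> q then cell_boundary X else (\<lambda>_. 0))"

lemma from_cell_diff:
  assumes "u \<in> chain_cells X q"
  shows "khovanov_diff D (from_cell q u) = frag_extend (from_cell (q - 1)) (cell_diff q u)"
proof -
  have cmul: "khovanov_diff D (frag_cmul k x) = frag_cmul k (khovanov_diff D x)" for k x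
    by (simp add: khovanov_diff_def frag_extend_cmul)
  have zero: "khovanov_diff D 0 = 0" by (simp add: khovanov_diff_def)
  from assms show ?thesis
  proof (cases rule: chain_cells_cases)
    case (Vertex T)
    show ?thesis
    proof (cases "ncr D = 1")
      \<comment> \<open>With one crossing the vertices are 0-cells, and the differential to the
        state with label B is the augmentation.\<close>
      case True
      have par: "parallel_set {..<ncr D}" using True by (auto simp: parallel_def)
      have "{x. x < ncr D \<and> T \<in> ends (state_graph_A D) x} = {0}"
        using all_parallel_ends[OF par Vertex(2), of 0] True by auto
      then have "khovanov_diff D (frag_of (minus_state D T)) = frag_of (plus_state D {0})"
        unfolding diff_minus_state[OF Vertex(2)] by simp
      moreover have "from_cell (- 1) None = frag_of (plus_state D {0})"
        using from_cell_None(3) proper_iff True twist_insert[of "{}" 0] by (simp add: lessThan_Suc)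
      ultimately show ?thesis using Vertex True by simp
    next
      case False
      then have two: "2 \<le> ncr D" using Vertex(3) by simp
      have "int (ncr D) - 1 - 1 = int (ncr D) - 2" by simp
      then show ?thesis
        using boundary_vertex[OF Vertex(2) two] Vertex(1,4) two by simp
    qed
  next
    case (Edge B)
    have sub: "B \<subseteq> {..<ncr D}" using Edge(2) by blast
    note c = parallel_set_card[OF Edge(2,3)]
    have q0: "0 \<le> q" using c Edge(4) by linarith
    show ?thesis
    proof (cases "card B + 1 = ncr D")
      case True
      then have "q = 0" using Edge(4) by simp
      then show ?thesis
        unfolding Edge(1) from_cell_edge[OF sub] cmul
        using boundary_last_edge[OF Edge(2) True] cell_boundary_edge_dim0[OF True] by simp
    next
      case False
      then have two: "card B + 2 \<le> ncr D" using c by simp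
      then have "q - 1 \<noteq> - 1" using Edge(4) by linarith
      from boundary_edge[OF Edge(2) two this] show ?thesis
        unfolding Edge(1) from_cell_edge[OF sub] cmul using q0 by simp
    qed
  next
    case Augmentation
    have full: "khovanov_diff D (frag_of (plus_state D {..<ncr D})) = 0" if p: "parallel_set {..<ncr D}"
    proof -
      have "{x. x \<notin> {..<ncr D} \<and> parallel_set (insert x {..<ncr D})} = {}" by blast
      then show ?thesis unfolding diff_plus_state[OF p] by (simp only: sum.empty)
    qed
    have "khovanov_diff D (from_cell (- 1) None) = 0"
    proof (cases "proper X")
      case True
      then show ?thesis using zero by (simp add: from_cell_None(1))
    next
      case False
      show ?thesis
      proof (cases "ncr D = 0")
        case True
        have "Inr 0 \<in> circles D sA" using circles_no_crossings[OF True] by simp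
        from diff_minus_state[OF this] show ?thesis using True by (simp add: from_cell_None(2))
      next
        case pos: False
        have "parallel_set {..<ncr D}" by (rule not_proper_parallel[OF False neq0_conv[THEN iffD1, OF pos]])
        from full[OF this] show ?thesis using False pos by (simp add: from_cell_None(3) cmul)
      qed
    qed
    then show ?thesis using Augmentation by simp
  next
    case Base
    then show ?thesis using zero by (simp add: from_cell_None(1))
  qed
qed

text \<open>The correction by the base point makes the augmentation vanish; this is the side
  condition \<open>h d f = 0\<close> in the only degree where it has content.\<close>

lemma cell_diff_to_cell:
  assumes "S \<in> almax_states 0" "proper X"
  shows "frag_extend (cell_boundary X) (to_cell S) = 0"
  using assms(1)
proof (cases rule: almax_states_cases)
  case (Minus T)
  then show ?thesis using assms(2) proper_iff by simp
next
  case (Plus B)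
  then have c: "card B + 1 = ncr D" by linarith
  then show ?thesis
    unfolding Plus(1) to_cell_plus[OF Plus(2,3)]
    using assms(2) cell_boundary_edge_dim0[OF c] by (simp add: frag_extend_cmul frag_extend_diff)
qed simp

text \<open>Away from base point and augmentation the maps are mutually inverse, apart from the
  0-cells of the proper case, where the base-point correction in \<open>to_cell\<close> is exactly
  the term \<open>h d\<close>.\<close>

lemma to_from_cell:
  assumes "u \<in> chain_cells X q"
  shows "frag_extend to_cell (from_cell q u) = frag_of u +
    (frag_extend (cell_diff (q + 1)) (contraction q u) + frag_extend (contraction (q - 1)) (cell_diff q u))"
  using assms
proof (cases rule: chain_cells_cases)
  case (Vertex T)
  have n: "frag_extend (contraction (q - 1)) (cell_diff q u) = 0"
  proof (cases "q = 0")
    case True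
    then have "\<not> proper X" using Vertex(4) proper_iff by simp
    then show ?thesis by (intro frag_extend_eq_0) (simp add: contraction_def)
  qed (auto intro: frag_extend_eq_0 simp: contraction_def)
  then show ?thesis using to_cell_minus[OF Vertex(2,3)] Vertex(1) by (simp add: contraction_def)
next
  case (Edge B)
  have sub: "B \<subseteq> {..<ncr D}" using Edge(2) by blast
  have q: "0 \<le> q" using parallel_set_card[OF Edge(2,3)] Edge(4) by linarith
  have l: "frag_extend to_cell (from_cell q u) = frag_of u - (if card B + 1 = ncr D \<and> proper X then frag_of None else 0)"
    unfolding Edge(1) from_cell_edge[OF sub]
    by (simp add: frag_extend_cmul to_cell_plus[OF Edge(2,3)])
  have "contraction q u = 0" using q by (simp add: contraction_def)
  moreover have "frag_extend (contraction (q - 1)) (cell_diff q u) =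
      - (if card B + 1 = ncr D \<and> proper X then frag_of None else 0)"
  proof (cases "card B + 1 = ncr D")
    case True
    then have "q = 0" using Edge(4) by simp
    then show ?thesis using True cell_boundary_edge_dim0[OF True] Edge(1) by (simp add: contraction_def)
  next
    case False
    then have "q - 1 \<noteq> - 1" using Edge(4) by linarith
    then show ?thesis using False by (auto intro!: frag_extend_eq_0 simp: contraction_def)
  qed
  ultimately show ?thesis using l by simp
next
  case Augmentation
  have n: "cell_diff q u = 0" using Augmentation by simp
  show ?thesis
  proof (cases "proper X")
    case True
    then show ?thesis
      using Augmentation by (simp add: from_cell_None(1) contraction_def frag_extend_minus)
  next
    case False
    have "frag_extend to_cell (from_cell (- 1) None) = frag_of None"
    proof (cases "ncr D = 0")
      case True
      then show ?thesis by (simp add: from_cell_None(2) to_cell_no_crossings)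
    next
      case pos: False
      then show ?thesis using False by (simp add: from_cell_None(3) frag_extend_cmul to_cell_full)
    qed
    then show ?thesis using Augmentation False by (simp add: contraction_def)
  qed
next
  case Base
  then show ?thesis by (simp add: from_cell_None(1) contraction_def)
qed

lemma almost_extreme_cell_complex:
  "chain_homotopy_equivalent (almost_extreme_complex D) (cell_complex X)"
proof (rule chain_homotopy_equivalent_free[where T = "chain_cells X" and S = almax_states
      and dM = cell_diff and dC = "\<lambda>q S. khovanov_diff D (frag_of S)"
      and f = "\<lambda>q. to_cell" and g = from_cell and h = contraction])
  interpret presimplicial X
    by unfold_locales (rule partial_presimplicial_set_presimplicial_of)
  show "is_chain_complex (cell_complex X)" by (rule is_chain_complex_cell_complex)
  have kd: "frag_extend (\<lambda>S. khovanov_diff D (frag_of S)) = khovanov_diff D"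
    by (simp add: khovanov_diff_def)
  show "Grp (cell_complex X) q = free_Abelian_group (chain_cells X q)"
    and "Diff (cell_complex X) q = frag_extend (cell_diff q)" for q
    by (auto simp: cell_complex_def fun_eq_iff frag_extend_eq_0)
  show "Grp (almost_extreme_complex D) q = free_Abelian_group (almax_states q)"
    and "Diff (almost_extreme_complex D) q = frag_extend (\<lambda>S. khovanov_diff D (frag_of S))" for q
    unfolding kd by (rule almost_extreme_group almost_extreme_Diff)+
  show "frag_extend (\<lambda>S. khovanov_diff D (frag_of S)) (from_cell q u) = frag_extend (from_cell (q - 1)) (cell_diff q u)"
    if "u \<in> chain_cells X q" for q u
    unfolding kd by (rule from_cell_diff[OF that])
  show "frag_extend (contraction (q - 1)) (frag_extend (cell_diff q) (to_cell S)) = 0"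
    if "S \<in> almax_states q" for q S
  \<comment> \<open>\<open>contraction (q - 1)\<close> is nonzero only for \<open>q = 0\<close> in
    the proper case.\<close>
  proof (cases "q = 0 \<and> proper X")
    case True
    then show ?thesis using cell_diff_to_cell[of S] that by simp
  next
    case False
    then show ?thesis by (intro frag_extend_eq_0) (auto simp: contraction_def)
  qed
  show "Poly_Mapping.keys (contraction q u) \<subseteq> chain_cells X (q + 1)" if "u \<in> chain_cells X q" for q u
    using base_in by (simp add: contraction_def)
qed (rule keys_khovanov_diff keys_to_cell keys_from_cell from_to_cell to_from_cell; assumption)+

end

theorem theorem6p1:
  fixes D :: diagram
  assumes "link_diagram D"
    and "connected_diagram D"
    and "A_adequate D"
  shows "chain_homotopy_equivalent
           (almost_extreme_complex D)
           (reduced_cellular_complex (realization (presimplicial_of D))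
                                     (skeleton (presimplicial_of D)))"
proof -
  have loc: "connected_adequate_diagram D"
    using assms by unfold_locales
  have "presimplicial (presimplicial_of D)"
    by unfold_locales (rule partial_presimplicial_set_presimplicial_of)
  then show ?thesis
    by (rule presimplicial.cellular_complex_transfer[OF _ connected_adequate_diagram.almost_extreme_cell_complex[OF loc]])
qed

end
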